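(* Let $p,q\in(1,+\infty)$ be conjugate exponents and let $\phi:\mathcal{P}_p(\mathbb{R}^d)\to(-\infty,+\infty]$ satisfy: ($\phi$1) $\phi(\mu)<+\infty$ implies $\mu\ll\mathcal{L}^d$; ($\phi$2) there exist $A,B>0$ and $\mu_\star\in\mathcal{P}_p(\mathbb{R}^d)$ such that $\phi(\cdot)\ge -A-B\,\mathcal{W}_p(\cdot,\mu_\star)^p$; ($\phi$3) $\phi$ is lower semicontinuous in $(\mathcal{P}_p(\mathbb{R}^d),\mathcal{W}_p)$; ($\phi$4) if $\sup_{n}\{\phi(\mu_n),\mathcal{W}_p(\mu_n,\mu_\star)\}<+\infty$, then there are $n_k\uparrow+\infty$ and $\mu$ with $\mathcal{W}_p(\mu_{n_k},\mu)\to0$. Assume moreover that for every $\nu\in\{\phi<+\infty\}$ the limiting subdifferential $\partial_l\phi(\nu)$ contains at most one element, denoted $D_l\phi(\nu)$ if it exists. (I) Let $(\tau_k)_{k\in\mathbb{N}}$, $\tau_k\downarrow0$, be a sequence of time step sizes and let $\bar\mu_{\tau_k}:[0,+\infty)\to\mathcal{P}_p(\mathbb{R}^d)$ be discrete solutions of the Minimizing Movement scheme associated with $$\Phi(\tau,\mu,\nu):=\phi(\nu)+\frac{1}{p\tau^{p-1}}\mathcal{W}_p(\nu,\mu)^p$$ whose initial data satisfy $\mathcal{W}_p(\bar\mu_{\tau_k}(0),\mu^0)\to0$ for some $\mu^0\in\{\phi<+\infty\}$ and $\lim_{k\to+\infty}\phi(\bar\mu_{\tau_k}(0))=\phi(\mu^0)$.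 Then there exist a subsequence $(\tau_{k_l})_{l\in\mathbb{N}}$, $\tau_{k_l}\downarrow0$, and a curve $\mu:[0,+\infty)\to\mathcal{P}_p(\mathbb{R}^d)$ such that $$\lim_{l\to+\infty}\mathcal{W}_p(\bar\mu_{\tau_{k_l}}(t),\mu(t))=0\quad\text{for all }t\ge0.$$ Every such limit curve $\mu$ is locally absolutely continuous in $(\mathcal{P}_p(\mathbb{R}^d),\mathcal{W}_p)$ and satisfies, for all $t\ge0$, $$\phi(\mu(0))-\phi(\mu(t))\ \ge\ \frac1q\int_0^t|\partial^-\phi|^q(\mu(r))\,\mathrm{d}r+\frac1p\int_0^t|\mu'|^p(r)\,\mathrm{d}r. \qquad (\ast)$$ (II) Let $\mu$ be a locally absolutely continuous curve in $(\mathcal{P}_p(\mathbb{R}^d),\mathcal{W}_p)$ with tangent vector field $v$, and assume that $\phi\circ\mu\in \mathrm{C}([0,+\infty))\cap \mathrm{W}^{1,1}_{\mathrm{loc}}((0,+\infty))$ with $$\partial_l\phi(\mu(t))\ne\emptyset,\qquad (\phi\circ\mu)'(t)=\int_{\mathbb{R}^d}\langle D_l\phi(\mu(t))(x),v_t(x)\rangle\,\mathrm{d}\mu_t(x)$$ for $\mathcal{L}^1$-a.e. $t>0$. Then the following three statements are equivalent: (a) $\mu$ satisfies the energy inequality $(\ast)$ for all $t\ge0$. (b) $\mu$ satisfies, for all $0\le s\le t<+\infty$, the energy dissipation equality $$\phi(\mu(s))-\phi(\mu(t))=\frac1q\int_s^t|\partial^-\phi|^q(\mu(r))\,\mathrm{d}r+\frac1p\int_s^t|\mu'|^p(r)\,\mathrm{d}r.$$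 (c) For $\mathcal{L}^1$-a.e. $t>0$, $\mu$ satisfies both $v_t=-j_q(D_l\phi(\mu(t)))$ $\mu_t$-a.e. and $|\partial^-\phi|(\mu(t))=\|D_l\phi(\mu(t))\|_{\mathrm{L}^q(\mu_t;\mathbb{R}^d)}$.
   Context: $\mathcal{P}_p(\mathbb{R}^d)$ is the space of Borel probability measures on $\mathbb{R}^d$ with $\int|x|^p\,\mathrm{d}\mu<+\infty$, endowed with the $p$-Wasserstein distance $\mathcal{W}_p(\mu_1,\mu_2)^p=\min_{\gamma}\int|x-y|^p\,\mathrm{d}\gamma$, the minimum over all Borel probability measures on $\mathbb{R}^d\times\mathbb{R}^d$ with marginals $\mu_1,\mu_2$. $\mathcal{L}^d$ is Lebesgue measure. We write $\mu_t=\mu(t)$. $j_q:\mathbb{R}^d\to\mathbb{R}^d$, $j_q(v)=|v|^{q-2}v$ for $v\ne0$, $j_q(0)=0$. Locally absolutely continuous curve: $\nu:[0,+\infty)\to\mathcal{P}_p(\mathbb{R}^d)$ for which there is $m$, integrable on $(0,T)$ for every $T>0$, with $\mathcal{W}_p(\nu(s),\nu(t))\le\int_s^t m(r)\,\mathrm{d}r$ for all $0\le s\le t<+\infty$. Its metric derivative is $|\nu'|(t)=\lim_{s\to t}\mathcal{W}_p(\nu(s),\nu(t))/|s-t|$, which exists for a.e. $t>0$. Its tangent vector field is the essentially unique Borel field $w:[0,+\infty)\times\mathbb{R}^d\to\mathbb{R}^d$ with $w_t\in\mathrm{L}^p(\nu_t;\mathbb{R}^d)$, $\|w_t\|_{\mathrm{L}^p(\nu_t;\mathbb{R}^d)}=|\nu'|(t)$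 for a.e. $t>0$, and $\partial_t\nu_t+\nabla\cdot(w_t\nu_t)=0$ in the distributional sense, i.e. tested against all $\xi\in\mathrm{C}_c^\infty((0,+\infty)\times\mathbb{R}^d)$. Slopes: for $\mu\in\{\phi<+\infty\}$, the local slope is $|\partial\phi|(\mu)=\limsup_{\mathcal{W}_p(\nu,\mu)\to0}\frac{(\phi(\mu)-\phi(\nu))^+}{\mathcal{W}_p(\mu,\nu)}$; the relaxed slope is $|\partial^-\phi|(\mu)=\inf\{\liminf_n|\partial\phi|(\mu_n):\ \mathcal{W}_p(\mu_n,\mu)\to0,\ \sup_n\phi(\mu_n)<+\infty\}$. Subdifferentials: for $\mu\in\{\phi<+\infty\}$, the strong subdifferential $\partial_s\phi(\mu)$ is the set of $\zeta\in\mathrm{L}^q(\mu;\mathbb{R}^d)$ with $\phi(T_\#\mu)-\phi(\mu)\ge\int\langle\zeta(x),T(x)-x\rangle\,\mathrm{d}\mu(x)+o(\|T-\mathrm{id}\|_{\mathrm{L}^p(\mu;\mathbb{R}^d)})$ for every $T\in\mathrm{L}^p(\mu;\mathbb{R}^d)$. The limiting subdifferential $\partial_l\phi(\mu)$ is the set of $\zeta\in\mathrm{L}^q(\mu;\mathbb{R}^d)$ for which there exist $\mu_n$ with $\mathcal{W}_p(\mu_n,\mu)\to0$ and $\zeta_n\in\partial_s\phi(\mu_n)$ such that $\sup_n\{\phi(\mu_n),\int|\zeta_n|^q\,\mathrm{d}\mu_n\}<+\infty$ and $\zeta_n\mu_n\to\zeta\mu$ in the distributional sense. Minimizing Movement scheme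 associated with $\Phi$: for $\tau>0$ and initial datum $\mu_\tau^0$, successively choose $\mu_\tau^m$ as a minimizer of $\Phi(\tau,\mu_\tau^{m-1},\cdot)$, $m\in\mathbb{N}$. The discrete solution is the piecewise constant interpolation $\mu_\tau(0)=\mu_\tau^0$, $\mu_\tau(t)=\mu_\tau^m$ for $t\in((m-1)\tau,m\tau]$. *)

theory Defs
  imports "HOL-Probability.Probability"
begin

section \<open>Lebesgue spaces\<close>

text \<open>Elements of \<open>L\<^sup>p(\<mu>; \<real>\<^sup>d)\<close> are represented by measurable functions; every notion
  below is invariant under changing such a representative on a \<open>\<mu>\<close>-null set.\<close>

definition Lp_space :: "real \<Rightarrow> 'a measure \<Rightarrow> ('a \<Rightarrow> 'b::euclidean_space) set" where
  "Lp_space p \<mu> = {f. f \<in> borel_measurable \<mu> \<and> integrable \<mu> (\<lambda>x. norm (f x) powr p)}"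

definition Lp_norm :: "real \<Rightarrow> 'a measure \<Rightarrow> ('a \<Rightarrow> 'b::euclidean_space) \<Rightarrow> real" where
  "Lp_norm p \<mu> f = (\<integral>x. norm (f x) powr p \<partial>\<mu>) powr (1 / p)"

definition duality_map :: "real \<Rightarrow> 'a::euclidean_space \<Rightarrow> 'a" where
  "duality_map q v = (if v = 0 then 0 else (norm v powr (q - 2)) *\<^sub>R v)"

text \<open>The library has no real powers of extended nonnegative reals; used for \<open>a > 0\<close>.\<close>

definition ennpowr :: "ennreal \<Rightarrow> real \<Rightarrow> ennreal" where
  "ennpowr x a = (if x = \<infinity> then \<infinity> else ennreal (enn2real x powr a))"


section \<open>Test functions and distributional notions\<close>

text \<open>\<open>C_k n f\<close>: the function \<open>f\<close> is \<open>n\<close> times continuously differentiable. On a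
  finite-dimensional space it suffices to iterate directional derivatives.\<close>

fun C_k :: "nat \<Rightarrow> ('a::euclidean_space \<Rightarrow> real) \<Rightarrow> bool" where
  "C_k 0 f \<longleftrightarrow> continuous_on UNIV f"
| "C_k (Suc n) f \<longleftrightarrow> (\<forall>x. f differentiable (at x)) \<and>
      (\<forall>v. C_k n (\<lambda>x. frechet_derivative f (at x) v))"

text \<open>\<open>C\<^sub>c\<^sup>\<infinity>(U)\<close> for open \<open>U\<close>, its elements being extended by zero to the whole space.\<close>

definition test_functions :: "'a::euclidean_space set \<Rightarrow> ('a \<Rightarrow> real) set" where
  "test_functions U = {\<xi>. (\<forall>n. C_k n \<xi>) \<and> compact (closure {x. \<xi> x \<noteq> 0})
      \<and> closure {x. \<xi> x \<noteq> 0} \<subseteq> U}"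

definition locally_integrable_pos :: "(real \<Rightarrow> real) \<Rightarrow> bool" where
  "locally_integrable_pos f \<longleftrightarrow>
     (\<forall>K. compact K \<and> K \<subseteq> {0<..} \<longrightarrow> set_integrable lborel K f)"

text \<open>\<open>f\<close> belongs to \<open>W\<^bsup>1,1\<^esup>\<close> locally on \<open>(0, \<infinity>)\<close> and \<open>g\<close> represents its weak derivative
  (which is unique up to null sets).\<close>

definition W11_loc_derivative :: "(real \<Rightarrow> real) \<Rightarrow> (real \<Rightarrow> real) \<Rightarrow> bool" where
  "W11_loc_derivative f g \<longleftrightarrow> locally_integrable_pos f \<and> locally_integrable_pos g \<and>
     (\<forall>\<xi> \<in> test_functions {0<..}.
        (LINT t:{0<..}|lborel. f t * deriv \<xi> t) = - (LINT t:{0<..}|lborel. g t * \<xi> t))"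


section \<open>Wasserstein space\<close>

definition wasserstein_space :: "real \<Rightarrow> 'a::euclidean_space measure set" where
  "wasserstein_space p =
     {\<mu>. prob_space \<mu> \<and> sets \<mu> = sets borel \<and> integrable \<mu> (\<lambda>x. norm x powr p)}"

definition couplings ::
    "'a::euclidean_space measure \<Rightarrow> 'a measure \<Rightarrow> ('a \<times> 'a) measure set" where
  "couplings \<mu> \<nu> = {\<gamma>. prob_space \<gamma> \<and> sets \<gamma> = sets borel
      \<and> distr \<gamma> borel fst = \<mu> \<and> distr \<gamma> borel snd = \<nu>}"

text \<open>On \<open>wasserstein_space p\<close> with \<open>p \<ge> 1\<close> the infimum is finite and attained.\<close>

definition wasserstein ::
    "real \<Rightarrow> 'a::euclidean_space measure \<Rightarrow> 'a measure \<Rightarrow> real" where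
  "wasserstein p \<mu> \<nu> = enn2real (INF \<gamma> \<in> couplings \<mu> \<nu>.
      \<integral>\<^sup>+ z. ennreal (norm (fst z - snd z) powr p) \<partial>\<gamma>) powr (1 / p)"


section \<open>Absolutely continuous curves\<close>

text \<open>Curves on \<open>[0, \<infinity>)\<close> are total functions on the reals whose values at negative times
  are irrelevant.\<close>

definition locally_ac_curve :: "real \<Rightarrow> (real \<Rightarrow> 'a::euclidean_space measure) \<Rightarrow> bool" where
  "locally_ac_curve p \<nu> \<longleftrightarrow> (\<forall>t\<ge>0. \<nu> t \<in> wasserstein_space p) \<and>
     (\<exists>m :: real \<Rightarrow> real. (\<forall>T>0. set_integrable lborel {0<..<T} m) \<and>
        (\<forall>s t. 0 \<le> s \<and> s \<le> t \<longrightarrow>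
           wasserstein p (\<nu> s) (\<nu> t) \<le> (LINT r:{s<..<t}|lborel. m r)))"

text \<open>The limit is meaningful only where it exists, which is almost everywhere in
  \<open>(0, \<infinity>)\<close> along locally absolutely continuous curves.\<close>

definition metric_derivative ::
    "real \<Rightarrow> (real \<Rightarrow> 'a::euclidean_space measure) \<Rightarrow> real \<Rightarrow> real" where
  "metric_derivative p \<nu> t =
     Lim (at t within {0..}) (\<lambda>s. wasserstein p (\<nu> s) (\<nu> t) / \<bar>s - t\<bar>)"

text \<open>\<open>frechet_derivative \<xi> (at (t, x)) (1, w t x)\<close> is
  \<open>\<partial>\<^sub>t \<xi>(t, x) + \<langle>\<nabla>\<^sub>x \<xi>(t, x), w\<^sub>t(x)\<rangle>\<close>.\<close>

definition continuity_equation ::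
    "(real \<Rightarrow> 'a::euclidean_space measure) \<Rightarrow> (real \<Rightarrow> 'a \<Rightarrow> 'a) \<Rightarrow> bool" where
  "continuity_equation \<nu> w \<longleftrightarrow>
     (\<forall>\<xi> \<in> test_functions ({0<..} \<times> UNIV).
        (LINT t:{0<..}|lborel.
           (\<integral>x. frechet_derivative \<xi> (at (t, x)) (1, w t x) \<partial>(\<nu> t))) = 0)"

definition tangent_field ::
    "real \<Rightarrow> (real \<Rightarrow> 'a::euclidean_space measure) \<Rightarrow> (real \<Rightarrow> 'a \<Rightarrow> 'a) \<Rightarrow> bool" where
  "tangent_field p \<nu> w \<longleftrightarrow>
     (\<lambda>(t, x). w t x) \<in> borel_measurable (restrict_space borel ({0..} \<times> UNIV)) \<and>
     (AE t in lborel. 0 < t \<longrightarrow>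
        w t \<in> Lp_space p (\<nu> t) \<and> Lp_norm p (\<nu> t) (w t) = metric_derivative p \<nu> t) \<and>
     continuity_equation \<nu> w"


section \<open>Slopes and subdifferentials\<close>

text \<open>Functionals \<open>\<phi>\<close> are only considered on \<open>wasserstein_space p\<close>, and the slopes and
  subdifferentials only at points \<open>\<mu>\<close> with \<open>\<phi> \<mu> < \<infinity>\<close>.\<close>

text \<open>The filter describes \<open>W\<^sub>p(\<nu>, \<mu>) \<rightarrow> 0\<close> with \<open>\<nu> \<noteq> \<mu>\<close> in the Wasserstein space.\<close>

definition local_slope ::
    "real \<Rightarrow> ('a::euclidean_space measure \<Rightarrow> ereal) \<Rightarrow> 'a measure \<Rightarrow> ennreal" where
  "local_slope p \<phi> \<mu> =
     Limsup (inf (filtercomap (\<lambda>\<nu>. wasserstein p \<nu> \<mu>) (at_right 0))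
                 (principal (wasserstein_space p)))
       (\<lambda>\<nu>. e2ennreal (max 0 (\<phi> \<mu> - \<phi> \<nu>)) / ennreal (wasserstein p \<mu> \<nu>))"

definition relaxed_slope ::
    "real \<Rightarrow> ('a::euclidean_space measure \<Rightarrow> ereal) \<Rightarrow> 'a measure \<Rightarrow> ennreal" where
  "relaxed_slope p \<phi> \<mu> =
     (INF m \<in> {m :: nat \<Rightarrow> 'a measure. (\<forall>n. m n \<in> wasserstein_space p) \<and>
                 (\<lambda>n. wasserstein p (m n) \<mu>) \<longlonglongrightarrow> 0 \<and> (SUP n. \<phi> (m n)) < \<infinity>}.
        liminf (\<lambda>n. local_slope p \<phi> (m n)))"

definition strong_subdifferential ::
    "real \<Rightarrow> real \<Rightarrow> ('a::euclidean_space measure \<Rightarrow> ereal) \<Rightarrow> 'a measure \<Rightarrow> ('a \<Rightarrow> 'a) set" where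
  "strong_subdifferential p q \<phi> \<mu> = {\<zeta> \<in> Lp_space q \<mu>.
     \<forall>\<epsilon>>0. \<exists>\<delta>>0. \<forall>T \<in> Lp_space p \<mu>. Lp_norm p \<mu> (\<lambda>x. T x - x) < \<delta> \<longrightarrow>
       \<phi> (distr \<mu> borel T) - \<phi> \<mu> \<ge>
         ereal ((\<integral>x. \<zeta> x \<bullet> (T x - x) \<partial>\<mu>) - \<epsilon> * Lp_norm p \<mu> (\<lambda>x. T x - x))}"

definition limiting_subdifferential ::
    "real \<Rightarrow> real \<Rightarrow> ('a::euclidean_space measure \<Rightarrow> ereal) \<Rightarrow> 'a measure \<Rightarrow> ('a \<Rightarrow> 'a) set" where
  "limiting_subdifferential p q \<phi> \<mu> = {\<zeta> \<in> Lp_space q \<mu>.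
     \<exists>(m :: nat \<Rightarrow> 'a measure) (z :: nat \<Rightarrow> 'a \<Rightarrow> 'a).
       (\<forall>n. m n \<in> wasserstein_space p) \<and> (\<lambda>n. wasserstein p (m n) \<mu>) \<longlonglongrightarrow> 0 \<and>
       (\<forall>n. z n \<in> strong_subdifferential p q \<phi> (m n)) \<and>
       (SUP n. \<phi> (m n)) < \<infinity> \<and>
       (SUP n. ereal (\<integral>x. norm (z n x) powr q \<partial>(m n))) < \<infinity> \<and>
       (\<forall>\<xi> \<in> test_functions UNIV.
          (\<lambda>n. \<integral>x. \<xi> x *\<^sub>R z n x \<partial>(m n)) \<longlonglongrightarrow> (\<integral>x. \<xi> x *\<^sub>R \<zeta> x \<partial>\<mu>))}"

text \<open>The element of the limiting subdifferential, when it is nonempty and its elements agree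
  \<open>\<mu>\<close>-almost everywhere.\<close>

definition Dl ::
    "real \<Rightarrow> real \<Rightarrow> ('a::euclidean_space measure \<Rightarrow> ereal) \<Rightarrow> 'a measure \<Rightarrow> 'a \<Rightarrow> 'a" where
  "Dl p q \<phi> \<mu> = (SOME \<zeta>. \<zeta> \<in> limiting_subdifferential p q \<phi> \<mu>)"


section \<open>Minimizing movements and energy dissipation\<close>

definition mm_functional :: "real \<Rightarrow> ('a::euclidean_space measure \<Rightarrow> ereal) \<Rightarrow>
    real \<Rightarrow> 'a measure \<Rightarrow> 'a measure \<Rightarrow> ereal" where
  "mm_functional p \<phi> \<tau> \<mu> \<nu> =
     \<phi> \<nu> + ereal (1 / (p * \<tau> powr (p - 1)) * wasserstein p \<nu> \<mu> powr p)"

definition discrete_solution :: "real \<Rightarrow> ('a::euclidean_space measure \<Rightarrow> ereal) \<Rightarrow>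
    real \<Rightarrow> (real \<Rightarrow> 'a measure) \<Rightarrow> bool" where
  "discrete_solution p \<phi> \<tau> u \<longleftrightarrow>
     (\<exists>M :: nat \<Rightarrow> 'a measure. M 0 \<in> wasserstein_space p \<and>
        (\<forall>m. is_arg_min (mm_functional p \<phi> \<tau> (M m)) (\<lambda>\<nu>. \<nu> \<in> wasserstein_space p) (M (Suc m))) \<and>
        u 0 = M 0 \<and>
        (\<forall>m t. real m * \<tau> < t \<and> t \<le> real (Suc m) * \<tau> \<longrightarrow> u t = M (Suc m)))"

definition dissipation :: "real \<Rightarrow> real \<Rightarrow> ('a::euclidean_space measure \<Rightarrow> ereal) \<Rightarrow>
    (real \<Rightarrow> 'a measure) \<Rightarrow> real \<Rightarrow> real \<Rightarrow> ennreal" where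
  "dissipation p q \<phi> \<mu> s t =
     ennreal (1 / q) * (\<integral>\<^sup>+ r \<in> {s..t}. ennpowr (relaxed_slope p \<phi> (\<mu> r)) q \<partial>lborel) +
     ennreal (1 / p) * (\<integral>\<^sup>+ r \<in> {s..t}. ennreal (metric_derivative p \<mu> r powr p) \<partial>lborel)"

definition energy_inequality :: "real \<Rightarrow> real \<Rightarrow> ('a::euclidean_space measure \<Rightarrow> ereal) \<Rightarrow>
    (real \<Rightarrow> 'a measure) \<Rightarrow> bool" where
  "energy_inequality p q \<phi> \<mu> \<longleftrightarrow>
     (\<forall>t\<ge>0. \<phi> (\<mu> 0) - \<phi> (\<mu> t) \<ge> enn2ereal (dissipation p q \<phi> \<mu> 0 t))"

definition energy_dissipation_equality :: "real \<Rightarrow> real \<Rightarrow>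
    ('a::euclidean_space measure \<Rightarrow> ereal) \<Rightarrow> (real \<Rightarrow> 'a measure) \<Rightarrow> bool" where
  "energy_dissipation_equality p q \<phi> \<mu> \<longleftrightarrow>
     (\<forall>s t. 0 \<le> s \<and> s \<le> t \<longrightarrow> \<phi> (\<mu> s) - \<phi> (\<mu> t) = enn2ereal (dissipation p q \<phi> \<mu> s t))"

end

theory Submission
 imports Defs "HOL-Complex_Analysis.Great_Picard"
begin

text \<open>Part II rests on one inequality: for a.e. \<open>t\<close>, Young's inequality gives
 \<open>- (\<phi> \<circ> \<mu>)' \<le> |D\<^sub>l\<phi>|\<^sup>q / q + |\<mu>'|\<^sup>p / p \<le> |\<partial>\<^sup>-\<phi>|\<^sup>q / q + |\<mu>'|\<^sup>p / p\<close>. Integrated, it is the converse of the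
 energy inequality, so the energy inequality forces equality almost everywhere, and equality in
 Young's inequality is the flow equation. The bound \<open>\<parallel>D\<^sub>l\<phi>\<parallel> \<le> |\<partial>\<^sup>-\<phi>|\<close> holds because a measure of finite
 slope is approximated by minimizers of \<open>\<Phi>(\<sigma>, \<mu>, \<cdot>)\<close> as \<open>\<sigma> \<rightarrow> 0\<close>; these have strong subgradients whose norm is
 controlled by the slope, and weak limits of those lie in the limiting subdifferential, which has only
 one element.

 For Part I, De Giorgi's interpolation inserts in every time step the minimizers of \<open>\<Phi>(\<sigma>, \<mu>, \<cdot>)\<close> for
 \<open>0 < \<sigma> \<le> \<tau>\<close>. It turns the discrete energy estimate into a sharp inequality between the energy drop and the
 integrals of \<open>G\<^sup>p / q\<close> and (discrete speed)\<open>\<^sup>p / p\<close>, where \<open>G = W / \<sigma>\<close> and \<open>G\<^bsup>p - 1\<^esup>\<close> dominates the slope at the interpolant. Weak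
 compactness of the speeds, Fatou's lemma for the slopes and lower semicontinuity of \<open>\<phi>\<close> pass it to
 the limit.\<close>

section \<open>Conjugate exponents\<close>

text \<open>The energy may decrease like the same power p of the distance that penalizes a step, so
  minimizers exist, and distances stay controlled, only for small steps; this is behind
  \<open>pen\<close>, \<open>slack\<close> and \<open>horizon\<close>. All minimizers at small steps
  have strong subgradients, but the slope controls their size only on average over the steps: De
  Giorgi's interpolation is therefore needed in Part II too, to select one good step. Distances are
  handled without optimal plans: near-optimal ones give the triangle inequality through approximate
  gluing, measures at distance 0 are never identified but have equal energy by lower semicontinuity,
  and limits of curves come from sequential compactness. Neither the relaxed slope nor the
  arbitrarily chosen minimizers are regular by definition; measurability comes from infima of the
  slope over balls and from monotonicity of W in the step. In Part I the energy may drop in the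
  limit, so the kinetic term and the final energy are given limits of their own before lower
  semicontinuity is applied.\<close>

locale conjugate_exponents =
 fixes p q :: real
 assumes p_gt_1: "1 < p" and q_gt_1: "1 < q" and conjugate: "1 / p + 1 / q = 1"
begin

lemma p_pos: "0 < p" and q_pos: "0 < q"
 using p_gt_1 q_gt_1 by auto

lemma q_eq: "q = p / (p - 1)"
 using conjugate p_gt_1 q_gt_1 by (simp add: field_simps)

lemma p_eq: "p = q / (q - 1)"
 using conjugate p_gt_1 q_gt_1 by (simp add: field_simps)

lemma inverse_q: "1 / q = (p - 1) / p" and inverse_p: "1 / p = (q - 1) / q"
 using conjugate p_gt_1 q_gt_1 by (simp_all add: field_simps)

lemma p_minus_1_times_q: "(p - 1) * q = p" and q_minus_1_times_p: "(q - 1) * p = q"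
 using p_gt_1 q_gt_1 q_eq p_eq by (metis diff_gt_0_iff_gt less_numeral_extra(3) nonzero_eq_divide_eq mult.commute)+

lemma young: "0 \<le> a ==> 0 \<le> b ==> a * b \<le> a powr p / p + b powr q / q"
 using Youngs_inequality[OF p_gt_1 q_gt_1 conjugate] .

text \<open>The hypotheses are symmetric in p and q. Weak compactness is proved once, for fields in
  L^q; the dual version supplies it for discrete speeds in L^p.\<close>

sublocale dual: conjugate_exponents q p
 using p_gt_1 q_gt_1 conjugate by unfold_locales auto

lemma holder:
 fixes f :: "'a \<Rightarrow> 'b::euclidean_space" and g :: "'a \<Rightarrow> 'c::euclidean_space"
 assumes "f \<in> Lp_space p M" "g \<in> Lp_space q M"
 shows "integrable M (\<lambda>x. norm (f x) * norm (g x))"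
  and "(\<integral>x. norm (f x) * norm (g x) \<partial>M) \<le> Lp_norm p M f * Lp_norm q M g"
proof -
 have [measurable]: "f \<in> borel_measurable M" "g \<in> borel_measurable M"
  and f: "integrable M (\<lambda>x. norm (f x) powr p)" and g: "integrable M (\<lambda>x. norm (g x) powr q)"
  using assms by (auto simp: Lp_space_def)
 show int: "integrable M (\<lambda>x. norm (f x) * norm (g x))"
 proof (rule Bochner_Integration.integrable_bound)
  show "integrable M (\<lambda>x. norm (f x) powr p / p + norm (g x) powr q / q)"
   using f g by auto
  show "AE x in M. norm (norm (f x) * norm (g x)) \<le> norm (norm (f x) powr p / p + norm (g x) powr q / q)"
   using order_trans[OF young abs_ge_self] by (intro AE_I2) simp
 qed simp
 define P where "P = (\<integral>x. norm (f x) powr p \<partial>M)"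
 define Q where "Q = (\<integral>x. norm (g x) powr q \<partial>M)"
 have PQ: "P \<ge> 0" "Q \<ge> 0" by (auto simp: P_def Q_def)
 show "(\<integral>x. norm (f x) * norm (g x) \<partial>M) \<le> Lp_norm p M f * Lp_norm q M g"
 \<comment> \<open>The proof normalizes both functions to norm one, which is impossible when one of
   them vanishes almost everywhere.\<close>
 proof (cases "P = 0 \<or> Q = 0")
  case True
  then have "AE x in M. norm (f x) * norm (g x) = 0"
  proof
   assume "P = 0"
   then have "AE x in M. norm (f x) powr p = 0"
    using integral_nonneg_eq_0_iff_AE[OF f] by (simp add: P_def)
   then show ?thesis by eventually_elim simp
  next
   assume "Q = 0"
   then have "AE x in M. norm (g x) powr q = 0"
    using integral_nonneg_eq_0_iff_AE[OF g] by (simp add: Q_def)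
   then show ?thesis by eventually_elim simp
  qed
  then have "(\<integral>x. norm (f x) * norm (g x) \<partial>M) = (\<integral>x. 0 \<partial>M)"
   by (intro integral_cong_AE) auto
  then show ?thesis by (simp add: Lp_norm_def)
 next
  case False
  then have pos: "P > 0" "Q > 0" using PQ by auto
  define F where "F = P powr (1/p)"
  define G where "G = Q powr (1/q)"
  have FG: "F > 0" "G > 0" "F powr p = P" "G powr q = Q"
   using pos p_pos q_pos by (auto simp: F_def G_def powr_powr)
  have "(\<integral>x. norm (f x) * norm (g x) \<partial>M) / (F * G) = (\<integral>x. (norm (f x) / F) * (norm (g x) / G) \<partial>M)"
   by (simp add: field_simps flip: Bochner_Integration.integral_divide_zero)
  also have "\<dots> \<le> (\<integral>x. norm (f x) powr p / (p * P) + norm (g x) powr q / (q * Q) \<partial>M)"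
  proof (rule integral_mono)
   show "integrable M (\<lambda>x. norm (f x) / F * (norm (g x) / G))"
    using int FG by (auto intro!: integrable_divide_zero simp: times_divide_times_eq)
   show "integrable M (\<lambda>x. norm (f x) powr p / (p * P) + norm (g x) powr q / (q * Q))"
    using f g by auto
   show "norm (f x) / F * (norm (g x) / G) \<le> norm (f x) powr p / (p * P) + norm (g x) powr q / (q * Q)" for x
    using young[of "norm (f x) / F" "norm (g x) / G"] FG
    by (simp add: powr_divide field_simps)
  qed
  also have "\<dots> = 1 / p + 1 / q"
   using f g pos by (simp add: P_def[symmetric] Q_def[symmetric])
  finally show ?thesis
   using FG conjugate by (simp add: Lp_norm_def F_def G_def P_def Q_def divide_le_eq)
 qed
qed

lemma holder_inner:
 fixes f :: "'a \<Rightarrow> 'b::euclidean_space" and g :: "'a \<Rightarrow> 'b"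
 assumes "f \<in> Lp_space p M" "g \<in> Lp_space q M"
 shows "integrable M (\<lambda>x. f x \<bullet> g x)"
  and "\<bar>\<integral>x. f x \<bullet> g x \<partial>M\<bar> \<le> Lp_norm p M f * Lp_norm q M g"
proof -
 have [measurable]: "f \<in> borel_measurable M" "g \<in> borel_measurable M"
  using assms by (auto simp: Lp_space_def)
 show int: "integrable M (\<lambda>x. f x \<bullet> g x)"
  by (rule Bochner_Integration.integrable_bound[OF holder(1)[OF assms]]) (auto simp: Cauchy_Schwarz_ineq2)
 have "\<bar>\<integral>x. f x \<bullet> g x \<partial>M\<bar> \<le> (\<integral>x. \<bar>f x \<bullet> g x\<bar> \<partial>M)"
  using integral_norm_bound[of M "\<lambda>x. f x \<bullet> g x"] by simp
 also have "\<dots> \<le> (\<integral>x. norm (f x) * norm (g x) \<partial>M)"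
  using int by (intro integral_mono holder(1)[OF assms]) (auto simp: Cauchy_Schwarz_ineq2)
 also note holder(2)[OF assms]
 finally show "\<bar>\<integral>x. f x \<bullet> g x \<partial>M\<bar> \<le> Lp_norm p M f * Lp_norm q M g" .
qed

text \<open>If an endpoint is 0 the claim reduces to w^p \<le> w on [0, 1]; otherwise it is
  convexity of the power on the open half-line.\<close>

lemma convex_powr:
 assumes "0 \<le> a" "0 \<le> b" "0 \<le> u" "u \<le> 1"
 shows "(u * a + (1 - u) * b) powr p \<le> u * a powr p + (1 - u) * b powr p"
proof -
 have le: "(w * c) powr p \<le> w * c powr p" if "0 \<le> w" "w \<le> 1" "0 \<le> c" for w c :: real
  using that powr_mono_both'[of 1 p w w] powr_le1[of "p - 1" w] p_gt_1
  by (cases "w = 0") (auto simp: powr_mult intro!: mult_right_mono)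
 consider "a = 0" | "b = 0" | "0 < a" "0 < b" using assms by fastforce
 then show ?thesis
 proof cases
  case 3
  then show ?thesis using convex_onD[OF powr_convex[of p], of "1 - u" a b] p_gt_1 assms by simp
 qed (use le[of "1 - u" b] le[of u a] assms p_pos in auto)
qed

lemma powr_add_le: "0 \<le> a ==> 0 \<le> b ==> (a + b) powr p \<le> 2 powr (p - 1) * (a powr p + b powr p)"
proof -
 assume "0 \<le> a" "0 \<le> b"
 then have "((a + b) / 2) powr p \<le> (a powr p + b powr p) / 2"
  using convex_powr[of a b "1/2"] by (simp add: field_simps)
 then show ?thesis using \<open>0 \<le> a\<close> \<open>0 \<le> b\<close>
  by (simp add: powr_divide powr_diff field_simps)
qed

text \<open>(f + g) / (a + b) is a convex combination of f / a and g / b with weights a / (a + b)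
  and b / (a + b); integrate convexity of the power. Upper bounds a, b > 0 in place of the norms
  themselves dispense with degenerate cases and with integrability.\<close>

lemma minkowski_nn_integral:
 fixes f g :: "'a \<Rightarrow> real"
 assumes [measurable]: "f \<in> borel_measurable M" "g \<in> borel_measurable M"
  and nn: "\<And>x. 0 \<le> f x" "\<And>x. 0 \<le> g x" and ab: "0 < a" "0 < b"
  and le: "(\<integral>\<^sup>+x. ennreal (f x powr p) \<partial>M) \<le> ennreal (a powr p)"
    "(\<integral>\<^sup>+x. ennreal (g x powr p) \<partial>M) \<le> ennreal (b powr p)"
 shows "(\<integral>\<^sup>+x. ennreal ((f x + g x) powr p) \<partial>M) \<le> ennreal ((a + b) powr p)"
proof -
 define c where "c = a + b"
 define u where "u = a / c"
 have u: "0 < c" "0 \<le> u" "u \<le> 1" "1 - u = b / c" using ab by (auto simp: u_def c_def field_simps)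
 have "(f x + g x) powr p \<le> (c powr p * u / a powr p) * f x powr p + (c powr p * (1 - u) / b powr p) * g x powr p" for x
 proof -
  have "(f x + g x) = c * (u * (f x / a) + (1 - u) * (g x / b))"
   using ab u(1) by (simp only: u(4)) (simp add: u_def distrib_left)
  then have "(f x + g x) powr p = c powr p * (u * (f x / a) + (1 - u) * (g x / b)) powr p"
   using nn ab u by (simp add: powr_mult)
  also have "\<dots> \<le> c powr p * (u * (f x / a) powr p + (1 - u) * (g x / b) powr p)"
   using nn ab u by (intro mult_left_mono convex_powr) auto
  finally show ?thesis using nn ab by (simp add: powr_divide algebra_simps)
 qed
 then have "(\<integral>\<^sup>+x. ennreal ((f x + g x) powr p) \<partial>M) \<le>
   (\<integral>\<^sup>+x. ennreal (c powr p * u / a powr p) * ennreal (f x powr p) +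
    ennreal (c powr p * (1 - u) / b powr p) * ennreal (g x powr p) \<partial>M)"
  using u(1-3) ab by (intro nn_integral_mono) (simp flip: ennreal_mult'' ennreal_plus)
 also have "\<dots> = ennreal (c powr p * u / a powr p) * (\<integral>\<^sup>+x. ennreal (f x powr p) \<partial>M) +
    ennreal (c powr p * (1 - u) / b powr p) * (\<integral>\<^sup>+x. ennreal (g x powr p) \<partial>M)"
  by (simp add: nn_integral_add nn_integral_cmult)
 also have "\<dots> \<le> ennreal (c powr p * u / a powr p) * ennreal (a powr p) +
    ennreal (c powr p * (1 - u) / b powr p) * ennreal (b powr p)"
  by (intro add_mono mult_left_mono le) auto
 also have "\<dots> = ennreal (c powr p)"
 proof -
  have "ennreal (c powr p * u / a powr p) * ennreal (a powr p) = ennreal (c powr p * u)"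
   "ennreal (c powr p * (1 - u) / b powr p) * ennreal (b powr p) = ennreal (c powr p * (1 - u))"
   using ab by (simp_all flip: ennreal_mult'')
  moreover have "c powr p * u + c powr p * (1 - u) = c powr p" by (simp add: algebra_simps)
  ultimately show ?thesis using u(1-3) by (simp del: ennreal_plus flip: ennreal_plus)
 qed
 finally show ?thesis by (simp add: c_def)
qed

end

section \<open>The Wasserstein distance\<close>

text \<open>Two laws that agree after passing to a countable partition are glued along it; refining the
 partition replaces the disintegration in the usual gluing lemma.\<close>

lemma gluing:
 fixes c1 :: "'a \<Rightarrow> nat" and c2 :: "'b \<Rightarrow> nat"
 assumes "prob_space M1" "prob_space M2"
  and [measurable]: "c1 \<in> measurable M1 (count_space UNIV)" "c2 \<in> measurable M2 (count_space UNIV)"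
  and eq: "distr M1 (count_space UNIV) c1 = distr M2 (count_space UNIV) c2"
 obtains G where "sets G = sets (M1 \<Otimes>\<^sub>M M2)"
  "\<And>f. f \<in> borel_measurable M1 ==> (\<integral>\<^sup>+w. f (fst w) \<partial>G) = (\<integral>\<^sup>+x. f x \<partial>M1)"
  "\<And>f. f \<in> borel_measurable M2 ==> (\<integral>\<^sup>+w. f (snd w) \<partial>G) = (\<integral>\<^sup>+x. f x \<partial>M2)"
  "AE w in G. c1 (fst w) = c2 (snd w)"
proof -
 interpret M1: prob_space M1 by fact
 interpret M2: prob_space M2 by fact
 interpret P: pair_prob_space M1 M2 ..
 define a where "a i = emeasure M1 (c1 -` {i} \<inter> space M1)" for i
 have a2: "a i = emeasure M2 (c2 -` {i} \<inter> space M2)" for i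
  using arg_cong[OF eq, of "\<lambda>N. emeasure N {i}"] by (simp add: a_def emeasure_distr)
 have fin: "a i \<noteq> \<infinity>" for i by (simp add: a_def)
 \<comment> \<open>Density of the glued law against the product: given a common cell, the two laws
   are made independent. Cells of mass 0 give the value \<infinity>, which \<open>ae1\<close> and
   \<open>ae2\<close> confine to null sets.\<close>
 define k where "k x y = (if c1 x = c2 y then 1 / a (c1 x) else 0)" for x y
 have [measurable]: "a \<in> borel_measurable (count_space UNIV)" by simp
 have [measurable]: "(\<lambda>w. a (c1 (fst w))) \<in> borel_measurable (M1 \<Otimes>\<^sub>M M2)"
  by (rule measurable_compose[of "\<lambda>w. c1 (fst w)" _ "count_space UNIV" a]) measurable
 have "Measurable.pred (M1 \<Otimes>\<^sub>M M2) (\<lambda>w. \<exists>i. c1 (fst w) = i \<and> c2 (snd w) = i)" by measurable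
 then have [measurable]: "Measurable.pred (M1 \<Otimes>\<^sub>M M2) (\<lambda>w. c1 (fst w) = c2 (snd w))"
  by (simp add: eq_commute[of "c1 _" "c2 _"])
 have k[measurable]: "(\<lambda>w. k (fst w) (snd w)) \<in> borel_measurable (M1 \<Otimes>\<^sub>M M2)"
  unfolding k_def by measurable
 define G where "G = density (M1 \<Otimes>\<^sub>M M2) (\<lambda>w. k (fst w) (snd w))"
 have ae1: "AE x in M1. a (c1 x) \<noteq> 0"
 proof -
  have "AE x in M1. c1 x = i \<longrightarrow> a i \<noteq> 0" for i
  proof (cases "a i = 0")
   case True
   then have "c1 -` {i} \<inter> space M1 \<in> null_sets M1" by (auto simp: a_def null_sets_def)
   then show ?thesis by (rule AE_I') (auto simp: True)
  qed simp
  then have "AE x in M1. \<forall>i. c1 x = i \<longrightarrow> a i \<noteq> 0" unfolding AE_all_countable by blast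
  then show ?thesis by eventually_elim simp
 qed
 have ae2: "AE x in M2. a (c2 x) \<noteq> 0"
 proof -
  have "AE x in M2. c2 x = i \<longrightarrow> a i \<noteq> 0" for i
  proof (cases "a i = 0")
   case True
   then have "c2 -` {i} \<inter> space M2 \<in> null_sets M2" by (auto simp: a2 null_sets_def)
   then show ?thesis by (rule AE_I') (auto simp: True)
  qed simp
  then have "AE x in M2. \<forall>i. c2 x = i \<longrightarrow> a i \<noteq> 0" unfolding AE_all_countable by blast
  then show ?thesis by eventually_elim simp
 qed
 have k1: "(\<integral>\<^sup>+y. k x y \<partial>M2) = 1" if "a (c1 x) \<noteq> 0" for x
 proof -
  have "(\<integral>\<^sup>+y. k x y \<partial>M2) = (\<integral>\<^sup>+y. (1 / a (c1 x)) * indicator (c2 -` {c1 x} \<inter> space M2) y \<partial>M2)"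
   by (intro nn_integral_cong) (auto simp: k_def)
  also have "\<dots> = (1 / a (c1 x)) * a (c1 x)"
   by (subst nn_integral_cmult_indicator) (auto simp: a2)
  finally show ?thesis using that fin by (simp add: ennreal_divide_times ennreal_divide_self top.not_eq_extremum)
 qed
 have k2: "(\<integral>\<^sup>+x. k x y \<partial>M1) = 1" if "a (c2 y) \<noteq> 0" for y
 proof -
  have "(\<integral>\<^sup>+x. k x y \<partial>M1) = (\<integral>\<^sup>+x. (1 / a (c2 y)) * indicator (c1 -` {c2 y} \<inter> space M1) x \<partial>M1)"
   by (intro nn_integral_cong) (auto simp: k_def)
  also have "\<dots> = (1 / a (c2 y)) * a (c2 y)"
   by (subst nn_integral_cmult_indicator) (auto simp: a_def)
  finally show ?thesis using that fin by (simp add: ennreal_divide_times ennreal_divide_self top.not_eq_extremum)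
 qed
 show ?thesis
 proof
  show "sets G = sets (M1 \<Otimes>\<^sub>M M2)" by (simp add: G_def)
  show "(\<integral>\<^sup>+w. f (fst w) \<partial>G) = (\<integral>\<^sup>+x. f x \<partial>M1)" if [measurable]: "f \<in> borel_measurable M1" for f
  proof -
   have "(\<integral>\<^sup>+w. f (fst w) \<partial>G) = (\<integral>\<^sup>+w. f (fst w) * k (fst w) (snd w) \<partial>(M1 \<Otimes>\<^sub>M M2))"
    by (simp add: G_def nn_integral_density mult.commute)
   also have "\<dots> = (\<integral>\<^sup>+x. \<integral>\<^sup>+y. f x * k x y \<partial>M2 \<partial>M1)"
    by (subst M2.nn_integral_fst[symmetric]) auto
   also have "\<dots> = (\<integral>\<^sup>+x. f x \<partial>M1)"
   proof (rule nn_integral_cong_AE)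
    show "AE x in M1. (\<integral>\<^sup>+y. f x * k x y \<partial>M2) = f x"
     using ae1 AE_space
    proof eventually_elim
     case (elim x)
     have [measurable]: "(\<lambda>y. k x y) \<in> borel_measurable M2"
      using elim measurable_Pair2[OF k, of x] by simp
     show ?case using k1[OF elim(1)] by (simp add: nn_integral_cmult)
    qed
   qed
   finally show ?thesis .
  qed
  show "(\<integral>\<^sup>+w. f (snd w) \<partial>G) = (\<integral>\<^sup>+x. f x \<partial>M2)" if [measurable]: "f \<in> borel_measurable M2" for f
  proof -
   have "(\<integral>\<^sup>+w. f (snd w) \<partial>G) = (\<integral>\<^sup>+w. f (snd w) * k (fst w) (snd w) \<partial>(M1 \<Otimes>\<^sub>M M2))"
    by (simp add: G_def nn_integral_density mult.commute)
   also have "\<dots> = (\<integral>\<^sup>+y. \<integral>\<^sup>+x. f y * k x y \<partial>M1 \<partial>M2)"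
    by (subst P.nn_integral_snd[symmetric]) (auto simp: split_beta')
   also have "\<dots> = (\<integral>\<^sup>+x. f x \<partial>M2)"
   proof (rule nn_integral_cong_AE)
    show "AE y in M2. (\<integral>\<^sup>+x. f y * k x y \<partial>M1) = f y"
     using ae2 AE_space
    proof eventually_elim
     case (elim y)
     have [measurable]: "(\<lambda>x. k x y) \<in> borel_measurable M1"
      using elim measurable_Pair1[OF k, of y] by simp
     show ?case using k2[OF elim(1)] by (simp add: nn_integral_cmult)
    qed
   qed
   finally show ?thesis .
  qed
  show "AE w in G. c1 (fst w) = c2 (snd w)"
   unfolding G_def by (subst AE_density) (auto simp: k_def split: if_splits)
 qed
qed

text \<open>The cell of a point is the index of the first member of a dense sequence within e / 2 of
  it.\<close>

lemma countable_small_cells: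
 fixes e :: real
 assumes "0 < e"
 obtains c :: "'a::{metric_space,second_countable_topology} \<Rightarrow> nat"
  where "c \<in> measurable borel (count_space UNIV)" "\<And>x y. c x = c y ==> dist x y < e"
proof -
 obtain D :: "'a set" where D: "countable D" "\<And>X. open X ==> X \<noteq> {} ==> \<exists>d\<in>D. d \<in> X"
  by (erule countable_dense_setE)
 define d where "d = from_nat_into D"
 have ne: "D \<noteq> {}" using D(2)[of UNIV] by auto
 have ex: "\<exists>n. dist x (d n) < e / 2" for x
 proof -
  obtain y where "y \<in> D" "y \<in> ball x (e/2)" using D(2)[of "ball x (e/2)"] assms by auto
  then show ?thesis using from_nat_into_surj[OF D(1), of y] by (auto simp: d_def)
 qed
 define c where "c x = (LEAST n. dist x (d n) < e / 2)" for x
 have c: "dist x (d (c x)) < e / 2" for x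
  unfolding c_def using ex by (rule LeastI_ex)
 show ?thesis
 proof
  show "c \<in> measurable borel (count_space UNIV)"
   unfolding c_def by measurable
  show "dist x y < e" if "c x = c y" for x y
   using c[of x] c[of y] that dist_triangle_half_l[of x "d (c x)" e y] by simp
 qed
qed

lemma wasserstein_spaceD:
 assumes "\<mu> \<in> wasserstein_space p"
 shows "prob_space \<mu>" "sets \<mu> = sets borel" "space \<mu> = UNIV" "integrable \<mu> (\<lambda>x. norm x powr p)"
 using assms by (auto simp: wasserstein_space_def dest: sets_eq_imp_space_eq)

lemma couplingsD:
 assumes "\<gamma> \<in> couplings \<mu> \<nu>"
 shows "prob_space \<gamma>" "sets \<gamma> = sets borel" "space \<gamma> = UNIV"
  "distr \<gamma> borel fst = \<mu>" "distr \<gamma> borel snd = \<nu>"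
  "fst \<in> borel_measurable \<gamma>" "snd \<in> borel_measurable \<gamma>"
  "sets \<mu> = sets borel" "sets \<nu> = sets borel"
proof -
 show sets: "prob_space \<gamma>" "sets \<gamma> = sets borel"
  "distr \<gamma> borel fst = \<mu>" "distr \<gamma> borel snd = \<nu>" using assms by (auto simp: couplings_def)
 then show "space \<gamma> = UNIV" "sets \<mu> = sets borel" "sets \<nu> = sets borel" by (auto dest: sets_eq_imp_space_eq)
 show "fst \<in> borel_measurable \<gamma>" "snd \<in> borel_measurable \<gamma>"
  unfolding measurable_cong_sets[OF sets(2) refl]
  by (auto intro!: borel_measurable_continuous_onI continuous_intros)
qed

abbreviation transport_cost :: "real \<Rightarrow> ('a \<times> 'a::euclidean_space) measure \<Rightarrow> ennreal" where
 "transport_cost p \<gamma> \<equiv> \<integral>\<^sup>+ z. ennreal (norm (fst z - snd z) powr p) \<partial>\<gamma>"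

lemma couplings_integrals:
 assumes \<gamma>: "\<gamma> \<in> couplings \<mu> \<nu>" and f: "f \<in> borel_measurable borel"
 shows "(\<integral>\<^sup>+z. f (fst z) \<partial>\<gamma>) = (\<integral>\<^sup>+x. f x \<partial>\<mu>)" "(\<integral>\<^sup>+z. f (snd z) \<partial>\<gamma>) = (\<integral>\<^sup>+x. f x \<partial>\<nu>)"
proof -
 note \<gamma>' = couplingsD[OF \<gamma>]
 show "(\<integral>\<^sup>+z. f (fst z) \<partial>\<gamma>) = (\<integral>\<^sup>+x. f x \<partial>\<mu>)"
  unfolding \<gamma>'(4)[symmetric] using \<gamma>'(6) f by (subst nn_integral_distr) auto
 show "(\<integral>\<^sup>+z. f (snd z) \<partial>\<gamma>) = (\<integral>\<^sup>+x. f x \<partial>\<nu>)"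
  unfolding \<gamma>'(5)[symmetric] using \<gamma>'(7) f by (subst nn_integral_distr) auto
qed

lemma couplings_swap:
 assumes \<gamma>: "\<gamma> \<in> couplings \<mu> \<nu>"
 shows "distr \<gamma> borel (\<lambda>z. (snd z, fst z)) \<in> couplings \<nu> \<mu>"
proof -
 note \<gamma>' = couplingsD[OF \<gamma>]
 interpret prob_space \<gamma> by fact
 note [measurable] = \<gamma>'(6,7)
 have [measurable]: "(\<lambda>z. (snd z, fst z)) \<in> borel_measurable \<gamma>" by measurable
 have fs[measurable]: "fst \<in> borel_measurable borel" "snd \<in> borel_measurable borel" 
  by (auto intro!: borel_measurable_continuous_onI continuous_intros)
 show ?thesis
  using \<gamma>'(4,5) by (auto simp: couplings_def distr_distr comp_def prob_space_distr)
qed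


lemma integrable_powr_add:
 fixes f g :: "'a \<Rightarrow> 'b::{banach,second_countable_topology}"
 assumes "1 < p" and [measurable]: "f \<in> borel_measurable M" "g \<in> borel_measurable M"
  and "integrable M (\<lambda>x. norm (f x) powr p)" "integrable M (\<lambda>x. norm (g x) powr p)"
 shows "integrable M (\<lambda>x. norm (f x + g x) powr p)"
proof (rule Bochner_Integration.integrable_bound)
 interpret conjugate_exponents p "p / (p - 1)"
  using assms(1) by unfold_locales (auto simp: field_simps)
 show "integrable M (\<lambda>x. 2 powr (p - 1) * (norm (f x) powr p + norm (g x) powr p))"
  using assms by auto
 have "norm (f x + g x) powr p \<le> 2 powr (p - 1) * (norm (f x) powr p + norm (g x) powr p)" for x
  using powr_add_le[of "norm (f x)" "norm (g x)"] powr_mono2[OF less_imp_le[OF p_pos] _ norm_triangle_ineq[of "f x" "g x"]]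
  by simp
 then show "AE x in M. norm (norm (f x + g x) powr p) \<le> norm (2 powr (p - 1) * (norm (f x) powr p + norm (g x) powr p))"
  by (intro AE_I2) auto
qed simp

lemma Lp_space_add: "1 < p ==> f \<in> Lp_space p M ==> g \<in> Lp_space p M ==> (\<lambda>x. f x + g x) \<in> Lp_space p M"
 using integrable_powr_add[of p f M g] by (auto simp: Lp_space_def)

lemma Lp_space_minus: "f \<in> Lp_space p M ==> (\<lambda>x. - f x) \<in> Lp_space p M"
 by (auto simp: Lp_space_def)

lemma Lp_space_diff: "1 < p ==> f \<in> Lp_space p M ==> g \<in> Lp_space p M ==> (\<lambda>x. f x - g x) \<in> Lp_space p M"
 using Lp_space_add[of p f M "\<lambda>x. - g x"] Lp_space_minus[of g p M] by simp

lemma couplings_cost_integrable: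
 assumes "1 < p" "\<mu> \<in> wasserstein_space p" "\<nu> \<in> wasserstein_space p" "\<gamma> \<in> couplings \<mu> \<nu>"
 shows "fst \<in> Lp_space p \<gamma>" "snd \<in> Lp_space p \<gamma>" "(\<lambda>z. fst z - snd z) \<in> Lp_space p \<gamma>"
proof -
 note \<gamma> = couplingsD[OF assms(4)]
 have [measurable]: "(\<lambda>x::'a. norm x powr p) \<in> borel_measurable borel" by measurable
 have "integrable (distr \<gamma> borel fst) (\<lambda>x. norm x powr p)"
  using wasserstein_spaceD(4)[OF assms(2)] \<gamma>(4) by simp
 then show 1: "fst \<in> Lp_space p \<gamma>"
  unfolding Lp_space_def using \<gamma>(6) by (auto simp: integrable_distr_eq)
 have "integrable (distr \<gamma> borel snd) (\<lambda>x. norm x powr p)"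
  using wasserstein_spaceD(4)[OF assms(3)] \<gamma>(5) by simp
 then show 2: "snd \<in> Lp_space p \<gamma>"
  unfolding Lp_space_def using \<gamma>(7) by (auto simp: integrable_distr_eq)
 show "(\<lambda>z. fst z - snd z) \<in> Lp_space p \<gamma>"
  by (rule Lp_space_diff[OF assms(1) 1 2])
qed

lemma product_coupling:
 assumes "prob_space \<mu>" "prob_space \<nu>" and sets: "sets \<mu> = sets borel" "sets \<nu> = sets borel"
 shows "\<mu> \<Otimes>\<^sub>M \<nu> \<in> couplings \<mu> \<nu>"
proof -
 interpret M1: prob_space \<mu> by fact
 interpret M2: prob_space \<nu> by fact
 interpret P: pair_prob_space \<mu> \<nu> ..
 have "distr (\<mu> \<Otimes>\<^sub>M \<nu>) borel fst = distr (\<mu> \<Otimes>\<^sub>M \<nu>) \<mu> fst"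
  "distr (\<mu> \<Otimes>\<^sub>M \<nu>) borel snd = distr (\<mu> \<Otimes>\<^sub>M \<nu>) \<nu> snd"
  using sets by (auto intro!: distr_cong)
 moreover have "sets (\<mu> \<Otimes>\<^sub>M \<nu>) = sets borel"
  using sets_pair_measure_cong[OF sets] by (simp only: borel_prod)
 moreover have "distr (\<mu> \<Otimes>\<^sub>M \<nu>) \<nu> snd = \<nu>"
  by (intro measure_eqI) (auto simp: emeasure_distr M2.emeasure_pair_measure_Times measurable_snd snd_vimage_eq_Times
    space_pair_measure Times_Int_Times M1.emeasure_space_1 sets.sets_into_space Int_absorb1 cong: )
 ultimately show ?thesis
  using M2.distr_pair_fst[of \<mu>] P.prob_space_axioms by (auto simp: couplings_def)
qed

context
 fixes p :: real assumes p: "1 < p"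
begin

lemma wasserstein_nonneg: "0 \<le> wasserstein p \<mu> \<nu>"
 by (simp add: wasserstein_def)

lemma wasserstein_le:
 assumes "\<gamma> \<in> couplings \<mu> \<nu>" "0 \<le> c"
  "transport_cost p \<gamma> \<le> ennreal (c powr p)"
 shows "wasserstein p \<mu> \<nu> \<le> c"
proof -
 have "(INF \<gamma> \<in> couplings \<mu> \<nu>. \<integral>\<^sup>+ z. ennreal (norm (fst z - snd z) powr p) \<partial>\<gamma>) \<le> ennreal (c powr p)"
  using assms by (meson INF_lower2)
 then have "enn2real (INF \<gamma> \<in> couplings \<mu> \<nu>. \<integral>\<^sup>+ z. ennreal (norm (fst z - snd z) powr p) \<partial>\<gamma>) \<le> c powr p"
  by (rule enn2real_leI[rotated]) simp
 then have "wasserstein p \<mu> \<nu> \<le> (c powr p) powr (1/p)"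
  unfolding wasserstein_def using p by (intro powr_mono2) auto
 then show ?thesis using p assms(2) by (simp add: powr_powr)
qed

text \<open>The strict inequality stands in for a minimizing plan. Finiteness of the infimum, seen
  from the product plan, is essential: \<open>enn2real\<close> maps an infinite infimum to 0, and
  the bound on the distance would then say nothing.\<close>

lemma near_optimal_coupling:
 assumes \<mu>: "\<mu> \<in> wasserstein_space p" and \<nu>: "\<nu> \<in> wasserstein_space p"
  and less: "wasserstein p \<mu> \<nu> < c"
 obtains \<gamma> where "\<gamma> \<in> couplings \<mu> \<nu>"
  "transport_cost p \<gamma> \<le> ennreal (c powr p)"
proof -
 define I where "I = (INF \<gamma> \<in> couplings \<mu> \<nu>. \<integral>\<^sup>+ z. ennreal (norm (fst z - snd z) powr p) \<partial>\<gamma>)"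
 have \<pi>: "\<mu> \<Otimes>\<^sub>M \<nu> \<in> couplings \<mu> \<nu>"
  using \<mu> \<nu> by (intro product_coupling) (auto dest: wasserstein_spaceD)
 have "I \<le> (\<integral>\<^sup>+ z. ennreal (norm (fst z - snd z) powr p) \<partial>(\<mu> \<Otimes>\<^sub>M \<nu>))"
  unfolding I_def using \<pi> by (rule INF_lower)
 also have "\<dots> < \<infinity>"
  using couplings_cost_integrable(3)[OF p \<mu> \<nu> \<pi>] by (simp add: Lp_space_def integrable_iff_bounded)
 finally have fin: "I < \<infinity>" .
 have "0 < c" using less wasserstein_nonneg[of \<mu> \<nu>] by simp
 have "enn2real I < c powr p"
 proof (rule ccontr)
  assume "\<not> ?thesis"
  then have "(c powr p) powr (1/p) \<le> enn2real I powr (1/p)" using p by (intro powr_mono2) auto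
  then show False using less \<open>0 < c\<close> p by (simp add: powr_powr wasserstein_def I_def[symmetric])
 qed
 then have "I < ennreal (c powr p)"
  using fin by (simp add: enn2real_less_iff flip: ennreal_enn2real_if)
 then obtain \<gamma> where "\<gamma> \<in> couplings \<mu> \<nu>"
  "transport_cost p \<gamma> < ennreal (c powr p)"
  unfolding I_def INF_less_iff by auto
 then show ?thesis by (intro that) auto
qed

lemma wasserstein_commute:
 fixes \<mu> \<nu> :: "'a::euclidean_space measure"
 shows "wasserstein p \<mu> \<nu> = wasserstein p \<nu> \<mu>"
proof -
 have le: "(INF \<gamma> \<in> couplings \<mu> \<nu>. \<integral>\<^sup>+ z. ennreal (norm (fst z - snd z) powr p) \<partial>\<gamma>)
   \<le> (INF \<gamma> \<in> couplings \<nu> \<mu>. \<integral>\<^sup>+ z. ennreal (norm (fst z - snd z) powr p) \<partial>\<gamma>)" 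
   for \<mu> \<nu> :: "'a measure"
 proof (rule INF_greatest)
  fix \<gamma> assume \<gamma>: "\<gamma> \<in> couplings \<nu> \<mu>"
  note [measurable] = couplingsD(6,7)[OF \<gamma>]
  have [measurable]: "fst \<in> borel_measurable (borel :: ('a \<times> 'a) measure)" "snd \<in> borel_measurable (borel :: ('a \<times> 'a) measure)"
   by (auto intro!: borel_measurable_continuous_onI continuous_intros)
  show "(INF \<gamma> \<in> couplings \<mu> \<nu>. \<integral>\<^sup>+ z. ennreal (norm (fst z - snd z) powr p) \<partial>\<gamma>) \<le>
    transport_cost p \<gamma>"
   by (rule INF_lower2[OF couplings_swap[OF \<gamma>]])
    (simp add: nn_integral_distr norm_minus_commute)
 qed
 show ?thesis unfolding wasserstein_def using le[of \<mu> \<nu>] le[of \<nu> \<mu>] by (simp add: order_antisym)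
qed

lemma wasserstein_self:
 assumes "\<mu> \<in> wasserstein_space p"
 shows "wasserstein p \<mu> \<mu> = 0"
proof -
 note \<mu> = wasserstein_spaceD[OF assms]
 interpret prob_space \<mu> by fact
 have d: "(\<lambda>x. (x, x)) \<in> borel_measurable \<mu>"
  unfolding measurable_cong_sets[OF \<mu>(2) refl]
  by (auto intro!: borel_measurable_continuous_onI continuous_intros)
 note [measurable] = d
 have [measurable]: "fst \<in> borel_measurable (borel :: ('a \<times> 'a) measure)" "snd \<in> borel_measurable (borel :: ('a \<times> 'a) measure)"
   by (auto intro!: borel_measurable_continuous_onI continuous_intros)
 have *: "distr \<mu> borel (\<lambda>x. x) = \<mu>"
  using distr_cong[OF refl \<mu>(2)[symmetric], of \<mu> "\<lambda>x. x" "\<lambda>x. x"] by simp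
 have "wasserstein p \<mu> \<mu> \<le> 0"
  by (rule wasserstein_le[of "distr \<mu> borel (\<lambda>x. (x, x))"])
   (auto simp: couplings_def prob_space_distr distr_distr comp_def * nn_integral_distr)
 then show ?thesis using wasserstein_nonneg[of \<mu> \<mu>] by simp
qed

text \<open>Near-optimal plans for the two pairs are glued along cells of diameter at most e, so the
  middle points agree only up to e; Minkowski's inequality turns the mismatch into a third
  summand.\<close>

lemma wasserstein_triangle:
 assumes \<mu>1: "\<mu>1 \<in> wasserstein_space p" and \<mu>2: "\<mu>2 \<in> wasserstein_space p" and \<mu>3: "\<mu>3 \<in> wasserstein_space p"
 shows "wasserstein p \<mu>1 \<mu>3 \<le> wasserstein p \<mu>1 \<mu>2 + wasserstein p \<mu>2 \<mu>3"
proof (rule field_le_epsilon)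
 interpret conjugate_exponents p "p / (p - 1)"
  using p by unfold_locales (auto simp: field_simps)
 fix e0 :: real assume "0 < e0"
 \<comment> \<open>One third for each near-optimal plan and one for the mismatch of the middle
   points.\<close>
 define e where "e = e0 / 3"
 have e: "0 < e" using \<open>0 < e0\<close> by (simp add: e_def)
 define a where "a = wasserstein p \<mu>1 \<mu>2 + e"
 define b where "b = wasserstein p \<mu>2 \<mu>3 + e"
 have ab: "0 < a" "0 < b" using e wasserstein_nonneg[of \<mu>1 \<mu>2] wasserstein_nonneg[of \<mu>2 \<mu>3] by (auto simp: a_def b_def)
 obtain \<gamma>1 where \<gamma>1: "\<gamma>1 \<in> couplings \<mu>1 \<mu>2"
  "transport_cost p \<gamma>1 \<le> ennreal (a powr p)"
  by (rule near_optimal_coupling[OF \<mu>1 \<mu>2, of a]) (auto simp: a_def e)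
 obtain \<gamma>2 where \<gamma>2: "\<gamma>2 \<in> couplings \<mu>2 \<mu>3"
  "transport_cost p \<gamma>2 \<le> ennreal (b powr p)"
  by (rule near_optimal_coupling[OF \<mu>2 \<mu>3, of b]) (auto simp: b_def e)
 obtain c :: "'a \<Rightarrow> nat" where c[measurable]: "c \<in> measurable borel (count_space UNIV)"
  and cd: "\<And>x y. c x = c y ==> dist x y < e"
  using countable_small_cells[OF e] by blast
 note g1 = couplingsD[OF \<gamma>1(1)] and g2 = couplingsD[OF \<gamma>2(1)]
 note [measurable] = g1(6,7) g2(6,7)
 obtain G where sG: "sets G = sets (\<gamma>1 \<Otimes>\<^sub>M \<gamma>2)"
  and G1: "\<And>f. f \<in> borel_measurable \<gamma>1 ==> (\<integral>\<^sup>+w. f (fst w) \<partial>G) = (\<integral>\<^sup>+x. f x \<partial>\<gamma>1)"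
  and G2: "\<And>f. f \<in> borel_measurable \<gamma>2 ==> (\<integral>\<^sup>+w. f (snd w) \<partial>G) = (\<integral>\<^sup>+x. f x \<partial>\<gamma>2)"
  and G3: "AE w in G. c (snd (fst w)) = c (fst (snd w))"
 proof (rule gluing[of \<gamma>1 \<gamma>2 "\<lambda>z. c (snd z)" "\<lambda>z. c (fst z)"])
  have "distr \<gamma>1 (count_space UNIV) (c \<circ> snd) = distr (distr \<gamma>1 borel snd) (count_space UNIV) c"
   by (rule distr_distr[symmetric]) measurable
  moreover have "distr \<gamma>2 (count_space UNIV) (c \<circ> fst) = distr (distr \<gamma>2 borel fst) (count_space UNIV) c"
   by (rule distr_distr[symmetric]) measurable
  ultimately show "distr \<gamma>1 (count_space UNIV) (\<lambda>z. c (snd z)) = distr \<gamma>2 (count_space UNIV) (\<lambda>z. c (fst z))"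
   using g1(5) g2(4) by (simp add: comp_def)
 qed (use g1(1) g2(1) in auto)
 note [measurable_cong] = sG
 have f1[measurable]: "(\<lambda>w. fst (fst w)) \<in> borel_measurable G" "(\<lambda>w. snd (fst w)) \<in> borel_measurable G"
  "(\<lambda>w. fst (snd w)) \<in> borel_measurable G" "(\<lambda>w. snd (snd w)) \<in> borel_measurable G" by measurable
 have "space G = UNIV" using sG g1(3) g2(3) by (simp add: space_pair_measure sets_eq_imp_space_eq[OF sG])
 then have "emeasure G (space G) = 1"
  using G1[of "\<lambda>_. 1"] prob_space.emeasure_space_1[OF g1(1)] by simp
 then interpret G: prob_space G by (rule prob_spaceI)
 define \<gamma> where "\<gamma> = distr G borel (\<lambda>w. (fst (fst w), snd (snd w)))"
 have [measurable]: "(\<lambda>w. (fst (fst w), snd (snd w))) \<in> borel_measurable G" by measurable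
 have [measurable]: "fst \<in> borel_measurable (borel :: ('a \<times> 'a) measure)" "snd \<in> borel_measurable (borel :: ('a \<times> 'a) measure)"
   by (auto intro!: borel_measurable_continuous_onI continuous_intros)
 have d1: "distr G borel (\<lambda>w. fst (fst w)) = \<mu>1"
 proof (rule measure_eqI)
  fix A assume "A \<in> sets (distr G borel (\<lambda>w. fst (fst w)))"
  then have [measurable]: "A \<in> sets borel" by simp
  have "emeasure (distr G borel (\<lambda>w. fst (fst w))) A = (\<integral>\<^sup>+w. indicator A (fst (fst w)) \<partial>G)"
   by (simp add: nn_integral_distr flip: nn_integral_indicator)
  also have "\<dots> = (\<integral>\<^sup>+z. indicator A (fst z) \<partial>\<gamma>1)" by (rule G1) measurable
  also have "\<dots> = emeasure \<mu>1 A" using couplings_integrals(1)[OF \<gamma>1(1), of "indicator A"] g1(8) by simp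
  finally show "emeasure (distr G borel (\<lambda>w. fst (fst w))) A = emeasure \<mu>1 A" .
 qed (use g1(8) in simp)
 have d2: "distr G borel (\<lambda>w. snd (snd w)) = \<mu>3"
 proof (rule measure_eqI)
  fix A assume "A \<in> sets (distr G borel (\<lambda>w. snd (snd w)))"
  then have [measurable]: "A \<in> sets borel" by simp
  have "emeasure (distr G borel (\<lambda>w. snd (snd w))) A = (\<integral>\<^sup>+w. indicator A (snd (snd w)) \<partial>G)"
   by (simp add: nn_integral_distr flip: nn_integral_indicator)
  also have "\<dots> = (\<integral>\<^sup>+z. indicator A (snd z) \<partial>\<gamma>2)" by (rule G2) measurable
  also have "\<dots> = emeasure \<mu>3 A" using couplings_integrals(2)[OF \<gamma>2(1), of "indicator A"] g2(9) by simp
  finally show "emeasure (distr G borel (\<lambda>w. snd (snd w))) A = emeasure \<mu>3 A" .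
 qed (use g2(9) in simp)
 have "\<gamma> \<in> couplings \<mu>1 \<mu>3"
  using d1 d2 by (auto simp: couplings_def \<gamma>_def G.prob_space_distr distr_distr comp_def)
 moreover have "transport_cost p \<gamma> \<le> ennreal ((a + e + b) powr p)"
 proof -
  let ?f = "\<lambda>w. norm (fst (fst w) - snd (fst w))" and ?g = "\<lambda>w. norm (fst (snd w) - snd (snd w))"
  have "transport_cost p \<gamma> = (\<integral>\<^sup>+ w. ennreal (norm (fst (fst w) - snd (snd w)) powr p) \<partial>G)"
   unfolding \<gamma>_def by (subst nn_integral_distr) auto
  also have "\<dots> \<le> (\<integral>\<^sup>+ w. ennreal (((?f w + e) + ?g w) powr p) \<partial>G)"
  proof (rule nn_integral_mono_AE)
   show "AE w in G. ennreal (norm (fst (fst w) - snd (snd w)) powr p) \<le> ennreal (((?f w + e) + ?g w) powr p)"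
    using G3
   proof eventually_elim
    case (elim w)
    have "norm (fst (fst w) - snd (snd w)) \<le> ?f w + dist (snd (fst w)) (fst (snd w)) + ?g w"
     unfolding dist_norm by norm
    also have "\<dots> \<le> ?f w + e + ?g w" using cd[OF elim] by simp
    finally show ?case using p by (intro ennreal_leI powr_mono2) auto
   qed
  qed
  also have "\<dots> \<le> ennreal ((a + e + b) powr p)"
  proof (rule minkowski_nn_integral)
   show "(\<integral>\<^sup>+ w. ennreal ((?f w + e) powr p) \<partial>G) \<le> ennreal ((a + e) powr p)"
   proof (rule minkowski_nn_integral)
    show "(\<integral>\<^sup>+ w. ennreal (?f w powr p) \<partial>G) \<le> ennreal (a powr p)"
     using G1[of "\<lambda>z. ennreal (norm (fst z - snd z) powr p)"] \<gamma>1(2) by simp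
    show "(\<integral>\<^sup>+ w. ennreal (e powr p) \<partial>G) \<le> ennreal (e powr p)" by (simp add: G.emeasure_space_1)
   qed (use e ab in auto)
   show "(\<integral>\<^sup>+ w. ennreal (?g w powr p) \<partial>G) \<le> ennreal (b powr p)"
     using G2[of "\<lambda>z. ennreal (norm (fst z - snd z) powr p)"] \<gamma>2(2) by simp
  qed (use e ab in auto)
  finally show ?thesis .
 qed
 ultimately have "wasserstein p \<mu>1 \<mu>3 \<le> a + e + b"
  using ab e by (intro wasserstein_le) auto
 then show "wasserstein p \<mu>1 \<mu>3 \<le> wasserstein p \<mu>1 \<mu>2 + wasserstein p \<mu>2 \<mu>3 + e0"
  by (simp add: a_def b_def e_def)
qed

end

section \<open>Weak compactness along varying measures\<close>

lemma tendsto_approx: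
 fixes a :: "nat \<Rightarrow> real"
 assumes "\<And>e. 0 < e ==> \<exists>b l'. b \<longlonglongrightarrow> l' \<and> (\<forall>n. \<bar>a n - b n\<bar> \<le> e) \<and> \<bar>l - l'\<bar> \<le> e"
 shows "a \<longlonglongrightarrow> l"
proof (rule tendstoI)
 fix e :: real assume "0 < e"
 then obtain b l' where b: "b \<longlonglongrightarrow> l'" "\<And>n. \<bar>a n - b n\<bar> \<le> e / 4" "\<bar>l - l'\<bar> \<le> e / 4"
  using assms[of "e / 4"] by auto
 have "\<forall>\<^sub>F n in sequentially. dist (b n) l' < e / 4" using b(1) \<open>0 < e\<close> by (intro tendstoD) auto
 then show "\<forall>\<^sub>F n in sequentially. dist (a n) l < e"
 proof eventually_elim
  case (elim n)
  then show ?case using b(2)[of n] b(3) \<open>0 < e\<close> unfolding dist_real_def by linarith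
 qed
qed

lemma convergent_approx:
 fixes a :: "nat \<Rightarrow> real"
 assumes "\<And>e. 0 < e ==> \<exists>b. convergent b \<and> (\<forall>n. \<bar>a n - b n\<bar> \<le> e)"
 shows "convergent a"
proof -
 have "Cauchy a"
 proof (rule metric_CauchyI)
  fix e :: real assume "0 < e"
  then obtain b where b: "convergent b" "\<And>n. \<bar>a n - b n\<bar> \<le> e / 4"
   using assms[of "e / 4"] by auto
  obtain N where N: "\<And>m n. m \<ge> N ==> n \<ge> N ==> dist (b m) (b n) < e / 4"
   using convergent_Cauchy[OF b(1)] \<open>0 < e\<close> metric_CauchyD[of b "e / 4"] by auto
  show "\<exists>N. \<forall>m\<ge>N. \<forall>n\<ge>N. dist (a m) (a n) < e"
  proof (intro exI allI impI)
   fix m n assume "m \<ge> N" "n \<ge> N"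
   then show "dist (a m) (a n) < e" using N[of m n] b(2)[of m] b(2)[of n] \<open>0 < e\<close>
    unfolding dist_real_def by linarith
  qed
 qed
 then show ?thesis by (rule Cauchy_convergent)
qed

text \<open>Finite intersections of basic open sets: countable, for a diagonal subsequence, and
  closed under intersection, for the Dynkin argument in \<open>weak_limit_nonneg\<close>.\<close>

lemma countable_Int_stable_generator:
 obtains G :: "'a::second_countable_topology set set"
 where "countable G" "Int_stable G" "UNIV \<in> G" "sets borel = sigma_sets UNIV G"
proof -
 obtain B :: "'a set set" where B: "countable B" "topological_basis B"
  using ex_countable_basis by auto
 define G where "G = (\<lambda>F. \<Inter>F) ` {F. finite F \<and> F \<subseteq> B}"
 have oB: "open b" if "b \<in> B" for b using that B(2) topological_basis_open by auto
 show ?thesis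
 proof
  show "countable G" unfolding G_def
   using countable_Collect_finite_subset[OF B(1)] by auto
  show "Int_stable G"
   unfolding Int_stable_def G_def
  proof safe
   fix E F assume "finite E" "E \<subseteq> B" "finite F" "F \<subseteq> B"
   then show "\<Inter> E \<inter> \<Inter> F \<in> Inter ` {F. finite F \<and> F \<subseteq> B}"
    by (intro image_eqI[of _ _ "E \<union> F"]) auto
  qed
  show "UNIV \<in> G" unfolding G_def by (rule image_eqI[of _ _ "{}"]) auto
  have 1: "sets (borel :: 'a measure) = sigma_sets UNIV B"
   using arg_cong[OF borel_eq_countable_basis[OF B], of sets] by simp
  have "G \<subseteq> sets borel" unfolding G_def using oB by (auto intro!: borel_open open_Inter)
  then have "sigma_sets UNIV G \<subseteq> sets (borel :: 'a measure)"
   using sets.sigma_sets_subset[of G "borel :: 'a measure"] by simp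
  moreover have "B \<subseteq> G"
   unfolding G_def by (auto intro!: image_eqI[of _ _ "{x}" for x])
  then have "sigma_sets UNIV B \<subseteq> sigma_sets UNIV G" by (rule sigma_sets_mono')
  ultimately show "sets (borel :: 'a measure) = sigma_sets UNIV G" using 1 by auto
 qed
qed

lemma norm_duality_map: "norm (duality_map q v) = norm v powr (q - 1)"
proof (cases "v = 0")
 case False
 have "q - 2 + 1 = q - 1" by simp
 with False show ?thesis using powr_add[of "norm v" "q - 2" 1] by (simp add: duality_map_def)
qed (simp add: duality_map_def)

lemma inner_duality_map: "v \<bullet> duality_map q v = norm v powr q"
proof (cases "v = 0")
 case False
 have "q - 2 + 2 = q" by simp
 with False show ?thesis using powr_add[of "norm v" "q - 2" 2]
  by (simp add: duality_map_def power2_norm_eq_inner[symmetric])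
qed (simp add: duality_map_def)

lemma duality_map_measurable[measurable]: "duality_map q \<in> borel_measurable borel"
 unfolding duality_map_def[abs_def] by measurable

lemma finite_prob_powr_integrable:
 fixes f :: "'a \<Rightarrow> 'b::{banach,second_countable_topology}"
 assumes "prob_space M" "f \<in> borel_measurable M" "\<And>x. norm (f x) \<le> K" "0 \<le> p"
 shows "integrable M (\<lambda>x. norm (f x) powr p)"
proof -
 interpret prob_space M by fact
 show ?thesis using assms
  by (intro integrable_const_bound[of _ "K powr p"] AE_I2) (auto intro!: powr_mono2)
qed

lemma Lp_space_bound:
 fixes f :: "'a \<Rightarrow> 'b::euclidean_space" and g :: "'a \<Rightarrow> 'c::euclidean_space"
 assumes "f \<in> Lp_space q M" and [measurable]: "g \<in> borel_measurable M"
  and "0 < q" "\<And>x. norm (g x) \<le> norm (f x)"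
 shows "g \<in> Lp_space q M" "Lp_norm q M g \<le> Lp_norm q M f"
proof -
 have [measurable]: "f \<in> borel_measurable M" and int: "integrable M (\<lambda>x. norm (f x) powr q)"
  using assms(1) by (auto simp: Lp_space_def)
 have le: "norm (g x) powr q \<le> norm (f x) powr q" for x
  using assms(3,4) by (intro powr_mono2) auto
 have int': "integrable M (\<lambda>x. norm (g x) powr q)"
  by (rule Bochner_Integration.integrable_bound[OF int]) (use le in auto)
 then show "g \<in> Lp_space q M" by (auto simp: Lp_space_def)
 have "(\<integral>x. norm (g x) powr q \<partial>M) \<le> (\<integral>x. norm (f x) powr q \<partial>M)"
  using int' int le by (rule integral_mono)
 then show "Lp_norm q M g \<le> Lp_norm q M f"
  unfolding Lp_norm_def using assms(3) by (intro powr_mono2) auto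
qed

context conjugate_exponents
begin

context
 fixes \<mu> :: "'a::second_countable_topology measure"
  and \<gamma> :: "nat \<Rightarrow> 'c measure" and X :: "nat \<Rightarrow> 'c \<Rightarrow> 'a" and C :: real
 assumes \<mu>: "prob_space \<mu>" "sets \<mu> = sets borel"
  and \<gamma>: "\<And>n. prob_space (\<gamma> n)" "\<And>n. X n \<in> borel_measurable (\<gamma> n)" "\<And>n. distr (\<gamma> n) borel (X n) = \<mu>"
begin

text \<open>The set functions \<open>N n A\<close>, the integrals of Z over the event that X lies in
  A, are bounded by C * \<mu>(A)^(1/p) uniformly in n. This one bound makes them relatively compact
  on a countable generator, carries convergence through disjoint unions, and makes the limit
  countably additive and absolutely continuous; g is its Radon-Nikodym density. Nonnegativity of Z
  makes the limit a measure.\<close>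

lemma weak_limit_nonneg:
 fixes Z :: "nat \<Rightarrow> 'c \<Rightarrow> real"
 assumes Z: "\<And>n. Z n \<in> Lp_space q (\<gamma> n)" "\<And>n. Lp_norm q (\<gamma> n) (Z n) \<le> C" "\<And>n z. 0 \<le> Z n z"
 obtains r g where "strict_mono (r :: nat \<Rightarrow> nat)" "integrable \<mu> g"
  "\<And>h K. h \<in> borel_measurable borel ==> (\<And>x. \<bar>h x\<bar> \<le> K) ==>
   (\<lambda>n. \<integral>z. h (X (r n) z) * Z (r n) z \<partial>\<gamma> (r n)) \<longlonglongrightarrow> (\<integral>x. h x * g x \<partial>\<mu>)"
proof -
 interpret \<mu>: prob_space \<mu> by fact
 interpret \<gamma>: prob_space "\<gamma> n" for n by (rule \<gamma>(1))
 note [measurable] = \<gamma>(2)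
 have Zm[measurable]: "Z n \<in> borel_measurable (\<gamma> n)" for n using Z(1) by (auto simp: Lp_space_def)
 have "0 \<le> Lp_norm q (\<gamma> 0) (Z 0)" by (simp add: Lp_norm_def)
 then have C: "0 \<le> C" using Z(2)[of 0] by linarith
 have one: "(\<lambda>z. h (X n z)) \<in> Lp_space p (\<gamma> n)"
  if [measurable]: "h \<in> borel_measurable borel" and "\<And>x. \<bar>h x\<bar> \<le> K" for h :: "'a \<Rightarrow> real" and K n
  using that finite_prob_powr_integrable[OF \<gamma>(1), of "\<lambda>z. h (X n z)" n K p] p_pos
  by (auto simp: Lp_space_def)
 have int: "integrable (\<gamma> n) (\<lambda>z. h (X n z) * Z n z)"
  if "h \<in> borel_measurable borel" and "\<And>x. \<bar>h x\<bar> \<le> K" for h :: "'a \<Rightarrow> real" and K n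
  using holder_inner(1)[OF one[OF that] Z(1)[of n]] by simp
 have bound: "\<bar>\<integral>z. h (X n z) * Z n z \<partial>\<gamma> n\<bar> \<le> (\<integral>x. \<bar>h x\<bar> powr p \<partial>\<mu>) powr (1/p) * C"
  if h[measurable]: "h \<in> borel_measurable borel" and "\<And>x. \<bar>h x\<bar> \<le> K" for h :: "'a \<Rightarrow> real" and K n
 proof -
  have "\<bar>\<integral>z. h (X n z) * Z n z \<partial>\<gamma> n\<bar> \<le> Lp_norm p (\<gamma> n) (\<lambda>z. h (X n z)) * Lp_norm q (\<gamma> n) (Z n)"
   using holder_inner(2)[OF one[OF that] Z(1)[of n]] by simp
  also have "\<dots> \<le> Lp_norm p (\<gamma> n) (\<lambda>z. h (X n z)) * C"
   by (intro mult_left_mono Z) (simp add: Lp_norm_def)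
  also have "Lp_norm p (\<gamma> n) (\<lambda>z. h (X n z)) = (\<integral>x. \<bar>h x\<bar> powr p \<partial>\<mu>) powr (1/p)"
   unfolding \<gamma>(3)[of n, symmetric] by (simp add: Lp_norm_def integral_distr)
  finally show ?thesis .
 qed
 define N where "N n A = (\<integral>z. indicator A (X n z) * Z n z \<partial>\<gamma> n)" for n A
 have N0: "0 \<le> N n A" for n A unfolding N_def using Z(3) by (intro integral_nonneg_AE) auto
 have Nb: "N n A \<le> measure \<mu> A powr (1/p) * C" if [measurable]: "A \<in> sets borel" for n A
 proof -
  have [measurable]: "A \<in> sets \<mu>" using \<mu>(2) by simp
  have "(\<integral>x. \<bar>indicat_real A x\<bar> powr p \<partial>\<mu>) = (\<integral>x. indicator A x \<partial>\<mu>)"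
   using p_pos by (intro Bochner_Integration.integral_cong) (auto simp: indicator_def)
  also have "\<dots> = measure \<mu> A" by simp
  finally have eq: "(\<integral>x. \<bar>indicat_real A x\<bar> powr p \<partial>\<mu>) = measure \<mu> A" .
  have "\<bar>indicat_real A x\<bar> \<le> 1" for x by (simp add: indicator_def)
  then show ?thesis using abs_le_D1[OF bound[of "indicator A" 1 n]] unfolding eq N_def by simp
 qed
 have Nadd: "N n (A \<union> B) = N n A + N n B" if "A \<in> sets borel" "B \<in> sets borel" "A \<inter> B = {}" for n A B
 proof -
  have "N n (A \<union> B) = (\<integral>z. indicator A (X n z) * Z n z + indicator B (X n z) * Z n z \<partial>\<gamma> n)"
   unfolding N_def using that(3) by (intro Bochner_Integration.integral_cong) (auto simp: indicator_def)
  also have "\<dots> = N n A + N n B" unfolding N_def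
   using int[of "indicator A" 1 n] int[of "indicator B" 1 n] that by (intro Bochner_Integration.integral_add) (auto simp: indicator_def)
  finally show ?thesis .
 qed
 have N_empty: "N n {} = 0" for n by (simp add: N_def)
 obtain G :: "'a set set" where G: "countable G" "Int_stable G" "UNIV \<in> G" "sets borel = sigma_sets UNIV G"
  by (rule countable_Int_stable_generator)
 have Gb: "A \<in> sets borel" if "A \<in> G" for A using that G(4) by auto
 \<comment> \<open>Diagonal subsequence over the countable generator; all Borel sets follow by
   Dynkin induction.\<close>
 obtain k :: "nat \<Rightarrow> nat" where k: "strict_mono k" "\<And>A. A \<in> G ==> \<exists>l. (\<lambda>n. N (k n) A) \<longlonglongrightarrow> l"
 proof (rule function_convergent_subsequence[OF G(1), of N "1 powr (1/p) * C"])
  fix n A assume "A \<in> G"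
  then have "N n A \<le> measure \<mu> A powr (1/p) * C" by (intro Nb Gb)
  also have "\<dots> \<le> 1 powr (1/p) * C" using C p_pos by (intro mult_right_mono powr_mono2) auto
  finally show "norm (N n A) \<le> 1 powr (1/p) * C" using N0[of n A] by simp
 qed auto
 have conv: "convergent (\<lambda>n. N (k n) A)" if "A \<in> sets borel" for A
 proof -
  have "G \<subseteq> Pow UNIV" "A \<in> sigma_sets UNIV G" using that by (simp_all add: G)
  with G(2) show ?thesis
  proof (induction rule: sigma_sets_induct_disjoint)
   case (basic A)
   then show ?case using k(2) by (auto simp: convergent_def)
  next
   case empty
   then show ?case by (simp add: N_empty convergent_const)
  next
   case (compl A)
   have A: "A \<in> sets borel" "UNIV - A \<in> sets borel" using compl(1) by (auto simp: G(4)[symmetric] Compl_eq_Diff_UNIV[symmetric])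
   have "N (k n) (UNIV - A) = N (k n) UNIV - N (k n) A" for n
    using Nadd[of A "UNIV - A" "k n"] A by (simp add: Un_absorb1)
   then show ?case using compl(2) k(2)[OF G(3)] by (auto simp: convergent_def intro!: tendsto_diff)
  next
   case (union A)
   have A[measurable]: "A i \<in> sets borel" for i using union(2) by (auto simp: G(4)[symmetric])
   have A'[measurable]: "A i \<in> sets \<mu>" for i using \<mu>(2) by simp
   have fin: "convergent (\<lambda>n. N (k n) (\<Union>i<J. A i))" for J
   proof (induction J)
    case (Suc J)
    have "N (k n) (\<Union>i<Suc J. A i) = N (k n) (\<Union>i<J. A i) + N (k n) (A J)" for n
    proof -
     have "(\<Union>i<Suc J. A i) = (\<Union>i<J. A i) \<union> A J" by (auto simp: less_Suc_eq)
     moreover have "x \<notin> A J" if "i < J" "x \<in> A i" for i x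
      using disjoint_family_onD[OF union(1) UNIV_I UNIV_I, of i J] that by auto
     then have "(\<Union>i<J. A i) \<inter> A J = {}" by blast
     moreover have "(\<Union>i<J. A i) \<in> sets borel" using A by (auto intro!: sets.finite_UN)
     ultimately show ?thesis using Nadd[of "(\<Union>i<J. A i)" "A J" "k n"] A by metis
    qed
    then show ?case using convergent_add[OF Suc union(3)[of J]] by presburger
   qed (simp add: N_empty convergent_const)
   show ?case
   proof (rule convergent_approx)
    fix e :: real assume "0 < e"
    \<comment> \<open>Tail of the union: its \<mu>-measure tends to 0, so \<open>N n (T J)\<close>
      is small uniformly in n.\<close>
    define T where "T J = (\<Union>i. A i) - (\<Union>i<J. A i)" for J
    have T[measurable]: "T J \<in> sets borel" "T J \<in> sets \<mu>" for J by (auto simp: T_def)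
    have "(\<lambda>J. measure \<mu> (T J)) \<longlonglongrightarrow> measure \<mu> (\<Inter>J. T J)"
     by (rule \<mu>.finite_Lim_measure_decseq) (auto simp: decseq_def T_def)
    moreover have "(\<Inter>J. T J) = {}" by (auto simp: T_def)
    ultimately have "(\<lambda>J. measure \<mu> (T J)) \<longlonglongrightarrow> 0" by simp
    then have "(\<lambda>J. measure \<mu> (T J) powr (1/p) * C) \<longlonglongrightarrow> 0 powr (1/p) * C"
     using p_pos by (intro tendsto_intros tendsto_powr') auto
    then have "(\<lambda>J. measure \<mu> (T J) powr (1/p) * C) \<longlonglongrightarrow> 0" by simp
    then have "\<forall>\<^sub>F J in sequentially. measure \<mu> (T J) powr (1/p) * C < e"
     using \<open>0 < e\<close> by (rule order_tendstoD(2))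
    then obtain J where J: "measure \<mu> (T J) powr (1/p) * C < e" by (auto simp: eventually_sequentially)
    have "\<bar>N (k n) (\<Union>i. A i) - N (k n) (\<Union>i<J. A i)\<bar> \<le> e" for n
    proof -
     have "N (k n) ((\<Union>i<J. A i) \<union> T J) = N (k n) (\<Union>i<J. A i) + N (k n) (T J)"
      by (rule Nadd) (auto simp: T_def)
     moreover have "(\<Union>i<J. A i) \<union> T J = (\<Union>i. A i)" by (auto simp: T_def)
     ultimately show ?thesis using Nb[of "T J" "k n"] N0[of "k n" "T J"] J by simp
    qed
    then show "\<exists>b. convergent b \<and> (\<forall>n. \<bar>N (k n) (\<Union>i. A i) - b n\<bar> \<le> e)" using fin by blast
   qed
  qed
 qed
 define L where "L A = lim (\<lambda>n. N (k n) A)" for A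
 have L: "(\<lambda>n. N (k n) A) \<longlonglongrightarrow> L A" if "A \<in> sets borel" for A
  using conv[OF that] by (simp add: L_def convergent_LIMSEQ_iff)
 have L0: "0 \<le> L A" if "A \<in> sets borel" for A by (rule LIMSEQ_le_const[OF L[OF that]]) (use N0 in auto)
 have Lb: "L A \<le> measure \<mu> A powr (1/p) * C" if "A \<in> sets borel" for A
  by (rule LIMSEQ_le_const2[OF L[OF that]]) (use Nb that in auto)
 have Ladd: "L (A \<union> B) = L A + L B" if "A \<in> sets borel" "B \<in> sets borel" "A \<inter> B = {}" for A B
 proof (rule LIMSEQ_unique)
  show "(\<lambda>n. N (k n) (A \<union> B)) \<longlonglongrightarrow> L (A \<union> B)" using that by (intro L) auto
  show "(\<lambda>n. N (k n) (A \<union> B)) \<longlonglongrightarrow> L A + L B" using that by (auto simp: Nadd intro!: tendsto_add L)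
 qed
 define \<nu> where "\<nu> = measure_of UNIV (sets borel) (\<lambda>A. ennreal (L A))"
 have sets_\<nu>: "sets \<nu> = sets borel" unfolding \<nu>_def 
  using sets.sigma_sets_eq[of "borel :: 'a measure"] by (simp add: sets_measure_of)
 have ca: "countably_additive (sets borel) (\<lambda>A. ennreal (L A))"
 proof (rule ring_of_sets.empty_continuous_imp_countably_additive)
  show "ring_of_sets UNIV (sets (borel :: 'a measure))"
   using sets.ring_of_sets_axioms[of "borel :: 'a measure"] by simp
  show "positive (sets borel) (\<lambda>A. ennreal (L A))" by (simp add: positive_def L_def N_empty)
  show "additive (sets borel) (\<lambda>A. ennreal (L A))"
   by (auto simp: additive_def Ladd L0)
  show "\<forall>A\<in>sets borel. ennreal (L A) \<noteq> \<infinity>" by simp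
  fix A :: "nat \<Rightarrow> 'a set" assume A: "range A \<subseteq> sets borel" "decseq A" "(\<Inter>i. A i) = {}"
  have "(\<lambda>i. measure \<mu> (A i)) \<longlonglongrightarrow> measure \<mu> (\<Inter>i. A i)"
   using A \<mu>(2) by (intro \<mu>.finite_Lim_measure_decseq) auto
  then have "(\<lambda>i. measure \<mu> (A i) powr (1/p) * C) \<longlonglongrightarrow> 0 powr (1/p) * C"
   using p_pos A(3) by (intro tendsto_intros tendsto_powr') auto
  then have lim0: "(\<lambda>i. measure \<mu> (A i) powr (1/p) * C) \<longlonglongrightarrow> 0" by simp
  have "(\<lambda>i. L (A i)) \<longlonglongrightarrow> 0"
  proof (rule tendsto_sandwich[OF _ _ tendsto_const lim0])
   show "\<forall>\<^sub>F i in sequentially. 0 \<le> L (A i)"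
    by (intro always_eventually allI L0) (use A(1) in auto)
   show "\<forall>\<^sub>F i in sequentially. L (A i) \<le> measure \<mu> (A i) powr (1/p) * C"
    by (intro always_eventually allI Lb) (use A(1) in auto)
  qed
  then show "(\<lambda>i. ennreal (L (A i))) \<longlonglongrightarrow> 0"
   using tendsto_ennrealI[of "\<lambda>i. L (A i)" 0 sequentially] by simp
 qed
 have em: "emeasure \<nu> A = ennreal (L A)" if "A \<in> sets borel" for A
  unfolding \<nu>_def
 proof (rule emeasure_measure_of_sigma)
  show "sigma_algebra UNIV (sets (borel :: 'a measure))" using sets.sigma_algebra_axioms[of "borel :: 'a measure"] by simp
  show "positive (sets borel) (\<lambda>A. ennreal (L A))" by (simp add: positive_def L_def N_empty)
 qed (use ca that in auto)
 have "absolutely_continuous \<mu> \<nu>"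
  unfolding absolutely_continuous_def
 proof
  fix A assume A: "A \<in> null_sets \<mu>"
  then have "A \<in> sets borel" "measure \<mu> A = 0" using \<mu>(2) by (auto simp: null_sets_def measure_def)
  moreover then have "L A = 0" using Lb[of A] L0[of A] p_pos by simp
  ultimately show "A \<in> null_sets \<nu>" by (auto simp: null_sets_def em sets_\<nu>)
 qed
 then obtain f where f[measurable]: "f \<in> borel_measurable \<mu>" and f': "density \<mu> f = \<nu>"
  using \<mu>.Radon_Nikodym[of \<nu>] sets_\<nu> \<mu>(2) by auto
 have fA: "(\<integral>\<^sup>+x. f x * indicator A x \<partial>\<mu>) = ennreal (L A)" if "A \<in> sets borel" for A
  using em[OF that] emeasure_density[OF f, of A] that \<mu>(2) by (simp add: f')
 have "(\<integral>\<^sup>+x. f x \<partial>\<mu>) \<noteq> \<infinity>" using fA[of UNIV] by simp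
 then have ffin: "AE x in \<mu>. f x \<noteq> \<infinity>" by (rule nn_integral_PInf_AE[OF f])
 define g where "g x = enn2real (f x)" for x
 have g[measurable]: "g \<in> borel_measurable \<mu>" "\<And>x. 0 \<le> g x" by (auto simp: g_def[abs_def])
 have nn: "(\<integral>\<^sup>+x. ennreal (indicator A x * g x) \<partial>\<mu>) = ennreal (L A)" if "A \<in> sets borel" for A
 proof -
  have "(\<integral>\<^sup>+x. ennreal (indicator A x * g x) \<partial>\<mu>) = (\<integral>\<^sup>+x. f x * indicator A x \<partial>\<mu>)"
  proof (rule nn_integral_cong_AE)
   show "AE x in \<mu>. ennreal (indicator A x * g x) = f x * indicator A x"
    using ffin
   proof eventually_elim
    case (elim x)
    then show ?case by (auto simp: g_def indicator_def less_top)
   qed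
  qed
  then show ?thesis using fA[OF that] by simp
 qed
 have gint: "integrable \<mu> g"
  using nn[of UNIV] by (intro integrableI_nonneg) (auto simp: g)
 have gA: "(\<integral>x. indicator A x * g x \<partial>\<mu>) = L A" if [measurable]: "A \<in> sets borel" for A
 proof -
  have [measurable]: "A \<in> sets \<mu>" using \<mu>(2) by simp
  show ?thesis using nn[of A] L0[of A] by (subst integral_eq_nn_integral) (auto simp: g)
 qed
 show ?thesis
 proof
  show "strict_mono k" "integrable \<mu> g" by fact+
  fix h :: "'a \<Rightarrow> real" and K assume h[measurable]: "h \<in> borel_measurable borel" and K: "\<And>x. \<bar>h x\<bar> \<le> K"
  have h'[measurable]: "h \<in> borel_measurable \<mu>" using h \<mu>(2) measurable_cong_sets by blast
  have gh: "integrable \<mu> (\<lambda>x. u x * g x)"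
   if [measurable]: "u \<in> borel_measurable borel" and "\<And>x. \<bar>u x\<bar> \<le> K'" for u :: "'a \<Rightarrow> real" and K'
  proof (rule Bochner_Integration.integrable_bound)
   have "u \<in> borel_measurable \<mu>" using that(1) \<mu>(2) measurable_cong_sets by blast
   then show "(\<lambda>x. u x * g x) \<in> borel_measurable \<mu>" by measurable
   show "integrable \<mu> (\<lambda>x. K' * g x)" using gint by simp
   show "AE x in \<mu>. norm (u x * g x) \<le> norm (K' * g x)"
    by (auto simp: abs_mult intro!: mult_right_mono order_trans[OF that(2) abs_ge_self])
  qed
  show "(\<lambda>n. \<integral>z. h (X (k n) z) * Z (k n) z \<partial>\<gamma> (k n)) \<longlonglongrightarrow> (\<integral>x. h x * g x \<partial>\<mu>)"
  proof (rule tendsto_approx)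
   fix e :: real assume "0 < e"
   have "0 \<le> K" using K[of undefined] by simp
   \<comment> \<open>\<open>G\<close> dominates C and the integral of g, and j = G / e, so rounding
     h down to multiples of 1 / j changes each side by at most e.\<close>
   define G where "G = C + (\<integral>x. g x \<partial>\<mu>) + 1"
   have gI: "0 \<le> (\<integral>x. g x \<partial>\<mu>)" using g(2) by (intro integral_nonneg_AE AE_I2)
   have G: "0 < G" using C gI by (simp add: G_def)
   define j where "j = G / e"
   have j: "0 < j" using G \<open>0 < e\<close> by (simp add: j_def)
   define A where "A i = {x. \<lfloor>h x * j\<rfloor> = i}" for i
   have A[measurable]: "A i \<in> sets borel" for i unfolding A_def by measurable
   define I where "I = {-\<lceil>K * j\<rceil> - 1 .. \<lceil>K * j\<rceil>}"
   define s where "s x = (\<Sum>i\<in>I. (of_int i / j) * indicator (A i) x)" for x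
   have s_eq: "s x = \<lfloor>h x * j\<rfloor> / j" for x
   proof -
    have "\<bar>h x * j\<bar> \<le> K * j" using K[of x] j by (simp add: abs_mult)
    then have "\<lfloor>h x * j\<rfloor> \<in> I" unfolding I_def by (auto simp: abs_le_iff) linarith+
    have "s x = (\<Sum>i\<in>I. if i = \<lfloor>h x * j\<rfloor> then of_int i / j else 0)"
     unfolding s_def by (intro sum.cong) (auto simp: A_def)
    also have "\<dots> = \<lfloor>h x * j\<rfloor> / j" using \<open>\<lfloor>h x * j\<rfloor> \<in> I\<close> by (simp add: I_def)
    finally show ?thesis .
   qed
   have near: "\<bar>h x - s x\<bar> \<le> 1 / j" for x
   proof -
    have "\<bar>h x - s x\<bar> = \<bar>h x * j - \<lfloor>h x * j\<rfloor>\<bar> / j" using j by (simp add: s_eq field_simps abs_divide)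
    also have "\<dots> \<le> 1 / j" using j by (intro divide_right_mono) linarith+
    finally show ?thesis .
   qed
   have [measurable]: "s \<in> borel_measurable borel" unfolding s_def by measurable
   have sb: "\<bar>s x\<bar> \<le> K + 1 / j" for x using near[of x] K[of x] by linarith
   have s1: "(\<integral>z. s (X n z) * Z n z \<partial>\<gamma> n) = (\<Sum>i\<in>I. (of_int i / j) * N n (A i))" for n
   proof -
    have "(\<integral>z. s (X n z) * Z n z \<partial>\<gamma> n) = (\<integral>z. (\<Sum>i\<in>I. (of_int i / j) * (indicator (A i) (X n z) * Z n z)) \<partial>\<gamma> n)"
     by (simp add: s_def sum_distrib_right mult.assoc)
    also have "\<dots> = (\<Sum>i\<in>I. (of_int i / j) * N n (A i))"
     unfolding N_def using int[of "indicator (A i)" 1 n for i]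
     by (subst Bochner_Integration.integral_sum) (auto simp: indicator_def)
    finally show ?thesis .
   qed
   have s2: "(\<integral>x. s x * g x \<partial>\<mu>) = (\<Sum>i\<in>I. (of_int i / j) * L (A i))"
   proof -
    have "(\<integral>x. s x * g x \<partial>\<mu>) = (\<integral>x. (\<Sum>i\<in>I. (of_int i / j) * (indicator (A i) x * g x)) \<partial>\<mu>)"
     by (simp add: s_def sum_distrib_right mult.assoc)
    also have "\<dots> = (\<Sum>i\<in>I. (of_int i / j) * L (A i))"
     unfolding gA[OF A, symmetric] using gh[of "indicator (A i)" 1 for i]
     by (subst Bochner_Integration.integral_sum) (auto simp: indicator_def)
    finally show ?thesis .
   qed
   have "(\<lambda>n. \<integral>z. s (X (k n) z) * Z (k n) z \<partial>\<gamma> (k n)) \<longlonglongrightarrow> (\<integral>x. s x * g x \<partial>\<mu>)"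
    unfolding s1 s2 by (intro tendsto_intros L A)
   moreover have "\<bar>(\<integral>z. h (X n z) * Z n z \<partial>\<gamma> n) - (\<integral>z. s (X n z) * Z n z \<partial>\<gamma> n)\<bar> \<le> e" for n
   proof -
    have "(\<integral>z. h (X n z) * Z n z \<partial>\<gamma> n) - (\<integral>z. s (X n z) * Z n z \<partial>\<gamma> n) = (\<integral>z. (h (X n z) - s (X n z)) * Z n z \<partial>\<gamma> n)"
     using int[OF h K, of n] int[of s "K + 1/j" n] sb by (simp add: left_diff_distrib)
    also have "\<bar>\<dots>\<bar> \<le> (\<integral>x. \<bar>h x - s x\<bar> powr p \<partial>\<mu>) powr (1/p) * C"
     by (rule bound[of "\<lambda>x. h x - s x" "1/j" n]) (use near in auto)
    also have "\<dots> \<le> (1 / j) * C"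
    proof -
     have "(\<integral>x. \<bar>h x - s x\<bar> powr p \<partial>\<mu>) \<le> (\<integral>x. (1 / j) powr p \<partial>\<mu>)"
     proof (rule integral_mono)
      have "(\<lambda>x. h x - s x) \<in> borel_measurable \<mu>" unfolding measurable_cong_sets[OF \<mu>(2) refl] by measurable
      then show "integrable \<mu> (\<lambda>x. \<bar>h x - s x\<bar> powr p)"
       using finite_prob_powr_integrable[OF \<mu>(1), of "\<lambda>x. h x - s x" "1/j" p] near p_pos by simp
     qed (use near p_pos in \<open>auto intro!: powr_mono2\<close>)
     then have "(\<integral>x. \<bar>h x - s x\<bar> powr p \<partial>\<mu>) powr (1/p) \<le> ((1 / j) powr p) powr (1/p)"
      using p_pos by (intro powr_mono2) (auto simp: \<mu>.prob_space)
     then show ?thesis using C j p_pos by (intro mult_right_mono) (auto simp: powr_powr)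
    qed
    also have "\<dots> \<le> (1 / j) * G" using j gI by (intro mult_left_mono) (auto simp: G_def)
    also have "\<dots> = e" using G by (simp add: j_def)
    finally show ?thesis .
   qed
   moreover have "\<bar>(\<integral>x. h x * g x \<partial>\<mu>) - (\<integral>x. s x * g x \<partial>\<mu>)\<bar> \<le> e"
   proof -
    have "(\<integral>x. h x * g x \<partial>\<mu>) - (\<integral>x. s x * g x \<partial>\<mu>) = (\<integral>x. (h x - s x) * g x \<partial>\<mu>)"
     using gh[OF h K] gh[of s "K + 1/j"] sb by (simp add: left_diff_distrib)
    also have "\<bar>\<dots>\<bar> \<le> (\<integral>x. \<bar>(h x - s x) * g x\<bar> \<partial>\<mu>)"
     using integral_norm_bound[of \<mu> "\<lambda>x. (h x - s x) * g x"] by simp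
    also have "\<dots> \<le> (\<integral>x. (1 / j) * g x \<partial>\<mu>)"
    proof (rule integral_mono)
     show "integrable \<mu> (\<lambda>x. \<bar>(h x - s x) * g x\<bar>)"
      using gh[of "\<lambda>x. h x - s x" "1/j"] near by (intro integrable_abs) auto
     show "\<bar>(h x - s x) * g x\<bar> \<le> 1 / j * g x" for x
      using mult_right_mono[OF near g(2), of x x] g(2)[of x] by (simp add: abs_mult)
    qed (use gint in simp)
    also have "\<dots> \<le> (1 / j) * G" using j C by (auto simp: G_def intro!: divide_right_mono)
    also have "\<dots> = e" using G by (simp add: j_def)
    finally show ?thesis .
   qed
   ultimately show "\<exists>b l'. b \<longlonglongrightarrow> l' \<and> (\<forall>n. \<bar>(\<integral>z. h (X (k n) z) * Z (k n) z \<partial>\<gamma> (k n)) - b n\<bar> \<le> e) \<and> \<bar>(\<integral>x. h x * g x \<partial>\<mu>) - l'\<bar> \<le> e"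
    by (intro exI[of _ "\<lambda>n. \<integral>z. s (X (k n) z) * Z (k n) z \<partial>\<gamma> (k n)"] exI[of _ "\<integral>x. s x * g x \<partial>\<mu>"]) auto
  qed
 qed
qed


end

end

text \<open>Positive and negative parts are treated in turn, the second along a subsequence of the
  first.\<close>

lemma (in conjugate_exponents) weak_limit_real:
 fixes \<mu> :: "'a::second_countable_topology measure" and Z :: "nat \<Rightarrow> 'c \<Rightarrow> real"
 assumes \<mu>: "prob_space \<mu>" "sets \<mu> = sets borel"
  and \<gamma>: "\<And>n. prob_space (\<gamma> n)" "\<And>n. X n \<in> borel_measurable (\<gamma> n)" "\<And>n. distr (\<gamma> n) borel (X n) = \<mu>"
  and Z: "\<And>n. Z n \<in> Lp_space q (\<gamma> n)" "\<And>n. Lp_norm q (\<gamma> n) (Z n) \<le> C"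
 obtains r g where "strict_mono (r :: nat \<Rightarrow> nat)" "integrable \<mu> g"
  "\<And>h K. h \<in> borel_measurable borel ==> (\<And>x. \<bar>h x\<bar> \<le> K) ==>
   (\<lambda>n. \<integral>z. h (X (r n) z) * Z (r n) z \<partial>\<gamma> (r n)) \<longlonglongrightarrow> (\<integral>x. h x * g x \<partial>\<mu>)"
proof -
 interpret \<gamma>: prob_space "\<gamma> n" for n by (rule \<gamma>(1))
 note [measurable] = \<gamma>(2)
 have part: "(\<lambda>z. max 0 (c * Z n z)) \<in> Lp_space q (\<gamma> n)" "Lp_norm q (\<gamma> n) (\<lambda>z. max 0 (c * Z n z)) \<le> C"
  if "\<bar>c\<bar> = 1" for c n
 proof -
  have [measurable]: "Z n \<in> borel_measurable (\<gamma> n)" and int: "integrable (\<gamma> n) (\<lambda>z. norm (Z n z) powr q)"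
   using Z(1)[of n] by (auto simp: Lp_space_def)
  have "norm (max 0 (c * Z n z)) \<le> norm (Z n z)" for z
   using that by (auto simp: max_def abs_if split: if_splits)
  then show "(\<lambda>z. max 0 (c * Z n z)) \<in> Lp_space q (\<gamma> n)" "Lp_norm q (\<gamma> n) (\<lambda>z. max 0 (c * Z n z)) \<le> C"
   using Lp_space_bound[OF Z(1)[of n], of "\<lambda>z. max 0 (c * Z n z)"] q_pos Z(2)[of n] by auto
 qed
 define P where "P n z = max 0 (1 * Z n z)" for n z
 define M where "M n z = max 0 (-1 * Z n z)" for n z
 have PM: "Z n z = P n z - M n z" for n z by (auto simp: P_def M_def max_def)
 have P: "P n \<in> Lp_space q (\<gamma> n)" "Lp_norm q (\<gamma> n) (P n) \<le> C" "0 \<le> P n z" for n z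
  using part[of 1 n] by (auto simp: P_def[abs_def])
 have M: "M n \<in> Lp_space q (\<gamma> n)" "Lp_norm q (\<gamma> n) (M n) \<le> C" "0 \<le> M n z" for n z
  using part[of "-1" n] by (auto simp: M_def[abs_def])
 obtain r1 g1 where r1: "strict_mono (r1 :: nat \<Rightarrow> nat)" "integrable \<mu> g1"
  "\<And>h K. h \<in> borel_measurable borel ==> (\<And>x. \<bar>h x\<bar> \<le> K) ==>
   (\<lambda>n. \<integral>z. h (X (r1 n) z) * P (r1 n) z \<partial>\<gamma> (r1 n)) \<longlonglongrightarrow> (\<integral>x. h x * g1 x \<partial>\<mu>)"
  using weak_limit_nonneg[where \<gamma>=\<gamma> and X=X and Z=P and C=C, OF \<mu> \<gamma> P] by blast
 obtain r2 g2 where r2: "strict_mono (r2 :: nat \<Rightarrow> nat)" "integrable \<mu> g2"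
  "\<And>h K. h \<in> borel_measurable borel ==> (\<And>x. \<bar>h x\<bar> \<le> K) ==>
   (\<lambda>n. \<integral>z. h (X (r1 (r2 n)) z) * M (r1 (r2 n)) z \<partial>\<gamma> (r1 (r2 n))) \<longlonglongrightarrow> (\<integral>x. h x * g2 x \<partial>\<mu>)"
  using weak_limit_nonneg[where \<gamma>="\<lambda>n. \<gamma> (r1 n)" and X="\<lambda>n. X (r1 n)" and Z="\<lambda>n. M (r1 n)" and C=C, OF \<mu> \<gamma> M] by blast
 show ?thesis
 proof
  show "strict_mono (r1 \<circ> r2)" using r1(1) r2(1) by (rule strict_mono_o)
  show "integrable \<mu> (\<lambda>x. g1 x - g2 x)" using r1(2) r2(2) by simp
  fix h :: "'a \<Rightarrow> real" and K assume h[measurable]: "h \<in> borel_measurable borel" and K: "\<And>x. \<bar>h x\<bar> \<le> K"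
  have h'[measurable]: "h \<in> borel_measurable \<mu>" using h \<mu>(2) measurable_cong_sets by blast
  have hL: "(\<lambda>z. h (X n z)) \<in> Lp_space p (\<gamma> n)" for n
   using K finite_prob_powr_integrable[OF \<gamma>(1), of "\<lambda>z. h (X n z)" n K p] p_pos by (auto simp: Lp_space_def)
  have hg: "integrable \<mu> (\<lambda>x. h x * g x)" if "integrable \<mu> g" for g
  proof (rule Bochner_Integration.integrable_bound)
   show "integrable \<mu> (\<lambda>x. K * g x)" using that by simp
   show "AE x in \<mu>. norm (h x * g x) \<le> norm (K * g x)"
    by (auto simp: abs_mult intro!: mult_right_mono order_trans[OF K abs_ge_self])
  qed (use that in measurable)
  have "(\<integral>z. h (X n z) * Z n z \<partial>\<gamma> n) = (\<integral>z. h (X n z) * P n z \<partial>\<gamma> n) - (\<integral>z. h (X n z) * M n z \<partial>\<gamma> n)" for n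
   using holder_inner(1)[OF hL P(1), of n] holder_inner(1)[OF hL M(1), of n] by (simp add: PM right_diff_distrib)
  moreover have "(\<integral>x. h x * (g1 x - g2 x) \<partial>\<mu>) = (\<integral>x. h x * g1 x \<partial>\<mu>) - (\<integral>x. h x * g2 x \<partial>\<mu>)"
   using hg[OF r1(2)] hg[OF r2(2)] by (simp add: right_diff_distrib)
  moreover have "(\<lambda>n. \<integral>z. h (X (r1 (r2 n)) z) * P (r1 (r2 n)) z \<partial>\<gamma> (r1 (r2 n))) \<longlonglongrightarrow> (\<integral>x. h x * g1 x \<partial>\<mu>)"
   using LIMSEQ_subseq_LIMSEQ[OF r1(3)[OF h K] r2(1)] by (simp add: comp_def)
  ultimately show "(\<lambda>n. \<integral>z. h (X ((r1 \<circ> r2) n) z) * Z ((r1 \<circ> r2) n) z \<partial>\<gamma> ((r1 \<circ> r2) n)) \<longlonglongrightarrow> (\<integral>x. h x * (g1 x - g2 x) \<partial>\<mu>)"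
   using tendsto_diff[OF _ r2(3)[OF h K]] by simp
 qed
qed

text \<open>Weak sequential compactness in L^q for fields on varying measures, seen through
  \<open>X n\<close>. With X = fst and plans \<gamma> it yields the weak limit of the barycentric
  projections of Z onto the first marginal, without disintegrating the plans. Bounded test functions
  are handled by coordinates; the L^q bound on the limit then admits all of L^p.\<close>

lemma (in conjugate_exponents) weak_compactness:
 fixes \<mu> :: "'a::second_countable_topology measure" and Z :: "nat \<Rightarrow> 'c \<Rightarrow> 'b::euclidean_space"
 assumes \<mu>: "prob_space \<mu>" "sets \<mu> = sets borel"
  and \<gamma>: "\<And>n. prob_space (\<gamma> n)" "\<And>n. X n \<in> borel_measurable (\<gamma> n)" "\<And>n. distr (\<gamma> n) borel (X n) = \<mu>"
  and Z: "\<And>n. Z n \<in> Lp_space q (\<gamma> n)" "\<And>n. Lp_norm q (\<gamma> n) (Z n) \<le> C"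
 obtains r \<zeta> where "strict_mono (r :: nat \<Rightarrow> nat)" "\<zeta> \<in> Lp_space q \<mu>" "Lp_norm q \<mu> \<zeta> \<le> C"
  "\<And>h. h \<in> Lp_space p \<mu> ==>
   (\<lambda>n. \<integral>z. h (X (r n) z) \<bullet> Z (r n) z \<partial>\<gamma> (r n)) \<longlonglongrightarrow> (\<integral>x. h x \<bullet> \<zeta> x \<partial>\<mu>)"
proof -
 interpret \<mu>: prob_space \<mu> by fact
 interpret \<gamma>: prob_space "\<gamma> n" for n by (rule \<gamma>(1))
 note [measurable] = \<gamma>(2)
 have Zm[measurable]: "Z n \<in> borel_measurable (\<gamma> n)" for n using Z(1) by (auto simp: Lp_space_def)
 have "0 \<le> Lp_norm q (\<gamma> 0) (Z 0)" by (simp add: Lp_norm_def)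
 then have C: "0 \<le> C" using Z(2)[of 0] by linarith
 have comp: "(\<lambda>z. Z n z \<bullet> b) \<in> Lp_space q (\<gamma> n)" "Lp_norm q (\<gamma> n) (\<lambda>z. Z n z \<bullet> b) \<le> C" if "b \<in> Basis" for b n
 proof -
  have "norm (Z n z \<bullet> b) \<le> norm (Z n z)" for z
   using Basis_le_norm[OF that, of "Z n z"] by simp
  then show "(\<lambda>z. Z n z \<bullet> b) \<in> Lp_space q (\<gamma> n)" "Lp_norm q (\<gamma> n) (\<lambda>z. Z n z \<bullet> b) \<le> C"
   using Lp_space_bound[OF Z(1)[of n], of "\<lambda>z. Z n z \<bullet> b"] q_pos Z(2)[of n] by auto
 qed
 define Q where "Q b r g \<longleftrightarrow> integrable \<mu> g \<and> (\<forall>h K. h \<in> borel_measurable borel \<longrightarrow> (\<forall>x. \<bar>h x\<bar> \<le> K) \<longrightarrow>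
   (\<lambda>n. \<integral>z. h (X (r n) z) * (Z (r n) z \<bullet> b) \<partial>\<gamma> (r n)) \<longlonglongrightarrow> (\<integral>x. h x * g x \<partial>\<mu>))"
  for b and r :: "nat \<Rightarrow> nat" and g
 have Q_sub: "Q b (r \<circ> s) g" if "Q b r g" "strict_mono s" for b r s g
  unfolding Q_def
 proof (intro conjI allI impI)
  show "integrable \<mu> g" using that(1) by (simp add: Q_def)
  fix h :: "'a \<Rightarrow> real" and K :: real assume "h \<in> borel_measurable borel" "\<forall>x. \<bar>h x\<bar> \<le> K"
  then have "(\<lambda>n. \<integral>z. h (X (r n) z) * (Z (r n) z \<bullet> b) \<partial>\<gamma> (r n)) \<longlonglongrightarrow> (\<integral>x. h x * g x \<partial>\<mu>)"
   using that(1) unfolding Q_def by blast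
  from LIMSEQ_subseq_LIMSEQ[OF this that(2)]
  show "(\<lambda>n. \<integral>z. h (X ((r \<circ> s) n) z) * (Z ((r \<circ> s) n) z \<bullet> b) \<partial>\<gamma> ((r \<circ> s) n)) \<longlonglongrightarrow> (\<integral>x. h x * g x \<partial>\<mu>)"
   by (simp add: comp_def)
 qed
 have "\<exists>r. strict_mono r \<and> (\<forall>b\<in>F. \<exists>g. Q b r g)" if "finite F" "F \<subseteq> Basis" for F
  using that
 proof (induction F)
  case empty
  then show ?case using strict_mono_id by auto
 next
  case (insert b F)
  then obtain r where r: "strict_mono r" "\<forall>b\<in>F. \<exists>g. Q b r g" by auto
  have "b \<in> Basis" using insert by auto
  obtain s g where s: "strict_mono (s :: nat \<Rightarrow> nat)" "integrable \<mu> g"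
  "\<And>h K. h \<in> borel_measurable borel ==> (\<And>x. \<bar>h x\<bar> \<le> K) ==>
   (\<lambda>n. \<integral>z. h (X (r (s n)) z) * (Z (r (s n)) z \<bullet> b) \<partial>\<gamma> (r (s n))) \<longlonglongrightarrow> (\<integral>x. h x * g x \<partial>\<mu>)"
  using weak_limit_real[where \<gamma>="\<lambda>n. \<gamma> (r n)" and X="\<lambda>n. X (r n)" and Z="\<lambda>n z. Z (r n) z \<bullet> b" and C=C, OF \<mu> \<gamma> comp[OF \<open>b \<in> Basis\<close>]] by blast
  then have "Q b (r \<circ> s) g" by (auto simp: Q_def)
  then show ?case using r s(1) Q_sub[OF _ s(1)] strict_mono_o by (intro exI[of _ "r \<circ> s"]) blast
 qed
 from this[of Basis] obtain r where r: "strict_mono r" "\<forall>b\<in>Basis. \<exists>g. Q b r g" by auto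
 then obtain g where g: "\<And>b. b \<in> Basis ==> Q b r (g b)" by metis
 define \<zeta> where "\<zeta> x = (\<Sum>b\<in>Basis. g b x *\<^sub>R b)" for x
 have gi: "integrable \<mu> (g b)" if "b \<in> Basis" for b using g[OF that] by (simp add: Q_def)
 have \<zeta>i: "integrable \<mu> \<zeta>" unfolding \<zeta>_def using gi by auto
 then have [measurable]: "\<zeta> \<in> borel_measurable \<mu>" by auto
 have [measurable]: "\<zeta> \<in> borel_measurable borel" using \<open>\<zeta> \<in> borel_measurable \<mu>\<close> measurable_cong_sets[OF \<mu>(2)] by blast
 have hX: "(\<lambda>z. h (X n z)) \<in> Lp_space p (\<gamma> n)" "Lp_norm p (\<gamma> n) (\<lambda>z. h (X n z)) = Lp_norm p \<mu> h"
  if "h \<in> Lp_space p \<mu>" for n and h :: "'a \<Rightarrow> 'b"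
 proof -
  have [measurable]: "h \<in> borel_measurable borel" and int: "integrable \<mu> (\<lambda>x. norm (h x) powr p)"
   using that measurable_cong_sets[OF \<mu>(2)] by (auto simp: Lp_space_def)
  have "integrable (distr (\<gamma> n) borel (X n)) (\<lambda>x. norm (h x) powr p)" using int \<gamma>(3) by simp
  then show "(\<lambda>z. h (X n z)) \<in> Lp_space p (\<gamma> n)" by (auto simp: Lp_space_def integrable_distr_eq)
  show "Lp_norm p (\<gamma> n) (\<lambda>z. h (X n z)) = Lp_norm p \<mu> h"
   unfolding Lp_norm_def \<gamma>(3)[of n, symmetric] by (simp add: integral_distr)
 qed
 have bnd: "\<bar>\<integral>z. h (X n z) \<bullet> Z n z \<partial>\<gamma> n\<bar> \<le> Lp_norm p \<mu> h * C" "integrable (\<gamma> n) (\<lambda>z. h (X n z) \<bullet> Z n z)"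
  if "h \<in> Lp_space p \<mu>" for n h
 proof -
  have "\<bar>\<integral>z. h (X n z) \<bullet> Z n z \<partial>\<gamma> n\<bar> \<le> Lp_norm p (\<gamma> n) (\<lambda>z. h (X n z)) * Lp_norm q (\<gamma> n) (Z n)"
   by (rule holder_inner(2)[OF hX(1)[OF that] Z(1)])
  also have "\<dots> \<le> Lp_norm p \<mu> h * C"
   unfolding hX(2)[OF that] by (intro mult_left_mono Z) (simp add: Lp_norm_def)
  finally show "\<bar>\<integral>z. h (X n z) \<bullet> Z n z \<partial>\<gamma> n\<bar> \<le> Lp_norm p \<mu> h * C" .
  show "integrable (\<gamma> n) (\<lambda>z. h (X n z) \<bullet> Z n z)"
   by (rule holder_inner(1)[OF hX(1)[OF that] Z(1)])
 qed
 have bdL: "h \<in> Lp_space p \<mu>" if "h \<in> borel_measurable \<mu>" "\<And>x. norm (h x) \<le> K" for h :: "'a \<Rightarrow> 'b" and K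
  using that finite_prob_powr_integrable[OF \<mu>(1), of h K p] p_pos by (auto simp: Lp_space_def)
 have conv_bd: "(\<lambda>n. \<integral>z. h (X (r n) z) \<bullet> Z (r n) z \<partial>\<gamma> (r n)) \<longlonglongrightarrow> (\<integral>x. h x \<bullet> \<zeta> x \<partial>\<mu>)"
  if h[measurable]: "h \<in> borel_measurable \<mu>" and K: "\<And>x. norm (h x) \<le> K" for h :: "'a \<Rightarrow> 'b" and K
 proof -
  have hb[measurable]: "h \<in> borel_measurable borel" using h measurable_cong_sets[OF \<mu>(2)] by blast
  have Kb: "\<bar>h x \<bullet> b\<bar> \<le> K" if "b \<in> Basis" for x b using K[of x] Basis_le_norm[OF that, of "h x"] by simp
  have K0: "0 \<le> K" using K[of undefined] norm_ge_zero order_trans by blast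
  have hbL: "(\<lambda>z. h (X n z) \<bullet> b) \<in> Lp_space p (\<gamma> n)" if "b \<in> Basis" for n b
   using Kb[OF that] finite_prob_powr_integrable[OF \<gamma>(1), of "\<lambda>z. h (X n z) \<bullet> b" n K p] p_pos by (auto simp: Lp_space_def)
  have e1: "(\<integral>z. h (X n z) \<bullet> Z n z \<partial>\<gamma> n) = (\<Sum>b\<in>Basis. \<integral>z. (h (X n z) \<bullet> b) * (Z n z \<bullet> b) \<partial>\<gamma> n)" for n
  proof -
   have "(\<integral>z. h (X n z) \<bullet> Z n z \<partial>\<gamma> n) = (\<integral>z. (\<Sum>b\<in>Basis. (h (X n z) \<bullet> b) * (Z n z \<bullet> b)) \<partial>\<gamma> n)"
    by (subst euclidean_inner) (rule refl)
   also have "\<dots> = (\<Sum>b\<in>Basis. \<integral>z. (h (X n z) \<bullet> b) * (Z n z \<bullet> b) \<partial>\<gamma> n)"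
    using holder_inner(1)[OF hbL comp(1)] by (intro Bochner_Integration.integral_sum) simp
   finally show ?thesis .
  qed
  have hgi: "integrable \<mu> (\<lambda>x. (h x \<bullet> b) * g b x)" if "b \<in> Basis" for b
  proof (rule Bochner_Integration.integrable_bound)
   show "integrable \<mu> (\<lambda>x. K * g b x)" using gi that by simp
   show "AE x in \<mu>. norm ((h x \<bullet> b) * g b x) \<le> norm (K * g b x)"
    using Kb[OF that] K0 by (intro AE_I2) (auto simp: abs_mult intro!: mult_right_mono)
  qed (use gi[OF that] in measurable)
  have e2: "(\<integral>x. h x \<bullet> \<zeta> x \<partial>\<mu>) = (\<Sum>b\<in>Basis. \<integral>x. (h x \<bullet> b) * g b x \<partial>\<mu>)"
   using hgi by (subst Bochner_Integration.integral_sum[symmetric]) (auto simp: \<zeta>_def inner_sum_right mult.commute)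
  show ?thesis unfolding e1 e2
  proof (rule tendsto_sum)
   fix b :: 'b assume b: "b \<in> Basis"
   have m: "(\<lambda>x. h x \<bullet> b) \<in> borel_measurable borel" by measurable
   note Qb = conjunct2[OF g[OF b, unfolded Q_def], rule_format]
   show "(\<lambda>n. \<integral>z. (h (X (r n) z) \<bullet> b) * (Z (r n) z \<bullet> b) \<partial>\<gamma> (r n)) \<longlonglongrightarrow> (\<integral>x. (h x \<bullet> b) * g b x \<partial>\<mu>)"
    by (rule Qb[OF m Kb[OF b]])
  qed
 qed
 define a where "a N x = indicator {x. norm (\<zeta> x) \<le> real N} x * norm (\<zeta> x) powr q" for N x
 have aN: "(\<integral>x. a N x \<partial>\<mu>) \<le> C powr q" "integrable \<mu> (a N)" for N
 proof -
  \<comment> \<open>The truncated duality map is a bounded test function with |h|^p = h . \<zeta> =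
    a N. Testing with it gives I \<le> I^(1/p) * C for the truncated integral I, hence I \<le>
    C^q.\<close>
  define h where "h x = indicator {x. norm (\<zeta> x) \<le> real N} x *\<^sub>R duality_map q (\<zeta> x)" for x
  have [measurable]: "h \<in> borel_measurable \<mu>" unfolding h_def by measurable
  have hK: "norm (h x) \<le> real N powr (q - 1)" for x
   using q_gt_1 by (auto simp: h_def indicator_def norm_duality_map intro!: powr_mono2)
  have hL: "h \<in> Lp_space p \<mu>" by (rule bdL[OF _ hK]) measurable
  have hp: "norm (h x) powr p = a N x" for x
   by (auto simp: h_def a_def indicator_def norm_duality_map powr_powr q_minus_1_times_p)
  have hz: "h x \<bullet> \<zeta> x = a N x" for x
   using inner_duality_map[of "\<zeta> x" q] by (auto simp: h_def a_def indicator_def inner_commute)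
  show ai: "integrable \<mu> (a N)" using hL by (simp add: Lp_space_def hp)
  define I where "I = (\<integral>x. a N x \<partial>\<mu>)"
  have I0: "0 \<le> I" unfolding I_def by (intro integral_nonneg_AE) (auto simp: a_def)
  have hn: "Lp_norm p \<mu> h = I powr (1/p)" by (simp add: Lp_norm_def hp I_def)
  have "I \<le> I powr (1/p) * C"
  proof (rule LIMSEQ_le_const2)
   show "(\<lambda>n. \<integral>z. h (X (r n) z) \<bullet> Z (r n) z \<partial>\<gamma> (r n)) \<longlonglongrightarrow> I"
    using conv_bd[of h, OF _ hK] by (simp add: hz I_def)
   show "\<exists>N. \<forall>n\<ge>N. (\<integral>z. h (X (r n) z) \<bullet> Z (r n) z \<partial>\<gamma> (r n)) \<le> I powr (1/p) * C"
    using bnd(1)[OF hL] unfolding hn by (meson abs_le_D1)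
  qed
  moreover have "I = I powr (1/p) * I powr (1/q)" using I0 conjugate
   by (cases "I = 0") (auto simp flip: powr_add)
  ultimately have "I = 0 \<or> I powr (1/q) \<le> C"
   using I0 by (metis mult_le_cancel_left_pos order_le_less powr_gt_zero)
  then show "(\<integral>x. a N x \<partial>\<mu>) \<le> C powr q"
  proof
   assume "I powr (1/q) \<le> C"
   then have "(I powr (1/q)) powr q \<le> C powr q" using q_pos by (intro powr_mono2) auto
   then show ?thesis using I0 q_pos by (simp add: powr_powr I_def)
  qed (simp add: I_def)
 qed
 have nn: "(\<integral>\<^sup>+x. ennreal (norm (\<zeta> x) powr q) \<partial>\<mu>) \<le> ennreal (C powr q)"
 proof -
  have "(\<integral>\<^sup>+x. ennreal (norm (\<zeta> x) powr q) \<partial>\<mu>) = (\<integral>\<^sup>+x. (SUP N. ennreal (a N x)) \<partial>\<mu>)"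
  proof (rule nn_integral_cong)
   fix x
   obtain N where "norm (\<zeta> x) \<le> real N" using real_arch_simple by blast
   then have "a N x = norm (\<zeta> x) powr q" by (simp add: a_def)
   moreover have "a n x \<le> norm (\<zeta> x) powr q" for n by (simp add: a_def indicator_def)
   ultimately show "ennreal (norm (\<zeta> x) powr q) = (SUP N. ennreal (a N x))"
    by (intro antisym SUP_upper2[of N] SUP_least) (auto intro: ennreal_leI)
  qed
  also have "\<dots> = (SUP N. \<integral>\<^sup>+x. ennreal (a N x) \<partial>\<mu>)"
   by (rule nn_integral_monotone_convergence_SUP)
    (auto simp: incseq_def le_fun_def a_def indicator_def intro!: ennreal_leI)
  also have "\<dots> \<le> ennreal (C powr q)"
  proof (rule SUP_least)
   fix N show "(\<integral>\<^sup>+x. ennreal (a N x) \<partial>\<mu>) \<le> ennreal (C powr q)"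
   proof (subst nn_integral_eq_integral[OF aN(2)])
    show "AE x in \<mu>. 0 \<le> a N x" by (simp add: a_def)
   qed (intro ennreal_leI aN(1))
  qed
  finally show ?thesis .
 qed
 have \<zeta>L: "\<zeta> \<in> Lp_space q \<mu>"
  using nn by (auto simp: Lp_space_def integrable_iff_bounded intro: le_less_trans)
 have \<zeta>C: "Lp_norm q \<mu> \<zeta> \<le> C"
 proof -
  have "(\<integral>x. norm (\<zeta> x) powr q \<partial>\<mu>) \<le> C powr q"
   using nn \<zeta>L by (subst (asm) nn_integral_eq_integral) (auto simp: Lp_space_def)
  then have "Lp_norm q \<mu> \<zeta> \<le> (C powr q) powr (1/q)"
   unfolding Lp_norm_def using q_pos by (intro powr_mono2) auto
  then show ?thesis using C q_pos by (simp add: powr_powr)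
 qed
 show ?thesis
 proof
  show "strict_mono r" "\<zeta> \<in> Lp_space q \<mu>" "Lp_norm q \<mu> \<zeta> \<le> C" by fact+
  fix h :: "'a \<Rightarrow> 'b" assume h: "h \<in> Lp_space p \<mu>"
  then have [measurable]: "h \<in> borel_measurable \<mu>" and hi: "integrable \<mu> (\<lambda>x. norm (h x) powr p)"
   by (auto simp: Lp_space_def)
  \<comment> \<open>Truncation by the norm: bounded, and convergent to h in L^p by dominated
    convergence.\<close>
  define t where "t N x = indicator {x. norm (h x) \<le> real N} x *\<^sub>R h x" for N x
  have tm[measurable]: "t N \<in> borel_measurable \<mu>" for N
  proof -
   have "{x \<in> space \<mu>. norm (h x) \<le> real N} \<in> sets \<mu>" by measurable
   moreover have "space \<mu> = UNIV" using sets_eq_imp_space_eq[OF \<mu>(2)] by simp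
   ultimately have [measurable]: "{x. norm (h x) \<le> real N} \<in> sets \<mu>" by simp
   show ?thesis unfolding t_def by measurable
  qed
  have tK: "norm (t N x) \<le> real N" for N x by (simp add: t_def indicator_def)
  have tL: "t N \<in> Lp_space p \<mu>" for N by (rule bdL[OF _ tK]) measurable
  have dL: "(\<lambda>x. h x - t N x) \<in> Lp_space p \<mu>" for N by (rule Lp_space_diff[OF p_gt_1 h tL])
  have "(\<lambda>N. \<integral>x. norm (h x - t N x) powr p \<partial>\<mu>) \<longlonglongrightarrow> (\<integral>x. 0 \<partial>\<mu>)"
  proof (rule integral_dominated_convergence[where w="\<lambda>x. norm (h x) powr p"])
   show "AE x in \<mu>. (\<lambda>N. norm (h x - t N x) powr p) \<longlonglongrightarrow> 0"
   proof (intro AE_I2 tendsto_eventually)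
    fix x
    obtain N where "norm (h x) \<le> real N" using real_arch_simple by blast
    then show "\<forall>\<^sub>F N in sequentially. norm (h x - t N x) powr p = 0"
     by (intro eventually_sequentiallyI[of N]) (auto simp: t_def)
   qed
   show "AE x in \<mu>. norm (norm (h x - t N x) powr p) \<le> norm (h x) powr p" for N
    by (intro AE_I2) (auto simp: t_def indicator_def)
  qed (use hi in auto)
  then have "(\<lambda>N. Lp_norm p \<mu> (\<lambda>x. h x - t N x) * C) \<longlonglongrightarrow> 0 powr (1/p) * C"
   unfolding Lp_norm_def using p_pos by (intro tendsto_intros tendsto_powr') auto
  then have lim0: "(\<lambda>N. Lp_norm p \<mu> (\<lambda>x. h x - t N x) * C) \<longlonglongrightarrow> 0" by simp
  show "(\<lambda>n. \<integral>z. h (X (r n) z) \<bullet> Z (r n) z \<partial>\<gamma> (r n)) \<longlonglongrightarrow> (\<integral>x. h x \<bullet> \<zeta> x \<partial>\<mu>)"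
  proof (rule tendsto_approx)
   fix e :: real assume "0 < e"
   then obtain N where N: "Lp_norm p \<mu> (\<lambda>x. h x - t N x) * C < e"
    using order_tendstoD(2)[OF lim0] by (auto simp: eventually_sequentially)
   have "\<bar>(\<integral>z. h (X n z) \<bullet> Z n z \<partial>\<gamma> n) - (\<integral>z. t N (X n z) \<bullet> Z n z \<partial>\<gamma> n)\<bar> \<le> e" for n
   proof -
    have "(\<integral>z. h (X n z) \<bullet> Z n z \<partial>\<gamma> n) - (\<integral>z. t N (X n z) \<bullet> Z n z \<partial>\<gamma> n) = (\<integral>z. (h (X n z) - t N (X n z)) \<bullet> Z n z \<partial>\<gamma> n)"
     using bnd(2)[OF h, of n] bnd(2)[OF tL, of n N] by (simp add: inner_diff_left)
    with bnd(1)[OF dL, of n N] N show ?thesis by simp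
   qed
   moreover have "\<bar>(\<integral>x. h x \<bullet> \<zeta> x \<partial>\<mu>) - (\<integral>x. t N x \<bullet> \<zeta> x \<partial>\<mu>)\<bar> \<le> e"
   proof -
    have "(\<integral>x. h x \<bullet> \<zeta> x \<partial>\<mu>) - (\<integral>x. t N x \<bullet> \<zeta> x \<partial>\<mu>) = (\<integral>x. (h x - t N x) \<bullet> \<zeta> x \<partial>\<mu>)"
     using holder_inner(1)[OF h \<zeta>L] holder_inner(1)[OF tL \<zeta>L] by (simp add: inner_diff_left)
    also have "\<bar>\<dots>\<bar> \<le> Lp_norm p \<mu> (\<lambda>x. h x - t N x) * Lp_norm q \<mu> \<zeta>"
     by (rule holder_inner(2)[OF dL \<zeta>L])
    also have "\<dots> \<le> Lp_norm p \<mu> (\<lambda>x. h x - t N x) * C"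
     by (intro mult_left_mono \<zeta>C) (simp add: Lp_norm_def)
    finally show ?thesis using N by simp
   qed
   ultimately show "\<exists>b l'. b \<longlonglongrightarrow> l' \<and> (\<forall>n. \<bar>(\<integral>z. h (X (r n) z) \<bullet> Z (r n) z \<partial>\<gamma> (r n)) - b n\<bar> \<le> e) \<and>
     \<bar>(\<integral>x. h x \<bullet> \<zeta> x \<partial>\<mu>) - l'\<bar> \<le> e"
    using conv_bd[of "t N", OF tm tK]
    by (intro exI[of _ "\<lambda>n. \<integral>z. t N (X (r n) z) \<bullet> Z (r n) z \<partial>\<gamma> (r n)"] exI[of _ "\<integral>x. t N x \<bullet> \<zeta> x \<partial>\<mu>"]) auto
  qed
 qed
qed

section \<open>The metric derivative\<close>

lemma negligible_imp_AE:
 assumes "negligible N" "\<And>x. x \<notin> N ==> P x"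
 shows "AE x in lborel. P x"
proof -
 have "N \<in> null_sets lebesgue" using assms(1) by (simp add: negligible_iff_null_sets)
 then have "AE x in lebesgue. P x" by (rule AE_I') (use assms(2) in auto)
 then show ?thesis by (simp add: AE_completion_iff)
qed

text \<open>Cut |f| at height n: what lies above has integral below e / 2, what lies below
  contributes at most n times the measure of A.\<close>

lemma integral_absolutely_continuous:
 fixes f :: "'a \<Rightarrow> real"
 assumes f: "integrable M f" and "0 < e"
 obtains d where "0 < d" "\<And>A. A \<in> sets M ==> emeasure M A < ennreal d ==> (LINT x:A|M. \<bar>f x\<bar>) < e"
proof -
 have [measurable]: "f \<in> borel_measurable M" using f by auto
 define t where "t n x = (if \<bar>f x\<bar> \<le> real n then 0 else \<bar>f x\<bar>)" for n x
 have [measurable]: "t n \<in> borel_measurable M" for n unfolding t_def by measurable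
 have ti: "integrable M (t n)" for n
  by (rule Bochner_Integration.integrable_bound[OF f]) (auto simp: t_def)
 have "(\<lambda>n. \<integral>x. t n x \<partial>M) \<longlonglongrightarrow> (\<integral>x. 0 \<partial>M)"
 proof (rule integral_dominated_convergence[where w="\<lambda>x. \<bar>f x\<bar>"])
  show "AE x in M. (\<lambda>n. t n x) \<longlonglongrightarrow> 0"
  proof (intro AE_I2 tendsto_eventually)
   fix x
   obtain N where "\<bar>f x\<bar> \<le> real N" using real_arch_simple by blast
   then show "\<forall>\<^sub>F N in sequentially. t N x = 0"
    by (intro eventually_sequentiallyI[of N]) (auto simp: t_def)
  qed
 qed (use f in \<open>auto simp: t_def\<close>)
 then have "(\<lambda>n. \<integral>x. t n x \<partial>M) \<longlonglongrightarrow> 0" by simp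
 then have "\<forall>\<^sub>F n in sequentially. (\<integral>x. t n x \<partial>M) < e / 2"
  by (rule order_tendstoD(2)) (use \<open>0 < e\<close> in simp)
 then obtain n where n: "(\<integral>x. t n x \<partial>M) < e / 2" by (auto simp: eventually_sequentially)
 define d where "d = (e / 2) / (real n + 1)"
 show ?thesis
 proof
  show "0 < d" using \<open>0 < e\<close> by (simp add: d_def)
  fix A assume A[measurable]: "A \<in> sets M" and less: "emeasure M A < ennreal d"
  have fin: "emeasure M A < \<infinity>" using less by (rule order.strict_trans) simp
  have mA: "measure M A \<le> d" using less \<open>0 < d\<close>
   by (simp add: measure_def enn2real_leI less_imp_le)
  have "(LINT x:A|M. \<bar>f x\<bar>) = (\<integral>x. indicator A x * \<bar>f x\<bar> \<partial>M)"
   by (simp add: set_lebesgue_integral_def)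
  also have "\<dots> \<le> (\<integral>x. t n x + real n * indicator A x \<partial>M)"
  proof (rule integral_mono)
   show "integrable M (\<lambda>x. indicator A x * \<bar>f x\<bar>)"
    using integrable_real_mult_indicator[OF A integrable_abs[OF f]] by (simp add: mult.commute)
   show "integrable M (\<lambda>x. t n x + real n * indicator A x)"
    using ti fin by auto
   show "indicator A x * \<bar>f x\<bar> \<le> t n x + real n * indicator A x" for x
    by (auto simp: t_def indicator_def)
  qed
  also have "\<dots> = (\<integral>x. t n x \<partial>M) + real n * measure M A"
   using ti fin by simp
  also have "\<dots> < e / 2 + real n * d + d"
   using n mA \<open>0 < d\<close> mult_left_mono[OF mA, of "real n"] by linarith
  also have "\<dots> = e"
  proof -
   have "(real n + 1) * d = e / 2"
   proof -
    have "k * (e / 2 / k) = e / 2" if "k \<noteq> 0" for k :: real using that by simp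
    from this[of "real n + 1"] show ?thesis unfolding d_def by simp
   qed
   then show ?thesis by (simp add: algebra_simps)
  qed
  finally show "(LINT x:A|M. \<bar>f x\<bar>) < e" .
 qed
qed

text \<open>Vitali covering. Disjoint intervals on which g has mean above d cover almost all of the
  exceptional set and lie in an open set barely larger than E, where g < c. The integral of g - d
  over their union V is nonnegative, yet at most (c - d) |V \<inter> E| plus small errors from V -
  E. So |V \<inter> E| is small, and this set covers the exceptional set up to a null set.\<close>

lemma lebesgue_differentiation_upper:
 fixes g :: "real \<Rightarrow> real"
 assumes g: "integrable lborel g" and cd: "c < d"
 shows "negligible {t. g t < c \<and> (\<forall>\<delta>>0. \<exists>a b. a < b \<and> a \<le> t \<and> t \<le> b \<and> b - a < \<delta> \<and>
  d * (b - a) < (LINT x:{a..b}|lborel. g x))}" (is "negligible ?N")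
proof -
 have gm[measurable]: "g \<in> borel_measurable borel" using g by auto
 have gset: "set_integrable lborel A g" if "A \<in> sets borel" for A
  using g that unfolding set_integrable_def by (intro integrable_mult_indicator) auto
 \<comment> \<open>Bounded pieces keep all measures finite.\<close>
 have "negligible (?N \<inter> {- R <..< R})" for R :: real
  unfolding negligible_outer_le
 proof (intro allI impI)
  fix e :: real assume "0 < e"
  \<comment> \<open>V - E causes two errors of at most \<eta>: the integral of |g| over it, and |d|
    times its measure. Together they amount to (d - c) e.\<close>
  define \<eta> where "\<eta> = e * (d - c) / 2"
  have "0 < \<eta>" using \<open>0 < e\<close> cd by (simp add: \<eta>_def)
  define E where "E = {t. g t < c}"
  have [measurable]: "E \<in> sets borel" unfolding E_def by measurable
  obtain \<delta>0 where \<delta>0: "0 < \<delta>0" "\<And>A. A \<in> sets lborel ==> emeasure lborel A < ennreal \<delta>0 ==> (LINT x:A|lborel. \<bar>g x\<bar>) < \<eta>"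
   using integral_absolutely_continuous[OF g \<open>0 < \<eta>\<close>] by blast
  define \<delta> where "\<delta> = min \<delta>0 (\<eta> / (\<bar>d\<bar> + 1))"
  have "0 < \<delta>" using \<delta>0(1) \<open>0 < \<eta>\<close> by (simp add: \<delta>_def)
  obtain U0 where U0: "open U0" "E \<subseteq> U0" "emeasure lborel (U0 - E) < ennreal \<delta>"
   using outer_regular_lborel[OF _ \<open>0 < \<delta>\<close>, of E] by auto
  define U where "U = U0 \<inter> {- R <..< R}"
  have U: "open U" using U0(1) by (auto simp: U_def)
  define K where "K = {(a, b). a < b \<and> {a..b} \<subseteq> U \<and> d * (b - a) < (LINT x:{a..b}|lborel. g x)}"
  define ce where "ce = (\<lambda>(a, b). (a + b) / 2 :: real)"
  define ra where "ra = (\<lambda>(a, b). (b - a) / 2 :: real)"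
  have cb: "cball (ce i) (ra i) = {fst i..snd i}" for i
   by (cases i) (auto simp: ce_def ra_def cball_eq_atLeastAtMost field_simps)
  obtain C where C: "countable C" "C \<subseteq> K" "pairwise (\<lambda>i j. disjnt (cball (ce i) (ra i)) (cball (ce j) (ra j))) C"
   "negligible (?N \<inter> {- R <..< R} - (\<Union>i\<in>C. cball (ce i) (ra i)))"
  proof (rule Vitali_covering_theorem_cballs)
   show "0 < ra i" if "i \<in> K" for i using that by (auto simp: K_def ra_def)
   fix t dd :: real assume t: "t \<in> ?N \<inter> {- R <..< R}" and "0 < dd"
   then have "t \<in> U" using U0(2) by (auto simp: U_def E_def)
   then obtain \<rho> where \<rho>: "0 < \<rho>" "ball t \<rho> \<subseteq> U" using U open_contains_ball by blast
   obtain a b where ab: "a < b" "a \<le> t" "t \<le> b" "b - a < min dd \<rho>" "d * (b - a) < (LINT x:{a..b}|lborel. g x)"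
    using t \<rho>(1) \<open>0 < dd\<close> by (auto dest!: spec[of _ "min dd \<rho>"])
   have "{a..b} \<subseteq> ball t \<rho>" using ab by (auto simp: dist_real_def)
   then show "\<exists>i. i \<in> K \<and> t \<in> cball (ce i) (ra i) \<and> ra i < dd"
    using ab \<rho> unfolding cb by (intro exI[of _ "(a, b)"]) (auto simp: K_def ra_def)
  qed
  define J where "J n = (\<Union>i\<in>{i\<in>C. to_nat_on C i = n}. {fst i..snd i})" for n
  have J: "J n = {} \<or> (\<exists>i\<in>C. J n = {fst i..snd i})" for n
  proof (cases "\<exists>i\<in>C. to_nat_on C i = n")
   case True
   then obtain i where i: "i \<in> C" "to_nat_on C i = n" by auto
   then have "{j\<in>C. to_nat_on C j = n} = {i}"
    using inj_onD[OF inj_on_to_nat_on[OF C(1)]] by blast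
   then have "J n = {fst i..snd i}" by (simp add: J_def)
   then show ?thesis using i(1) by blast
  next
   case False
   then have "J n = {}" by (auto simp: J_def)
   then show ?thesis ..
  qed
  have Jm[measurable]: "J n \<in> sets borel" for n
   using J[of n] by (elim disjE bexE) simp_all
  have Jdisj: "disjoint_family J"
   unfolding disjoint_family_on_def
  proof (intro ballI impI)
   fix m n :: nat assume "m \<noteq> n"
   show "J m \<inter> J n = {}"
   proof (rule ccontr)
    assume "J m \<inter> J n \<noteq> {}"
    then obtain x i j where "x \<in> {fst i..snd i}" "x \<in> {fst j..snd j}" "i \<in> C" "j \<in> C" "to_nat_on C i = m" "to_nat_on C j = n"
     unfolding J_def by blast
    moreover then have "i \<noteq> j" using \<open>m \<noteq> n\<close> by auto
    ultimately show False using C(3) unfolding pairwise_def disjnt_def cb by blast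
   qed
  qed
  define V where "V = (\<Union>n. J n)"
  have V_eq: "V = (\<Union>i\<in>C. cball (ce i) (ra i))" unfolding V_def J_def cb by auto
  have [measurable]: "V \<in> sets borel" unfolding V_def by auto
  have VU: "V \<subseteq> U" using C(2) unfolding V_eq cb K_def by fastforce
  have Ub: "U \<subseteq> {- R <..< R}" by (auto simp: U_def)
  have fin: "emeasure lborel A < \<infinity>" if "A \<subseteq> {- R <..< R}" for A
  proof -
   have "emeasure lborel A \<le> emeasure lborel {-R..R}" using that by (intro emeasure_mono) auto
   also have "\<dots> < \<infinity>" by (cases "-R \<le> R") auto
   finally show ?thesis .
  qed
  have cint: "set_integrable lborel A (\<lambda>x. k)" if "A \<in> sets borel" "A \<subseteq> {- R <..< R}" for A and k :: real
   using fin[OF that(2)] that(1) unfolding set_integrable_def by auto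
  have gd: "set_integrable lborel A (\<lambda>x. g x - d)" if "A \<in> sets borel" "A \<subseteq> {- R <..< R}" for A
   using gset[OF that(1)] cint[OF that] by (rule set_integral_diff)
  have Vb: "V \<subseteq> {- R <..< R}" using VU Ub by auto
  have J_nonneg: "0 \<le> (LINT x:J n|lborel. g x - d)" for n
   using J[of n]
  proof
   assume "\<exists>i\<in>C. J n = {fst i..snd i}"
   then obtain i where i: "i \<in> C" "J n = {fst i..snd i}" by auto
   then have "i \<in> K" using C(2) by auto
   then have ab: "fst i < snd i" "d * (snd i - fst i) < (LINT x:{fst i..snd i}|lborel. g x)" "{fst i..snd i} \<subseteq> U" by (auto simp: K_def)
   have "(LINT x:{fst i..snd i}|lborel. g x - d) = (LINT x:{fst i..snd i}|lborel. g x) - (LINT x:{fst i..snd i}|lborel. d)"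
    using ab(3) Ub by (intro set_integral_diff gset cint) auto
   also have "(LINT x:{fst i..snd i}|lborel. d) = d * (snd i - fst i)"
    using ab by (simp add: set_lebesgue_integral_def)
   finally show ?thesis using i ab by simp
  qed (simp add: set_lebesgue_integral_def)
  have JV: "J n \<subseteq> V" for n by (auto simp: V_def)
  have lim: "(\<lambda>n. LINT x:(\<Union>i<n. J i)|lborel. g x - d) \<longlonglongrightarrow> (LINT x:(\<Union>n. \<Union>i<n. J i)|lborel. g x - d)"
  proof (rule set_integral_cont_up)
   show "set_integrable lborel (\<Union>n. \<Union>i<n. J i) (\<lambda>x. g x - d)"
    using JV Vb by (intro gd) (auto intro!: sets.finite_UN)
   show "incseq (\<lambda>n. \<Union>i<n. J i)" by (intro incseq_SucI UN_mono) auto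
  qed (auto intro!: sets.finite_UN)
  have part: "0 \<le> (LINT x:(\<Union>i<n. J i)|lborel. g x - d)" for n
  proof (induction n)
   case (Suc n)
   have "(\<Union>i<Suc n. J i) = (\<Union>i<n. J i) \<union> J n" by (auto simp: less_Suc_eq)
   moreover have "J i \<inter> J n = {}" if "i < n" for i
    using Jdisj that by (auto simp: disjoint_family_on_def)
   then have "(\<Union>i<n. J i) \<inter> J n = {}" by blast
   moreover have "set_integrable lborel (\<Union>i<n. J i) (\<lambda>x. g x - d)"
   proof (rule gd)
    show "(\<Union>i<n. J i) \<in> sets borel" by (intro sets.finite_UN Jm) simp
    show "(\<Union>i<n. J i) \<subseteq> {- R <..< R}" using JV Vb by blast
   qed
   moreover have "set_integrable lborel (J n) (\<lambda>x. g x - d)"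
    using JV Vb by (intro gd Jm) blast
   ultimately have "(LINT x:(\<Union>i<Suc n. J i)|lborel. g x - d) = (LINT x:(\<Union>i<n. J i)|lborel. g x - d) + (LINT x:J n|lborel. g x - d)"
    using set_integral_Un by metis
   then show ?case using Suc J_nonneg[of n] by simp
  qed (simp add: set_lebesgue_integral_def)
  have UJ: "(\<Union>n. \<Union>i<n. J i) = V"
  proof
   show "V \<subseteq> (\<Union>n. \<Union>i<n. J i)" unfolding V_def using lessI by blast
  qed (use JV in blast)
  have pos: "0 \<le> (LINT x:V|lborel. g x - d)"
   by (rule LIMSEQ_le_const[OF lim[unfolded UJ]]) (use part in blast)
  have VE: "V = (V \<inter> E) \<union> (V - E)" by auto
  have "(LINT x:V|lborel. g x - d) = (LINT x:V \<inter> E|lborel. g x - d) + (LINT x:V - E|lborel. g x - d)"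
   using Vb by (subst VE, intro set_integral_Un gd) auto
  also have "(LINT x:V \<inter> E|lborel. g x - d) \<le> (LINT x:V \<inter> E|lborel. c - d)"
   using Vb by (intro set_integral_mono gd cint) (auto simp: E_def)
  also have "(LINT x:V \<inter> E|lborel. c - d) = (c - d) * measure lborel (V \<inter> E)"
   using fin[of "V \<inter> E"] Vb by (simp add: set_lebesgue_integral_def mult.commute)
  also have "(LINT x:V - E|lborel. g x - d) \<le> (LINT x:V - E|lborel. \<bar>g x\<bar> + \<bar>d\<bar>)"
   using Vb gset by (intro set_integral_mono gd set_integral_add(1) cint set_integrable_abs) auto
  also have "\<dots> = (LINT x:V - E|lborel. \<bar>g x\<bar>) + (LINT x:V - E|lborel. \<bar>d\<bar>)"
   using Vb gset by (intro set_integral_add(2) cint set_integrable_abs) auto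
  also have "(LINT x:V - E|lborel. \<bar>d\<bar>) = \<bar>d\<bar> * measure lborel (V - E)"
   using fin[of "V - E"] Vb by (auto simp add: set_lebesgue_integral_def mult.commute)
  finally have main: "0 \<le> (c - d) * measure lborel (V \<inter> E) + ((LINT x:V - E|lborel. \<bar>g x\<bar>) + \<bar>d\<bar> * measure lborel (V - E))"
   using pos by linarith
  have "emeasure lborel (V - E) \<le> emeasure lborel (U0 - E)"
   using VU U0(1) by (intro emeasure_mono) (auto simp: U_def)
  then have small: "emeasure lborel (V - E) < ennreal \<delta>" using U0(3) by simp
  then have "emeasure lborel (V - E) < ennreal \<delta>0" by (rule order_less_le_trans) (auto simp: \<delta>_def intro: ennreal_leI)
  then have "(LINT x:V - E|lborel. \<bar>g x\<bar>) < \<eta>" using \<delta>0(2) by auto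
  moreover have "\<bar>d\<bar> * measure lborel (V - E) \<le> \<eta>"
  proof -
   have "measure lborel (V - E) \<le> \<delta>"
    using small \<open>0 < \<delta>\<close> by (simp add: measure_def enn2real_leI less_imp_le)
   also have "\<dots> \<le> \<eta> / (\<bar>d\<bar> + 1)" by (simp add: \<delta>_def)
   finally have "(\<bar>d\<bar> + 1) * measure lborel (V - E) \<le> \<eta>" by (simp add: field_simps)
   then show ?thesis using measure_nonneg[of lborel "V - E"] unfolding distrib_right by linarith
  qed
  ultimately have "(d - c) * measure lborel (V \<inter> E) \<le> 2 * \<eta>"
   using main unfolding left_diff_distrib by linarith
  also have "2 * \<eta> = (d - c) * e" by (simp add: \<eta>_def)
  finally have le: "measure lborel (V \<inter> E) \<le> e" using cd by simp
  define T where "T = (?N \<inter> {- R <..< R} - V) \<union> (V \<inter> E)"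
  have neg: "negligible (?N \<inter> {- R <..< R} - V)" using C(4) by (simp add: V_eq)
  have VE_m: "V \<inter> E \<in> lmeasurable"
   using fin[of "V \<inter> E"] Vb by (intro fmeasurableI) auto
  show "\<exists>T. ?N \<inter> {- R <..< R} \<subseteq> T \<and> T \<in> lmeasurable \<and> measure lebesgue T \<le> e"
  proof (intro exI[of _ T] conjI)
   show "?N \<inter> {- R <..< R} \<subseteq> T" unfolding T_def E_def by auto
   show "T \<in> lmeasurable" unfolding T_def by (rule fmeasurable.Un[OF negligible_imp_measurable[OF neg] VE_m])
   have "measure lebesgue T \<le> measure lebesgue (?N \<inter> {- R <..< R} - V) + measure lebesgue (V \<inter> E)"
    unfolding T_def by (rule measure_Un_le[OF negligible_imp_sets[OF neg] fmeasurableD[OF VE_m]])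
   also have "\<dots> = measure lebesgue (V \<inter> E)"
    using negligible_imp_measure0[OF neg] by linarith
   also have "\<dots> = measure lborel (V \<inter> E)" by (rule measure_completion) measurable
   finally show "measure lebesgue T \<le> e" using le by simp
  qed
 qed
 then have "negligible (\<Union>n::nat. ?N \<inter> {- real n <..< real n})" by (intro negligible_countable_Union) auto
 moreover have "(\<Union>n::nat. ?N \<inter> {- real n <..< real n}) = ?N"
 proof -
  have "\<exists>n. t \<in> {- real n <..< real n}" for t :: real
  proof -
   obtain n where "\<bar>t\<bar> < real n" using reals_Archimedean2 by blast
   then have "- real n < t \<and> t < real n" by linarith
   then show ?thesis by auto
  qed
  then show ?thesis by blast
 qed
 ultimately show ?thesis by simp
qed

text \<open>Rational numbers c < d strictly between g(t) and g(t) + e reduce the upper estimate to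
  countably many exceptional sets; the lower one is the same for -g. The intervals need only contain
  t, because one-sided ones occur later.\<close>

lemma lebesgue_differentiation:
 fixes g :: "real \<Rightarrow> real"
 assumes g: "integrable lborel g"
 shows "AE t in lborel. \<forall>e>0. \<exists>\<delta>>0. \<forall>a b. a < b \<longrightarrow> a \<le> t \<longrightarrow> t \<le> b \<longrightarrow> b - a < \<delta> \<longrightarrow>
  \<bar>(LINT x:{a..b}|lborel. g x) - g t * (b - a)\<bar> \<le> e * (b - a)"
proof -
 define N where "N h c d = {t. h t < c \<and> (\<forall>\<delta>>0. \<exists>a b. a < b \<and> a \<le> t \<and> t \<le> b \<and> b - a < \<delta> \<and>
  d * (b - a) < (LINT x:{a..b}|lborel. h x))}" for h :: "real \<Rightarrow> real" and c d
 define Q where "Q = {(c, d). c \<in> \<rat> \<and> d \<in> \<rat> \<and> c < (d :: real)}"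
 have "countable (\<rat> \<times> \<rat> :: (real \<times> real) set)" by (intro countable_SIGMA countable_rat)
 then have "countable Q" by (rule countable_subset[rotated]) (auto simp: Q_def)
 then have "negligible (\<Union>z\<in>Q. N g (fst z) (snd z) \<union> N (\<lambda>x. - g x) (fst z) (snd z))"
  unfolding N_def using g
  by (intro negligible_countable_Union negligible_Un) (auto simp: Q_def intro!: negligible_Un lebesgue_differentiation_upper)
 then show ?thesis
 proof (rule negligible_imp_AE, intro allI impI)
  fix t e :: real assume t: "t \<notin> (\<Union>z\<in>Q. N g (fst z) (snd z) \<union> N (\<lambda>x. - g x) (fst z) (snd z))" and "0 < e"
  have half: "\<exists>\<delta>>0. \<forall>a b. a < b \<longrightarrow> a \<le> t \<longrightarrow> t \<le> b \<longrightarrow> b - a < \<delta> \<longrightarrow> (LINT x:{a..b}|lborel. h x) \<le> (h t + e) * (b - a)"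
   if h: "\<And>c d. (c, d) \<in> Q ==> t \<notin> N h c d" for h
  proof -
   obtain c where c: "c \<in> \<rat>" "h t < c" "c < h t + e" using Rats_dense_in_real[of "h t" "h t + e"] \<open>0 < e\<close> by auto
   obtain d where d: "d \<in> \<rat>" "c < d" "d < h t + e" using Rats_dense_in_real[of c "h t + e"] c by auto
   have "t \<notin> N h c d" using c d by (intro h) (auto simp: Q_def)
   then have "\<not> (\<forall>\<delta>>0. \<exists>a b. a < b \<and> a \<le> t \<and> t \<le> b \<and> b - a < \<delta> \<and> d * (b - a) < (LINT x:{a..b}|lborel. h x))"
    using c(2) by (simp only: N_def mem_Collect_eq) simp
   then obtain \<delta> where \<delta>0: "0 < \<delta>" "\<not> (\<exists>a b. a < b \<and> a \<le> t \<and> t \<le> b \<and> b - a < \<delta> \<and> d * (b - a) < (LINT x:{a..b}|lborel. h x))"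
    by blast
   then have \<delta>: "(LINT x:{a..b}|lborel. h x) \<le> d * (b - a)" if "a < b" "a \<le> t" "t \<le> b" "b - a < \<delta>" for a b
    using that by (meson not_less)
   show ?thesis
   proof (intro exI[of _ \<delta>] conjI allI impI)
    fix a b :: real assume *: "a < b" "a \<le> t" "t \<le> b" "b - a < \<delta>"
    have "d * (b - a) \<le> (h t + e) * (b - a)" using d * by (intro mult_right_mono) auto
    with \<delta>[OF *] show "(LINT x:{a..b}|lborel. h x) \<le> (h t + e) * (b - a)" by simp
   qed (rule \<delta>0(1))
  qed
  have tQ: "t \<notin> N g c d" "t \<notin> N (\<lambda>x. - g x) c d" if "(c, d) \<in> Q" for c d
   using t that by force+
  obtain d1 where d1: "d1 > 0" "\<And>a b. a < b ==> a \<le> t ==> t \<le> b ==> b - a < d1 ==> (LINT x:{a..b}|lborel. g x) \<le> (g t + e) * (b - a)"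
   using half[OF tQ(1)] by blast
  obtain d2 where d2: "d2 > 0" "\<And>a b. a < b ==> a \<le> t ==> t \<le> b ==> b - a < d2 ==> (LINT x:{a..b}|lborel. - g x) \<le> (- g t + e) * (b - a)"
   using half[OF tQ(2)] by blast
  show "\<exists>\<delta>>0. \<forall>a b. a < b \<longrightarrow> a \<le> t \<longrightarrow> t \<le> b \<longrightarrow> b - a < \<delta> \<longrightarrow>
    \<bar>(LINT x:{a..b}|lborel. g x) - g t * (b - a)\<bar> \<le> e * (b - a)"
  proof (intro exI[of _ "min d1 d2"] conjI allI impI)
   fix a b :: real assume *: "a < b" "a \<le> t" "t \<le> b" "b - a < min d1 d2"
   have "(LINT x:{a..b}|lborel. - g x) = - (LINT x:{a..b}|lborel. g x)"
    by (simp add: set_lebesgue_integral_def)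
   then have "(LINT x:{a..b}|lborel. g x) \<le> (g t + e) * (b - a)" "- (LINT x:{a..b}|lborel. g x) \<le> (- g t + e) * (b - a)"
    using d1(2)[of a b] d2(2)[of a b] * by auto
   then show "\<bar>(LINT x:{a..b}|lborel. g x) - g t * (b - a)\<bar> \<le> e * (b - a)"
    by (simp add: abs_le_iff algebra_simps)
  qed (use d1 d2 in auto)
 qed
qed


lemma indefinite_integral_split:
 fixes m :: "real \<Rightarrow> real"
 assumes m: "integrable lborel m" and "s \<le> t"
 shows "(LINT x:{..t}|lborel. m x) - (LINT x:{..s}|lborel. m x) = (LINT x:{s..t}|lborel. m x)"
  "(LINT x:{s<..t}|lborel. m x) = (LINT x:{s..t}|lborel. m x)"
proof -
 have set: "set_integrable lborel A m" if "A \<in> sets borel" for A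
  using m that unfolding set_integrable_def by (intro integrable_mult_indicator) auto
 show eq: "(LINT x:{s<..t}|lborel. m x) = (LINT x:{s..t}|lborel. m x)"
  by (rule set_integral_discrete_difference[of "{s}"]) auto
 have "(LINT x:{..s} \<union> {s<..t}|lborel. m x) = (LINT x:{..s}|lborel. m x) + (LINT x:{s<..t}|lborel. m x)"
  by (intro set_integral_Un set) auto
 moreover have "{..s} \<union> {s<..t} = {..t}" using assms(2) by auto
 ultimately show "(LINT x:{..t}|lborel. m x) - (LINT x:{..s}|lborel. m x) = (LINT x:{s..t}|lborel. m x)"
  using eq by simp
qed

lemma integral_Icc_tendsto_0:
 fixes m :: "real \<Rightarrow> real"
 assumes m: "integrable lborel m" and "0 < e"
 obtains d where "0 < d" "\<And>s t. s \<le> t ==> t - s < d ==> (LINT x:{s..t}|lborel. m x) < e"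
proof -
 obtain d where d: "0 < d" "\<And>A. A \<in> sets lborel ==> emeasure lborel A < ennreal d ==> (LINT x:A|lborel. \<bar>m x\<bar>) < e"
  using integral_absolutely_continuous[OF m \<open>0 < e\<close>] by blast
 have set: "set_integrable lborel A m" if "A \<in> sets borel" for A
  using m that unfolding set_integrable_def by (intro integrable_mult_indicator) auto
 show ?thesis
 proof
  fix s t :: real assume "s \<le> t" "t - s < d"
  then have "(LINT x:{s..t}|lborel. \<bar>m x\<bar>) < e" by (intro d) (auto intro!: ennreal_lessI d)
  moreover have "(LINT x:{s..t}|lborel. m x) \<le> (LINT x:{s..t}|lborel. \<bar>m x\<bar>)"
   by (intro set_integral_mono set set_integrable_abs) auto
  ultimately show "(LINT x:{s..t}|lborel. m x) < e" by simp
 qed (rule d)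
qed

lemma sum_measure_exists:
 assumes "sets M = sets N"
 obtains S where "sets S = sets M" "\<And>A. A \<in> sets M ==> emeasure S A = emeasure M A + emeasure N A"
proof
 let ?S = "measure_of (space M) (sets M) (\<lambda>A. emeasure M A + emeasure N A)"
 show "sets ?S = sets M" by (simp add: sets.sigma_sets_eq)
 fix A assume A: "A \<in> sets M"
 show "emeasure ?S A = emeasure M A + emeasure N A"
 proof (rule emeasure_measure_of_sigma)
  show "sigma_algebra (space M) (sets M)" by (rule sets.sigma_algebra_axioms)
  show "positive (sets M) (\<lambda>A. emeasure M A + emeasure N A)" by (simp add: positive_def)
  show "countably_additive (sets M) (\<lambda>A. emeasure M A + emeasure N A)"
   using assms by (auto simp: countably_additive_def suminf_add[symmetric] suminf_emeasure)
 qed fact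
qed

text \<open>With M the primitive of m, both M + f and M - f are nondecreasing, and their Stieltjes
  measures add up to 2 m dx. Each is therefore absolutely continuous, and the density of the first
  minus m is the derivative of f.\<close>

lemma ac_function_density:
 fixes f m :: "real \<Rightarrow> real"
 assumes m: "integrable lborel m" "\<And>x. 0 \<le> m x"
  and f: "\<And>s t. s \<le> t ==> \<bar>f t - f s\<bar> \<le> (LINT x:{s..t}|lborel. m x)"
 obtains g where "g \<in> borel_measurable borel" "\<And>x. \<bar>g x\<bar> \<le> m x"
  "\<And>s t. s \<le> t ==> f t - f s = (LINT x:{s..t}|lborel. g x)"
proof -
 have mm[measurable]: "m \<in> borel_measurable borel" using m by auto
 have set: "set_integrable lborel A h" if "A \<in> sets borel" "integrable lborel h" for A and h :: "real \<Rightarrow> real"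
  using that unfolding set_integrable_def by (intro integrable_mult_indicator) auto
 define M where "M x = (LINT y:{..x}|lborel. m y)" for x
 have M: "M t - M s = (LINT x:{s..t}|lborel. m x)" if "s \<le> t" for s t
  unfolding M_def by (rule indefinite_integral_split[OF m(1) that])
 have inc: "emeasure (interval_measure (\<lambda>x. M x + c * f x)) {s<..t} = ennreal ((M t + c * f t) - (M s + c * f s))"
  if "\<bar>c\<bar> = 1" "s \<le> t" for c s t
 proof (rule emeasure_interval_measure_Ioc[OF that(2)])
  fix x y :: real assume "x \<le> y"
  have "\<bar>c * (f y - f x)\<bar> \<le> M y - M x" using f[OF \<open>x \<le> y\<close>] M[OF \<open>x \<le> y\<close>] that(1) by (simp add: abs_mult)
  then show "M x + c * f x \<le> M y + c * f y" by (simp add: abs_le_iff algebra_simps)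
 next
  fix a :: real
  show "continuous (at_right a) (\<lambda>x. M x + c * f x)"
   unfolding continuous_within
  proof (rule tendstoI)
   fix e :: real assume "0 < e"
   obtain d where d: "0 < d" "\<And>s t. s \<le> t ==> t - s < d ==> (LINT x:{s..t}|lborel. m x) < e / 2"
    using integral_Icc_tendsto_0[OF m(1), of "e / 2"] \<open>0 < e\<close> by auto
   show "\<forall>\<^sub>F x in at_right a. dist (M x + c * f x) (M a + c * f a) < e"
    unfolding eventually_at
   proof (intro exI[of _ d] conjI ballI impI)
    fix x assume "x \<in> {a<..}" "x \<noteq> a \<and> dist x a < d"
    then have x: "a \<le> x" "x - a < d" by (auto simp: dist_real_def)
    have "\<bar>c * (f x - f a)\<bar> \<le> M x - M a" "M x - M a < e / 2"
     using f[OF x(1)] M[OF x(1)] d(2)[OF x] that(1) by (auto simp: abs_mult)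
    then show "dist (M x + c * f x) (M a + c * f a) < e"
     unfolding dist_real_def right_diff_distrib by linarith
   qed (rule d)
  qed
 qed
 define \<nu>1 where "\<nu>1 = interval_measure (\<lambda>x. M x + 1 * f x)"
 define \<nu>2 where "\<nu>2 = interval_measure (\<lambda>x. M x + (-1) * f x)"
 have \<nu>sets: "sets \<nu>1 = sets borel" "sets \<nu>2 = sets borel" by (auto simp: \<nu>1_def \<nu>2_def)
 obtain S where S: "sets S = sets \<nu>1" "\<And>A. A \<in> sets \<nu>1 ==> emeasure S A = emeasure \<nu>1 A + emeasure \<nu>2 A"
  using sum_measure_exists[of \<nu>1 \<nu>2] \<nu>sets by auto
 define \<kappa> where "\<kappa> = density lborel (\<lambda>x. ennreal (2 * m x))"
 have \<kappa>_Ioc: "emeasure \<kappa> {s<..t} = ennreal (2 * (M t - M s))" if "s \<le> t" for s t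
 proof -
  have "emeasure \<kappa> {s<..t} = (\<integral>\<^sup>+x. ennreal (2 * (indicator {s<..t} x * m x)) \<partial>lborel)"
   unfolding \<kappa>_def by (subst emeasure_density) (auto intro!: nn_integral_cong simp: indicator_def)
  also have "\<dots> = ennreal (\<integral>x. 2 * (indicator {s<..t} x * m x) \<partial>lborel)"
   using set[of "{s<..t}" m] m by (intro nn_integral_eq_integral) (auto simp: set_integrable_def)
  also have "(\<integral>x. 2 * (indicator {s<..t} x * m x) \<partial>lborel) = 2 * (LINT x:{s<..t}|lborel. m x)"
   by (simp add: set_lebesgue_integral_def)
  finally show ?thesis using indefinite_integral_split(2)[OF m(1) that] M[OF that] by simp
 qed
 \<comment> \<open>Both measures agree on half-open intervals, where the increments of f
   cancel.\<close>
 have "S = \<kappa>"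
 proof (rule measure_eqI_generator_eq[where \<Omega>=UNIV and E="range (\<lambda>(s, t). {s<..t})" and A="\<lambda>n. {- real n<..real n}"])
  show "Int_stable (range (\<lambda>(s, t). {s<..t :: real}))"
   unfolding Int_stable_def
  proof safe
   fix a b c d :: real
   have "{a<..b} \<inter> {c<..d} = {max a c<..min b d}" by auto
   then show "{a<..b} \<inter> {c<..d} \<in> range (\<lambda>(s, t). {s<..t})" by (auto intro!: image_eqI[of _ _ "(max a c, min b d)"])
  qed
  show "emeasure S X = emeasure \<kappa> X" if "X \<in> range (\<lambda>(s, t). {s<..t})" for X
  proof -
   obtain s t where X: "X = {s<..t}" using \<open>X \<in> _\<close> by auto
   show ?thesis
   proof (cases "s \<le> t")
    case True
    have "emeasure S X = ennreal ((M t + 1 * f t) - (M s + 1 * f s)) + ennreal ((M t + (-1) * f t) - (M s + (-1) * f s))"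
     unfolding X using inc[of 1, OF _ True] inc[of "-1", OF _ True] \<nu>sets
     by (subst S(2)) (simp_all add: \<nu>1_def \<nu>2_def)
    also have "\<dots> = ennreal (2 * (M t - M s))"
     using f[OF True] M[OF True] by (subst ennreal_plus[symmetric]) (auto simp: abs_le_iff algebra_simps)
    finally show ?thesis using \<kappa>_Ioc[OF True] X by simp
   qed (simp add: X)
  qed
  have "sigma_sets UNIV (range (\<lambda>(s, t). {s<..t :: real})) = sets borel"
   by (simp add: borel_sigma_sets_Ioc)
  then show "sets S = sigma_sets UNIV (range (\<lambda>(s, t). {s<..t}))" "sets \<kappa> = sigma_sets UNIV (range (\<lambda>(s, t). {s<..t}))"
   using S(1) \<nu>sets by (auto simp: \<kappa>_def)
  have "\<exists>n. x \<in> {- real n<..real n}" for x :: real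
  proof -
   obtain n where "\<bar>x\<bar> < real n" using reals_Archimedean2 by blast
   then have "- real n < x \<and> x \<le> real n" by linarith
   then show ?thesis by auto
  qed
  then show "(\<Union>n. {- real n<..real n}) = UNIV" by blast
  show "emeasure S {- real n<..real n} \<noteq> \<infinity>" for n
   using inc[of 1 "- real n" "real n"] inc[of "-1" "- real n" "real n"] \<nu>sets
   by (subst S(2)) (auto simp add: \<nu>1_def \<nu>2_def)
 qed auto
 then have le: "emeasure \<nu>1 A \<le> emeasure \<kappa> A" if "A \<in> sets borel" for A
  using S(2)[of A] that \<nu>sets by auto
 have "absolutely_continuous lborel \<nu>1"
  unfolding absolutely_continuous_def
 proof
  fix A assume A: "A \<in> null_sets (lborel :: real measure)"
  have "absolutely_continuous lborel \<kappa>" unfolding \<kappa>_def by (rule absolutely_continuousI_density) measurable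
  then have "A \<in> null_sets \<kappa>" using A by (auto simp: absolutely_continuous_def)
  then show "A \<in> null_sets \<nu>1" using le[of A] \<nu>sets by (auto simp: null_sets_def \<kappa>_def)
 qed
 then obtain f1 where f1[measurable]: "f1 \<in> borel_measurable lborel" and f1': "density lborel f1 = \<nu>1"
  using sigma_finite_measure.Radon_Nikodym[OF sigma_finite_lborel, of \<nu>1] \<nu>sets by auto
 have "emeasure \<kappa> UNIV < \<infinity>"
  unfolding \<kappa>_def using m by (subst emeasure_density) (auto simp: nn_integral_cmult ennreal_mult integrable_iff_bounded ennreal_mult_less_top)
 then have "emeasure \<nu>1 UNIV < \<infinity>" using le[of UNIV] by (auto intro: le_less_trans)
 then have fin: "(\<integral>\<^sup>+x. f1 x \<partial>lborel) < \<infinity>" by (simp add: f1'[symmetric] emeasure_density)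
 then have ffin: "AE x in lborel. f1 x \<noteq> \<infinity>" by (intro nn_integral_PInf_AE) auto
 define g1 where "g1 x = enn2real (f1 x)" for x
 have g1m[measurable]: "g1 \<in> borel_measurable borel" unfolding g1_def[abs_def] by measurable
 have eq: "AE x in lborel. ennreal (g1 x) = f1 x"
  using ffin by eventually_elim (simp add: g1_def less_top)
 have g1i: "integrable lborel g1"
 proof (rule integrableI_nonneg)
  show "(\<integral>\<^sup>+x. ennreal (g1 x) \<partial>lborel) < \<infinity>"
   using fin nn_integral_cong_AE[OF eq] by simp
 qed (auto simp: g1_def)
 define g2 where "g2 x = g1 x - m x" for x
 have g2i: "integrable lborel g2" unfolding g2_def using g1i m by auto
 have g2: "f t - f s = (LINT x:{s..t}|lborel. g2 x)" if "s \<le> t" for s t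
 proof -
  have "ennreal (LINT x:{s<..t}|lborel. g1 x) = (\<integral>\<^sup>+x. ennreal (indicator {s<..t} x * g1 x) \<partial>lborel)"
   using set[OF _ g1i, of "{s<..t}"] unfolding set_lebesgue_integral_def set_integrable_def
   by (subst nn_integral_eq_integral) (auto simp: g1_def)
  also have "\<dots> = (\<integral>\<^sup>+x. f1 x * indicator {s<..t} x \<partial>lborel)"
  proof (rule nn_integral_cong_AE)
   show "AE x in lborel. ennreal (indicator {s<..t} x * g1 x) = f1 x * indicator {s<..t} x"
    using eq by eventually_elim (simp add: indicator_def)
  qed
  also have "\<dots> = emeasure \<nu>1 {s<..t}" by (simp add: f1'[symmetric] emeasure_density)
  also have "\<dots> = ennreal ((M t + 1 * f t) - (M s + 1 * f s))"
   using inc[of 1, OF _ that] by (simp add: \<nu>1_def)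
  finally have "(LINT x:{s<..t}|lborel. g1 x) = (M t - M s) + (f t - f s)"
   using f[OF that] M[OF that]
   by (subst (asm) ennreal_inj) (auto simp: set_lebesgue_integral_def g1_def abs_le_iff intro!: integral_nonneg_AE)
  moreover have "(LINT x:{s<..t}|lborel. g1 x) = (LINT x:{s..t}|lborel. g1 x)"
   by (rule indefinite_integral_split(2)[OF g1i that])
  moreover have "(LINT x:{s..t}|lborel. g2 x) = (LINT x:{s..t}|lborel. g1 x) - (LINT x:{s..t}|lborel. m x)"
   unfolding g2_def by (intro set_integral_diff set g1i m) auto
  ultimately show ?thesis using M[OF that] by simp
 qed
 \<comment> \<open>The bound on the increments of f passes to the densities at common Lebesgue
   points.\<close>
 have AE_le: "AE x in lborel. \<bar>g2 x\<bar> \<le> m x"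
  using lebesgue_differentiation[OF g2i] lebesgue_differentiation[OF m(1)]
 proof eventually_elim
  case (elim t)
  show "\<bar>g2 t\<bar> \<le> m t"
  proof (rule field_le_epsilon)
   fix e :: real assume "0 < e"
   obtain d1 where d1: "0 < d1" "\<And>a b. a < b ==> a \<le> t ==> t \<le> b ==> b - a < d1 ==>
     \<bar>(LINT x:{a..b}|lborel. g2 x) - g2 t * (b - a)\<bar> \<le> (e/2) * (b - a)"
    using elim(1) \<open>0 < e\<close> half_gt_zero by blast
   obtain d2 where d2: "0 < d2" "\<And>a b. a < b ==> a \<le> t ==> t \<le> b ==> b - a < d2 ==>
     \<bar>(LINT x:{a..b}|lborel. m x) - m t * (b - a)\<bar> \<le> (e/2) * (b - a)"
    using elim(2) \<open>0 < e\<close> half_gt_zero by blast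
   define h where "h = min d1 d2 / 2"
   have h: "0 < h" "h < d1" "h < d2" using d1(1) d2(1) by (auto simp: h_def)
   have "\<bar>(LINT x:{t..t+h}|lborel. g2 x) - g2 t * h\<bar> \<le> (e/2) * h"
    "\<bar>(LINT x:{t..t+h}|lborel. m x) - m t * h\<bar> \<le> (e/2) * h"
    using d1(2)[of t "t + h"] d2(2)[of t "t + h"] h by auto
   moreover have "\<bar>LINT x:{t..t+h}|lborel. g2 x\<bar> \<le> (LINT x:{t..t+h}|lborel. m x)"
    using f[of t "t + h"] g2[of t "t + h"] h by simp
   ultimately have "\<bar>g2 t * h\<bar> \<le> m t * h + e / 2 * h + e / 2 * h" by linarith
   then have "\<bar>g2 t\<bar> * h \<le> (m t + e) * h" using h by (simp add: abs_mult algebra_simps)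
   then show "\<bar>g2 t\<bar> \<le> m t + e" using h by simp
  qed
 qed
 \<comment> \<open>Redefined on a null set, so that the bound by m holds at every point.\<close>
 define g where "g x = (if \<bar>g2 x\<bar> \<le> m x then g2 x else 0)" for x
 have [measurable]: "g2 \<in> borel_measurable borel" using g2i by auto
 show ?thesis
 proof
  show gm[measurable]: "g \<in> borel_measurable borel" unfolding g_def by measurable
  show "\<bar>g x\<bar> \<le> m x" for x using m(2)[of x] by (simp add: g_def)
  fix s t :: real assume "s \<le> t"
  have "(LINT x:{s..t}|lborel. g x) = (LINT x:{s..t}|lborel. g2 x)"
  proof (rule set_lebesgue_integral_cong_AE)
   show "AE x\<in>{s..t} in lborel. g x = g2 x" using AE_le by eventually_elim (simp add: g_def)
  qed auto
  then show "f t - f s = (LINT x:{s..t}|lborel. g x)" using g2[OF \<open>s \<le> t\<close>] by simp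
 qed
qed

text \<open>The speed is the supremum of the derivatives of the distances to a
 countable dense set of points of the curve.\<close>

lemma metric_speed_exists:
 fixes D :: "real \<Rightarrow> real \<Rightarrow> real" and m :: "real \<Rightarrow> real"
 assumes m: "integrable lborel m" "\<And>x. 0 \<le> m x"
  and D: "\<And>s t. 0 \<le> D s t" "\<And>s t. D s t = D t s" "\<And>s. D s s = 0" "\<And>r s t. D r t \<le> D r s + D s t"
  and le: "\<And>s t. s \<le> t ==> D s t \<le> (LINT x:{s..t}|lborel. m x)"
 obtains w where "w \<in> borel_measurable borel" "\<And>x. 0 \<le> w x" "\<And>x. w x \<le> m x"
  "\<And>s t. s \<le> t ==> D s t \<le> (LINT x:{s..t}|lborel. w x)"
  "AE t in lborel. ((\<lambda>s. D s t / \<bar>s - t\<bar>) \<longlongrightarrow> w t) (at t)"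
proof -
 have [measurable]: "m \<in> borel_measurable borel" using m by auto
 have "\<exists>g. g \<in> borel_measurable borel \<and> (\<forall>x. \<bar>g x\<bar> \<le> m x) \<and>
  (\<forall>s t. s \<le> t \<longrightarrow> D r t - D r s = (LINT x:{s..t}|lborel. g x))" for r
 proof -
  have "\<bar>D r t - D r s\<bar> \<le> (LINT x:{s..t}|lborel. m x)" if "s \<le> t" for s t
   using D(4)[of r t s] D(4)[of r s t] D(2)[of s t] le[OF that] by linarith
  then show ?thesis
  proof (rule ac_function_density[OF m])
   fix g assume "g \<in> borel_measurable borel" "\<And>x. \<bar>g x\<bar> \<le> m x"
    "\<And>s t. s \<le> t ==> D r t - D r s = (LINT x:{s..t}|lborel. g x)"
   then show ?thesis by (intro exI[of _ g]) auto
  qed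
 qed
 then obtain G where G[measurable]: "\<And>r. G r \<in> borel_measurable borel" and Gm: "\<And>r x. \<bar>G r x\<bar> \<le> m x"
  and GD: "\<And>r s t. s \<le> t ==> D r t - D r s = (LINT x:{s..t}|lborel. G r x)" by metis
 have Gi: "integrable lborel (G r)" for r
  by (rule Bochner_Integration.integrable_bound[OF m(1)]) (use Gm order_trans[OF Gm abs_ge_self] in auto)
 have set: "set_integrable lborel A h" if "A \<in> sets borel" "integrable lborel h" for A and h :: "real \<Rightarrow> real"
  using that unfolding set_integrable_def by (intro integrable_mult_indicator) auto
 define w where "w x = (SUP r\<in>\<rat>. \<bar>G r x\<bar>)" for x
 have bdd: "bdd_above ((\<lambda>r. \<bar>G r x\<bar>) ` \<rat>)" for x using Gm by (intro bdd_aboveI2[of _ _ "m x"]) auto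
 have wm[measurable]: "w \<in> borel_measurable borel"
  unfolding w_def by (rule borel_measurable_cSUP) (auto intro: countable_rat bdd)
 have Rne: "\<rat> \<noteq> ({} :: real set)" using Rats_0 by blast
 have Gw: "\<bar>G r x\<bar> \<le> w x" if "r \<in> \<rat>" for r x
  unfolding w_def using that bdd by (intro cSUP_upper) auto
 have w0: "0 \<le> w x" for x using Gw[OF Rats_0, of x] by linarith
 have wle: "w x \<le> m x" for x unfolding w_def using Gm Rne by (intro cSUP_least) auto
 have wi: "integrable lborel w"
  by (rule Bochner_Integration.integrable_bound[OF m(1)]) (use w0 wle m(2) in auto)
 \<comment> \<open>For a rational r just to the right of s, D s t exceeds D r t - D r s by at most 2
   D s r, which is small.\<close>
 have Dw: "D s t \<le> (LINT x:{s..t}|lborel. w x)" if "s \<le> t" for s t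
 proof (rule field_le_epsilon)
  fix e :: real assume "0 < e"
  obtain d where d: "0 < d" "\<And>s t. s \<le> t ==> t - s < d ==> (LINT x:{s..t}|lborel. m x) < e / 2"
   using integral_Icc_tendsto_0[OF m(1), of "e / 2"] \<open>0 < e\<close> by auto
  obtain r where r: "r \<in> \<rat>" "s < r" "r < s + d" using Rats_dense_in_real[of s "s + d"] d(1) by auto
  have "D s r < e / 2" using le[of s r] d(2)[of s r] r by auto
  moreover have "D r t - D r s \<le> (LINT x:{s..t}|lborel. w x)"
   unfolding GD[OF that] using order_trans[OF abs_ge_self Gw[OF r(1)]] by (intro set_integral_mono set Gi wi) auto
  ultimately show "D s t \<le> (LINT x:{s..t}|lborel. w x) + e"
   using D(4)[of s t r] D(2)[of r s] by linarith
 qed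
 have "AE t in lborel. \<forall>r\<in>\<rat>. \<forall>e>0. \<exists>\<delta>>0. \<forall>a b. a < b \<longrightarrow> a \<le> t \<longrightarrow> t \<le> b \<longrightarrow> b - a < \<delta> \<longrightarrow>
  \<bar>(LINT x:{a..b}|lborel. G r x) - G r t * (b - a)\<bar> \<le> e * (b - a)"
  by (intro AE_ball_countable' lebesgue_differentiation Gi countable_rat)
 then have "AE t in lborel. ((\<lambda>s. D s t / \<bar>s - t\<bar>) \<longlongrightarrow> w t) (at t)"
  using lebesgue_differentiation[OF wi]
 proof eventually_elim
  case (elim t)
  show ?case
  proof (rule tendstoI)
   fix e :: real assume "0 < e"
   then have e2: "0 < e / 3" by simp
   obtain d1 where d1: "0 < d1" "\<And>a b. a < b ==> a \<le> t ==> t \<le> b ==> b - a < d1 ==>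
     \<bar>(LINT x:{a..b}|lborel. w x) - w t * (b - a)\<bar> \<le> (e/3) * (b - a)"
    using elim(2) e2 by blast
   have "w t - e / 3 < w t" using e2 by simp
   then obtain r where r: "r \<in> \<rat>" "w t - e / 3 < \<bar>G r t\<bar>"
    unfolding w_def using less_cSUP_iff[OF Rne bdd] by auto
   obtain d2 where d2: "0 < d2" "\<And>a b. a < b ==> a \<le> t ==> t \<le> b ==> b - a < d2 ==>
     \<bar>(LINT x:{a..b}|lborel. G r x) - G r t * (b - a)\<bar> \<le> (e/3) * (b - a)"
    using elim(1) r(1) e2 by blast
   \<comment> \<open>Above, D is bounded by the integral of w. Below, D a b dominates |D r b - D r
     a| for an r with |G r t| within e / 3 of the supremum; a second third pays for the error at the
     Lebesgue point, the last one for strictness.\<close>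
   have key: "(w t - e) * (b - a) < D a b \<and> D a b < (w t + e) * (b - a)"
    if ab: "a < b" "a \<le> t" "t \<le> b" "b - a < min d1 d2" for a b
   proof
    have e3: "e / 3 * (b - a) < e * (b - a)" "e / 3 * (b - a) + e / 3 * (b - a) < e * (b - a)"
     using ab(1) \<open>0 < e\<close> by auto
    have "D a b \<le> w t * (b - a) + e / 3 * (b - a)"
     using Dw[of a b] d1(2)[of a b] ab by linarith
    also have "\<dots> < (w t + e) * (b - a)" using e3(1) by (simp only: distrib_right add_strict_left_mono)
    finally show "D a b < (w t + e) * (b - a)" .
    have "\<bar>LINT x:{a..b}|lborel. G r x\<bar> \<le> D a b"
     using D(4)[of r b a] D(4)[of r a b] D(2)[of a b] GD[of a b r] ab(1) by linarith
    then have "\<bar>G r t\<bar> * (b - a) \<le> D a b + e / 3 * (b - a)"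
    proof -
     have "b - a < d2" using ab(4) by simp
     moreover have "\<bar>G r t * (b - a)\<bar> = \<bar>G r t\<bar> * (b - a)" using ab(1) by (simp add: abs_mult)
     ultimately show ?thesis
      using d2(2)[OF ab(1-3)] \<open>\<bar>LINT x:{a..b}|lborel. G r x\<bar> \<le> D a b\<close> by linarith
    qed
    moreover have "(w t - e / 3) * (b - a) \<le> \<bar>G r t\<bar> * (b - a)"
     using r(2) ab(1) by (intro mult_right_mono) auto
    moreover have "(w t - e) * (b - a) < (w t - e / 3) * (b - a) - e / 3 * (b - a)"
     using e3(2) unfolding left_diff_distrib by linarith
    ultimately show "(w t - e) * (b - a) < D a b" by linarith
   qed
   show "\<forall>\<^sub>F s in at t. dist (D s t / \<bar>s - t\<bar>) (w t) < e"
    unfolding eventually_at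
   proof (intro exI[of _ "min d1 d2"] conjI ballI impI)
    fix s assume s: "s \<noteq> t \<and> dist s t < min d1 d2"
    then have pos: "0 < \<bar>s - t\<bar>" by simp
    have "(w t - e) * \<bar>s - t\<bar> < D s t \<and> D s t < (w t + e) * \<bar>s - t\<bar>"
    proof (cases "s < t")
     case True
     then show ?thesis using key[of s t] s by (auto simp: dist_real_def)
    next
     case False
     then show ?thesis using key[of t s] s D(2)[of s t] by (auto simp: dist_real_def)
    qed
    then have "w t - e < D s t / \<bar>s - t\<bar>" "D s t / \<bar>s - t\<bar> < w t + e"
     using pos by (auto simp: less_divide_eq divide_less_eq)
    then show "dist (D s t / \<bar>s - t\<bar>) (w t) < e" by (simp add: dist_real_def abs_less_iff)
   qed (use d1 d2 in auto)
  qed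
 qed
 then show ?thesis using that[of w] wm w0 wle Dw by blast
qed

section \<open>Increments of continuous Sobolev functions\<close>

text \<open>For P = 1 this is the classical function exp(-1/x), smooth with all derivatives 0 at 0;
  the factor P(1/x) makes the family closed under differentiation.\<close>

definition flat :: "real poly \<Rightarrow> real \<Rightarrow> real" where
 "flat P x = (if 0 < x then poly P (1 / x) * exp (- (1 / x)) else 0)"

lemma poly_times_exp_neg_tendsto_0: "((\<lambda>y. poly P y * exp (- y)) \<longlongrightarrow> (0 :: real)) at_top"
proof -
 have "((\<lambda>y. \<Sum>i\<le>degree P. coeff P i * (y ^ i / exp y)) \<longlongrightarrow> (\<Sum>i\<le>degree P. coeff P i * 0)) at_top"
  by (intro tendsto_sum tendsto_mult tendsto_const tendsto_power_div_exp_0)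
 moreover have "poly P y * exp (- y) = (\<Sum>i\<le>degree P. coeff P i * (y ^ i / exp y))" for y
  by (simp add: poly_altdef sum_distrib_right exp_minus divide_inverse mult.assoc)
 ultimately show ?thesis by simp
qed

lemma flat_right_limit: "((\<lambda>x. flat P x) \<longlongrightarrow> 0) (at_right 0)"
proof -
 have "((\<lambda>x. poly P (inverse x) * exp (- inverse x)) \<longlongrightarrow> 0) (at_right 0)"
  by (rule filterlim_compose[OF poly_times_exp_neg_tendsto_0 filterlim_inverse_at_top_right])
 then show ?thesis
  by (rule Lim_transform_eventually) (auto simp: flat_def eventually_at_right_less inverse_eq_divide eventually_at_filter)
qed

text \<open>In y = 1/x the derivative is -y^2 d/dy, which sends P(y) exp(-y) to y^2 (P - P')(y)
  exp(-y); the two \<open>pCons 0\<close> multiply by y^2.\<close>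

lemma flat_has_derivative:
 "(flat P has_real_derivative flat (pCons 0 (pCons 0 (P - pderiv P))) x) (at x)"
proof (cases "x = 0")
 case False
 show ?thesis
 proof (cases "0 < x")
  case True
  have a: "((\<lambda>x. poly P (1 / x) * exp (- (1 / x))) has_real_derivative flat (pCons 0 (pCons 0 (P - pderiv P))) x) (at x)"
   using True
   by (auto intro!: derivative_eq_intros DERIV_chain'[where g="poly P", OF _ poly_DERIV] simp: flat_def field_simps power2_eq_square)
  have ev: "\<forall>\<^sub>F y in nhds x. poly P (1 / y) * exp (- (1 / y)) = flat P y"
   using eventually_nhds_in_open[of "{0<..}" x] True by (auto simp: flat_def elim: eventually_mono)
  show ?thesis by (rule iffD1[OF DERIV_cong_ev[OF refl ev refl] a])
 next
  case neg: False
  then have "x < 0" using False by simp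
  have a: "((\<lambda>x. 0) has_real_derivative 0) (at x)" by simp
  have ev: "\<forall>\<^sub>F y in nhds x. 0 = flat P y"
   using eventually_nhds_in_open[of "{..<0}" x] \<open>x < 0\<close> by (auto simp: flat_def elim: eventually_mono)
  have "(flat P has_real_derivative 0) (at x)" by (rule iffD1[OF DERIV_cong_ev[OF refl ev refl] a])
  then show ?thesis using neg by (simp add: flat_def)
 qed
next
 case True
 have "((\<lambda>h. flat P h / h) \<longlongrightarrow> 0) (at 0)"
 proof (rule filterlim_split_at)
  show "((\<lambda>h. flat P h / h) \<longlongrightarrow> 0) (at_left 0)"
   by (rule tendsto_eventually) (auto simp: flat_def eventually_at_filter)
  show "((\<lambda>h. flat P h / h) \<longlongrightarrow> 0) (at_right 0)"
   by (rule Lim_transform_eventually[OF flat_right_limit[of "pCons 0 P"]]) (auto simp: flat_def eventually_at_filter)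
 qed
 then show ?thesis using True by (simp add: DERIV_def flat_def)
qed

text \<open>A class closed under differentiation, so that membership yields derivatives of all
  orders without computing any.\<close>

inductive smooth_algebra :: "(real \<Rightarrow> real) \<Rightarrow> bool" where
 flat: "smooth_algebra (\<lambda>x. flat P (a * x + b))"
| const: "smooth_algebra (\<lambda>x. c)"
| add: "smooth_algebra f ==> smooth_algebra g ==> smooth_algebra (\<lambda>x. f x + g x)"
| mult: "smooth_algebra f ==> smooth_algebra g ==> smooth_algebra (\<lambda>x. f x * g x)"

lemma smooth_algebra_derivative:
 "smooth_algebra f ==> \<exists>f'. smooth_algebra f' \<and> (\<forall>x. (f has_real_derivative f' x) (at x))"
proof (induction rule: smooth_algebra.induct)
 case (flat P a b)
 let ?Q = "pCons 0 (pCons 0 (P - pderiv P))"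
 have "((\<lambda>x. flat P (a * x + b)) has_real_derivative a * flat ?Q (a * x + b)) (at x)" for x
 proof -
  have "((\<lambda>x. a * x + b) has_real_derivative a) (at x)" by (auto intro!: derivative_eq_intros)
  from DERIV_chain2[OF flat_has_derivative this] show ?thesis by (simp add: mult.commute)
 qed
 moreover have "smooth_algebra (\<lambda>x. a * flat ?Q (a * x + b))"
  by (intro smooth_algebra.mult smooth_algebra.const smooth_algebra.flat)
 ultimately show ?case by blast
next
 case (const c)
 then show ?case using smooth_algebra.const[of 0] by (intro exI[of _ "\<lambda>x. 0"]) auto
next
 case (add f g)
 then obtain f' g' where "smooth_algebra f'" "smooth_algebra g'"
  "\<And>x. (f has_real_derivative f' x) (at x)" "\<And>x. (g has_real_derivative g' x) (at x)" by blast
 then show ?case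
  by (intro exI[of _ "\<lambda>x. f' x + g' x"] conjI smooth_algebra.add allI DERIV_add)
next
 case (mult f g)
 then obtain f' g' where "smooth_algebra f'" "smooth_algebra g'"
  "\<And>x. (f has_real_derivative f' x) (at x)" "\<And>x. (g has_real_derivative g' x) (at x)" by blast
 with mult(1,2) show ?case
  by (intro exI[of _ "\<lambda>x. f' x * g x + g' x * f x"] conjI smooth_algebra.add smooth_algebra.mult allI DERIV_mult)
qed

text \<open>Only f' is required in the algebra, since the smooth step is known only as an
  antiderivative of a bump.\<close>

lemma C_k_antiderivative:
 assumes f: "\<And>x. (f has_real_derivative f' x) (at x)" and "smooth_algebra f'"
 shows "C_k n f"
 using assms
proof (induction n arbitrary: f f')
 case 0
 then show ?case by (auto intro!: continuous_at_imp_continuous_on DERIV_isCont)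
next
 case (Suc n)
 have "(f has_derivative (\<lambda>h. h * f' x)) (at x)" for x
  using Suc.prems(1)[of x] by (simp add: has_field_derivative_def mult.commute[of "f' x"] mult_commute_abs)
 then have eq: "frechet_derivative f (at x) v = v * f' x" for x v
  using frechet_derivative_at by metis
 have "C_k n (\<lambda>x. v * f' x)" for v
 proof -
  have "smooth_algebra (\<lambda>x. v * f' x)" using Suc.prems(2) by (intro smooth_algebra.mult smooth_algebra.const)
  then obtain f'' where "smooth_algebra f''" "\<And>x. ((\<lambda>x. v * f' x) has_real_derivative f'' x) (at x)"
   using smooth_algebra_derivative by blast
  then show ?thesis using Suc.IH by blast
 qed
 then show ?case unfolding C_k.simps eq using Suc.prems(1) real_differentiable_def by blast
qed

text \<open>The bump is the product of exp(-1/(1 + x)) and exp(-1/(1 - x)), cut off outside [-1, 1]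
  and divided by its integral c; the step is its primitive. Affine arguments appear in the
  conclusion because \<open>smooth_algebra\<close> has no rule for composition.\<close>

lemma smooth_step:
 obtains \<rho> \<theta> :: "real \<Rightarrow> real"
 where "\<And>a b. smooth_algebra (\<lambda>x. \<rho> (a * x + b))" "\<And>x. 0 \<le> \<rho> x" "\<And>x. 1 \<le> \<bar>x\<bar> ==> \<rho> x = 0"
  "\<And>x. (\<theta> has_real_derivative \<rho> x) (at x)" "\<And>x. 0 \<le> \<theta> x" "\<And>x. \<theta> x \<le> 1"
  "\<And>x. x \<le> -1 ==> \<theta> x = 0" "\<And>x. 1 \<le> x ==> \<theta> x = 1"
proof -
 define r where "r x = flat 1 (1 * x + 1) * flat 1 (-1 * x + 1)" for x
 have r0: "0 \<le> r x" "1 \<le> \<bar>x\<bar> ==> r x = 0" "\<bar>x\<bar> < 1 ==> 0 < r x" for x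
  by (auto simp: r_def flat_def abs_le_iff abs_less_iff)
 have rs: "smooth_algebra (\<lambda>x. r (a * x + b))" for a b
 proof -
  have "smooth_algebra (\<lambda>x. flat 1 (a * x + (b + 1)) * flat 1 ((-a) * x + (1 - b)))"
   by (intro smooth_algebra.mult smooth_algebra.flat)
  then show ?thesis by (simp add: r_def algebra_simps)
 qed
 have rc: "isCont r x" for x
 proof -
  have "smooth_algebra r" using rs[of 1 0] by simp
  then show ?thesis using smooth_algebra_derivative DERIV_isCont by blast
 qed
 obtain F where "\<And>x. (F has_vector_derivative r x) (at x)"
  using einterval_antiderivative[of "-\<infinity>" "\<infinity>" r] rc by auto
 then have F: "(F has_real_derivative r x) (at x)" for x by (simp add: has_real_derivative_iff_has_vector_derivative)
 have mvt: "\<exists>z. a < z \<and> z < b \<and> F b - F a = (b - a) * r z" if "a < b" for a b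
  by (rule MVT2[OF that]) (rule F)
 define c where "c = F 1 - F (-1)"
 have c: "0 < c"
 proof -
  obtain z where z: "-1 < z" "z < 1" "F 1 - F (-1) = (1 - (-1)) * r z" using mvt[of "-1" 1] by auto
  then have "0 < r z" by (intro r0(3)) linarith
  then show ?thesis using z(3) by (simp add: c_def)
 qed
 have mono: "F a \<le> F b" if "a \<le> b" for a b
 proof (cases "a < b")
  case True
  then obtain z where "F b - F a = (b - a) * r z" using mvt by blast
  then show ?thesis using True r0(1)[of z] mult_nonneg_nonneg[of "b - a" "r z"] by linarith
 qed (use that in simp)
 have left: "F x = F (-1)" if "x \<le> -1" for x
 proof (cases "x < -1")
  case True
  then obtain z where z: "z < -1" "F (-1) - F x = (-1 - x) * r z" using mvt by blast
  then have "r z = 0" by (intro r0(2)) linarith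
  then show ?thesis using z(2) by simp
 qed (use that in simp)
 have right: "F x = F 1" if "1 \<le> x" for x
 proof (cases "1 < x")
  case True
  then obtain z where z: "1 < z" "F x - F 1 = (x - 1) * r z" using mvt by blast
  then have "r z = 0" by (intro r0(2)) linarith
  then show ?thesis using z(2) by simp
 qed (use that in simp)
 show ?thesis
 proof (rule that[of "\<lambda>x. (1 / c) * r x" "\<lambda>x. (1 / c) * (F x - F (-1))"])
  show "smooth_algebra (\<lambda>x. (1 / c) * r (a * x + b))" for a b
   by (intro smooth_algebra.mult smooth_algebra.const rs)
  show "((\<lambda>x. (1 / c) * (F x - F (-1))) has_real_derivative (1 / c) * r x) (at x)" for x
   using F[of x] c by (auto intro!: derivative_eq_intros)
  have lo: "F (-1) \<le> F x" and hi: "F x \<le> F 1" for x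
  proof -
   show "F (-1) \<le> F x" using mono[of "-1" x] left[of x] by linarith
   show "F x \<le> F 1" using mono[of x 1] right[of x] by linarith
  qed
  show "0 \<le> (1 / c) * (F x - F (-1))" for x using lo[of x] c by simp
  show "(1 / c) * (F x - F (-1)) \<le> 1" for x using hi[of x] c by (simp add: c_def)
  show "(1 / c) * (F x - F (-1)) = 0" if "x \<le> -1" for x using left[OF that] by simp
  show "(1 / c) * (F x - F (-1)) = 1" if "1 \<le> x" for x using right[OF that] c by (simp add: c_def)
 qed (use r0 c in auto)
qed

text \<open>Test the weak derivative against a smooth approximation \<xi> of the indicator of
  [s, t]. Its derivative is a unit bump at s minus one at t, which recovers f(s) - f(t) by
  continuity, while \<xi> differs from the indicator only in two short windows, where the integral
  of |g| is small.\<close>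

lemma continuous_W11_increment:
 fixes f g :: "real \<Rightarrow> real"
 assumes cont: "continuous_on {0<..} f" and W: "W11_loc_derivative f g" and st: "0 < s" "s < t"
 shows "f t - f s = (LINT r:{s..t}|lborel. g r)"
proof -
 obtain \<rho> \<theta> :: "real \<Rightarrow> real" where
  \<rho>: "\<And>a b. smooth_algebra (\<lambda>x. \<rho> (a * x + b))" "\<And>x. 0 \<le> \<rho> x" "\<And>x. 1 \<le> \<bar>x\<bar> ==> \<rho> x = 0"
  and \<theta>: "\<And>x. (\<theta> has_real_derivative \<rho> x) (at x)" "\<And>x. 0 \<le> \<theta> x" "\<And>x. \<theta> x \<le> 1"
  "\<And>x. x \<le> -1 ==> \<theta> x = 0" "\<And>x. 1 \<le> x ==> \<theta> x = 1"
  by (rule smooth_step) blast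
 have \<rho>c: "isCont \<rho> x" for x
 proof -
  have "smooth_algebra \<rho>" using \<rho>(1)[of 1 0] by simp
  then show ?thesis using smooth_algebra_derivative DERIV_isCont by blast
 qed
 have gint: "set_integrable lborel K g" if "compact K" "K \<subseteq> {0<..}" for K
  using W that by (auto simp: W11_loc_derivative_def locally_integrable_pos_def)
 have "\<bar>(f t - f s) - (LINT r:{s..t}|lborel. g r)\<bar> \<le> 0 + \<eta>0" if "0 < \<eta>0" for \<eta>0
 proof -
  \<comment> \<open>The errors are \<eta> for the value of f at each endpoint and 2 \<eta> for the
    two windows.\<close>
  define \<eta> where "\<eta> = \<eta>0 / 4"
  have "0 < \<eta>" using that by (simp add: \<eta>_def)
  have isc: "isCont f s" "isCont f t" using cont st by (auto simp: continuous_on_eq_continuous_at)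
  obtain e1 where e1: "0 < e1" "\<And>r. \<bar>r - s\<bar> < e1 ==> \<bar>f r - f s\<bar> < \<eta>"
   using isc(1) \<open>0 < \<eta>\<close> by (auto simp: continuous_at_eps_delta dist_real_def)
  obtain e2 where e2: "0 < e2" "\<And>r. \<bar>r - t\<bar> < e2 ==> \<bar>f r - f t\<bar> < \<eta>"
   using isc(2) \<open>0 < \<eta>\<close> by (auto simp: continuous_at_eps_delta dist_real_def)
  \<comment> \<open>One compact set in the open half-line containing [s, t] and both
    windows.\<close>
  define K where "K = {s / 2..t + s}"
  have K: "compact K" "K \<subseteq> {0<..}" using st by (auto simp: K_def)
  define h where "h r = indicator K r * \<bar>g r\<bar>" for r
  have "integrable lborel (\<lambda>r. \<bar>indicator K r * g r\<bar>)"
   using gint[OF K] unfolding set_integrable_def by (intro integrable_abs) simp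
  then have hi: "integrable lborel h" by (simp add: h_def[abs_def] abs_mult)
  obtain e3 where e3: "0 < e3" "\<And>a b. a \<le> b ==> b - a < e3 ==> (LINT x:{a..b}|lborel. h x) < \<eta>"
   using integral_Icc_tendsto_0[OF hi \<open>0 < \<eta>\<close>] by blast
  \<comment> \<open>Half-width of the windows: within the moduli of continuity of f at s and t, with
    2 \<epsilon> below e3, and keeping the windows away from 0.\<close>
  define \<epsilon> where "\<epsilon> = min (min e1 e2) (min e3 s) / 4"
  have \<epsilon>: "0 < \<epsilon>" "\<epsilon> < e1" "\<epsilon> < e2" "2 * \<epsilon> < e3" "\<epsilon> < s / 2" using e1 e2 e3 st by (auto simp: \<epsilon>_def min_def)
  define k where "k = 1 / \<epsilon>"
  have k: "0 < k" "k * \<epsilon> = 1" using \<epsilon>(1) by (auto simp: k_def)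
  \<comment> \<open>The affine form matches \<open>smooth_algebra\<close>; the window about a is
    mapped onto [-1, 1].\<close>
  have arg: "k * r + (- k * a) = k * (r - a)" for r a by (simp add: algebra_simps)
  have ge: "1 \<le> k * r + (- k * a)" if "a + \<epsilon> \<le> r" for a r
   unfolding arg using mult_left_mono[of \<epsilon> "r - a" k] k that by linarith
  have lee: "k * r + (- k * a) \<le> -1" if "r \<le> a - \<epsilon>" for a r
   unfolding arg using mult_left_mono[of "r - a" "- \<epsilon>" k] k that by simp
  define A where "A a r = k * \<rho> (k * r + (- k * a))" for a r
  have A0: "A a r = 0" if "r \<notin> {a - \<epsilon>..a + \<epsilon>}" for a r
  proof -
   have "a + \<epsilon> \<le> r \<or> r \<le> a - \<epsilon>" using that by auto
   then have "1 \<le> \<bar>k * r + (- k * a)\<bar>" using ge[of a r] lee[of r a] by linarith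
   then show ?thesis by (simp add: A_def \<rho>(3))
  qed
  have Ann: "0 \<le> A a r" for a r using \<rho>(2) k by (simp add: A_def)
  have Ader: "((\<lambda>r. \<theta> (k * r + (- k * a))) has_real_derivative A a r) (at r)" for a r
  proof -
   have "((\<lambda>x. k * x + (- k * a)) has_real_derivative k) (at r)" by (auto intro!: derivative_eq_intros)
   from DERIV_chain2[OF \<theta>(1) this] show ?thesis by (simp add: A_def mult.commute)
  qed
  have Acont: "isCont (A a) r" for a r
   unfolding A_def by (intro continuous_intros isCont_o2[OF _ \<rho>c])
  have A1: "(LINT r:{a - \<epsilon>..a + \<epsilon>}|lborel. A a r) = 1" for a
  proof -
   have "(LINT r|lborel. A a r * indicator {a - \<epsilon>..a + \<epsilon>} r) =
     \<theta> (k * (a + \<epsilon>) + (- k * a)) - \<theta> (k * (a - \<epsilon>) + (- k * a))"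
    by (rule integral_FTC_Icc_real) (use \<epsilon> Ader Acont in auto)
   moreover have "k * (a + \<epsilon>) + (- k * a) = 1" "k * (a - \<epsilon>) + (- k * a) = -1"
    using k by (auto simp: algebra_simps)
   ultimately have "(LINT r|lborel. A a r * indicator {a - \<epsilon>..a + \<epsilon>} r) = 1"
    using \<theta>(4)[of "-1"] \<theta>(5)[of 1] by simp
   then show ?thesis by (simp add: set_lebesgue_integral_def mult.commute)
  qed
  have approx: "set_integrable lborel {0<..} (\<lambda>r. f r * A a r)"
   "\<bar>(LINT r:{0<..}|lborel. f r * A a r) - f a\<bar> \<le> \<eta>"
   if a: "\<epsilon> < a" and near: "\<And>r. \<bar>r - a\<bar> \<le> \<epsilon> ==> \<bar>f r - f a\<bar> < \<eta>" for a
  proof -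
   let ?I = "{a - \<epsilon>..a + \<epsilon>}"
   have sub: "?I \<subseteq> {0<..}" using a by auto
   have cI: "continuous_on ?I f" using cont sub by (rule continuous_on_subset)
   have cA: "continuous_on ?I (A a)" using Acont by (auto intro: continuous_at_imp_continuous_on)
   have i1: "set_integrable lborel ?I (\<lambda>r. f r * A a r)"
    by (intro borel_integrable_atLeastAtMost' continuous_on_mult cI cA)
   have i2: "set_integrable lborel ?I (A a)" by (intro borel_integrable_atLeastAtMost' cA)
   have eq: "indicat_real {0<..} r * (f r * A a r) = indicator ?I r * (f r * A a r)" for r
    using A0[of r a] sub by (auto simp: indicator_def)
   show "set_integrable lborel {0<..} (\<lambda>r. f r * A a r)" using i1 by (simp add: set_integrable_def eq)
   have "(LINT r:{0<..}|lborel. f r * A a r) - f a = (LINT r:?I|lborel. f r * A a r) - (LINT r:?I|lborel. f a * A a r)"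
    using A1[of a] by (simp add: set_lebesgue_integral_def eq)
   also have "\<dots> = (LINT r:?I|lborel. f r * A a r - f a * A a r)"
    using i1 i2 by (intro set_integral_diff(2)[symmetric]) auto
   also have "\<bar>\<dots>\<bar> \<le> (LINT r:?I|lborel. \<bar>f r * A a r - f a * A a r\<bar>)"
    using set_integral_norm_bound[of lborel ?I "\<lambda>r. f r * A a r - f a * A a r"] i1 i2 by (simp add: set_integral_diff)
   also have "\<dots> \<le> (LINT r:?I|lborel. \<eta> * A a r)"
   proof (rule set_integral_mono)
    show "set_integrable lborel ?I (\<lambda>r. \<bar>f r * A a r - f a * A a r\<bar>)"
     using i1 i2 by (intro set_integrable_abs set_integral_diff(1)) auto
    show "set_integrable lborel ?I (\<lambda>r. \<eta> * A a r)" using i2 by simp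
    fix r assume "r \<in> ?I"
    then have "\<bar>f r - f a\<bar> < \<eta>" by (intro near) auto
    then have "\<bar>f r - f a\<bar> * A a r \<le> \<eta> * A a r" using Ann by (intro mult_right_mono) auto
    then show "\<bar>f r * A a r - f a * A a r\<bar> \<le> \<eta> * A a r"
     using Ann[of a r] by (simp add: abs_mult flip: left_diff_distrib)
   qed
   also have "\<dots> = \<eta>" using A1[of a] by simp
   finally show "\<bar>(LINT r:{0<..}|lborel. f r * A a r) - f a\<bar> \<le> \<eta>" .
  qed
  define \<xi> where "\<xi> r = \<theta> (k * r + (- k * s)) - \<theta> (k * r + (- k * t))" for r
  have \<xi>d: "(\<xi> has_real_derivative A s r - A t r) (at r)" for r
   unfolding \<xi>_def by (intro DERIV_diff Ader)
  have \<xi>a: "smooth_algebra (\<lambda>r. A s r - A t r)"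
  proof -
   have "smooth_algebra (\<lambda>r. k * \<rho> (k * r + (- k * s)) + (- k) * \<rho> (k * r + (- k * t)))"
    by (intro smooth_algebra.add smooth_algebra.mult smooth_algebra.const \<rho>(1))
   then show ?thesis by (simp add: A_def)
  qed
  have supp: "{r. \<xi> r \<noteq> 0} \<subseteq> {s - \<epsilon>..t + \<epsilon>}"
  proof
   fix r assume r: "r \<in> {r. \<xi> r \<noteq> 0}"
   have "\<xi> r = 0" if "r < s - \<epsilon>" using that st lee[of r s] lee[of r t] by (simp add: \<xi>_def \<theta>(4))
   moreover have "\<xi> r = 0" if "t + \<epsilon> < r" using that st ge[of s r] ge[of t r] by (simp add: \<xi>_def \<theta>(5))
   ultimately show "r \<in> {s - \<epsilon>..t + \<epsilon>}" using r by force
  qed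
  have cl: "closure {r. \<xi> r \<noteq> 0} \<subseteq> {s - \<epsilon>..t + \<epsilon>}" using supp by (rule closure_minimal) simp
  have "\<xi> \<in> test_functions {0<..}"
   unfolding test_functions_def
  proof (intro CollectI conjI allI)
   show "C_k n \<xi>" for n using \<xi>d \<xi>a by (rule C_k_antiderivative)
   show "compact (closure {r. \<xi> r \<noteq> 0})"
    using cl compact_Icc[of "s - \<epsilon>" "t + \<epsilon>"] by (meson closed_closure compact_Int_closed compact_eq_bounded_closed bounded_subset)
   show "closure {r. \<xi> r \<noteq> 0} \<subseteq> {0<..}" using cl \<epsilon> st by fastforce
  qed
  then have weak: "(LINT r:{0<..}|lborel. f r * deriv \<xi> r) = - (LINT r:{0<..}|lborel. g r * \<xi> r)"
   using W by (auto simp: W11_loc_derivative_def)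
  have dx: "deriv \<xi> r = A s r - A t r" for r by (rule DERIV_imp_deriv[OF \<xi>d])
  have as: "\<bar>(LINT r:{0<..}|lborel. f r * A s r) - f s\<bar> \<le> \<eta>" "set_integrable lborel {0<..} (\<lambda>r. f r * A s r)"
   using approx[of s] \<epsilon> e1 by auto
  have at: "\<bar>(LINT r:{0<..}|lborel. f r * A t r) - f t\<bar> \<le> \<eta>" "set_integrable lborel {0<..} (\<lambda>r. f r * A t r)"
   using approx[of t] \<epsilon> e2 st by auto
  have lhs: "(LINT r:{0<..}|lborel. f r * deriv \<xi> r) = (LINT r:{0<..}|lborel. f r * A s r) - (LINT r:{0<..}|lborel. f r * A t r)"
   using as(2) at(2) by (simp add: dx right_diff_distrib set_integral_diff)
  have \<xi>c: "continuous_on UNIV \<xi>" using \<xi>d by (auto intro!: continuous_at_imp_continuous_on DERIV_isCont)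
  have [measurable]: "\<xi> \<in> borel_measurable borel" using \<xi>c by (rule borel_measurable_continuous_onI)
  have \<xi>b: "\<bar>\<xi> r\<bar> \<le> 1" for r
   using \<theta>(2,3)[of "k * r + (- k * s)"] \<theta>(2,3)[of "k * r + (- k * t)"] by (simp add: \<xi>_def abs_le_iff)
  have gK: "integrable lborel (\<lambda>r. indicator K r * g r)" using gint[OF K] by (simp add: set_integrable_def)
  have sK: "{s - \<epsilon>..t + \<epsilon>} \<subseteq> K" using \<epsilon> st by (auto simp: K_def)
  have e1g: "indicator {0<..} r * (g r * \<xi> r) = (indicator K r * g r) * \<xi> r" for r
   using supp sK K(2) by (auto simp: indicator_def)
  have e2g: "indicator {s..t} r * g r = (indicator K r * g r) * indicator {s..t} r" for r
  proof -
   have "r \<in> {s..t} ==> r \<in> K" using st by (simp add: K_def)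
   then show ?thesis by (auto simp: indicator_def)
  qed
  have i\<xi>: "integrable lborel (\<lambda>r. (indicator K r * g r) * \<xi> r)"
   by (rule Bochner_Integration.integrable_bound[OF gK])
    (use gK \<xi>b in \<open>auto simp: abs_mult intro!: mult_left_le borel_measurable_times\<close>)
  have iI: "integrable lborel (\<lambda>r. (indicator K r * g r) * indicator {s..t} r)"
   using integrable_real_mult_indicator[OF _ gK, of "{s..t}"] by simp
  have ih: "integrable lborel (\<lambda>r. indicator {a..b} r * h r)" for a b
   using integrable_real_mult_indicator[OF _ hi, of "{a..b}"] by (simp add: mult.commute)
  have diff: "(LINT r:{0<..}|lborel. g r * \<xi> r) - (LINT r:{s..t}|lborel. g r) =
    (LINT r|lborel. (indicator K r * g r) * \<xi> r - (indicator K r * g r) * indicator {s..t} r)"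
   unfolding set_lebesgue_integral_def real_scaleR_def e1g e2g
   by (rule Bochner_Integration.integral_diff[OF i\<xi> iI, symmetric])
  have "\<bar>(LINT r:{0<..}|lborel. g r * \<xi> r) - (LINT r:{s..t}|lborel. g r)\<bar> \<le> (LINT r|lborel. \<bar>(indicator K r * g r) * \<xi> r - (indicator K r * g r) * indicator {s..t} r\<bar>)"
   unfolding diff real_norm_def[symmetric] by (rule integral_norm_bound)
  also have "\<dots> \<le> (LINT r|lborel. indicator {s - \<epsilon>..s + \<epsilon>} r * h r + indicator {t - \<epsilon>..t + \<epsilon>} r * h r)"
  proof (rule integral_mono)
   show "integrable lborel (\<lambda>r. \<bar>(indicator K r * g r) * \<xi> r - (indicator K r * g r) * indicator {s..t} r\<bar>)"
    by (intro integrable_abs Bochner_Integration.integrable_diff i\<xi> iI)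
   show "integrable lborel (\<lambda>r. indicator {s - \<epsilon>..s + \<epsilon>} r * h r + indicator {t - \<epsilon>..t + \<epsilon>} r * h r)"
    by (intro Bochner_Integration.integrable_add ih)
   fix r
   have c: "\<bar>\<xi> r - indicator {s..t} r\<bar> \<le> indicator {s - \<epsilon>..s + \<epsilon>} r + indicator {t - \<epsilon>..t + \<epsilon>} r"
   proof (cases "r \<in> {s - \<epsilon>..s + \<epsilon>} \<or> r \<in> {t - \<epsilon>..t + \<epsilon>}")
    case True
    have "\<theta> (k * r + (- k * t)) \<le> \<theta> (k * r + (- k * s))"
    proof (rule DERIV_nonneg_imp_nondecreasing[where f=\<theta>])
     show "k * r + (- k * t) \<le> k * r + (- k * s)" using k st by simp
    qed (use \<theta>(1) \<rho>(2) in blast)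
    then have "0 \<le> \<xi> r" by (simp add: \<xi>_def)
    then have "\<bar>\<xi> r - indicator {s..t} r\<bar> \<le> 1" using \<xi>b[of r] by (auto simp: indicator_def abs_le_iff)
    then show ?thesis using True by (auto simp: indicator_def)
   next
    case False
    then consider "r < s - \<epsilon>" | "s + \<epsilon> < r" "r < t - \<epsilon>" | "t + \<epsilon> < r" by fastforce
    then have "\<xi> r = indicator {s..t} r"
    proof cases
     case 1
     then show ?thesis using supp \<epsilon> st by (auto simp: indicator_def)
    next
     case 2
     then show ?thesis using ge[of s r] lee[of r t] \<epsilon> by (simp add: \<xi>_def \<theta>(4,5) indicator_def)
    next
     case 3
     then show ?thesis using supp \<epsilon> st by (auto simp: indicator_def)
    qed
    then show ?thesis by simp
   qed
   have "\<bar>(indicator K r * g r) * \<xi> r - (indicator K r * g r) * indicator {s..t} r\<bar> = h r * \<bar>\<xi> r - indicator {s..t} r\<bar>"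
    by (simp add: h_def abs_mult flip: right_diff_distrib)
   also have "\<dots> \<le> h r * (indicator {s - \<epsilon>..s + \<epsilon>} r + indicator {t - \<epsilon>..t + \<epsilon>} r)"
    using c by (intro mult_left_mono) (auto simp: h_def)
   finally show "\<bar>(indicator K r * g r) * \<xi> r - (indicator K r * g r) * indicator {s..t} r\<bar> \<le>
     indicator {s - \<epsilon>..s + \<epsilon>} r * h r + indicator {t - \<epsilon>..t + \<epsilon>} r * h r"
    by (simp add: algebra_simps)
  qed
  also have "\<dots> = (LINT r:{s - \<epsilon>..s + \<epsilon>}|lborel. h r) + (LINT r:{t - \<epsilon>..t + \<epsilon>}|lborel. h r)"
   using ih by (simp add: set_lebesgue_integral_def)
  also have "\<dots> \<le> 2 * \<eta>"
   using e3(2)[of "s - \<epsilon>" "s + \<epsilon>"] e3(2)[of "t - \<epsilon>" "t + \<epsilon>"] \<epsilon> by simp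
  finally show ?thesis
   using as(1) at(1) weak unfolding lhs \<eta>_def by linarith
 qed
 then have "\<bar>(f t - f s) - (LINT r:{s..t}|lborel. g r)\<bar> \<le> 0" by (rule field_le_epsilon)
 then show ?thesis by simp
qed

section \<open>First-order expansion of the transport cost\<close>

context conjugate_exponents
begin

text \<open>Young's inequality for y and x^(p-1), the q-th power of the latter being x^p.\<close>

lemma powr_tangent:
 assumes "0 \<le> x" "0 \<le> y"
 shows "x powr p + p * (x powr (p - 1) * (y - x)) \<le> y powr p"
proof -
 have "y * x powr (p - 1) \<le> y powr p / p + (x powr (p - 1)) powr q / q"
  using assms by (intro young) auto
 also have "(x powr (p - 1)) powr q = x powr p" using p_minus_1_times_q by (simp add: powr_powr)
 finally have "p * (y * x powr (p - 1)) \<le> p * (y powr p / p + x powr p / q)"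
  using p_pos by (intro mult_left_mono) auto
 also have "\<dots> = y powr p + (p * (1 / q)) * x powr p" using p_pos by (simp add: distrib_left)
 also have "p * (1 / q) = p - 1" using inverse_q p_pos by simp
 finally have 1: "p * (y * x powr (p - 1)) \<le> y powr p + (p - 1) * x powr p" .
 have eq: "x powr (p - 1) * x = x powr p"
  using assms(1) by (cases "x = 0") (auto simp: powr_diff)
 have "p * (x powr (p - 1) * (y - x)) = p * (y * x powr (p - 1)) - p * x powr p"
  unfolding right_diff_distrib eq by (simp add: mult.commute)
 with 1 show ?thesis unfolding left_diff_distrib by linarith
qed

text \<open>\<open>duality_map p\<close> is the gradient of |.|^p / p, and this is its tangent
  inequality.\<close>

lemma norm_powr_tangent:
 fixes a b :: "'a::euclidean_space"
 shows "norm a powr p + p * (duality_map p a \<bullet> (b - a)) \<le> norm b powr p"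
proof -
 have "duality_map p a \<bullet> b \<le> norm a powr (p - 1) * norm b"
  using norm_cauchy_schwarz[of "duality_map p a" b] by (simp add: norm_duality_map)
 moreover have "norm a powr (p - 1) * norm a = norm a powr p"
  by (cases "a = 0") (auto simp: powr_diff)
 ultimately have "duality_map p a \<bullet> (b - a) \<le> norm a powr (p - 1) * (norm b - norm a)"
  using inner_duality_map[of a p] by (simp add: inner_diff_right right_diff_distrib inner_commute)
 then have "p * (duality_map p a \<bullet> (b - a)) \<le> p * (norm a powr (p - 1) * (norm b - norm a))"
  using p_pos by (intro mult_left_mono) auto
 then show ?thesis using powr_tangent[of "norm a" "norm b"] by simp
qed

lemma duality_map_scaleR: "0 < c ==> duality_map p (c *\<^sub>R v) = (c powr (p - 1)) *\<^sub>R duality_map p v"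
proof -
 assume "0 < c"
 have "c powr (p - 2) * c = c powr (p - 1)" using powr_add[of c "p - 2" 1] \<open>0 < c\<close> by simp
 then show ?thesis using \<open>0 < c\<close> by (simp add: duality_map_def powr_mult mult_ac)
qed

lemma duality_map_continuous: "continuous_on UNIV (duality_map p :: 'a::euclidean_space \<Rightarrow> 'a)"
proof (rule continuous_at_imp_continuous_on, intro ballI)
 fix v :: 'a
 show "isCont (duality_map p) v"
 proof (cases "v = 0")
  case True
  have "((\<lambda>x::'a. norm x powr (p - 1)) \<longlongrightarrow> norm (0::'a) powr (p - 1)) (at 0)"
   using p_gt_1 by (intro tendsto_powr' tendsto_intros) auto
  then have "((\<lambda>x::'a. norm (duality_map p x)) \<longlongrightarrow> 0) (at 0)"
   using p_gt_1 by (simp add: norm_duality_map)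
  then have "(duality_map p \<longlongrightarrow> (0::'a)) (at 0)" by (rule tendsto_norm_zero_cancel)
  then show ?thesis using True by (simp add: isCont_def duality_map_def)
 next
  case False
  have "isCont (\<lambda>v. (norm v powr (p - 2)) *\<^sub>R v) v" using False by (intro continuous_intros) auto
  moreover have "\<forall>\<^sub>F x in nhds v. duality_map p x = (norm x powr (p - 2)) *\<^sub>R x"
   using t1_space_nhds[OF False] by eventually_elim (simp add: duality_map_def)
  ultimately show ?thesis by (simp cong: isCont_cong)
 qed
qed

text \<open>A continuity modulus with the right homogeneity in a. If |h| < \<kappa> |a|, scaling
  reduces to |a| = 1 and uniform continuity on a ball; otherwise |a| \<le> |h| / \<kappa> and both
  values are bounded by a multiple of |h|^(p-1). After pairing with h the first term is linear in h
  with small factor, the second of order |h|^p.\<close>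

lemma duality_map_increment:
 assumes "0 < \<eta>"
 obtains C where "0 \<le> C"
  "\<And>a h :: 'a::euclidean_space. norm (duality_map p (a + h) - duality_map p a) \<le> \<eta> * norm a powr (p - 1) + C * norm h powr (p - 1)"
proof -
 have "uniformly_continuous_on (cball 0 2) (duality_map p :: 'a \<Rightarrow> 'a)"
  by (intro compact_uniformly_continuous continuous_on_subset[OF duality_map_continuous]) auto
 then obtain \<kappa>0 where \<kappa>0: "0 < \<kappa>0" "\<And>u v :: 'a. u \<in> cball 0 2 ==> v \<in> cball 0 2 ==> dist v u < \<kappa>0 ==> dist (duality_map p v) (duality_map p u) < \<eta>"
  unfolding uniformly_continuous_on_def using assms by metis
 define \<kappa> where "\<kappa> = min \<kappa>0 1"
 have \<kappa>: "0 < \<kappa>" "\<kappa> \<le> \<kappa>0" "\<kappa> \<le> 1" using \<kappa>0(1) by (auto simp: \<kappa>_def)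
 define C where "C = 2 * (1 / \<kappa> + 1) powr (p - 1)"
 show ?thesis
 proof
  show "0 \<le> C" by (simp add: C_def)
  fix a h :: 'a
  show "norm (duality_map p (a + h) - duality_map p a) \<le> \<eta> * norm a powr (p - 1) + C * norm h powr (p - 1)"
  proof (cases "norm h < \<kappa> * norm a")
   case True
   then have a: "0 < norm a" using \<kappa>(1) by (metis norm_ge_zero mult_zero_right not_less order_le_less)
   define e where "e = (1 / norm a) *\<^sub>R a"
   define k where "k = (1 / norm a) *\<^sub>R h"
   have ek: "a = norm a *\<^sub>R e" "a + h = norm a *\<^sub>R (e + k)" using a by (auto simp: e_def k_def scaleR_add_right)
   have e1: "norm e = 1" using a by (simp add: e_def)
   have k1: "norm k < \<kappa>" using True a by (simp add: k_def field_simps)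
   have "norm (e + k) \<le> 2" using norm_triangle_ineq[of e k] e1 k1 \<kappa>(3) by simp
   then have "e \<in> cball 0 2" "e + k \<in> cball 0 2" using e1 by auto
   then have lt: "norm (duality_map p (e + k) - duality_map p e) < \<eta>"
    using \<kappa>0(2)[of e "e + k"] k1 \<kappa>(2) by (simp add: dist_norm)
   have "duality_map p (a + h) - duality_map p a = (norm a powr (p - 1)) *\<^sub>R (duality_map p (e + k) - duality_map p e)"
    using duality_map_scaleR[OF a, of e] duality_map_scaleR[OF a, of "e + k"] ek by (metis scaleR_diff_right)
   then have "norm (duality_map p (a + h) - duality_map p a) = norm a powr (p - 1) * norm (duality_map p (e + k) - duality_map p e)"
    by simp
   also have "\<dots> \<le> norm a powr (p - 1) * \<eta>" using lt by (intro mult_left_mono) auto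
   finally show ?thesis using \<open>0 \<le> C\<close> by (simp add: mult.commute add_increasing2)
  next
   case False
   then have le: "norm a \<le> (1 / \<kappa>) * norm h" using \<kappa>(1) by (simp add: field_simps)
   have "norm (duality_map p (a + h) - duality_map p a) \<le> norm (a + h) powr (p - 1) + norm a powr (p - 1)"
    using norm_triangle_ineq4[of "duality_map p (a + h)" "duality_map p a"] by (simp add: norm_duality_map)
   also have "norm (a + h) powr (p - 1) \<le> ((1 / \<kappa> + 1) * norm h) powr (p - 1)"
    using p_gt_1 norm_triangle_ineq[of a h] le by (intro powr_mono2) (auto simp: distrib_right)
   also have "norm a powr (p - 1) \<le> ((1 / \<kappa> + 1) * norm h) powr (p - 1)"
    using p_gt_1 le by (intro powr_mono2) (auto simp: distrib_right intro: add_increasing2)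
   also have "((1 / \<kappa> + 1) * norm h) powr (p - 1) + ((1 / \<kappa> + 1) * norm h) powr (p - 1) = C * norm h powr (p - 1)"
    using \<kappa>(1) by (simp add: C_def powr_mult)
   finally show ?thesis using assms by (simp add: add_increasing)
  qed
 qed
qed

end

text \<open>Telescoping by translation: the integral over [a, b] of G(s) - G(s + h) is that of G
  over [a, a + h] minus that over [b, b + h], hence at most h (G(a) - G(b + h)). This replaces
  differentiating the monotone function G.\<close>

lemma antitone_shift_integral:
 fixes G v :: "real \<Rightarrow> real"
 assumes G: "antimono G" and h: "0 < h" and [measurable]: "v \<in> borel_measurable borel" and v: "\<And>s. 0 \<le> v s"
  and le: "\<And>s. a \<le> s ==> s \<le> b ==> h * v s \<le> G s - G (s + h)" and ab: "a \<le> b"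
 shows "(\<integral>\<^sup>+s\<in>{a..b}. ennreal (v s) \<partial>lborel) \<le> ennreal (G a - G (b + h))"
proof -
 have "(\<lambda>x. - G x) \<in> borel_measurable borel"
  using G by (intro borel_measurable_mono) (auto simp: mono_def antimono_def)
 then have Gm[measurable]: "G \<in> borel_measurable borel" by simp
 define G1 where "G1 s = G s - G (b + h)" for s
 have [measurable]: "G1 \<in> borel_measurable borel" by (simp add: G1_def[abs_def])
 have G1a: "G1 s \<le> G1 a" if "a \<le> s" for s using G that by (simp add: G1_def antimono_def)
 have G10: "0 \<le> G1 s" if "s \<le> b + h" for s using G that by (simp add: G1_def antimono_def)
 have bnd: "integrable lborel (\<lambda>s. indicator {c..d} s * G1 s)" if "a \<le> c" "d \<le> b + h" for c d
 proof (rule Bochner_Integration.integrable_bound)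
  show "integrable lborel (\<lambda>s. indicator {c..d} s * G1 a)" by (cases "c \<le> d") (auto intro!: integrable_real_mult_indicator)
  show "AE s in lborel. norm (indicator {c..d} s * G1 s) \<le> norm (indicator {c..d} s * G1 a)"
   using G1a G10 that by (intro AE_I2) (auto simp: indicator_def)
 qed measurable
 have sh: "integrable lborel (\<lambda>s. indicator {a..b} s * G1 (s + h))"
  "(LINT s|lborel. indicator {a..b} s * G1 (s + h)) = (LINT s|lborel. indicator {a + h..b + h} s * G1 s)"
 proof -
  have eq: "indicator {a + h..b + h} (h + 1 * s) * G1 (h + 1 * s) = indicator {a..b} s * G1 (s + h)" for s
   by (auto simp: indicator_def add.commute)
  show "integrable lborel (\<lambda>s. indicator {a..b} s * G1 (s + h))"
   using lborel_integrable_real_affine[OF bnd[of "a + h" "b + h"], of 1 h] h by (simp only: eq)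
  show "(LINT s|lborel. indicator {a..b} s * G1 (s + h)) = (LINT s|lborel. indicator {a + h..b + h} s * G1 s)"
   using lborel_integral_real_affine[of 1 "\<lambda>s. indicator {a + h..b + h} s * G1 s" h] unfolding eq by simp
 qed
 have i1: "integrable lborel (\<lambda>s. indicator {a..b} s * G1 s)" using bnd[of a b] h by simp
 have vi: "integrable lborel (\<lambda>s. indicator {a..b} s * (h * v s))"
 proof (rule Bochner_Integration.integrable_bound)
  show "integrable lborel (\<lambda>s. indicator {a..b} s * G1 s - indicator {a..b} s * G1 (s + h))" using i1 sh(1) by simp
  show "AE s in lborel. norm (indicator {a..b} s * (h * v s)) \<le> norm (indicator {a..b} s * G1 s - indicator {a..b} s * G1 (s + h))"
   using le v h by (intro AE_I2) (auto simp: indicator_def G1_def intro!: order_trans[OF le abs_ge_self])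
 qed measurable
 have "h * (LINT s|lborel. indicator {a..b} s * v s) = (LINT s|lborel. indicator {a..b} s * (h * v s))"
  by (simp add: mult.left_commute)
 also have "\<dots> \<le> (LINT s|lborel. indicator {a..b} s * G1 s - indicator {a..b} s * G1 (s + h))"
  using le by (intro integral_mono vi Bochner_Integration.integrable_diff i1 sh) (auto simp: indicator_def G1_def)
 also have "\<dots> = (LINT s|lborel. indicator {a..b} s * G1 s - indicator {a + h..b + h} s * G1 s)"
  using i1 sh bnd[of "a + h" "b + h"] h by simp
 also have "\<dots> \<le> (LINT s|lborel. indicator {a..a + h} s * G1 a)"
 proof (rule integral_mono)
  show "integrable lborel (\<lambda>s. indicator {a..b} s * G1 s - indicator {a + h..b + h} s * G1 s)"
   using i1 bnd[of "a + h" "b + h"] h by simp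
  show "integrable lborel (\<lambda>s. indicator {a..a + h} s * G1 a)" using h by (auto intro!: integrable_real_mult_indicator)
  show "indicator {a..b} s * G1 s - indicator {a + h..b + h} s * G1 s \<le> indicator {a..a + h} s * G1 a" for s
   using G1a[of s] G10[of s] G1a[of a] G10[of a] h ab by (auto simp: indicator_def)
 qed
 also have "\<dots> = h * G1 a" using h by simp
 finally have fin: "(LINT s|lborel. indicator {a..b} s * v s) \<le> G1 a" using h by simp
 have "integrable lborel (\<lambda>s. h * (indicator {a..b} s * v s))" using vi by (simp add: mult.left_commute)
 then have vi': "integrable lborel (\<lambda>s. indicator {a..b} s * v s)" 
  using integrable_mult_right[of "1 / h" lborel "\<lambda>s. h * (indicator {a..b} s * v s)"] h by simp
 have "(\<integral>\<^sup>+s\<in>{a..b}. ennreal (v s) \<partial>lborel) = (\<integral>\<^sup>+s. ennreal (indicator {a..b} s * v s) \<partial>lborel)"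
  by (intro nn_integral_cong) (auto simp: indicator_def)
 also have "\<dots> = ennreal (LINT s|lborel. indicator {a..b} s * v s)"
  by (rule nn_integral_eq_integral[OF vi']) (use v in auto)
 also have "\<dots> \<le> ennreal (G1 a)" using fin by (rule ennreal_leI)
 finally show ?thesis by (simp add: G1_def)
qed

text \<open>The derivative is continuous and vanishes off the compact support, hence is bounded. The
  Lipschitz bound later moves a test function from one marginal of a plan to the other.\<close>

lemma test_function_lipschitz:
 fixes \<xi> :: "'a::euclidean_space \<Rightarrow> real"
 assumes "\<xi> \<in> test_functions UNIV"
 obtains L M where "0 \<le> L" "\<And>x y. \<bar>\<xi> x - \<xi> y\<bar> \<le> L * norm (x - y)" "\<And>x. \<bar>\<xi> x\<bar> \<le> M" "\<xi> \<in> borel_measurable borel"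
proof -
 define K where "K = closure {x. \<xi> x \<noteq> 0}"
 have K: "compact K" and "C_k (Suc 0) \<xi>" using assms unfolding test_functions_def K_def by blast+
 then have d: "\<And>x. \<xi> differentiable (at x)" and c: "\<And>v. continuous_on UNIV (\<lambda>x. frechet_derivative \<xi> (at x) v)" by auto
 have hd: "(\<xi> has_derivative frechet_derivative \<xi> (at x)) (at x)" for x
  using d frechet_derivative_works by blast
 have cont: "continuous_on UNIV \<xi>" using hd by (auto intro!: continuous_at_imp_continuous_on has_derivative_continuous)
 have out: "frechet_derivative \<xi> (at x) v = 0" if "x \<notin> K" for x v
 proof -
  have "open (- K)" by (simp add: K_def open_Compl)
  then have "\<forall>\<^sub>F y in nhds x. y \<in> - K" using that by (intro eventually_nhds_in_open) auto
  then have "\<forall>\<^sub>F y in nhds x. \<xi> y = 0"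
   by eventually_elim (use closure_subset[of "{x. \<xi> x \<noteq> 0}"] in \<open>auto simp: K_def\<close>)
  then have "((\<lambda>y. 0) has_derivative frechet_derivative \<xi> (at x)) (at x)"
   using hd[of x] has_derivative_transform_eventually[of \<xi> "frechet_derivative \<xi> (at x)" x UNIV "\<lambda>y. 0"]
   by (simp add: eventually_nhds_conv_at)
  then have "frechet_derivative \<xi> (at x) = (\<lambda>v. 0)" by (rule has_derivative_unique) simp
  then show ?thesis by simp
 qed
 have "\<exists>m. \<forall>x. \<bar>frechet_derivative \<xi> (at x) b\<bar> \<le> m" for b
 proof -
  have "bounded ((\<lambda>x. frechet_derivative \<xi> (at x) b) ` K)"
   by (intro compact_imp_bounded compact_continuous_image K continuous_on_subset[OF c]) auto
  then obtain m where m: "\<And>x. x \<in> K ==> \<bar>frechet_derivative \<xi> (at x) b\<bar> \<le> m" by (auto simp: bounded_iff)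
  have "\<bar>frechet_derivative \<xi> (at x) b\<bar> \<le> max m 0" for x using m[of x] out[of x b] by (cases "x \<in> K") auto
  then show ?thesis by blast
 qed
 then obtain m where m: "\<And>b x. \<bar>frechet_derivative \<xi> (at x) b\<bar> \<le> m b" by metis
 define L where "L = (\<Sum>b\<in>Basis. m b)"
 have m0: "0 \<le> m b" for b using m[of undefined b] by linarith
 have on: "onorm (frechet_derivative \<xi> (at x)) \<le> L" for x
 proof (rule onorm_bound)
  show "0 \<le> L" using m0 by (simp add: L_def sum_nonneg)
  fix v :: 'a
  interpret bounded_linear "frechet_derivative \<xi> (at x)" using hd by (rule has_derivative_bounded_linear)
  have "frechet_derivative \<xi> (at x) v = frechet_derivative \<xi> (at x) (\<Sum>b\<in>Basis. (v \<bullet> b) *\<^sub>R b)"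
   by (simp add: euclidean_representation)
  also have "\<dots> = (\<Sum>b\<in>Basis. (v \<bullet> b) * frechet_derivative \<xi> (at x) b)" by (simp add: sum scaleR)
  also have "norm \<dots> \<le> (\<Sum>b\<in>Basis. norm v * m b)"
   using m m0 Basis_le_norm by (intro order_trans[OF norm_sum] sum_mono) (auto simp: abs_mult intro!: mult_mono)
  also have "\<dots> = L * norm v" by (simp add: L_def mult.commute flip: sum_distrib_left)
  finally show "norm (frechet_derivative \<xi> (at x) v) \<le> L * norm v" .
 qed
 have lip: "\<bar>\<xi> x - \<xi> y\<bar> \<le> L * norm (x - y)" for x y
  using differentiable_bound[of UNIV \<xi> "\<lambda>x. frechet_derivative \<xi> (at x)" L x y] hd on by simp
 have "bounded (\<xi> ` K)" by (intro compact_imp_bounded compact_continuous_image K continuous_on_subset[OF cont]) auto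
 then obtain M where M: "\<And>x. x \<in> K ==> \<bar>\<xi> x\<bar> \<le> M" by (auto simp: bounded_iff)
 have "\<bar>\<xi> x\<bar> \<le> max M 0" for x
 proof (cases "x \<in> K")
  case False
  then have "\<xi> x = 0" using closure_subset[of "{x. \<xi> x \<noteq> 0}"] unfolding K_def by blast
  then show ?thesis by simp
 qed (use M[of x] in auto)
 then show ?thesis
  using that[of L "max M 0"] lip m0 borel_measurable_continuous_onI[OF cont] by (auto simp: L_def sum_nonneg)
qed


section \<open>Minimizers of the penalized functional\<close>

locale minimizing_movements = conjugate_exponents p q for p q :: real +
 fixes \<phi> :: "'a::euclidean_space measure \<Rightarrow> ereal" and A B :: real and \<mu>star :: "'a measure"
 assumes proper: "\<mu> \<in> wasserstein_space p ==> \<phi> \<mu> \<noteq> -\<infinity>"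
  and AB: "A > 0" "B > 0" and star: "\<mu>star \<in> wasserstein_space p"
  and below: "\<mu> \<in> wasserstein_space p ==> ereal (- A - B * wasserstein p \<mu> \<mu>star powr p) \<le> \<phi> \<mu>"
  and lsc: "(\<And>n. m n \<in> wasserstein_space p) ==> \<mu> \<in> wasserstein_space p ==>
   (\<lambda>n. wasserstein p (m n) \<mu>) \<longlonglongrightarrow> 0 ==> \<phi> \<mu> \<le> liminf (\<lambda>n. \<phi> (m n))"
  and compactness: "(\<And>n. m n \<in> wasserstein_space p) ==> (SUP n. \<phi> (m n)) < \<infinity> ==>
   (SUP n. ereal (wasserstein p (m n) \<mu>star)) < \<infinity> ==>
   \<exists>(k :: nat \<Rightarrow> nat) \<mu>. strict_mono k \<and> \<mu> \<in> wasserstein_space p \<and> (\<lambda>n. wasserstein p (m (k n)) \<mu>) \<longlonglongrightarrow> 0"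
begin

abbreviation "P \<equiv> wasserstein_space p :: 'a measure set"
abbreviation "W \<equiv> wasserstein p :: 'a measure \<Rightarrow> 'a measure \<Rightarrow> real"

lemmas W_nonneg = wasserstein_nonneg[OF p_gt_1]
lemmas W_commute = wasserstein_commute[OF p_gt_1]
lemmas W_self = wasserstein_self[OF p_gt_1]
lemmas W_triangle = wasserstein_triangle[OF p_gt_1]

definition "energy \<mu> = real_of_ereal (\<phi> \<mu>)"
definition "fdom = {\<mu> \<in> P. \<phi> \<mu> < \<infinity>}"
definition "pen \<sigma> = 1 / (p * \<sigma> powr (p - 1))"

lemma fdomD: "\<mu> \<in> fdom ==> \<mu> \<in> P" "\<mu> \<in> fdom ==> \<phi> \<mu> = ereal (energy \<mu>)"
 using proper[of \<mu>] by (cases "\<phi> \<mu>"; auto simp: fdom_def energy_def)+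

lemma fdomI: "\<mu> \<in> P ==> \<phi> \<mu> \<le> ereal c ==> \<mu> \<in> fdom"
 using le_less_trans[of "\<phi> \<mu>" "ereal c" \<infinity>] by (simp add: fdom_def)

lemma fdomI_le: "\<mu> \<in> P ==> \<phi> \<mu> \<le> ereal c ==> energy \<mu> \<le> c"
 using fdomI fdomD by fastforce

lemma lsc_bound:
 assumes "\<And>n. m n \<in> P" "\<mu> \<in> P" "(\<lambda>n. W (m n) \<mu>) \<longlonglongrightarrow> 0" "\<And>n. \<phi> (m n) \<le> ereal (c n)" "c \<longlonglongrightarrow> l"
 shows "\<mu> \<in> fdom" "energy \<mu> \<le> l"
proof -
 have "\<phi> \<mu> \<le> liminf (\<lambda>n. \<phi> (m n))" using assms by (intro lsc)
 also have "\<dots> \<le> liminf (\<lambda>n. ereal (c n))" using assms by (intro Liminf_mono) auto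
 also have "\<dots> = ereal l" using assms(5) by (intro lim_imp_Liminf) auto
 finally have "\<phi> \<mu> \<le> ereal l" .
 then show "\<mu> \<in> fdom" "energy \<mu> \<le> l" using assms(2) fdomI fdomI_le by auto
qed

text \<open>Lower semicontinuity along constant sequences; it takes the place of the identity of
  measures at distance 0.\<close>

lemma phi_cong:
 assumes "\<mu> \<in> P" "\<nu> \<in> P" "W \<mu> \<nu> = 0"
 shows "\<phi> \<mu> = \<phi> \<nu>"
proof -
 have "\<phi> \<mu> \<le> liminf (\<lambda>n::nat. \<phi> \<nu>)" using assms by (intro lsc) (auto simp: W_commute[of \<nu> \<mu>])
 moreover have "\<phi> \<nu> \<le> liminf (\<lambda>n::nat. \<phi> \<mu>)" using assms by (intro lsc) auto
 ultimately show ?thesis by (simp add: Liminf_const)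
qed

lemma W_diff: "\<mu> \<in> P ==> \<nu> \<in> P ==> \<omega> \<in> P ==> \<bar>W \<mu> \<omega> - W \<nu> \<omega>\<bar> \<le> W \<mu> \<nu>"
 using W_triangle[of \<mu> \<nu> \<omega>] W_triangle[of \<nu> \<mu> \<omega>] W_commute[of \<mu> \<nu>] by linarith

lemma W_tendsto:
 assumes "\<And>n. m n \<in> P" "\<mu> \<in> P" "\<omega> \<in> P" "(\<lambda>n. W (m n) \<mu>) \<longlonglongrightarrow> 0"
 shows "(\<lambda>n. W (m n) \<omega>) \<longlonglongrightarrow> W \<mu> \<omega>"
 unfolding tendsto_dist_iff[of _ "W \<mu> \<omega>"]
 by (rule tendsto_sandwich[OF _ _ tendsto_const assms(4)])
  (use W_diff[OF assms(1,2,3)] in \<open>auto simp: dist_real_def\<close>)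

text \<open>\<open>base\<close> and \<open>slack\<close> are the constants of the growth bound
  recentred from \<open>\<mu>star\<close> at another measure, see \<open>energy_below\<close>;
  2^(p-1) comes from (a + b)^p \<le> 2^(p-1) (a^p + b^p).\<close>

definition "base \<mu> = A + B * 2 powr (p - 1) * W \<mu> \<mu>star powr p"
definition "slack = B * 2 powr (p - 1)"

lemma slack_pos: "0 < slack"
 using AB by (auto simp: base_def slack_def intro: add_pos_nonneg)

lemma energy_below:
 assumes "\<mu> \<in> P" "\<nu> \<in> fdom"
 shows "- base \<mu> - slack * W \<nu> \<mu> powr p \<le> energy \<nu>"
proof -
 have \<nu>: "\<nu> \<in> P" "\<phi> \<nu> = ereal (energy \<nu>)" using fdomD[OF assms(2)] by auto
 have "W \<nu> \<mu>star powr p \<le> (W \<nu> \<mu> + W \<mu> \<mu>star) powr p"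
  using p_pos W_nonneg W_triangle[OF \<nu>(1) assms(1) star] by (intro powr_mono2) auto
 also have "\<dots> \<le> 2 powr (p - 1) * (W \<nu> \<mu> powr p + W \<mu> \<mu>star powr p)"
  using W_nonneg by (intro powr_add_le) auto
 finally have "B * W \<nu> \<mu>star powr p \<le> B * (2 powr (p - 1) * (W \<nu> \<mu> powr p + W \<mu> \<mu>star powr p))"
  using AB by (intro mult_left_mono) auto
 moreover have "- A - B * W \<nu> \<mu>star powr p \<le> energy \<nu>" using below[OF \<nu>(1)] \<nu>(2) by simp
 ultimately show ?thesis by (simp add: base_def slack_def algebra_simps)
qed

lemma pen_pos: "0 < \<sigma> ==> 0 < pen \<sigma>"
 using p_pos by (simp add: pen_def)

lemma pen_antimono: "0 < \<sigma> ==> \<sigma> \<le> \<sigma>' ==> pen \<sigma>' \<le> pen \<sigma>"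
 using p_gt_1 unfolding pen_def by (intro divide_left_mono mult_left_mono powr_mono2 mult_pos_pos) auto

lemma pen_large:
 obtains \<tau> where "0 < \<tau>" "\<And>\<sigma>. 0 < \<sigma> ==> \<sigma> \<le> \<tau> ==> L \<le> pen \<sigma>"
proof -
 define l where "l = max L 1"
 define \<tau> where "\<tau> = (1 / (p * l)) powr (1 / (p - 1))"
 have l: "0 < p * l" using p_pos by (simp add: l_def)
 show ?thesis
 proof
  have "p \<noteq> 0" "l \<noteq> 0" using l by auto
  then show \<tau>: "0 < \<tau>" by (simp add: \<tau>_def)
  have "\<tau> powr (p - 1) = (1 / (p * l)) powr (1 / (p - 1) * (p - 1))" by (simp add: \<tau>_def powr_powr)
  also have "1 / (p - 1) * (p - 1) = 1" using p_gt_1 by simp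
  also have "(1 / (p * l)) powr 1 = 1 / (p * l)" using l by (intro powr_one) (simp add: less_imp_le)
  finally have "\<tau> powr (p - 1) = 1 / (p * l)" .
  then have "pen \<tau> = l" using l p_pos by (simp add: pen_def l_def)
  then show "L \<le> pen \<sigma>" if "0 < \<sigma>" "\<sigma> \<le> \<tau>" for \<sigma>
   using pen_antimono[OF that] by (simp add: l_def)
 qed
qed

text \<open>\<open>pen \<sigma>\<close> is \<sigma>^(1-p) / p, so its derivative carries (p - 1) / p
  = 1 / q: this is the origin of the factor 1 / q in front of the slope term.\<close>

lemma pen_has_derivative: "0 < s ==> (pen has_real_derivative - (s powr (- p) / q)) (at s)"
proof -
 assume s: "0 < s"
 have "((\<lambda>s. s powr (1 - p) / p) has_real_derivative (1 - p) * s powr (1 - p - 1) / p) (at s)"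
  using s p_pos by (auto intro!: derivative_eq_intros)
 moreover have "(1 - p) * s powr (1 - p - 1) / p = - (s powr (- p) / q)"
 proof -
  have "(1 - p) / p = - (1 / q)" by (metis inverse_q minus_diff_eq minus_divide_left)
  moreover have "1 - p - 1 = - p" by simp
  moreover have "(1 - p) * s powr (- p) / p = (1 - p) / p * s powr (- p)" by simp
  ultimately show ?thesis by simp
 qed
 moreover have "\<forall>\<^sub>F x in nhds s. x powr (1 - p) / p = pen x"
  using eventually_nhds_in_open[of "{0<..}" s] s
  by (auto elim!: eventually_mono simp: pen_def powr_diff powr_minus_divide field_simps)
 ultimately show ?thesis using DERIV_cong_ev[of s s "\<lambda>s. s powr (1 - p) / p" pen] by metis
qed

lemma pen_decrease:
 assumes "0 < s" "0 < h"
 shows "h * (s + h) powr (- p) / q \<le> pen s - pen (s + h)"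
proof -
 obtain z where z: "s < z" "z < s + h" "pen (s + h) - pen s = (s + h - s) * - (z powr (- p) / q)"
  using MVT2[of s "s + h" pen "\<lambda>z. - (z powr (- p) / q)"] pen_has_derivative assms by auto
 have "(s + h) powr (- p) \<le> z powr (- p)"
  using z assms p_pos by (intro powr_mono2') auto
 then have "h * (s + h) powr (- p) / q \<le> h * z powr (- p) / q"
  using assms q_pos by (intro divide_right_mono mult_left_mono) auto
 then show ?thesis using z(3) by simp
qed

definition "minimizer \<sigma> \<mu> \<nu> \<longleftrightarrow> \<nu> \<in> fdom \<and> (\<forall>\<nu>'\<in>fdom. energy \<nu> + pen \<sigma> * W \<nu> \<mu> powr p \<le> energy \<nu>' + pen \<sigma> * W \<nu>' \<mu> powr p)"

lemma minimizer_le: "minimizer \<sigma> \<mu> \<nu> ==> \<nu>' \<in> fdom ==> energy \<nu> + pen \<sigma> * W \<nu> \<mu> powr p \<le> energy \<nu>' + pen \<sigma> * W \<nu>' \<mu> powr p"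
 by (simp add: minimizer_def)

lemma minimizer_fdom: "minimizer \<sigma> \<mu> \<nu> ==> \<nu> \<in> fdom"
 by (simp add: minimizer_def)

lemma minimizer_base:
 assumes "minimizer \<sigma> \<mu> \<nu>" "\<mu> \<in> fdom"
 shows "energy \<nu> + pen \<sigma> * W \<nu> \<mu> powr p \<le> energy \<mu>"
 using minimizer_le[OF assms] W_self[OF fdomD(1)[OF assms(2)]] p_pos by simp

text \<open>Comparison with \<mu> itself shows that a minimizer has finite energy, after which only
  real-valued competitors matter.\<close>

lemma is_arg_min_minimizer:
 assumes "is_arg_min (mm_functional p \<phi> \<sigma> \<mu>) (\<lambda>\<nu>. \<nu> \<in> P) \<nu>" "\<mu> \<in> fdom"
 shows "minimizer \<sigma> \<mu> \<nu>"
proof -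
 have \<nu>: "\<nu> \<in> P" and min: "\<And>\<nu>'. \<nu>' \<in> P ==> mm_functional p \<phi> \<sigma> \<mu> \<nu> \<le> mm_functional p \<phi> \<sigma> \<mu> \<nu>'"
  using assms(1) by (auto simp: is_arg_min_def not_less)
 have "mm_functional p \<phi> \<sigma> \<mu> \<nu> \<le> mm_functional p \<phi> \<sigma> \<mu> \<mu>" using assms(2) by (intro min fdomD)
 also have "\<dots> < \<infinity>" using fdomD[OF assms(2)] by (simp add: mm_functional_def)
 finally have "\<phi> \<nu> < \<infinity>" by (auto simp: mm_functional_def)
 then have \<nu>d: "\<nu> \<in> fdom" using \<nu> by (simp add: fdom_def)
 moreover have "energy \<nu> + pen \<sigma> * W \<nu> \<mu> powr p \<le> energy \<nu>' + pen \<sigma> * W \<nu>' \<mu> powr p" if "\<nu>' \<in> fdom" for \<nu>'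
  using min[OF fdomD(1)[OF that]] fdomD(2)[OF that] fdomD(2)[OF \<nu>d] by (simp add: mm_functional_def pen_def)
 ultimately show ?thesis by (simp add: minimizer_def)
qed

lemma bounded_energy_compact:
 assumes "\<And>n. m n \<in> fdom" "\<And>n. energy (m n) \<le> C" "\<omega> \<in> P" "\<And>n. W (m n) \<omega> \<le> D"
 obtains r \<nu> where "strict_mono (r :: nat \<Rightarrow> nat)" "\<nu> \<in> P" "(\<lambda>n. W (m (r n)) \<nu>) \<longlonglongrightarrow> 0"
proof -
 have m: "m n \<in> P" "\<phi> (m n) \<le> ereal C" for n using fdomD[OF assms(1)[of n]] assms(2)[of n] by auto
 have "(SUP n. \<phi> (m n)) \<le> ereal C" using m by (intro SUP_least)
 then have 1: "(SUP n. \<phi> (m n)) < \<infinity>" by (rule le_less_trans) simp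
 have "W (m n) \<mu>star \<le> D + W \<omega> \<mu>star" for n using W_triangle[OF m(1)[of n] assms(3) star] assms(4)[of n] by linarith
 then have "(SUP n. ereal (W (m n) \<mu>star)) \<le> ereal (D + W \<omega> \<mu>star)" by (intro SUP_least) simp
 then have 2: "(SUP n. ereal (W (m n) \<mu>star)) < \<infinity>" by (rule le_less_trans) simp
 show ?thesis using compactness[OF m(1) 1 2] that by blast
qed

text \<open>Direct method: one unit of penalty beyond \<open>slack\<close> keeps W^p bounded along a
  minimizing sequence.\<close>

lemma minimizer_exists:
 assumes \<mu>: "\<mu> \<in> fdom" and k: "slack + 1 \<le> pen \<sigma>" and \<sigma>: "0 < \<sigma>"
 obtains \<nu> where "minimizer \<sigma> \<mu> \<nu>"
proof -
 note \<mu>P = fdomD(1)[OF \<mu>]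
 define E where "E \<nu> = energy \<nu> + pen \<sigma> * W \<nu> \<mu> powr p" for \<nu>
 have low: "- base \<mu> + W \<nu> \<mu> powr p \<le> E \<nu>" if "\<nu> \<in> fdom" for \<nu>
 proof -
  have "(slack + 1) * W \<nu> \<mu> powr p \<le> pen \<sigma> * W \<nu> \<mu> powr p" using k by (intro mult_right_mono) auto
  then show ?thesis using energy_below[OF \<mu>P that] by (simp add: E_def distrib_right)
 qed
 define I where "I = (INF \<nu>\<in>fdom. E \<nu>)"
 have bdd: "bdd_below (E ` fdom)" using low by (intro bdd_belowI2[of _ "- base \<mu>"]) (meson add_increasing2 order_trans powr_ge_zero order_refl)
 have I: "I \<le> E \<nu>" if "\<nu> \<in> fdom" for \<nu> unfolding I_def using bdd that by (rule cINF_lower)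
 have "\<exists>\<nu>\<in>fdom. E \<nu> < I + 1 / real (Suc n)" for n
 proof -
  have "(INF \<nu>\<in>fdom. E \<nu>) < I + 1 / real (Suc n)" by (simp add: I_def)
  then show ?thesis using \<mu> by (subst (asm) cINF_less_iff[OF _ bdd]) auto
 qed
 then obtain m where m: "\<And>n. m n \<in> fdom" "\<And>n. E (m n) < I + 1 / real (Suc n)" by metis
 have I1: "E (m n) \<le> I + 1" for n
 proof -
  have "1 / real (Suc n) \<le> 1" by simp
  then show ?thesis using m(2)[of n] by linarith
 qed
 have Wb: "W (m n) \<mu> powr p \<le> I + 1 + base \<mu>" for n using low[OF m(1)[of n]] I1[of n] by simp
 have wb: "W (m n) \<mu> \<le> (I + 1 + base \<mu>) powr (1 / p)" for n
 proof -
  have "(W (m n) \<mu> powr p) powr (1 / p) \<le> (I + 1 + base \<mu>) powr (1 / p)" using p_pos Wb by (intro powr_mono2) auto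
  then show ?thesis using p_pos W_nonneg by (simp add: powr_powr)
 qed
 have eb: "energy (m n) \<le> I + 1" for n
  using I1[of n] mult_nonneg_nonneg[OF less_imp_le[OF pen_pos[OF \<sigma>]], of "W (m n) \<mu> powr p"]
  by (simp add: E_def)
 obtain r \<nu> where r: "strict_mono (r :: nat \<Rightarrow> nat)" "\<nu> \<in> P" "(\<lambda>n. W (m (r n)) \<nu>) \<longlonglongrightarrow> 0"
  by (rule bounded_energy_compact[OF m(1) eb \<mu>P wb])
 have mP: "m (r n) \<in> P" for n using m(1) fdomD by blast
 have W\<nu>: "(\<lambda>n. W (m (r n)) \<mu>) \<longlonglongrightarrow> W \<nu> \<mu>" using W_tendsto[of "\<lambda>n. m (r n)", OF mP r(2) \<mu>P r(3)] .
 \<comment> \<open>Lower semicontinuity is applied through the upper bound "infimum + gap - penalty"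
   on the energies, which converges because the distances to \<mu> do.\<close>
 have c1: "(\<lambda>n. I + 1 / real (Suc (r n)) - pen \<sigma> * W (m (r n)) \<mu> powr p) \<longlonglongrightarrow> I + 0 - pen \<sigma> * W \<nu> \<mu> powr p"
  using LIMSEQ_subseq_LIMSEQ[OF LIMSEQ_inverse_real_of_nat r(1)] p_pos W_nonneg
  by (intro tendsto_intros tendsto_powr' W\<nu>) (auto simp: comp_def inverse_eq_divide W_nonneg)
 have c2: "\<phi> (m (r n)) \<le> ereal (I + 1 / real (Suc (r n)) - pen \<sigma> * W (m (r n)) \<mu> powr p)" for n
  using m(2)[of "r n"] fdomD(2)[OF m(1)[of "r n"]] by (simp add: E_def)
 have \<nu>: "\<nu> \<in> fdom" "energy \<nu> \<le> I + 0 - pen \<sigma> * W \<nu> \<mu> powr p"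
  using lsc_bound[of "\<lambda>n. m (r n)", OF mP r(2,3) c2 c1] by auto
 have "minimizer \<sigma> \<mu> \<nu>"
  unfolding minimizer_def
 proof (intro conjI ballI)
  fix \<nu>' assume "\<nu>' \<in> fdom"
  then show "energy \<nu> + pen \<sigma> * W \<nu> \<mu> powr p \<le> energy \<nu>' + pen \<sigma> * W \<nu>' \<mu> powr p"
   using I[of \<nu>'] \<nu>(2) by (simp add: E_def)
 qed (rule \<nu>)
 then show ?thesis by (rule that)
qed

end

lemma Lp_norm_nonneg: "0 \<le> Lp_norm p M f"
 by (simp add: Lp_norm_def)

lemma Lp_norm_powr: "0 < p ==> Lp_norm p M f powr p = (\<integral>x. norm (f x) powr p \<partial>M)"
 by (simp add: Lp_norm_def powr_powr)

context minimizing_movements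
begin

text \<open>The two minimality inequalities add up to (pen \<sigma> - pen \<sigma>') (W^p - W'^p)
  \<le> 0, and \<open>pen\<close> is strictly decreasing. Monotonicity is also the source of
  measurability in \<sigma>.\<close>

lemma minimizer_mono:
 assumes "minimizer \<sigma> \<mu> \<nu>" "minimizer \<sigma>' \<mu> \<nu>'" "0 < \<sigma>" "\<sigma> < \<sigma>'"
 shows "W \<nu> \<mu> \<le> W \<nu>' \<mu>"
proof -
 have "0 < (\<sigma>' - \<sigma>) * (\<sigma> + (\<sigma>' - \<sigma>)) powr (- p) / q" using assms q_pos by (intro divide_pos_pos mult_pos_pos) auto
 also have "\<dots> \<le> pen \<sigma> - pen (\<sigma> + (\<sigma>' - \<sigma>))" using assms by (intro pen_decrease) auto
 finally have k: "0 < pen \<sigma> - pen \<sigma>'" by simp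
 have "(pen \<sigma> - pen \<sigma>') * W \<nu> \<mu> powr p \<le> (pen \<sigma> - pen \<sigma>') * W \<nu>' \<mu> powr p"
  using minimizer_le[OF assms(1) minimizer_fdom[OF assms(2)]] minimizer_le[OF assms(2) minimizer_fdom[OF assms(1)]]
  by (simp add: left_diff_distrib)
 then have "W \<nu> \<mu> powr p \<le> W \<nu>' \<mu> powr p" using k by simp
 then show ?thesis using p_pos W_nonneg[of \<nu> \<mu>] W_nonneg[of \<nu>' \<mu>] by (meson not_less powr_less_mono2)
qed

text \<open>De Giorgi's variational interpolation: the bound is the integrated form of
 \<open>d/d\<sigma> (min \<Phi>(\<sigma>, \<mu>, \<cdot>)) = - (W / \<sigma>)\<^sup>p / q\<close>.\<close>

lemma interpolation_estimate:
 assumes \<mu>: "\<mu> \<in> fdom" and \<tau>: "0 < \<tau>" and N: "\<And>\<sigma>. 0 < \<sigma> ==> \<sigma> \<le> \<tau> ==> minimizer \<sigma> \<mu> (N \<sigma>)"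
 shows "(\<integral>\<^sup>+\<sigma>\<in>{0<..\<tau>}. ennreal ((W (N \<sigma>) \<mu> / \<sigma>) powr p) \<partial>lborel) \<le>
  ennreal (q * (energy \<mu> - (energy (N \<tau>) + pen \<tau> * W (N \<tau>) \<mu> powr p)))"
proof -
 define w where "w \<sigma> = W (N \<sigma>) \<mu>" for \<sigma>
 define F where "F \<sigma> = energy (N \<sigma>) + pen \<sigma> * w \<sigma> powr p" for \<sigma>
 have w0: "0 \<le> w \<sigma>" for \<sigma> by (simp add: w_def W_nonneg)
 have wm: "w \<sigma> \<le> w \<sigma>'" if "0 < \<sigma>" "\<sigma> \<le> \<sigma>'" "\<sigma>' \<le> \<tau>" for \<sigma> \<sigma>'
  using minimizer_mono[OF N N, of \<sigma> \<sigma>'] that by (cases "\<sigma> = \<sigma>'") (auto simp: w_def)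
 \<comment> \<open>Only the minimizer at the larger step is tested, against the one at the smaller
   step; the distance thus appears at the left endpoint, and no continuity of the minimizers in
   \<sigma> enters.\<close>
 have Fd: "w \<sigma> powr p * (pen \<sigma> - pen \<sigma>') \<le> F \<sigma> - F \<sigma>'" if "0 < \<sigma>" "\<sigma> \<le> \<sigma>'" "\<sigma>' \<le> \<tau>" for \<sigma> \<sigma>'
  using minimizer_le[OF N[of \<sigma>'] minimizer_fdom[OF N[of \<sigma>]]] that
  by (simp add: F_def w_def algebra_simps)
 have Fmono: "F \<sigma>' \<le> F \<sigma>" if "0 < \<sigma>" "\<sigma> \<le> \<sigma>'" "\<sigma>' \<le> \<tau>" for \<sigma> \<sigma>'
 proof -
  have "0 \<le> w \<sigma> powr p * (pen \<sigma> - pen \<sigma>')" using pen_antimono[OF that(1,2)] by (intro mult_nonneg_nonneg) auto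
  with Fd[OF that] show ?thesis by linarith
 qed
 have Fle: "F \<sigma> \<le> energy \<mu>" if "0 < \<sigma>" "\<sigma> \<le> \<tau>" for \<sigma>
  using minimizer_base[OF N[OF that] \<mu>] by (simp add: F_def w_def)
 \<comment> \<open>A mesh tending to 0, small enough that [h, \<tau> - h] is nonempty.\<close>
 define h where "h n = \<tau> / real (n + 2)" for n :: nat
 have h: "0 < h n" "2 * h n \<le> \<tau>" for n using \<tau> by (auto simp: h_def field_simps)
 have h0: "h \<longlonglongrightarrow> 0"
  unfolding h_def by (rule tendsto_divide_0[OF tendsto_const]) (intro filterlim_compose[OF filterlim_real_sequentially] filterlim_at_infinity_imp_norm_at_top filterlim_at_top_imp_at_infinity filterlim_add_const_nat_at_top)
 \<comment> \<open>Clamping to [h, \<tau>] extends the monotone functions to the whole line, as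
   \<open>antitone_shift_integral\<close> requires.\<close>
 define c where "c n s = max (h n) (min s \<tau>)" for n s
 have c: "0 < c n s" "c n s \<le> \<tau>" "h n \<le> c n s" "s \<le> s' ==> c n s \<le> c n s'" for n s s'
  using h[of n] \<tau> by (auto simp: c_def)
 define v where "v n s = w (c n s) powr p * (c n s + h n) powr (- p)" for n s
 have [measurable]: "c n \<in> borel_measurable borel" for n unfolding c_def by measurable
 have "(\<lambda>s. w (c n s)) \<in> borel_measurable borel" for n
  by (rule borel_measurable_mono) (auto simp: mono_def intro!: wm c)
 note [measurable] = this
 have [measurable]: "v n \<in> borel_measurable borel" for n unfolding v_def by measurable
 define f where "f n s = ennreal (v n s) * indicator {h n..\<tau> - h n} s" for n s
 have [measurable]: "f n \<in> borel_measurable borel" for n unfolding f_def by measurable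
 have fint: "(\<integral>\<^sup>+s. f n s \<partial>lborel) \<le> ennreal (q * (energy \<mu> - F \<tau>))" for n
 proof -
  have "(\<integral>\<^sup>+s\<in>{h n..\<tau> - h n}. ennreal (v n s) \<partial>lborel) \<le> ennreal (q * F (c n (h n)) - q * F (c n (\<tau> - h n + h n)))"
  proof (rule antitone_shift_integral[where h="h n"])
   show "antimono (\<lambda>s. q * F (c n s))"
    using q_pos by (auto simp: antimono_def intro!: mult_left_mono Fmono c)
   show "h n * v n s \<le> q * F (c n s) - q * F (c n (s + h n))" if "h n \<le> s" "s \<le> \<tau> - h n" for s
   proof -
    have cs: "c n s = s" "c n (s + h n) = s + h n" using that h[of n] \<tau> by (auto simp: c_def)
    have s: "0 < s" using that h[of n] by linarith
    have "w s powr p * (h n * (s + h n) powr (- p) / q) \<le> w s powr p * (pen s - pen (s + h n))"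
     using pen_decrease[OF s h(1)] by (intro mult_left_mono) auto
    also have "\<dots> \<le> F s - F (s + h n)" using that s h(1)[of n] by (intro Fd) auto
    finally have "q * (w s powr p * (h n * (s + h n) powr (- p) / q)) \<le> q * (F s - F (s + h n))"
     using q_pos by (intro mult_left_mono) auto
    then show ?thesis using q_pos by (simp add: cs v_def right_diff_distrib mult_ac)
   qed
  qed (use h[of n] in \<open>auto simp: v_def\<close>)
  also have "\<dots> \<le> ennreal (q * (energy \<mu> - F \<tau>))"
  proof (rule ennreal_leI)
   have "c n (h n) = h n" "c n (\<tau> - h n + h n) = \<tau>" using h[of n] \<tau> by (auto simp: c_def)
   then show "q * F (c n (h n)) - q * F (c n (\<tau> - h n + h n)) \<le> q * (energy \<mu> - F \<tau>)"
    using Fle[of "h n"] h[of n] q_pos \<tau> by (simp add: right_diff_distrib)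
  qed
  finally show ?thesis by (simp add: f_def)
 qed
 \<comment> \<open>At each s in (0, \<tau>) the functions converge to the integrand; Fatou's lemma
   then removes the mesh.\<close>
 have lim: "(\<lambda>n. f n s) \<longlonglongrightarrow> ennreal ((w s / s) powr p)" if s: "0 < s" "s < \<tau>" for s
 proof -
  have "\<forall>\<^sub>F n in sequentially. h n < min s (\<tau> - s)" using s by (intro order_tendstoD(2)[OF h0]) auto
  then have ev: "\<forall>\<^sub>F n in sequentially. ennreal (w s powr p * (s + h n) powr (- p)) = f n s"
   by eventually_elim (use s in \<open>auto simp: f_def v_def c_def\<close>)
  have "(\<lambda>n. w s powr p * (s + h n) powr (- p)) \<longlonglongrightarrow> w s powr p * (s + 0) powr (- p)"
   using s by (intro tendsto_intros h0) auto
  also have "w s powr p * (s + 0) powr (- p) = (w s / s) powr p"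
   using s w0[of s] by (simp add: powr_divide powr_minus_divide)
  finally show ?thesis using Lim_transform_eventually[OF tendsto_ennrealI ev] by blast
 qed
 have "(\<integral>\<^sup>+\<sigma>\<in>{0<..\<tau>}. ennreal ((w \<sigma> / \<sigma>) powr p) \<partial>lborel) \<le> (\<integral>\<^sup>+s. liminf (\<lambda>n. f n s) \<partial>lborel)"
 proof (rule nn_integral_mono_AE)
  have "AE s in lborel. s \<noteq> \<tau>" by (rule AE_lborel_singleton)
  then show "AE s in lborel. ennreal ((w s / s) powr p) * indicator {0<..\<tau>} s \<le> liminf (\<lambda>n. f n s)"
  proof eventually_elim
   case (elim s)
   then show ?case using lim_imp_Liminf[OF _ lim[of s]] by (auto simp: indicator_def)
  qed
 qed
 also have "\<dots> \<le> liminf (\<lambda>n. \<integral>\<^sup>+s. f n s \<partial>lborel)" by (rule nn_integral_liminf) measurable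
 also have "\<dots> \<le> liminf (\<lambda>n::nat. ennreal (q * (energy \<mu> - F \<tau>)))" using fint by (intro Liminf_mono) auto
 also have "\<dots> = ennreal (q * (energy \<mu> - F \<tau>))" by (simp add: Liminf_const)
 finally show ?thesis by (simp add: w_def F_def)
qed

section \<open>Local slopes in terms of real-valued energies\<close>

lemma eventually_near:
 "eventually Q (inf (filtercomap (\<lambda>\<nu>. W \<nu> \<mu>) (at_right 0)) (principal P)) \<longleftrightarrow>
  (\<exists>\<delta>>0. \<forall>\<nu>\<in>P. 0 < W \<nu> \<mu> \<longrightarrow> W \<nu> \<mu> < \<delta> \<longrightarrow> Q \<nu>)"
 unfolding eventually_inf_principal eventually_filtercomap eventually_at_right_field
proof
 assume "\<exists>\<delta>>0. \<forall>\<nu>\<in>P. 0 < W \<nu> \<mu> \<longrightarrow> W \<nu> \<mu> < \<delta> \<longrightarrow> Q \<nu>"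
 then obtain \<delta> where \<delta>: "0 < \<delta>" "\<forall>\<nu>\<in>P. 0 < W \<nu> \<mu> \<longrightarrow> W \<nu> \<mu> < \<delta> \<longrightarrow> Q \<nu>" by blast
 then show "\<exists>R. (\<exists>b>0. \<forall>y>0. y < b \<longrightarrow> R y) \<and> (\<forall>\<nu>. R (W \<nu> \<mu>) \<longrightarrow> \<nu> \<in> P \<longrightarrow> Q \<nu>)"
  by (intro exI[of _ "\<lambda>x. 0 < x \<and> x < \<delta>"]) blast
qed blast

lemma slope_quotient:
 assumes "\<mu> \<in> fdom" "\<nu> \<in> P" "0 < W \<nu> \<mu>"
 shows "e2ennreal (max 0 (\<phi> \<mu> - \<phi> \<nu>)) / ennreal (W \<mu> \<nu>) =
  (if \<nu> \<in> fdom then ennreal (max 0 (energy \<mu> - energy \<nu>) / W \<nu> \<mu>) else 0)"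
proof (cases "\<nu> \<in> fdom")
 case True
 have "max 0 (\<phi> \<mu> - \<phi> \<nu>) = ereal (max 0 (energy \<mu> - energy \<nu>))"
  using fdomD(2)[OF assms(1)] fdomD(2)[OF True] by (simp add: max_def zero_ereal_def)
 then have "e2ennreal (max 0 (\<phi> \<mu> - \<phi> \<nu>)) = ennreal (max 0 (energy \<mu> - energy \<nu>))"
  by (simp only: e2ennreal_ereal)
 moreover have "ennreal (max 0 (energy \<mu> - energy \<nu>)) / ennreal (W \<nu> \<mu>) = ennreal (max 0 (energy \<mu> - energy \<nu>) / W \<nu> \<mu>)"
  using assms(3) by (intro divide_ennreal) auto
 ultimately show ?thesis using True by (simp only: W_commute[of \<mu> \<nu>] if_True)
next
 case False
 then have "\<phi> \<nu> = \<infinity>" using assms(2) by (simp add: fdom_def)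
 then have "max 0 (\<phi> \<mu> - \<phi> \<nu>) = 0" using fdomD(2)[OF assms(1)] by (simp add: max_def)
 then show ?thesis using False by simp
qed

lemma slope_lessD:
 assumes \<mu>: "\<mu> \<in> fdom" and less: "local_slope p \<phi> \<mu> < ennreal c"
 obtains \<delta> where "0 < \<delta>" "\<And>\<nu>. \<nu> \<in> fdom ==> W \<nu> \<mu> < \<delta> ==> energy \<mu> \<le> energy \<nu> + c * W \<nu> \<mu>"
proof -
 have "\<forall>\<^sub>F \<nu> in inf (filtercomap (\<lambda>\<nu>. W \<nu> \<mu>) (at_right 0)) (principal P).
   e2ennreal (max 0 (\<phi> \<mu> - \<phi> \<nu>)) / ennreal (W \<mu> \<nu>) < ennreal c"
  using less unfolding local_slope_def by (rule Limsup_lessD)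
 then obtain \<delta> where \<delta>: "0 < \<delta>" "\<And>\<nu>. \<nu> \<in> P ==> 0 < W \<nu> \<mu> ==> W \<nu> \<mu> < \<delta> ==>
   e2ennreal (max 0 (\<phi> \<mu> - \<phi> \<nu>)) / ennreal (W \<mu> \<nu>) < ennreal c"
  unfolding eventually_near by blast
 show ?thesis
 proof
  fix \<nu> assume \<nu>: "\<nu> \<in> fdom" "W \<nu> \<mu> < \<delta>"
  show "energy \<mu> \<le> energy \<nu> + c * W \<nu> \<mu>"
  \<comment> \<open>The slope sees only measures at positive distance; at distance 0 the energies
    agree by \<open>phi_cong\<close>.\<close>
  proof (cases "W \<nu> \<mu> = 0")
   case True
   then have "energy \<nu> = energy \<mu>" using phi_cong[OF fdomD(1)[OF \<nu>(1)] fdomD(1)[OF \<mu>]] by (simp add: energy_def)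
   then show ?thesis using True by simp
  next
   case False
   then have pos: "0 < W \<nu> \<mu>" using W_nonneg[of \<nu> \<mu>] by simp
   have "ennreal (max 0 (energy \<mu> - energy \<nu>) / W \<nu> \<mu>) < ennreal c"
    using \<delta>(2)[OF fdomD(1)[OF \<nu>(1)] pos \<nu>(2)] slope_quotient[OF \<mu> fdomD(1)[OF \<nu>(1)] pos] \<nu>(1) by simp
   then have "max 0 (energy \<mu> - energy \<nu>) / W \<nu> \<mu> < c" using pos by (subst (asm) ennreal_less_iff) auto
   then have "max 0 (energy \<mu> - energy \<nu>) < c * W \<nu> \<mu>" using pos by (simp add: divide_less_eq)
   then show ?thesis by linarith
  qed
 qed (rule \<delta>)
qed

lemma slope_leI:
 assumes \<mu>: "\<mu> \<in> fdom" and "0 \<le> c"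
  and *: "\<And>e. 0 < e ==> \<exists>\<delta>>0. \<forall>\<nu>\<in>fdom. 0 < W \<nu> \<mu> \<longrightarrow> W \<nu> \<mu> < \<delta> \<longrightarrow> energy \<mu> - energy \<nu> \<le> (c + e) * W \<nu> \<mu>"
 shows "local_slope p \<phi> \<mu> \<le> ennreal c"
proof (rule ennreal_le_epsilon)
 fix e :: real assume "0 < e"
 then obtain \<delta> where \<delta>: "0 < \<delta>" "\<And>\<nu>. \<nu> \<in> fdom ==> 0 < W \<nu> \<mu> ==> W \<nu> \<mu> < \<delta> ==> energy \<mu> - energy \<nu> \<le> (c + e) * W \<nu> \<mu>"
  using * by blast
 have "local_slope p \<phi> \<mu> \<le> ennreal (c + e)"
  unfolding local_slope_def
 proof (rule Limsup_bounded, unfold eventually_near, intro exI[of _ \<delta>] conjI ballI impI)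
  fix \<nu> assume \<nu>: "\<nu> \<in> P" "0 < W \<nu> \<mu>" "W \<nu> \<mu> < \<delta>"
  have "max 0 (energy \<mu> - energy \<nu>) / W \<nu> \<mu> \<le> c + e" if "\<nu> \<in> fdom"
  proof -
   have "max 0 (energy \<mu> - energy \<nu>) \<le> (c + e) * W \<nu> \<mu>"
    using \<delta>(2)[OF that \<nu>(2,3)] \<open>0 \<le> c\<close> \<open>0 < e\<close> \<nu>(2) by simp
   then show ?thesis using \<nu>(2) by (simp add: divide_le_eq)
  qed
  then show "e2ennreal (max 0 (\<phi> \<mu> - \<phi> \<nu>)) / ennreal (W \<mu> \<nu>) \<le> ennreal (c + e)"
   unfolding slope_quotient[OF \<mu> \<nu>(1,2)] by (auto intro: ennreal_leI)
 qed (rule \<delta>)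
 then show "local_slope p \<phi> \<mu> \<le> ennreal c + ennreal e" using \<open>0 \<le> c\<close> \<open>0 < e\<close> by simp
qed

text \<open>For a competitor at distance d from the minimizer, the triangle inequality bounds the
  energy drop by \<open>pen \<sigma>\<close> times (w + d)^p - w^p. The tangent inequality at w + d
  makes this ((w + d) / \<sigma>)^(p-1) d, since p * pen \<sigma> = \<sigma>^(1-p).\<close>

lemma slope_minimizer:
 assumes min: "minimizer \<sigma> \<mu> \<nu>" and \<mu>: "\<mu> \<in> P" and \<sigma>: "0 < \<sigma>"
 shows "local_slope p \<phi> \<nu> \<le> ennreal ((W \<nu> \<mu> / \<sigma>) powr (p - 1))"
proof (rule slope_leI[OF minimizer_fdom[OF min]])
 fix e :: real assume "0 < e"
 define w where "w = W \<nu> \<mu>"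
 have w: "0 \<le> w" by (simp add: w_def W_nonneg)
 have "((\<lambda>d. ((w + d) / \<sigma>) powr (p - 1)) \<longlongrightarrow> ((w + 0) / \<sigma>) powr (p - 1)) (at_right 0)"
  using p_gt_1 w \<sigma> by (intro tendsto_powr' tendsto_intros) (auto simp: eventually_at_filter)
 then have "\<forall>\<^sub>F d in at_right 0. ((w + d) / \<sigma>) powr (p - 1) < (w / \<sigma>) powr (p - 1) + e"
  by (rule order_tendstoD(2)) (use \<open>0 < e\<close> in simp)
 then obtain \<delta> where \<delta>: "0 < \<delta>" "\<And>d. 0 < d ==> d < \<delta> ==> ((w + d) / \<sigma>) powr (p - 1) < (w / \<sigma>) powr (p - 1) + e"
  unfolding eventually_at_right_field by auto
 show "\<exists>\<delta>>0. \<forall>\<omega>\<in>fdom. 0 < W \<omega> \<nu> \<longrightarrow> W \<omega> \<nu> < \<delta> \<longrightarrow>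
   energy \<nu> - energy \<omega> \<le> ((W \<nu> \<mu> / \<sigma>) powr (p - 1) + e) * W \<omega> \<nu>"
 proof (intro exI[of _ \<delta>] conjI ballI impI)
  fix \<omega> assume \<omega>: "\<omega> \<in> fdom" and d: "0 < W \<omega> \<nu>" "W \<omega> \<nu> < \<delta>"
  let ?d = "W \<omega> \<nu>"
  have "W \<omega> \<mu> \<le> w + ?d"
   using W_triangle[OF fdomD(1)[OF \<omega>] fdomD(1)[OF minimizer_fdom[OF min]] \<mu>] by (simp add: w_def)
  then have le: "W \<omega> \<mu> powr p \<le> (w + ?d) powr p" using p_pos W_nonneg by (intro powr_mono2) auto
  have "energy \<nu> - energy \<omega> \<le> pen \<sigma> * (W \<omega> \<mu> powr p - w powr p)"
   using minimizer_le[OF min \<omega>] by (simp add: w_def right_diff_distrib)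
  also have "\<dots> \<le> pen \<sigma> * ((w + ?d) powr p - w powr p)"
   using le pen_pos[OF \<sigma>] by (intro mult_left_mono) auto
  also have "\<dots> \<le> pen \<sigma> * (p * ((w + ?d) powr (p - 1) * ?d))"
   using powr_tangent[of "w + ?d" w] w d pen_pos[OF \<sigma>] by (intro mult_left_mono) (auto simp: algebra_simps)
  also have "\<dots> = ((w + ?d) / \<sigma>) powr (p - 1) * ?d"
   using w d \<sigma> p_pos by (simp add: pen_def powr_divide)
  also have "\<dots> \<le> ((w / \<sigma>) powr (p - 1) + e) * ?d"
   using \<delta>(2)[OF d] d by (intro mult_right_mono) auto
  finally show "energy \<nu> - energy \<omega> \<le> ((W \<nu> \<mu> / \<sigma>) powr (p - 1) + e) * ?d" by (simp add: w_def)
 qed (rule \<delta>)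
qed simp

text \<open>The subgradient is a weak limit of barycentric projections of near-optimal plans; working with
 plans makes optimal transport maps, and hence the absolute continuity of measures of finite energy,
 unnecessary.\<close>

lemma strong_subdifferential_minimizer:
 assumes min: "minimizer \<sigma> \<mu> \<nu>" and \<mu>: "\<mu> \<in> P" and \<sigma>: "0 < \<sigma>" and C: "(W \<nu> \<mu> / \<sigma>) powr (p - 1) < C"
 obtains \<zeta> where "\<zeta> \<in> strong_subdifferential p q \<phi> \<nu>" "Lp_norm q \<nu> \<zeta> \<le> C"
proof -
 have \<nu>: "\<nu> \<in> fdom" "\<nu> \<in> P" using minimizer_fdom[OF min] fdomD by auto
 note \<nu>s = wasserstein_spaceD[OF \<nu>(2)]
 have mb: "f \<in> borel_measurable \<nu> \<longleftrightarrow> f \<in> borel_measurable borel" for f :: "'a \<Rightarrow> 'a"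
  using measurable_cong_sets[OF \<nu>s(2) refl] by blast
 define w where "w = W \<nu> \<mu>"
 have w: "0 \<le> w" by (simp add: w_def W_nonneg)
 have lim1: "(\<lambda>n. 1 / real (Suc n)) \<longlonglongrightarrow> 0" using LIMSEQ_inverse_real_of_nat by (simp add: inverse_eq_divide)
 have "(\<lambda>n. ((w + 1 / real (Suc n)) / \<sigma>) powr (p - 1)) \<longlonglongrightarrow> ((w + 0) / \<sigma>) powr (p - 1)"
  using p_gt_1 w \<sigma> by (intro tendsto_powr' tendsto_intros lim1) auto
 then have "\<forall>\<^sub>F n in sequentially. ((w + 1 / real (Suc n)) / \<sigma>) powr (p - 1) < C"
  by (rule order_tendstoD(2)) (use C in \<open>simp add: w_def\<close>)
 then obtain N where N: "\<And>n. n \<ge> N ==> ((w + 1 / real (Suc n)) / \<sigma>) powr (p - 1) < C"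
  by (auto simp: eventually_sequentially)
 \<comment> \<open>Optimality gaps, starting at an index from which the norm bound stays below
   C.\<close>
 define d where "d n = 1 / real (Suc (n + N))" for n
 have d: "0 < d n" "d n \<le> 1" "((w + d n) / \<sigma>) powr (p - 1) \<le> C" for n
  using N[of "n + N"] by (auto simp: d_def)
 have d0: "d \<longlonglongrightarrow> 0" unfolding d_def by (rule LIMSEQ_ignore_initial_segment[OF lim1])
 have "\<exists>\<gamma>. \<gamma> \<in> couplings \<nu> \<mu> \<and> transport_cost p \<gamma> \<le> ennreal ((w + d n) powr p)" for n
  using near_optimal_coupling[OF p_gt_1 \<nu>(2) \<mu>, of "w + d n"] d(1)[of n] by (auto simp: w_def)
 then obtain \<gamma> where \<gamma>: "\<And>n. \<gamma> n \<in> couplings \<nu> \<mu>"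
  "\<And>n. transport_cost p (\<gamma> n) \<le> ennreal ((w + d n) powr p)" by metis
 note \<gamma>s = couplingsD[OF \<gamma>(1)]
 note [measurable] = \<gamma>s(6,7)
 have cL: "(\<lambda>z. fst z - snd z) \<in> Lp_space p (\<gamma> n)" for n
  by (rule couplings_cost_integrable(3)[OF p_gt_1 \<nu>(2) \<mu> \<gamma>(1)])
 define cost where "cost n = (\<integral>z. norm (fst z - snd z) powr p \<partial>\<gamma> n)" for n
 have cost: "cost n \<le> (w + d n) powr p" "0 \<le> cost n" for n
 proof -
  have "ennreal (cost n) \<le> ennreal ((w + d n) powr p)"
   using \<gamma>(2)[of n] cL[of n] unfolding cost_def by (subst (asm) nn_integral_eq_integral) (auto simp: Lp_space_def)
  then show "cost n \<le> (w + d n) powr p" by (subst (asm) ennreal_le_iff) auto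
 qed (simp add: cost_def)
 define J where "J n z = duality_map p (fst z - snd z)" for n :: nat and z :: "'a \<times> 'a"
 have [measurable]: "J n \<in> borel_measurable (\<gamma> n)" for n unfolding J_def by measurable
 have Jq: "norm (J n z) powr q = norm (fst z - snd z) powr p" for n z
  by (simp add: J_def norm_duality_map powr_powr p_minus_1_times_q)
 have JL: "J n \<in> Lp_space q (\<gamma> n)" "Lp_norm q (\<gamma> n) (J n) = cost n powr (1 / q)" for n
  using cL[of n] by (auto simp: Lp_space_def Lp_norm_def Jq cost_def)
 have pq: "(x powr p) powr (1 / q) = x powr (p - 1)" for x
  using inverse_q p_pos by (simp add: powr_powr)
 define s where "s = \<sigma> powr (p - 1)"
 have s: "0 < s" using \<sigma> by (simp add: s_def)
 \<comment> \<open>Euler-Lagrange: the penalty changes to first order by the integral of J . h / s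
   under a displacement h of the first coordinate, and minimality makes minus this field a
   subgradient.\<close>
 define Z where "Z n z = (- (1 / s)) *\<^sub>R J n z" for n z
 have [measurable]: "Z n \<in> borel_measurable (\<gamma> n)" for n unfolding Z_def by measurable
 have Znorm: "norm (Z n z) = norm (J n z) / s" for n z using s by (simp add: Z_def)
 have ZL: "Z n \<in> Lp_space q (\<gamma> n)" for n
  using JL(1)[of n] s by (auto simp: Lp_space_def Znorm powr_divide)
 have ZC: "Lp_norm q (\<gamma> n) (Z n) \<le> C" for n
 proof -
  have "Lp_norm q (\<gamma> n) (Z n) = (cost n / s powr q) powr (1 / q)"
   using s by (simp add: Lp_norm_def Znorm powr_divide Jq cost_def)
  also have "\<dots> = cost n powr (1 / q) / s" using s cost(2)[of n] q_pos by (simp add: powr_divide powr_powr)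
  also have "\<dots> \<le> ((w + d n) powr p) powr (1 / q) / s"
   using s q_pos cost by (intro divide_right_mono powr_mono2) auto
  also have "\<dots> = ((w + d n) / \<sigma>) powr (p - 1)" using w d(1)[of n] \<sigma> by (simp add: pq s_def powr_divide)
  also have "\<dots> \<le> C" by (rule d)
  finally show ?thesis .
 qed
 obtain r \<zeta> where r: "strict_mono (r :: nat \<Rightarrow> nat)" and \<zeta>: "\<zeta> \<in> Lp_space q \<nu>" "Lp_norm q \<nu> \<zeta> \<le> C"
  and conv: "\<And>h. h \<in> Lp_space p \<nu> ==> (\<lambda>n. \<integral>z. h (fst z) \<bullet> Z (r n) z \<partial>\<gamma> (r n)) \<longlonglongrightarrow> (\<integral>x. h x \<bullet> \<zeta> x \<partial>\<nu>)"
  using weak_compactness[where \<gamma>=\<gamma> and X="\<lambda>n. fst" and Z=Z and C=C, OF \<nu>s(1,2) \<gamma>s(1) \<gamma>s(6) \<gamma>s(4) ZL ZC] by blast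
 have "\<exists>\<delta>>0. \<forall>T \<in> Lp_space p \<nu>. Lp_norm p \<nu> (\<lambda>x. T x - x) < \<delta> \<longrightarrow>
    \<phi> (distr \<nu> borel T) - \<phi> \<nu> \<ge>
     ereal ((\<integral>x. \<zeta> x \<bullet> (T x - x) \<partial>\<nu>) - \<epsilon> * Lp_norm p \<nu> (\<lambda>x. T x - x))" if "0 < \<epsilon>" for \<epsilon>
 proof -
  \<comment> \<open>Each of the two remainder terms is to be at most (\<epsilon> s / 2) H:
    \<open>\<eta>\<close> achieves this for the linear one, \<open>\<delta>\<close> for the one of
    order H^p. All costs are at most (w + 1)^p.\<close>
  define \<eta> where "\<eta> = \<epsilon> * s / (2 * (w + 1) powr (p - 1))"
  have \<eta>: "0 < \<eta>" using that s w by (simp add: \<eta>_def)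
  have \<eta>': "\<eta> * (w + 1) powr (p - 1) = \<epsilon> * s / 2" using w by (simp add: \<eta>_def)
  obtain C' where C': "0 \<le> C'" "\<And>a h :: 'a. norm (duality_map p (a + h) - duality_map p a) \<le> \<eta> * norm a powr (p - 1) + C' * norm h powr (p - 1)"
   using duality_map_increment[OF \<eta>] by blast
  define \<delta> where "\<delta> = ((\<epsilon> * s / 2) / (C' + 1)) powr (1 / (p - 1))"
  have \<delta>: "0 < \<delta>" using that s C' by (simp add: \<delta>_def)
  have \<delta>p: "C' * x powr (p - 1) \<le> \<epsilon> * s / 2" if "0 \<le> x" "x < \<delta>" for x
  proof -
   have "x powr (p - 1) \<le> \<delta> powr (p - 1)" using that p_gt_1 by (intro powr_mono2) auto
   also have "\<dots> = (\<epsilon> * s / 2) / (C' + 1)"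
    using \<open>0 < \<epsilon>\<close> s C'(1) p_gt_1 by (simp add: \<delta>_def powr_powr)
   finally have "(C' + 1) * x powr (p - 1) \<le> \<epsilon> * s / 2" using C'(1) by (simp add: field_simps)
   then show ?thesis using powr_ge_zero[of x "p - 1"] unfolding distrib_right by linarith
  qed
  show ?thesis
  proof (intro exI[of _ \<delta>] conjI ballI impI \<delta>)
   fix T assume T: "T \<in> Lp_space p \<nu>" and H\<delta>: "Lp_norm p \<nu> (\<lambda>x. T x - x) < \<delta>"
   define H where "H = Lp_norm p \<nu> (\<lambda>x. T x - x)"
   have H0: "0 \<le> H" by (simp add: H_def Lp_norm_nonneg)
   define h where "h x = T x - x" for x
   have idL: "(\<lambda>x. x) \<in> Lp_space p \<nu>" using \<nu>s(4) mb[of "\<lambda>x. x"] by (simp add: Lp_space_def)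
   have hL: "h \<in> Lp_space p \<nu>" unfolding h_def by (rule Lp_space_diff[OF p_gt_1 T idL])
   have [measurable]: "T \<in> borel_measurable borel" "h \<in> borel_measurable borel"
    using T hL mb by (auto simp: Lp_space_def)
   define \<rho> where "\<rho> = distr \<nu> borel T"
   have Tm: "T \<in> borel_measurable \<nu>" using T by (simp add: Lp_space_def)
   have \<rho>: "\<rho> \<in> P"
    unfolding wasserstein_space_def \<rho>_def using prob_space.prob_space_distr[OF \<nu>s(1) Tm] T Tm
    by (auto simp: integrable_distr_eq Lp_space_def)
   have fstL: "(\<lambda>z. f (fst z)) \<in> Lp_space p (\<gamma> n)" "(\<integral>z. norm (f (fst z)) powr p \<partial>\<gamma> n) = (\<integral>x. norm (f x) powr p \<partial>\<nu>)"
    if f: "f \<in> Lp_space p \<nu>" for f :: "'a \<Rightarrow> 'a" and n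
   proof -
    have [measurable]: "f \<in> borel_measurable borel" using f mb[of f] by (simp add: Lp_space_def)
    have "integrable (distr (\<gamma> n) borel fst) (\<lambda>x. norm (f x) powr p)" using f \<gamma>s(4)[of n] by (simp add: Lp_space_def)
    then show "(\<lambda>z. f (fst z)) \<in> Lp_space p (\<gamma> n)" by (auto simp: Lp_space_def integrable_distr_eq)
    have "(\<integral>x. norm (f x) powr p \<partial>distr (\<gamma> n) borel fst) = (\<integral>z. norm (f (fst z)) powr p \<partial>\<gamma> n)"
     by (rule integral_distr) measurable
    then show "(\<integral>z. norm (f (fst z)) powr p \<partial>\<gamma> n) = (\<integral>x. norm (f x) powr p \<partial>\<nu>)" by (simp add: \<gamma>s(4))
   qed
   have Hp: "(\<integral>x. norm (h x) powr p \<partial>\<nu>) = H powr p"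
    using Lp_norm_powr[OF p_pos, of \<nu> h] by (simp add: H_def h_def[abs_def])
   have hn: "Lp_norm p (\<gamma> n) (\<lambda>z. h (fst z)) = H" for n
    using fstL(2)[OF hL, of n] by (simp add: Lp_norm_def H_def h_def)
   \<comment> \<open>The plan is pushed forward by T in its first coordinate. The bound holds along
     all the near-optimal plans, and the limit replaces Z by \<zeta>.\<close>
   have upper: "W \<rho> \<mu> powr p \<le> (w + d n) powr p - p * s * (\<integral>z. h (fst z) \<bullet> Z n z \<partial>\<gamma> n) + p * (\<epsilon> * s * H)" for n
   proof -
    define \<gamma>' where "\<gamma>' = distr (\<gamma> n) borel (\<lambda>z. (T (fst z), snd z))"
    have pm[measurable]: "(\<lambda>z. (T (fst z), snd z)) \<in> borel_measurable (\<gamma> n)" by measurable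
    have fm[measurable]: "fst \<in> borel_measurable (borel :: ('a \<times> 'a) measure)" "snd \<in> borel_measurable (borel :: ('a \<times> 'a) measure)"
     by (auto intro!: borel_measurable_continuous_onI continuous_intros)
    have "distr (distr (\<gamma> n) borel fst) borel T = distr (\<gamma> n) borel (T \<circ> fst)" by (rule distr_distr) measurable
    then have d1: "distr (\<gamma> n) borel (\<lambda>z. T (fst z)) = \<rho>" using \<gamma>s(4)[of n] by (simp add: \<rho>_def comp_def)
    have \<gamma>': "\<gamma>' \<in> couplings \<rho> \<mu>"
     using d1 \<gamma>s(5)[of n] prob_space.prob_space_distr[OF \<gamma>s(1) pm]
     by (auto simp: couplings_def \<gamma>'_def distr_distr comp_def)
    have TL: "(\<lambda>z. T (fst z) - snd z) \<in> Lp_space p (\<gamma> n)"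
     by (rule Lp_space_diff[OF p_gt_1 fstL(1)[OF T] couplings_cost_integrable(2)[OF p_gt_1 \<nu>(2) \<mu> \<gamma>(1)]])
    define c1 where "c1 = (\<integral>z. norm (T (fst z) - snd z) powr p \<partial>\<gamma> n)"
    have c10: "0 \<le> c1" by (simp add: c1_def)
    have "W \<rho> \<mu> \<le> c1 powr (1 / p)"
    proof (rule wasserstein_le[OF p_gt_1 \<gamma>'])
     have "transport_cost p \<gamma>' = (\<integral>\<^sup>+ z. ennreal (norm (T (fst z) - snd z) powr p) \<partial>\<gamma> n)"
      unfolding \<gamma>'_def by (subst nn_integral_distr) auto
     also have "\<dots> = ennreal c1" unfolding c1_def using TL by (intro nn_integral_eq_integral) (auto simp: Lp_space_def)
     finally show "transport_cost p \<gamma>' \<le> ennreal ((c1 powr (1 / p)) powr p)"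
      using c10 p_pos by (simp add: powr_powr)
    qed simp
    then have "W \<rho> \<mu> powr p \<le> (c1 powr (1 / p)) powr p" using p_pos W_nonneg by (intro powr_mono2) auto
    then have "W \<rho> \<mu> powr p \<le> c1" using c10 p_pos by (simp add: powr_powr)
    also have "c1 \<le> (\<integral>z. norm (fst z - snd z) powr p + p * (h (fst z) \<bullet> J n z) +
      p * (\<eta> * (norm (h (fst z)) * norm (J n z)) + C' * norm (h (fst z)) powr p) \<partial>\<gamma> n)"
     unfolding c1_def
    proof (rule integral_mono)
     show "integrable (\<gamma> n) (\<lambda>z. norm (T (fst z) - snd z) powr p)" using TL by (simp add: Lp_space_def)
     show "integrable (\<gamma> n) (\<lambda>z. norm (fst z - snd z) powr p + p * (h (fst z) \<bullet> J n z) +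
       p * (\<eta> * (norm (h (fst z)) * norm (J n z)) + C' * norm (h (fst z)) powr p))"
      using cL[of n] fstL(1)[OF hL, of n] holder_inner(1)[OF fstL(1)[OF hL] JL(1), of n] holder(1)[OF fstL(1)[OF hL] JL(1), of n]
      by (auto simp: Lp_space_def)
     fix z :: "'a \<times> 'a"
     let ?a = "fst z - snd z" and ?h = "h (fst z)"
     have ah: "T (fst z) - snd z = ?a + ?h" by (simp add: h_def)
     \<comment> \<open>The tangent inequality at a + h bounds |a + h|^p from above; the increment
       bound then exchanges the duality map at a + h for that at a.\<close>
     have "norm (?a + ?h) powr p \<le> norm ?a powr p + p * (duality_map p (?a + ?h) \<bullet> ?h)"
      using norm_powr_tangent[of "?a + ?h" ?a] by (simp add: inner_minus_right)
     also have "duality_map p (?a + ?h) \<bullet> ?h = duality_map p ?a \<bullet> ?h + (duality_map p (?a + ?h) - duality_map p ?a) \<bullet> ?h"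
      by (simp add: inner_diff_left)
     also have "(duality_map p (?a + ?h) - duality_map p ?a) \<bullet> ?h \<le> (\<eta> * norm ?a powr (p - 1) + C' * norm ?h powr (p - 1)) * norm ?h"
      by (rule order_trans[OF norm_cauchy_schwarz]) (intro mult_right_mono C' norm_ge_zero)
     also have "\<dots> = \<eta> * (norm ?h * norm (J n z)) + C' * norm ?h powr p"
     proof -
      have "norm ?h powr (p - 1) * norm ?h = norm ?h powr p" by (cases "?h = 0") (auto simp: powr_diff)
      then show ?thesis by (simp add: J_def norm_duality_map algebra_simps)
     qed
     finally show "norm (T (fst z) - snd z) powr p \<le> norm ?a powr p + p * (?h \<bullet> J n z) +
       p * (\<eta> * (norm ?h * norm (J n z)) + C' * norm ?h powr p)"
      using p_pos by (simp add: ah J_def inner_commute distrib_left mult_left_mono)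
    qed
    also have "\<dots> = cost n + p * (\<integral>z. h (fst z) \<bullet> J n z \<partial>\<gamma> n) +
      p * (\<eta> * (\<integral>z. norm (h (fst z)) * norm (J n z) \<partial>\<gamma> n) + C' * H powr p)"
     using cL[of n] fstL(1)[OF hL, of n] holder_inner(1)[OF fstL(1)[OF hL] JL(1), of n] holder(1)[OF fstL(1)[OF hL] JL(1), of n]
      fstL(2)[OF hL, of n] Hp
     by (simp add: Lp_space_def cost_def)
    also have "(\<integral>z. h (fst z) \<bullet> J n z \<partial>\<gamma> n) = - s * (\<integral>z. h (fst z) \<bullet> Z n z \<partial>\<gamma> n)"
     using s by (simp add: Z_def)
    finally have "W \<rho> \<mu> powr p \<le> cost n + p * (- s * (\<integral>z. h (fst z) \<bullet> Z n z \<partial>\<gamma> n)) +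
      p * (\<eta> * (\<integral>z. norm (h (fst z)) * norm (J n z) \<partial>\<gamma> n) + C' * H powr p)" .
    moreover have "\<eta> * (\<integral>z. norm (h (fst z)) * norm (J n z) \<partial>\<gamma> n) + C' * H powr p \<le> \<epsilon> * s * H"
    proof -
     have "cost n \<le> (w + 1) powr p"
      using cost(1)[of n] d(1,2)[of n] w p_pos by (intro order_trans[OF cost(1)] powr_mono2) auto
     then have "cost n powr (1 / q) \<le> ((w + 1) powr p) powr (1 / q)"
      using cost(2) q_pos by (intro powr_mono2) auto
     then have "H * cost n powr (1 / q) \<le> H * (w + 1) powr (p - 1)"
      using H0 by (intro mult_left_mono) (auto simp: pq)
     then have "(\<integral>z. norm (h (fst z)) * norm (J n z) \<partial>\<gamma> n) \<le> H * (w + 1) powr (p - 1)"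
      using holder(2)[OF fstL(1)[OF hL] JL(1), of n] hn[of n] JL(2)[of n] by simp
     then have "\<eta> * (\<integral>z. norm (h (fst z)) * norm (J n z) \<partial>\<gamma> n) \<le> \<eta> * (H * (w + 1) powr (p - 1))"
      using \<eta> by (intro mult_left_mono) auto
     also have "\<dots> = \<eta> * (w + 1) powr (p - 1) * H" by simp
     also have "\<dots> = \<epsilon> * s / 2 * H" by (simp only: \<eta>')
     finally have 1: "\<eta> * (\<integral>z. norm (h (fst z)) * norm (J n z) \<partial>\<gamma> n) \<le> \<epsilon> * s / 2 * H" .
     have "H powr p = H powr (p - 1) * H" using H0 by (cases "H = 0") (auto simp: powr_diff)
     then have "C' * H powr p = C' * H powr (p - 1) * H" by simp
     also have "\<dots> \<le> \<epsilon> * s / 2 * H" using \<delta>p[of H] H0 H\<delta> by (intro mult_right_mono) (auto simp: H_def)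
     finally show ?thesis using 1 by simp
    qed
    then have "p * (\<eta> * (\<integral>z. norm (h (fst z)) * norm (J n z) \<partial>\<gamma> n) + C' * H powr p) \<le> p * (\<epsilon> * s * H)"
     using p_pos by (intro mult_left_mono) auto
    ultimately show ?thesis using cost(1)[of n] by (simp add: mult.assoc)
   qed
   have "(\<lambda>n. (w + d (r n)) powr p - p * s * (\<integral>z. h (fst z) \<bullet> Z (r n) z \<partial>\<gamma> (r n)) + p * (\<epsilon> * s * H)) \<longlonglongrightarrow>
     (w + 0) powr p - p * s * (\<integral>x. h x \<bullet> \<zeta> x \<partial>\<nu>) + p * (\<epsilon> * s * H)"
    using w d(1) p_pos LIMSEQ_subseq_LIMSEQ[OF d0 r]
    by (intro tendsto_intros conv[OF hL] tendsto_powr') (auto simp: comp_def intro!: always_eventually add_nonneg_nonneg less_imp_le)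
   then have "W \<rho> \<mu> powr p \<le> (w + 0) powr p - p * s * (\<integral>x. h x \<bullet> \<zeta> x \<partial>\<nu>) + p * (\<epsilon> * s * H)"
    by (rule LIMSEQ_le_const) (use upper in blast)
   then have "pen \<sigma> * (W \<rho> \<mu> powr p - w powr p) \<le> pen \<sigma> * (p * s * (\<epsilon> * H - (\<integral>x. h x \<bullet> \<zeta> x \<partial>\<nu>)))"
    using pen_pos[OF \<sigma>] by (intro mult_left_mono) (auto simp: algebra_simps)
   also have "\<dots> = \<epsilon> * H - (\<integral>x. h x \<bullet> \<zeta> x \<partial>\<nu>)"
    using s p_pos by (simp add: pen_def s_def[symmetric])
   finally have main: "(\<integral>x. h x \<bullet> \<zeta> x \<partial>\<nu>) - \<epsilon> * H \<le> pen \<sigma> * w powr p - pen \<sigma> * W \<rho> \<mu> powr p"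
    by (simp add: right_diff_distrib)
   show "ereal ((\<integral>x. \<zeta> x \<bullet> (T x - x) \<partial>\<nu>) - \<epsilon> * Lp_norm p \<nu> (\<lambda>x. T x - x)) \<le> \<phi> (distr \<nu> borel T) - \<phi> \<nu>"
   proof (cases "\<rho> \<in> fdom")
    case True
    have "(\<integral>x. h x \<bullet> \<zeta> x \<partial>\<nu>) - \<epsilon> * H \<le> energy \<rho> - energy \<nu>"
     using minimizer_le[OF min True] main by (simp add: w_def)
    then show ?thesis
     using fdomD(2)[OF True] fdomD(2)[OF \<nu>(1)] by (simp add: \<rho>_def[symmetric] h_def H_def inner_commute)
   next
    case False
    then have "\<phi> \<rho> = \<infinity>" using \<rho> by (simp add: fdom_def)
    then show ?thesis using fdomD(2)[OF \<nu>(1)] by (simp add: \<rho>_def)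
   qed
  qed
 qed
 then have "\<zeta> \<in> strong_subdifferential p q \<phi> \<nu>" using \<zeta>(1) by (simp add: strong_subdifferential_def)
 then show ?thesis using \<zeta>(2) by (rule that)
qed

end

section \<open>From a finite slope to a limiting subgradient\<close>

context minimizing_movements
begin

lemma small_minimizers:
 assumes \<mu>: "\<mu> \<in> fdom" and e: "0 < e"
 obtains \<tau> where "0 < \<tau>" "\<And>\<sigma>. 0 < \<sigma> ==> \<sigma> \<le> \<tau> ==> \<exists>\<nu>. minimizer \<sigma> \<mu> \<nu>"
  "\<And>\<sigma> \<nu>. 0 < \<sigma> ==> \<sigma> \<le> \<tau> ==> minimizer \<sigma> \<mu> \<nu> ==> W \<nu> \<mu> < e"
proof -
 note \<mu>P = fdomD(1)[OF \<mu>]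
 define M where "M = energy \<mu> + base \<mu>"
 have M: "0 \<le> M" using energy_below[OF \<mu>P \<mu>] W_self[OF \<mu>P] p_pos by (simp add: M_def)
 \<comment> \<open>\<open>M\<close> bounds (pen \<sigma> - slack) W^p at every minimizer, whereas W
   \<ge> e and pen \<sigma> \<ge> L would make it at least M + 1.\<close>
 define L where "L = slack + 1 + (M + 1) / e powr p"
 have ep: "0 < e powr p" using e by simp
 have L: "slack + 1 \<le> L" using M ep by (simp add: L_def)
 obtain \<tau> where \<tau>: "0 < \<tau>" "\<And>\<sigma>. 0 < \<sigma> ==> \<sigma> \<le> \<tau> ==> L \<le> pen \<sigma>"
  using pen_large[of L] by blast
 show ?thesis
 proof (rule that[OF \<tau>(1)])
  fix \<sigma> assume \<sigma>: "0 < \<sigma>" "\<sigma> \<le> \<tau>"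
  show "\<exists>\<nu>. minimizer \<sigma> \<mu> \<nu>"
   using minimizer_exists[OF \<mu> order_trans[OF L \<tau>(2)[OF \<sigma>]] \<sigma>(1)] by blast
  fix \<nu> assume min: "minimizer \<sigma> \<mu> \<nu>"
  show "W \<nu> \<mu> < e"
  proof (rule ccontr)
   assume "\<not> W \<nu> \<mu> < e"
   then have le: "e powr p \<le> W \<nu> \<mu> powr p" using e p_pos by (intro powr_mono2) auto
   have "M + 1 = (M + 1) / e powr p * e powr p" using ep by simp
   also have "\<dots> \<le> (pen \<sigma> - slack) * W \<nu> \<mu> powr p"
   proof (intro mult_mono)
    have "0 \<le> (M + 1) / e powr p" using M ep by simp
    then show "(M + 1) / e powr p \<le> pen \<sigma> - slack" "0 \<le> pen \<sigma> - slack"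
     using \<tau>(2)[OF \<sigma>] unfolding L_def by linarith+
   qed (use le in auto)
   also have "\<dots> \<le> M"
    using minimizer_base[OF min \<mu>] energy_below[OF \<mu>P minimizer_fdom[OF min]] by (simp add: M_def left_diff_distrib)
   finally show False by simp
  qed
 qed
qed

text \<open>The interpolation estimate bounds the mean of (W / \<sigma>)^p over 0 < \<sigma> \<le>
  \<tau> by c'^q, where c' < c still exceeds the slope. Hence some \<sigma> has (W / \<sigma>)^(p-1)
  < c, and the minimizer there has a strong subgradient of norm at most c.\<close>

lemma near_strong_subgradient:
 assumes \<mu>: "\<mu> \<in> fdom" and slope: "local_slope p \<phi> \<mu> < ennreal c" and e: "0 < e"
 obtains \<nu> \<zeta> where "\<nu> \<in> fdom" "W \<nu> \<mu> < e" "energy \<nu> \<le> energy \<mu>"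
  "\<zeta> \<in> strong_subdifferential p q \<phi> \<nu>" "Lp_norm q \<nu> \<zeta> \<le> c"
proof -
 note \<mu>P = fdomD(1)[OF \<mu>]
 obtain x where x: "local_slope p \<phi> \<mu> < x" "x < ennreal c" using dense[OF slope] by blast
 then obtain c' where c': "x = ennreal c'" "0 \<le> c'" by (cases x) auto
 have cc: "c' < c" using x(2) c' by (simp add: ennreal_less_iff)
 obtain \<delta> where \<delta>: "0 < \<delta>" "\<And>\<nu>. \<nu> \<in> fdom ==> W \<nu> \<mu> < \<delta> ==> energy \<mu> \<le> energy \<nu> + c' * W \<nu> \<mu>"
  using slope_lessD[OF \<mu>, of c'] x(1) c'(1) by blast
 have "0 < min e \<delta>" using e \<delta>(1) by simp
 then obtain \<tau> where \<tau>: "0 < \<tau>" "\<And>\<sigma>. 0 < \<sigma> ==> \<sigma> \<le> \<tau> ==> \<exists>\<nu>. minimizer \<sigma> \<mu> \<nu>"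
  "\<And>\<sigma> \<nu>. 0 < \<sigma> ==> \<sigma> \<le> \<tau> ==> minimizer \<sigma> \<mu> \<nu> ==> W \<nu> \<mu> < min e \<delta>"
  using small_minimizers[OF \<mu>] by blast
 define N where "N \<sigma> = (SOME \<nu>. minimizer \<sigma> \<mu> \<nu>)" for \<sigma>
 have N: "minimizer \<sigma> \<mu> (N \<sigma>)" if "0 < \<sigma>" "\<sigma> \<le> \<tau>" for \<sigma>
  unfolding N_def using \<tau>(2)[OF that] by (rule someI_ex)
 define w where "w = W (N \<tau>) \<mu>"
 define D where "D = energy \<mu> - (energy (N \<tau>) + pen \<tau> * w powr p)"
 have w0: "0 \<le> w" by (simp add: w_def W_nonneg)
 have ew: "energy \<mu> \<le> energy (N \<tau>) + c' * w"
  using \<delta>(2)[OF minimizer_fdom[OF N]] \<tau>(3)[OF _ _ N] \<tau>(1) by (simp add: w_def)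
 have D: "q * D \<le> \<tau> * c' powr q"
 proof -
  \<comment> \<open>The weight in Young's inequality for which (w / t)^p / p is exactly the penalty
    \<open>pen \<tau> * w powr p\<close>.\<close>
  define t where "t = \<tau> powr (1 / q)"
  have t: "0 < t" "t powr q = \<tau>" using \<tau>(1) q_pos by (auto simp: t_def powr_powr)
  have "p / q = p - 1" using inverse_q p_pos by (simp add: field_simps)
  then have tp: "t powr p = \<tau> powr (p - 1)" by (simp add: t_def powr_powr)
  have "c' * w = (w / t) * (c' * t)" using t(1) by simp
  also have "\<dots> \<le> (w / t) powr p / p + (c' * t) powr q / q" using w0 t(1) c'(2) by (intro young) auto
  also have "(w / t) powr p / p = pen \<tau> * w powr p" using w0 t by (simp add: powr_divide tp pen_def mult.commute)
  also have "(c' * t) powr q / q = \<tau> * c' powr q / q" using c'(2) t by (simp add: powr_mult mult.commute)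
  finally have "D \<le> \<tau> * c' powr q / q" using ew by (simp add: D_def)
  then show ?thesis using q_pos by (simp add: field_simps)
 qed
 have "\<exists>\<sigma>. 0 < \<sigma> \<and> \<sigma> \<le> \<tau> \<and> (W (N \<sigma>) \<mu> / \<sigma>) powr (p - 1) < c"
 proof (rule ccontr)
  assume "\<not> ?thesis"
  then have ge: "c \<le> (W (N \<sigma>) \<mu> / \<sigma>) powr (p - 1)" if "0 < \<sigma>" "\<sigma> \<le> \<tau>" for \<sigma> using that by force
  have c0: "0 \<le> c" using cc c'(2) by simp
  have "ennreal (c powr q) * indicator {0<..\<tau>} \<sigma> \<le> ennreal ((W (N \<sigma>) \<mu> / \<sigma>) powr p) * indicator {0<..\<tau>} \<sigma>" for \<sigma>
  proof (cases "\<sigma> \<in> {0<..\<tau>}")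
   case True
   then have "c powr q \<le> ((W (N \<sigma>) \<mu> / \<sigma>) powr (p - 1)) powr q"
    using ge c0 q_pos by (intro powr_mono2) auto
   then have "c powr q \<le> (W (N \<sigma>) \<mu> / \<sigma>) powr p" by (simp add: powr_powr p_minus_1_times_q)
   then show ?thesis using True by (simp add: ennreal_leI)
  qed simp
  then have "(\<integral>\<^sup>+\<sigma>. ennreal (c powr q) * indicator {0<..\<tau>} \<sigma> \<partial>lborel) \<le>
    (\<integral>\<^sup>+\<sigma>\<in>{0<..\<tau>}. ennreal ((W (N \<sigma>) \<mu> / \<sigma>) powr p) \<partial>lborel)" by (intro nn_integral_mono)
  also have "\<dots> \<le> ennreal (q * D)"
   using interpolation_estimate[OF \<mu> \<tau>(1) N] by (simp add: D_def w_def)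
  also have "\<dots> \<le> ennreal (\<tau> * c' powr q)" using D by (rule ennreal_leI)
  also have "(\<integral>\<^sup>+\<sigma>. ennreal (c powr q) * indicator {0<..\<tau>} \<sigma> \<partial>lborel) = ennreal (\<tau> * c powr q)"
   using \<tau>(1) by (subst nn_integral_cmult_indicator) (auto simp: ennreal_mult' mult.commute)
  finally have "\<tau> * c powr q \<le> \<tau> * c' powr q" using \<tau>(1) by (subst (asm) ennreal_le_iff) auto
  then have "c powr q \<le> c' powr q" using \<tau>(1) by simp
  moreover have "c' powr q < c powr q" using cc c'(2) q_pos by (intro powr_less_mono2) auto
  ultimately show False by simp
 qed
 then obtain \<sigma> where \<sigma>: "0 < \<sigma>" "\<sigma> \<le> \<tau>" "(W (N \<sigma>) \<mu> / \<sigma>) powr (p - 1) < c" by blast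
 note min = N[OF \<sigma>(1,2)]
 obtain \<zeta> where \<zeta>: "\<zeta> \<in> strong_subdifferential p q \<phi> (N \<sigma>)" "Lp_norm q (N \<sigma>) \<zeta> \<le> c"
  by (rule strong_subdifferential_minimizer[OF min \<mu>P \<sigma>(1,3)])
 have "0 \<le> pen \<sigma> * W (N \<sigma>) \<mu> powr p" using pen_pos[OF \<sigma>(1)] by simp
 then have "energy (N \<sigma>) \<le> energy \<mu>" using minimizer_base[OF min \<mu>] by linarith
 moreover have "W (N \<sigma>) \<mu> < e" using \<tau>(3)[OF \<sigma>(1,2) min] by simp
 ultimately show ?thesis using that[OF minimizer_fdom[OF min]] \<zeta> by blast
qed

text \<open>Along a recovery sequence, measures of slope below c have strong subgradients of norm at
  most c nearby. These are pulled back to plans from \<mu>, where weak compactness applies because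
  the first marginal is fixed.\<close>

lemma relaxed_slope_subgradient:
 assumes \<mu>: "\<mu> \<in> P" and slope: "relaxed_slope p \<phi> \<mu> < ennreal c"
 obtains \<zeta> where "\<zeta> \<in> limiting_subdifferential p q \<phi> \<mu>" "Lp_norm q \<mu> \<zeta> \<le> c"
proof -
 note \<mu>s = wasserstein_spaceD[OF \<mu>]
 obtain m where m: "\<And>n. m n \<in> P" "(\<lambda>n. W (m n) \<mu>) \<longlonglongrightarrow> 0" "(SUP n. \<phi> (m n)) < \<infinity>"
  "liminf (\<lambda>n. local_slope p \<phi> (m n)) < ennreal c"
  using slope unfolding relaxed_slope_def INF_less_iff by auto
 have c0: "0 \<le> c" using slope by (cases "0 \<le> c") (auto simp: ennreal_neg)
 \<comment> \<open>A limit inferior below c yields only infinitely many good indices;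
   \<open>I j\<close> below picks one that is at least j.\<close>
 have freq: "\<exists>n\<ge>N. local_slope p \<phi> (m n) < ennreal c" for N
 proof (rule ccontr)
  assume "\<not> ?thesis"
  then have "\<forall>\<^sub>F n in sequentially. ennreal c \<le> local_slope p \<phi> (m n)"
   by (intro eventually_sequentiallyI[of N]) (auto simp: not_less)
  then have "ennreal c \<le> liminf (\<lambda>n. local_slope p \<phi> (m n))" by (rule Liminf_bounded)
  then show False using m(4) by simp
 qed
 have md: "m n \<in> fdom" for n using m(1)[of n] le_less_trans[OF SUP_upper m(3), of n] by (simp add: fdom_def)
 define S where "S = (SUP n. \<phi> (m n))"
 have Sle: "ereal (energy (m n)) \<le> S" for n
  using SUP_upper[of n UNIV "\<lambda>n. \<phi> (m n)"] fdomD(2)[OF md[of n]] by (simp add: S_def)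
 have "\<exists>n \<nu> \<zeta>. n \<ge> j \<and> \<nu> \<in> fdom \<and> W \<nu> (m n) < 1 / real (Suc j) \<and> energy \<nu> \<le> energy (m n) \<and>
   \<zeta> \<in> strong_subdifferential p q \<phi> \<nu> \<and> Lp_norm q \<nu> \<zeta> \<le> c" for j
 proof -
  obtain n where n: "n \<ge> j" "local_slope p \<phi> (m n) < ennreal c" using freq by blast
  obtain \<nu> \<zeta> where "\<nu> \<in> fdom" "W \<nu> (m n) < 1 / real (Suc j)" "energy \<nu> \<le> energy (m n)"
   "\<zeta> \<in> strong_subdifferential p q \<phi> \<nu>" "Lp_norm q \<nu> \<zeta> \<le> c"
   using near_strong_subgradient[OF md n(2), of "1 / real (Suc j)"] by auto
  with n(1) show ?thesis by blast
 qed
 then obtain I \<nu> z where I: "\<And>j. I j \<ge> j" and \<nu>: "\<And>j. \<nu> j \<in> fdom" "\<And>j. W (\<nu> j) (m (I j)) < 1 / real (Suc j)"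
   "\<And>j. energy (\<nu> j) \<le> energy (m (I j))"
  and z: "\<And>j. z j \<in> strong_subdifferential p q \<phi> (\<nu> j)" "\<And>j. Lp_norm q (\<nu> j) (z j) \<le> c" by metis
 have \<nu>P: "\<nu> j \<in> P" for j using fdomD(1)[OF \<nu>(1)] .
 have zL: "z j \<in> Lp_space q (\<nu> j)" for j using z(1)[of j] by (simp add: strong_subdifferential_def)
 have lim1: "(\<lambda>n. 1 / real (Suc n)) \<longlonglongrightarrow> 0" using LIMSEQ_inverse_real_of_nat by (simp add: inverse_eq_divide)
 have Ilim: "filterlim I sequentially sequentially"
  unfolding filterlim_at_top using I by (auto intro!: eventually_sequentiallyI order_trans[OF _ I])
 have "(\<lambda>j. W (m (I j)) \<mu>) \<longlonglongrightarrow> 0" by (rule filterlim_compose[OF m(2) Ilim])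
 then have sum0: "(\<lambda>j. 1 / real (Suc j) + W (m (I j)) \<mu>) \<longlonglongrightarrow> 0" using tendsto_add[OF lim1] by simp
 have W0: "(\<lambda>j. W (\<nu> j) \<mu>) \<longlonglongrightarrow> 0"
 proof (rule tendsto_sandwich[OF _ _ tendsto_const sum0])
  show "\<forall>\<^sub>F j in sequentially. W (\<nu> j) \<mu> \<le> 1 / real (Suc j) + W (m (I j)) \<mu>"
  proof (intro always_eventually allI)
   fix j show "W (\<nu> j) \<mu> \<le> 1 / real (Suc j) + W (m (I j)) \<mu>"
    using W_triangle[OF \<nu>P m(1) \<mu>, of j "I j"] \<nu>(2)[of j] by linarith
  qed
 qed (simp add: W_nonneg)
 \<comment> \<open>The extra 1 / (j + 1) makes room for a near-optimal plan.\<close>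
 define d where "d j = W \<mu> (\<nu> j) + 1 / real (Suc j)" for j
 have d0: "d \<longlonglongrightarrow> 0" using tendsto_add[OF W0 lim1] by (simp add: d_def[abs_def] W_commute[of \<mu>])
 have "\<exists>\<gamma>. \<gamma> \<in> couplings \<mu> (\<nu> j) \<and> transport_cost p \<gamma> \<le> ennreal (d j powr p)" for j
  using near_optimal_coupling[OF p_gt_1 \<mu> \<nu>P, of j "d j"] by (auto simp: d_def)
 then obtain \<gamma> where \<gamma>: "\<And>j. \<gamma> j \<in> couplings \<mu> (\<nu> j)"
  "\<And>j. transport_cost p (\<gamma> j) \<le> ennreal (d j powr p)" by metis
 note \<gamma>s = couplingsD[OF \<gamma>(1)]
 note [measurable] = \<gamma>s(6,7)
 have d1: "0 \<le> d j" for j by (simp add: d_def W_nonneg)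
 have cL: "(\<lambda>w. fst w - snd w) \<in> Lp_space p (\<gamma> j)" for j
  by (rule couplings_cost_integrable(3)[OF p_gt_1 \<mu> \<nu>P \<gamma>(1)])
 have cost: "Lp_norm p (\<gamma> j) (\<lambda>w. fst w - snd w) \<le> d j" for j
 proof -
  have "ennreal (\<integral>w. norm (fst w - snd w) powr p \<partial>\<gamma> j) \<le> ennreal (d j powr p)"
   using \<gamma>(2)[of j] cL[of j] by (subst (asm) nn_integral_eq_integral) (auto simp: Lp_space_def)
  then have "(\<integral>w. norm (fst w - snd w) powr p \<partial>\<gamma> j) \<le> d j powr p" by (subst (asm) ennreal_le_iff) auto
  then have "Lp_norm p (\<gamma> j) (\<lambda>w. fst w - snd w) \<le> (d j powr p) powr (1 / p)"
   unfolding Lp_norm_def using p_pos by (intro powr_mono2) auto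
  then show ?thesis using d1[of j] p_pos by (simp add: powr_powr)
 qed
 have zm[measurable]: "z j \<in> borel_measurable borel" for j
 proof -
  have "z j \<in> borel_measurable (\<nu> j)" using zL[of j] by (simp add: Lp_space_def)
  then show ?thesis using measurable_cong_sets[OF \<gamma>s(9)[of j] refl] by blast
 qed
 define Z where "Z j w = z j (snd w)" for j and w :: "'a \<times> 'a"
 have Zsnd: "integrable (\<gamma> j) (\<lambda>w. norm (Z j w) powr q)" "(\<integral>w. norm (Z j w) powr q \<partial>\<gamma> j) = (\<integral>y. norm (z j y) powr q \<partial>\<nu> j)" for j
 proof -
  have "integrable (distr (\<gamma> j) borel snd) (\<lambda>y. norm (z j y) powr q)" using zL[of j] \<gamma>s(5)[of j] by (simp add: Lp_space_def)
  then show "integrable (\<gamma> j) (\<lambda>w. norm (Z j w) powr q)" by (simp add: Z_def integrable_distr_eq)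
  have "(\<integral>y. norm (z j y) powr q \<partial>distr (\<gamma> j) borel snd) = (\<integral>w. norm (z j (snd w)) powr q \<partial>\<gamma> j)"
   by (rule integral_distr) measurable
  then show "(\<integral>w. norm (Z j w) powr q \<partial>\<gamma> j) = (\<integral>y. norm (z j y) powr q \<partial>\<nu> j)" by (simp add: Z_def \<gamma>s(5))
 qed
 have [measurable]: "Z j \<in> borel_measurable (\<gamma> j)" for j unfolding Z_def by measurable
 have ZL: "Z j \<in> Lp_space q (\<gamma> j)" for j using Zsnd(1)[of j] by (simp add: Lp_space_def)
 have Zeq: "Lp_norm q (\<gamma> j) (Z j) = Lp_norm q (\<nu> j) (z j)" for j by (simp add: Lp_norm_def Zsnd(2))
 have ZC: "Lp_norm q (\<gamma> j) (Z j) \<le> c" for j using z(2)[of j] Zeq[of j] by simp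
 obtain r \<zeta> where r: "strict_mono (r :: nat \<Rightarrow> nat)" and \<zeta>: "\<zeta> \<in> Lp_space q \<mu>" "Lp_norm q \<mu> \<zeta> \<le> c"
  and conv: "\<And>h. h \<in> Lp_space p \<mu> ==> (\<lambda>n. \<integral>w. h (fst w) \<bullet> Z (r n) w \<partial>\<gamma> (r n)) \<longlonglongrightarrow> (\<integral>x. h x \<bullet> \<zeta> x \<partial>\<mu>)"
  using weak_compactness[where \<gamma>=\<gamma> and X="\<lambda>n. fst" and Z=Z and C=c, OF \<mu>s(1,2) \<gamma>s(1) \<gamma>s(6) \<gamma>s(4) ZL ZC] by blast
 have "\<zeta> \<in> limiting_subdifferential p q \<phi> \<mu>"
  unfolding limiting_subdifferential_def
 proof (intro CollectI conjI \<zeta>(1) exI[of _ "\<lambda>n. \<nu> (r n)"] exI[of _ "\<lambda>n. z (r n)"] allI ballI)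
  show "\<nu> (r n) \<in> P" for n by (rule \<nu>P)
  show "(\<lambda>n. W (\<nu> (r n)) \<mu>) \<longlonglongrightarrow> 0" using LIMSEQ_subseq_LIMSEQ[OF W0 r] by (simp add: comp_def)
  show "z (r n) \<in> strong_subdifferential p q \<phi> (\<nu> (r n))" for n by (rule z)
  have "\<phi> (\<nu> j) \<le> S" for j
   using order_trans[OF _ Sle[of "I j"], of "\<phi> (\<nu> j)"] \<nu>(3)[of j] fdomD(2)[OF \<nu>(1)[of j]] by simp
  then have "(SUP n. \<phi> (\<nu> (r n))) \<le> S" by (intro SUP_least)
  then show "(SUP n. \<phi> (\<nu> (r n))) < \<infinity>" by (rule le_less_trans) (use m(3) in \<open>simp add: S_def\<close>)
  have "(\<integral>x. norm (z j x) powr q \<partial>\<nu> j) \<le> c powr q" for j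
   using powr_mono2[OF less_imp_le[OF q_pos] Lp_norm_nonneg z(2)[of j]] by (simp add: Lp_norm_powr[OF q_pos])
  then have "(SUP n. ereal (\<integral>x. norm (z (r n) x) powr q \<partial>\<nu> (r n))) \<le> ereal (c powr q)" by (intro SUP_least) simp
  then show "(SUP n. ereal (\<integral>x. norm (z (r n) x) powr q \<partial>\<nu> (r n))) < \<infinity>" by (rule le_less_trans) simp
  fix \<xi> :: "'a \<Rightarrow> real" assume "\<xi> \<in> test_functions UNIV"
  then obtain L M where L: "0 \<le> L" "\<And>x y. \<bar>\<xi> x - \<xi> y\<bar> \<le> L * norm (x - y)" and M: "\<And>x. \<bar>\<xi> x\<bar> \<le> M"
   and \<xi>m[measurable]: "\<xi> \<in> borel_measurable borel" using test_function_lipschitz by blast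
  have bd: "integrable N (\<lambda>w. \<xi> (f w) *\<^sub>R g w)"
   if "prob_space N" "g \<in> Lp_space q N" "f \<in> borel_measurable N" for N :: "'b measure" and f :: "'b \<Rightarrow> 'a" and g :: "'b \<Rightarrow> 'a"
  proof -
   note [measurable] = that(3)
   have [measurable]: "g \<in> borel_measurable N" using that(2) by (simp add: Lp_space_def)
   have "(\<lambda>w. \<xi> (f w)) \<in> Lp_space p N"
    using finite_prob_powr_integrable[OF that(1), of "\<lambda>w. \<xi> (f w)" M p] M p_pos by (auto simp: Lp_space_def)
   from holder(1)[OF this that(2)] show ?thesis
    by (rule Bochner_Integration.integrable_bound) auto
  qed
  have i\<zeta>: "integrable \<mu> (\<lambda>x. \<xi> x *\<^sub>R \<zeta> x)"
  proof (rule bd[OF \<mu>s(1) \<zeta>(1)])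
   show "(\<lambda>x. x) \<in> borel_measurable \<mu>" unfolding measurable_cong_sets[OF \<mu>s(2) refl] by measurable
  qed
  have if': "integrable (\<gamma> j) (\<lambda>w. \<xi> (fst w) *\<^sub>R Z j w)" for j by (rule bd[OF \<gamma>s(1) ZL]) measurable
  have is': "integrable (\<gamma> j) (\<lambda>w. \<xi> (snd w) *\<^sub>R Z j w)" for j by (rule bd[OF \<gamma>s(1) ZL]) measurable
  have s_eq: "(\<integral>y. \<xi> y *\<^sub>R z j y \<partial>\<nu> j) = (\<integral>w. \<xi> (snd w) *\<^sub>R Z j w \<partial>\<gamma> j)" for j
  proof -
   have "(\<integral>y. \<xi> y *\<^sub>R z j y \<partial>distr (\<gamma> j) borel snd) = (\<integral>w. \<xi> (snd w) *\<^sub>R z j (snd w) \<partial>\<gamma> j)"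
    by (rule integral_distr) measurable
   then show ?thesis by (simp add: Z_def \<gamma>s(5))
  qed
  have first: "(\<lambda>n. \<integral>w. \<xi> (fst w) *\<^sub>R Z (r n) w \<partial>\<gamma> (r n)) \<longlonglongrightarrow> (\<integral>x. \<xi> x *\<^sub>R \<zeta> x \<partial>\<mu>)"
   unfolding tendsto_componentwise_iff[of _ "\<integral>x. \<xi> x *\<^sub>R \<zeta> x \<partial>\<mu>"]
  proof
   fix b :: 'a assume b: "b \<in> Basis"
   have hm: "(\<lambda>x. \<xi> x *\<^sub>R b) \<in> borel_measurable \<mu>"
    unfolding measurable_cong_sets[OF \<mu>s(2) refl] by measurable
   have "norm (\<xi> x *\<^sub>R b) \<le> M" for x using M[of x] b by simp
   then have "(\<lambda>x. \<xi> x *\<^sub>R b) \<in> Lp_space p \<mu>"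
    using finite_prob_powr_integrable[OF \<mu>s(1) hm, of M p] hm p_pos by (simp add: Lp_space_def)
   from conv[OF this] have "(\<lambda>n. \<integral>w. (\<xi> (fst w) *\<^sub>R Z (r n) w) \<bullet> b \<partial>\<gamma> (r n)) \<longlonglongrightarrow> (\<integral>x. (\<xi> x *\<^sub>R \<zeta> x) \<bullet> b \<partial>\<mu>)"
    by (simp add: inner_commute)
   then show "(\<lambda>n. (\<integral>w. \<xi> (fst w) *\<^sub>R Z (r n) w \<partial>\<gamma> (r n)) \<bullet> b) \<longlonglongrightarrow> (\<integral>x. \<xi> x *\<^sub>R \<zeta> x \<partial>\<mu>) \<bullet> b"
    by (simp only: integral_inner_left[OF if'] integral_inner_left[OF i\<zeta>])
  qed
  \<comment> \<open>The definition evaluates the test function at the second marginal, the weak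
    limit at the first; the difference is at most the Lipschitz constant times the transport
    distance times the norm of the subgradient.\<close>
  have second: "(\<lambda>n. (\<integral>w. \<xi> (snd w) *\<^sub>R Z (r n) w \<partial>\<gamma> (r n)) - (\<integral>w. \<xi> (fst w) *\<^sub>R Z (r n) w \<partial>\<gamma> (r n))) \<longlonglongrightarrow> 0"
  proof (rule tendsto_norm_zero_cancel, rule tendsto_sandwich[OF _ _ tendsto_const])
   have "(\<lambda>n. L * d (r n) * c) \<longlonglongrightarrow> L * 0 * c"
    using LIMSEQ_subseq_LIMSEQ[OF d0 r] by (intro tendsto_intros) (simp add: comp_def)
   then show "(\<lambda>n. L * d (r n) * c) \<longlonglongrightarrow> 0" by simp
   have "norm ((\<integral>w. \<xi> (snd w) *\<^sub>R Z j w \<partial>\<gamma> j) - (\<integral>w. \<xi> (fst w) *\<^sub>R Z j w \<partial>\<gamma> j)) \<le> L * d j * c" for j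
   proof -
    have "norm ((\<integral>w. \<xi> (snd w) *\<^sub>R Z j w \<partial>\<gamma> j) - (\<integral>w. \<xi> (fst w) *\<^sub>R Z j w \<partial>\<gamma> j)) =
      norm (\<integral>w. \<xi> (snd w) *\<^sub>R Z j w - \<xi> (fst w) *\<^sub>R Z j w \<partial>\<gamma> j)"
     by (simp only: Bochner_Integration.integral_diff[OF is' if'])
    also have "\<dots> \<le> (\<integral>w. norm (\<xi> (snd w) *\<^sub>R Z j w - \<xi> (fst w) *\<^sub>R Z j w) \<partial>\<gamma> j)"
     by (rule integral_norm_bound)
    also have "\<dots> \<le> (\<integral>w. L * (norm (fst w - snd w) * norm (Z j w)) \<partial>\<gamma> j)"
    proof (rule integral_mono)
     show "integrable (\<gamma> j) (\<lambda>w. norm (\<xi> (snd w) *\<^sub>R Z j w - \<xi> (fst w) *\<^sub>R Z j w))"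
      by (intro integrable_norm Bochner_Integration.integrable_diff is' if')
     show "integrable (\<gamma> j) (\<lambda>w. L * (norm (fst w - snd w) * norm (Z j w)))"
      by (intro integrable_mult_right holder(1)[OF cL ZL])
     fix w :: "'a \<times> 'a"
     have "\<bar>\<xi> (snd w) - \<xi> (fst w)\<bar> * norm (Z j w) \<le> L * norm (snd w - fst w) * norm (Z j w)"
      by (intro mult_right_mono L) simp
     then show "norm (\<xi> (snd w) *\<^sub>R Z j w - \<xi> (fst w) *\<^sub>R Z j w) \<le> L * (norm (fst w - snd w) * norm (Z j w))"
      by (simp add: norm_minus_commute mult.assoc flip: scaleR_diff_left)
    qed
    also have "\<dots> = L * (\<integral>w. norm (fst w - snd w) * norm (Z j w) \<partial>\<gamma> j)" by simp
    also have "\<dots> \<le> L * (Lp_norm p (\<gamma> j) (\<lambda>w. fst w - snd w) * Lp_norm q (\<gamma> j) (Z j))"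
     by (intro mult_left_mono holder(2)[OF cL ZL] L(1))
    also have "\<dots> \<le> L * (d j * c)"
     by (intro mult_left_mono mult_mono cost ZC L(1) d1 Lp_norm_nonneg)
    finally show ?thesis by (simp add: mult.assoc)
   qed
   then show "\<forall>\<^sub>F n in sequentially. norm ((\<integral>w. \<xi> (snd w) *\<^sub>R Z (r n) w \<partial>\<gamma> (r n)) - (\<integral>w. \<xi> (fst w) *\<^sub>R Z (r n) w \<partial>\<gamma> (r n))) \<le> L * d (r n) * c"
    by (intro always_eventually allI)
  qed simp
  show "(\<lambda>n. \<integral>x. \<xi> x *\<^sub>R z (r n) x \<partial>\<nu> (r n)) \<longlonglongrightarrow> (\<integral>x. \<xi> x *\<^sub>R \<zeta> x \<partial>\<mu>)"
   using tendsto_add[OF second first] by (simp add: s_eq)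
 qed
 then show ?thesis using \<zeta>(2) by (rule that)
qed

text \<open>The bound \<open>K\<close> on the energy is fixed before the infimum over it is taken because the relaxed slope
 itself need not be lower semicontinuous: the recovery sequences of nearby measures may have
 unbounded energies.\<close>

definition "slope_envelope K j \<mu> = (INF \<nu>\<in>{\<nu> \<in> P. W \<nu> \<mu> < 1 / real (Suc j) \<and> \<phi> \<nu> \<le> ereal (real K)}. local_slope p \<phi> \<nu>)"

text \<open>Under a fixed energy bound K, recovery sequences amount to choosing a nearly optimal
  measure in each of the shrinking balls. What remains are countable operations, as measurability
  demands.\<close>

lemma relaxed_slope_eq:
 assumes \<mu>: "\<mu> \<in> P"
 shows "relaxed_slope p \<phi> \<mu> = (INF K. SUP j. slope_envelope K j \<mu>)"
proof (rule antisym)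
 show "(INF K. SUP j. slope_envelope K j \<mu>) \<le> relaxed_slope p \<phi> \<mu>"
  unfolding relaxed_slope_def
 proof (rule INF_greatest)
  fix m assume "m \<in> {m :: nat \<Rightarrow> 'a measure. (\<forall>n. m n \<in> P) \<and> (\<lambda>n. W (m n) \<mu>) \<longlonglongrightarrow> 0 \<and> (SUP n. \<phi> (m n)) < \<infinity>}"
  then have m: "\<And>n. m n \<in> P" "(\<lambda>n. W (m n) \<mu>) \<longlonglongrightarrow> 0" "(SUP n. \<phi> (m n)) < \<infinity>" by auto
  obtain K :: nat where K: "(SUP n. \<phi> (m n)) \<le> ereal (real K)"
  proof (cases "SUP n. \<phi> (m n)")
   case (real x)
   then show ?thesis using real_arch_simple[of x] that by auto
  qed (use m(3) that in auto)
  have \<phi>K: "\<phi> (m n) \<le> ereal (real K)" for n using order_trans[OF SUP_upper K] by auto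
  have "(SUP j. slope_envelope K j \<mu>) \<le> liminf (\<lambda>n. local_slope p \<phi> (m n))"
  proof (rule SUP_least)
   fix j
   have "\<forall>\<^sub>F n in sequentially. W (m n) \<mu> < 1 / real (Suc j)" by (rule order_tendstoD(2)[OF m(2)]) simp
   then have "\<forall>\<^sub>F n in sequentially. slope_envelope K j \<mu> \<le> local_slope p \<phi> (m n)"
    unfolding slope_envelope_def by eventually_elim (rule INF_lower, use m(1) \<phi>K in auto)
   then show "slope_envelope K j \<mu> \<le> liminf (\<lambda>n. local_slope p \<phi> (m n))" by (rule Liminf_bounded)
  qed
  then show "(INF K. SUP j. slope_envelope K j \<mu>) \<le> liminf (\<lambda>n. local_slope p \<phi> (m n))" by (rule INF_lower2[OF UNIV_I])
 qed
 show "relaxed_slope p \<phi> \<mu> \<le> (INF K. SUP j. slope_envelope K j \<mu>)"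
 proof (rule INF_greatest)
  fix K
  show "relaxed_slope p \<phi> \<mu> \<le> (SUP j. slope_envelope K j \<mu>)"
  proof (rule dense_ge)
   fix x assume x: "(SUP j. slope_envelope K j \<mu>) < x"
   have "\<exists>\<nu>. \<nu> \<in> P \<and> W \<nu> \<mu> < 1 / real (Suc j) \<and> \<phi> \<nu> \<le> ereal (real K) \<and> local_slope p \<phi> \<nu> < x" for j
   proof -
    have "slope_envelope K j \<mu> < x" using SUP_upper[of j UNIV "\<lambda>j. slope_envelope K j \<mu>"] x by auto
    then show ?thesis unfolding slope_envelope_def INF_less_iff by blast
   qed
   then obtain m where m: "\<And>j. m j \<in> P" "\<And>j. W (m j) \<mu> < 1 / real (Suc j)" "\<And>j. \<phi> (m j) \<le> ereal (real K)" "\<And>j. local_slope p \<phi> (m j) < x"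
    by metis
   have lim1: "(\<lambda>n. 1 / real (Suc n)) \<longlonglongrightarrow> 0" using LIMSEQ_inverse_real_of_nat by (simp add: inverse_eq_divide)
   have "(\<lambda>j. W (m j) \<mu>) \<longlonglongrightarrow> 0"
    by (rule tendsto_sandwich[OF _ _ tendsto_const lim1]) (use m(2) in \<open>auto simp: W_nonneg less_imp_le\<close>)
   moreover have "(SUP j. \<phi> (m j)) < \<infinity>" by (rule le_less_trans[of _ "ereal (real K)"]) (use m(3) in \<open>auto intro: SUP_least\<close>)
   ultimately have "relaxed_slope p \<phi> \<mu> \<le> liminf (\<lambda>j. local_slope p \<phi> (m j))"
    unfolding relaxed_slope_def using m(1) by (intro INF_lower) auto
   also have "\<dots> \<le> liminf (\<lambda>j::nat. x)" using m(4) by (intro Liminf_mono always_eventually) (auto intro: less_imp_le)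
   finally show "relaxed_slope p \<phi> \<mu> \<le> x" by (simp add: Liminf_const)
  qed
 qed
qed

text \<open>For fixed K the supremum over j is lower semicontinuous along the curve: for s near t, a
  ball about u(s) of half the radius lies in the ball about u(t), so the infimum over it is
  larger.\<close>

lemma relaxed_slope_measurable:
 assumes u: "\<And>t :: real. u t \<in> P" and cont: "\<And>t e. 0 < e ==> \<exists>d>0. \<forall>s. \<bar>s - t\<bar> < d \<longrightarrow> W (u s) (u t) < e"
 shows "(\<lambda>t. relaxed_slope p \<phi> (u t)) \<in> borel_measurable borel"
proof -
 have "(\<lambda>t. SUP j. slope_envelope K j (u t)) \<in> borel_measurable borel" for K
 proof (rule borel_measurableI_greater)
  fix y
  have "open {t. y < (SUP j. slope_envelope K j (u t))}"
   unfolding open_dist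
  proof (intro ballI)
   fix t assume "t \<in> {t. y < (SUP j. slope_envelope K j (u t))}"
   then obtain j where j: "y < slope_envelope K j (u t)" by (auto simp: less_SUP_iff)
   \<comment> \<open>1 / (i + 1) is half of 1 / (j + 1).\<close>
   define i where "i = Suc (2 * j)"
   have i: "1 / real (Suc i) + 1 / real (Suc i) = 1 / real (Suc j)" by (simp add: i_def field_simps)
   obtain d where d: "0 < d" "\<And>s. \<bar>s - t\<bar> < d ==> W (u s) (u t) < 1 / real (Suc i)"
    using cont[of "1 / real (Suc i)" t] by auto
   have "y < (SUP j. slope_envelope K j (u s))" if "\<bar>s - t\<bar> < d" for s
   proof -
    have "slope_envelope K j (u t) \<le> slope_envelope K i (u s)"
     unfolding slope_envelope_def
    proof (rule INF_superset_mono, rule subsetI)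
     fix \<nu> assume \<nu>: "\<nu> \<in> {\<nu> \<in> P. W \<nu> (u s) < 1 / real (Suc i) \<and> \<phi> \<nu> \<le> ereal (real K)}"
     then have "W \<nu> (u t) < 1 / real (Suc j)" using W_triangle[of \<nu> "u s" "u t"] u d(2)[OF that] i by auto
     with \<nu> show "\<nu> \<in> {\<nu> \<in> P. W \<nu> (u t) < 1 / real (Suc j) \<and> \<phi> \<nu> \<le> ereal (real K)}" by auto
    qed simp
    with j show ?thesis using SUP_upper[of i UNIV "\<lambda>j. slope_envelope K j (u s)"] by (auto intro: less_le_trans)
   qed
   then show "\<exists>e>0. \<forall>s. dist s t < e \<longrightarrow> s \<in> {t. y < (SUP j. slope_envelope K j (u t))}"
    using d(1) by (auto simp: dist_real_def)
  qed
  then show "{t \<in> space borel. y < (SUP j. slope_envelope K j (u t))} \<in> sets borel" by simp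
 qed
 then have "(\<lambda>t. INF K. SUP j. slope_envelope K j (u t)) \<in> borel_measurable borel"
  by (intro borel_measurable_INF) auto
 then show ?thesis by (simp add: relaxed_slope_eq[OF u])
qed

end

lemma powr_tangent_eq:
 fixes x y p :: real
 assumes "1 < p" "0 \<le> x" "0 \<le> y" and eq: "x powr p = y powr p + p * (y powr (p - 1) * (x - y))"
 shows "x = y"
proof -
 have mvt: "\<exists>z. a < z \<and> z < b \<and> b powr p - a powr p = p * z powr (p - 1) * (b - a)" if "0 \<le> a" "a < b" for a b
 proof -
  have "\<exists>z\<in>{a<..<b}. b powr p - a powr p = (\<lambda>h. p * z powr (p - 1) * h) (b - a)"
  proof (rule mvt_simple[OF that(2), of "\<lambda>x. x powr p" "\<lambda>z h. p * z powr (p - 1) * h"])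
   fix x assume x: "a \<le> x" "x \<le> b"
   show "((\<lambda>x. x powr p) has_derivative (\<lambda>h. p * x powr (p - 1) * h)) (at x within {a..b})"
   proof (cases "0 < x")
    case True
    then have "((\<lambda>x. x powr p) has_real_derivative p * x powr (p - 1)) (at x)" by (auto intro!: derivative_eq_intros)
    then show ?thesis by (simp add: has_field_derivative_def has_derivative_at_withinI mult_commute_abs)
   next
    case False
    then have x0: "x = 0" using x that by auto
    have "((\<lambda>y. y powr (p - 1)) \<longlongrightarrow> 0 powr (p - 1)) (at 0 within {a..b})"
     using assms(1) that by (intro tendsto_powr' tendsto_intros) (auto simp: eventually_at_filter)
    moreover have "\<forall>\<^sub>F y in at 0 within {a..b}. y powr (p - 1) = (y powr p - 0 powr p) / (y - 0)"
     unfolding eventually_at_filter using that by (intro always_eventually allI impI) (auto simp: powr_diff)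
    ultimately have "((\<lambda>y. (y powr p - 0 powr p) / (y - 0)) \<longlongrightarrow> 0) (at 0 within {a..b})"
     using assms(1) Lim_transform_eventually by fastforce
    then have "((\<lambda>x. x powr p) has_real_derivative 0) (at 0 within {a..b})" by (simp add: has_field_derivative_iff)
    moreover have "(*) (0::real) = (\<lambda>h. 0)" by auto
    ultimately show ?thesis using x0 assms(1) by (simp add: has_field_derivative_def)
   qed
  qed
  then show ?thesis by auto
 qed
 have "False" if xy: "x < y"
 proof -
  obtain z where z: "x < z" "z < y" "y powr p - x powr p = p * z powr (p - 1) * (y - x)" using mvt[OF assms(2) xy] by blast
  have "z powr (p - 1) < y powr (p - 1)" using z assms by (intro powr_less_mono2) auto
  then have "p * z powr (p - 1) * (y - x) < p * y powr (p - 1) * (y - x)" using xy assms(1) by simp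
  then show False using z(3) eq by (simp add: algebra_simps)
 qed
 moreover have "False" if xy: "y < x"
 proof -
  obtain z where z: "y < z" "z < x" "x powr p - y powr p = p * z powr (p - 1) * (x - y)" using mvt[OF assms(3) xy] by blast
  have "y powr (p - 1) < z powr (p - 1)" using z assms by (intro powr_less_mono2) auto
  then have "p * y powr (p - 1) * (x - y) < p * z powr (p - 1) * (x - y)" using xy assms(1) by simp
  then show False using z(3) eq by simp
 qed
 ultimately show ?thesis by (meson linorder_neqE)
qed

context conjugate_exponents
begin

lemma inner_young:
 fixes a b :: "'a::euclidean_space"
 shows "0 \<le> norm a powr q / q + norm b powr p / p + a \<bullet> b"
 using young[of "norm b" "norm a"] Cauchy_Schwarz_ineq2[of a b] by (simp add: mult.commute abs_le_iff)

text \<open>Equality in Young's inequality gives |b| = |a|^(q-1), equality in Cauchy-Schwarz gives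
  the direction; together they make |b + j_q(a)|^2 vanish.\<close>

lemma inner_young_eq:
 fixes a b :: "'a::euclidean_space"
 assumes eq: "norm a powr q / q + norm b powr p / p + a \<bullet> b = 0"
 shows "b = - duality_map q a"
proof -
 define y where "y = norm a powr (q - 1)"
 have y: "0 \<le> y" "y powr p = norm a powr q" by (auto simp: y_def powr_powr q_minus_1_times_p)
 have "(q - 1) * (p - 1) = 1" using p_minus_1_times_q q_minus_1_times_p by (simp add: algebra_simps)
 then have yp: "y powr (p - 1) = norm a" by (simp add: y_def powr_powr)
 have cs: "- (norm a * norm b) \<le> a \<bullet> b" using Cauchy_Schwarz_ineq2[of a b] by (simp add: abs_le_iff)
 have ab: "norm b * norm a = norm b powr p / p + norm a powr q / q"
  using young[of "norm b" "norm a"] cs eq by (simp add: mult.commute)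
 have ip: "a \<bullet> b = - (norm a * norm b)" using ab eq by (simp add: mult.commute)
 have "norm b = y"
 proof (rule powr_tangent_eq[OF p_gt_1 norm_ge_zero y(1)])
  have "p * (norm b * norm a) = p * (norm b powr p / p + norm a powr q / q)" by (simp only: ab)
  also have "\<dots> = norm b powr p + (p * (1 / q)) * norm a powr q" using p_pos by (simp add: distrib_left)
  also have "p * (1 / q) = p - 1" using inverse_q p_pos by simp
  finally have "p * (norm a * norm b) = norm b powr p + (p - 1) * norm a powr q" by (simp add: mult.commute)
  moreover have "norm a * y = norm a powr q"
   by (cases "a = 0") (auto simp: y_def powr_diff)
  then have "p * (norm a * (norm b - y)) = p * (norm a * norm b) - p * norm a powr q"
   by (simp add: right_diff_distrib)
  ultimately show "norm b powr p = y powr p + p * (y powr (p - 1) * (norm b - y))"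
   unfolding yp y(2) left_diff_distrib by linarith
 qed
 show ?thesis
 proof (cases "a = 0")
  case True
  then have "norm b = 0" using \<open>norm b = y\<close> by (simp add: y_def)
  then show ?thesis using True by (simp add: duality_map_def)
 next
  case False
  have d: "b \<bullet> duality_map q a = - (y * y)"
  proof -
   have "b \<bullet> duality_map q a = norm a powr (q - 2) * (a \<bullet> b)" using False by (simp add: duality_map_def inner_commute)
   also have "\<dots> = - ((norm a powr (q - 2) * norm a) * norm b)" by (simp add: ip)
   also have "norm a powr (q - 2) * norm a = y"
    using powr_add[of "norm a" "q - 2" 1] False by (simp add: y_def)
   finally show ?thesis using \<open>norm b = y\<close> by simp
  qed
  have "(norm (b + duality_map q a))\<^sup>2 = (norm b)\<^sup>2 + 2 * (b \<bullet> duality_map q a) + (norm (duality_map q a))\<^sup>2"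
   by (simp add: power2_norm_eq_inner inner_add_left inner_add_right inner_commute)
  also have "\<dots> = 0" using d \<open>norm b = y\<close> by (simp add: norm_duality_map y_def power2_eq_square)
  finally show ?thesis by (simp add: eq_neg_iff_add_eq_0)
 qed
qed

end

section \<open>Speed of absolutely continuous curves\<close>

lemma set_integral_Icc_mono:
 fixes m m' :: "real \<Rightarrow> real"
 assumes "set_integrable lborel X m" "set_integrable lborel Y m'"
  and "\<And>x. x \<in> X ==> x \<in> Y \<and> m x \<le> m' x" "\<And>x. x \<in> Y ==> 0 \<le> m' x"
 shows "(LINT x:X|lborel. m x) \<le> (LINT x:Y|lborel. m' x)"
 unfolding set_lebesgue_integral_def
 using assms(1,2) unfolding set_integrable_def
 by (rule integral_mono) (use assms(3,4) in \<open>auto simp: indicator_def\<close>)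

lemma integrable_imp_set_integrable:
 fixes m :: "real \<Rightarrow> real"
 shows "integrable lborel m ==> X \<in> sets borel ==> set_integrable lborel X m"
 unfolding set_integrable_def by (rule integrable_mult_indicator) auto

context
 fixes p :: real assumes p: "1 < p"
begin

lemma metric_derivative_on_interval:
 fixes u :: "real \<Rightarrow> 'a::euclidean_space measure" and m :: "real \<Rightarrow> real"
 assumes T: "0 < T" and u: "\<And>t. 0 \<le> t ==> t \<le> T ==> u t \<in> wasserstein_space p"
  and m: "integrable lborel m" "\<And>x. 0 \<le> m x"
  and le: "\<And>s t. 0 \<le> s ==> s \<le> t ==> t \<le> T ==> wasserstein p (u s) (u t) \<le> (LINT x:{s..t}|lborel. m x)"
 obtains w where "w \<in> borel_measurable borel" "\<And>x. 0 \<le> w x" "\<And>x. w x \<le> m x"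
  "\<And>s t. 0 \<le> s ==> s \<le> t ==> t \<le> T ==> wasserstein p (u s) (u t) \<le> (LINT x:{s..t}|lborel. w x)"
  "AE t in lborel. 0 < t \<longrightarrow> t < T \<longrightarrow> metric_derivative p u t = w t"
proof -
 \<comment> \<open>Clamping times to [0, T] produces a pseudo-distance on the whole line, as
   \<open>metric_speed_exists\<close> requires.\<close>
 define c where "c x = max 0 (min T x)" for x
 define D where "D s t = wasserstein p (u (c s)) (u (c t))" for s t
 have c: "0 \<le> c x" "c x \<le> T" for x using T by (auto simp: c_def)
 have cid: "c x = x" if "0 \<le> x" "x \<le> T" for x using that by (simp add: c_def)
 have uc: "u (c x) \<in> wasserstein_space p" for x using u c by blast
 have le': "D s t \<le> (LINT x:{s..t}|lborel. m x)" if st: "s \<le> t" for s t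
 proof (cases "c s = c t")
  case True
  have "0 \<le> (LINT x:{s..t}|lborel. m x)"
   unfolding set_lebesgue_integral_def using m(2) by (intro integral_nonneg_AE) auto
  then show ?thesis using True wasserstein_self[OF p uc] by (simp add: D_def)
 next
  case False
  then have cc: "c s \<le> c t" "s \<le> c s" "c t \<le> t" using st T by (auto simp: c_def max_def min_def split: if_splits)
  have "D s t \<le> (LINT x:{c s..c t}|lborel. m x)" unfolding D_def by (intro le c cc)
  also have "\<dots> \<le> (LINT x:{s..t}|lborel. m x)"
   by (intro set_integral_Icc_mono integrable_imp_set_integrable m) (use cc in auto)
  finally show ?thesis .
 qed
 have D: "\<And>s t. 0 \<le> D s t" "\<And>s t. D s t = D t s" "\<And>s. D s s = 0" "\<And>r s t. D r t \<le> D r s + D s t"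
  unfolding D_def
  by (rule wasserstein_nonneg[OF p] wasserstein_commute[OF p] wasserstein_self[OF p uc] wasserstein_triangle[OF p uc uc uc])+
 obtain w where w: "w \<in> borel_measurable borel" "\<And>x. 0 \<le> w x" "\<And>x. w x \<le> m x"
  "\<And>s t. s \<le> t ==> D s t \<le> (LINT x:{s..t}|lborel. w x)"
  "AE t in lborel. ((\<lambda>s. D s t / \<bar>s - t\<bar>) \<longlongrightarrow> w t) (at t)"
  using metric_speed_exists[OF m D le'] by blast
 show ?thesis
 proof (rule that[OF w(1-3)])
  show "wasserstein p (u s) (u t) \<le> (LINT x:{s..t}|lborel. w x)" if "0 \<le> s" "s \<le> t" "t \<le> T" for s t
   using w(4)[of s t] that by (simp add: D_def cid)
  show "AE t in lborel. 0 < t \<longrightarrow> t < T \<longrightarrow> metric_derivative p u t = w t"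
   using w(5)
  proof eventually_elim
   case (elim t)
   show ?case
   proof (intro impI)
    assume t: "0 < t" "t < T"
    then have "t \<in> {0<..<T}" by simp
    then have "\<forall>\<^sub>F s in at t. s \<in> {0<..<T}"
     using eventually_at_in_open'[of "{0<..<T}" t] by simp
    then have "\<forall>\<^sub>F s in at t. D s t / \<bar>s - t\<bar> = wasserstein p (u s) (u t) / \<bar>s - t\<bar>"
     by eventually_elim (use t in \<open>simp add: D_def cid\<close>)
    with elim have "((\<lambda>s. wasserstein p (u s) (u t) / \<bar>s - t\<bar>) \<longlongrightarrow> w t) (at t)"
     by (rule Lim_transform_eventually)
    moreover have "at t within {0..} = at t" using t by (intro at_within_interior) simp
    ultimately show "metric_derivative p u t = w t"
     unfolding metric_derivative_def by (simp add: tendsto_Lim)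
   qed
  qed
 qed
qed

text \<open>The bound in \<open>locally_ac_curve\<close> may change sign and be integrable only
  locally. Here it is nonnegative and integrable on the line, one for each [0, n + 1], which is what
  the differentiation theorems take. For curves in the Wasserstein space the two notions
  agree.\<close>

definition "ac_on_intervals u \<longleftrightarrow> (\<forall>n::nat. \<exists>m :: real \<Rightarrow> real. integrable lborel m \<and> (\<forall>x. 0 \<le> m x) \<and>
 (\<forall>s t. 0 \<le> s \<longrightarrow> s \<le> t \<longrightarrow> t \<le> real n + 1 \<longrightarrow> wasserstein p (u s) (u t) \<le> (LINT x:{s..t}|lborel. m x)))"

lemma ac_on_intervalsE:
 assumes "ac_on_intervals u"
 obtains m :: "real \<Rightarrow> real" where "integrable lborel m" "\<And>x. 0 \<le> m x"
  "\<And>s t. 0 \<le> s ==> s \<le> t ==> t \<le> real n + 1 ==> wasserstein p (u s) (u t) \<le> (LINT x:{s..t}|lborel. m x)"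
proof -
 from spec[OF assms[unfolded ac_on_intervals_def], of n] obtain m :: "real \<Rightarrow> real"
  where "integrable lborel m \<and> (\<forall>x. 0 \<le> m x) \<and> (\<forall>s t. 0 \<le> s \<longrightarrow> s \<le> t \<longrightarrow> t \<le> real n + 1 \<longrightarrow>
   wasserstein p (u s) (u t) \<le> (LINT x:{s..t}|lborel. m x))" by (rule exE)
 then show thesis by (intro that[of m]) simp_all
qed

lemma locally_ac_imp_intervals:
 assumes "locally_ac_curve p u"
 shows "ac_on_intervals u"
 unfolding ac_on_intervals_def
proof
 fix n :: nat
 obtain m where m: "\<And>T. 0 < T ==> set_integrable lborel {0<..<T} m"
  and le: "\<And>s t. 0 \<le> s ==> s \<le> t ==> wasserstein p (u s) (u t) \<le> (LINT r:{s<..<t}|lborel. m r)"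
  using assms unfolding locally_ac_curve_def by blast
 define m' where "m' x = \<bar>indicator {0<..<real n + 1} x * m x\<bar>" for x
 have im: "integrable lborel (\<lambda>x. indicator {0<..<real n + 1} x * m x)"
  using m[of "real n + 1"] by (simp add: set_integrable_def)
 then have im': "integrable lborel m'" unfolding m'_def by (rule integrable_abs)
 have "wasserstein p (u s) (u t) \<le> (LINT x:{s..t}|lborel. m' x)" if st: "0 \<le> s" "s \<le> t" "t \<le> real n + 1" for s t
 proof -
  have "set_integrable lborel {s<..<t} (\<lambda>x. indicator {0<..<real n + 1} x * m x)"
   using im by (rule integrable_imp_set_integrable) simp
  then have "set_integrable lborel {s<..<t} m"
   by (rule set_integrable_cong[THEN iffD1, rotated 3]) (use st in \<open>auto simp: indicator_def\<close>)
  then have "(LINT r:{s<..<t}|lborel. m r) \<le> (LINT x:{s..t}|lborel. m' x)"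
   by (rule set_integral_Icc_mono[OF _ integrable_imp_set_integrable[OF im']])
    (use st in \<open>auto simp: m'_def indicator_def\<close>)
  with le[OF st(1,2)] show ?thesis by linarith
 qed
 then show "\<exists>m. integrable lborel m \<and> (\<forall>x. 0 \<le> m x) \<and>
  (\<forall>s t. 0 \<le> s \<longrightarrow> s \<le> t \<longrightarrow> t \<le> real n + 1 \<longrightarrow> wasserstein p (u s) (u t) \<le> (LINT x:{s..t}|lborel. m x))"
  using im' by (intro exI[of _ m']) (auto simp: m'_def)
qed

text \<open>The speeds found on the intervals [0, n + 1] all agree almost everywhere with the metric
  derivative, so they can be patched together by using index floor(t) at time t.\<close>

lemma ac_curve_speed:
 fixes u :: "real \<Rightarrow> 'a::euclidean_space measure"
 assumes u: "\<And>t. 0 \<le> t ==> u t \<in> wasserstein_space p" and ac: "ac_on_intervals u"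
 obtains w where "w \<in> borel_measurable borel" "\<And>x. 0 \<le> w x" "\<And>T. set_integrable lborel {0<..<T} w"
  "\<And>s t. 0 \<le> s ==> s \<le> t ==> wasserstein p (u s) (u t) \<le> (LINT x:{s<..<t}|lborel. w x)"
  "AE t in lborel. 0 < t \<longrightarrow> metric_derivative p u t = w t"
proof -
 define Q where "Q n w \<longleftrightarrow> w \<in> borel_measurable borel \<and> (\<forall>x. 0 \<le> w x) \<and> integrable lborel w \<and>
  (\<forall>s t. 0 \<le> s \<longrightarrow> s \<le> t \<longrightarrow> t \<le> real n + 1 \<longrightarrow> wasserstein p (u s) (u t) \<le> (LINT x:{s..t}|lborel. w x)) \<and>
  (AE t in lborel. 0 < t \<longrightarrow> t < real n + 1 \<longrightarrow> metric_derivative p u t = w t)" for n :: nat and w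
 have ex: "\<exists>w. Q n w" for n
 proof -
  obtain m where m: "integrable lborel m" "\<And>x. 0 \<le> m x"
   "\<And>s t. 0 \<le> s ==> s \<le> t ==> t \<le> real n + 1 ==> wasserstein p (u s) (u t) \<le> (LINT x:{s..t}|lborel. m x)"
   by (rule ac_on_intervalsE[OF ac, of n], rule that)
  have n: "0 < real n + 1" by simp
  obtain w where w: "w \<in> borel_measurable borel" "\<And>x. 0 \<le> w x" "\<And>x. w x \<le> m x"
   "\<And>s t. 0 \<le> s ==> s \<le> t ==> t \<le> real n + 1 ==> wasserstein p (u s) (u t) \<le> (LINT x:{s..t}|lborel. w x)"
   "AE t in lborel. 0 < t \<longrightarrow> t < real n + 1 \<longrightarrow> metric_derivative p u t = w t"
   by (rule metric_derivative_on_interval[OF n u m]) (assumption | rule that)+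
  have iw: "integrable lborel w"
  proof (rule Bochner_Integration.integrable_bound[OF m(1)])
   show "AE x in lborel. norm (w x) \<le> norm (m x)" by (simp add: w(2,3) m(2))
  qed (use w(1) in simp)
  show ?thesis unfolding Q_def by (intro exI[of _ w] conjI allI impI w(1,2,4,5) iw)
 qed
 define wn where "wn n = (SOME w. Q n w)" for n
 have "Q n (wn n)" for n unfolding wn_def by (rule someI_ex[OF ex])
 note wnQ = this[unfolded Q_def]
 have wn[measurable]: "\<And>n. wn n \<in> borel_measurable borel" and wn0: "\<And>n x. 0 \<le> wn n x"
  and wni: "\<And>n. integrable lborel (wn n)"
  and wnle: "\<And>n s t. 0 \<le> s ==> s \<le> t ==> t \<le> real n + 1 ==> wasserstein p (u s) (u t) \<le> (LINT x:{s..t}|lborel. wn n x)"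
  and wnae: "\<And>n. AE t in lborel. 0 < t \<longrightarrow> t < real n + 1 \<longrightarrow> metric_derivative p u t = wn n t"
  using wnQ by simp_all
 define w where "w t = wn (nat \<lfloor>t\<rfloor>) t" for t
 have wm[measurable]: "w \<in> borel_measurable borel"
  unfolding w_def by (rule measurable_compose_countable) measurable
 have ae: "AE t in lborel. \<forall>n. 0 < t \<longrightarrow> t < real n + 1 \<longrightarrow> metric_derivative p u t = wn n t"
  unfolding AE_all_countable using wnae by blast
 have md: "AE t in lborel. 0 < t \<longrightarrow> metric_derivative p u t = w t"
  using ae
 proof eventually_elim
  case (elim t)
  show ?case
  proof
   assume t: "0 < t"
   then have "t < real (nat \<lfloor>t\<rfloor>) + 1" by linarith
   with elim t show "metric_derivative p u t = w t" by (simp add: w_def)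
  qed
 qed
 have eq: "AE t in lborel. 0 < t \<longrightarrow> t < real n + 1 \<longrightarrow> wn n t = w t" for n
  using ae md by eventually_elim auto
 show ?thesis
 proof (rule that[OF wm _ _ _ md])
  show "0 \<le> w x" for x by (simp add: w_def wn0)
  show "set_integrable lborel {0<..<T} w" for T
  proof -
   define n where "n = nat \<lceil>T\<rceil>"
   have n: "T < real n + 1" unfolding n_def by linarith
   have "integrable lborel (\<lambda>x. indicator {0<..<T} x *\<^sub>R wn n x)"
    using integrable_imp_set_integrable[OF wni] by (simp add: set_integrable_def)
   then have "integrable lborel (\<lambda>x. indicator {0<..<T} x *\<^sub>R w x)"
   proof (rule integrable_cong_AE_imp)
    show "AE x in lborel. indicator {0<..<T} x *\<^sub>R wn n x = indicator {0<..<T} x *\<^sub>R w x"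
     using eq[of n] by eventually_elim (use n in \<open>auto simp: indicator_def\<close>)
   qed measurable
   then show ?thesis by (simp add: set_integrable_def)
  qed
  fix s t :: real assume st: "0 \<le> s" "s \<le> t"
  define n where "n = nat \<lceil>t\<rceil>"
  have n: "t < real n + 1" unfolding n_def by linarith
  have "(LINT x:{s..t}|lborel. wn n x) = (LINT x:{s<..<t}|lborel. w x)"
   unfolding set_lebesgue_integral_def
  proof (rule integral_cong_AE)
   show "AE x in lborel. indicator {s..t} x *\<^sub>R wn n x = indicator {s<..<t} x *\<^sub>R w x"
    using eq[of n] AE_lborel_singleton[of s] AE_lborel_singleton[of t]
    by eventually_elim (use n st in \<open>auto simp: indicator_def\<close>)
  qed measurable
  then show "wasserstein p (u s) (u t) \<le> (LINT x:{s<..<t}|lborel. w x)"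
   using wnle[of s t n] st n by simp
 qed
qed

lemma intervals_imp_locally_ac:
 assumes "\<And>t. 0 \<le> t ==> u t \<in> wasserstein_space p" "ac_on_intervals u"
 shows "locally_ac_curve p u"
proof -
 obtain w where "\<And>T. set_integrable lborel {0<..<T} w"
  "\<And>s t. 0 \<le> s ==> s \<le> t ==> wasserstein p (u s) (u t) \<le> (LINT x:{s<..<t}|lborel. w x)"
  by (rule ac_curve_speed[OF assms]) (assumption | rule that)+
 then show ?thesis unfolding locally_ac_curve_def using assms(1) by blast
qed

lemma ac_curve_continuous:
 assumes ac: "ac_on_intervals u" and e: "0 < e"
 shows "\<exists>d>0. \<forall>s. \<bar>s - t\<bar> < d \<longrightarrow> wasserstein p (u (max 0 s)) (u (max 0 t)) < e"
proof -
 define n where "n = nat \<lceil>\<bar>t\<bar> + 1\<rceil>"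
 have n: "\<bar>t\<bar> + 1 \<le> real n" unfolding n_def by linarith
 obtain m where m: "integrable lborel m" "\<And>x. 0 \<le> m x"
  "\<And>s t. 0 \<le> s ==> s \<le> t ==> t \<le> real n + 1 ==> wasserstein p (u s) (u t) \<le> (LINT x:{s..t}|lborel. m x)"
  by (rule ac_on_intervalsE[OF ac, of n], rule that)
 obtain d where d: "0 < d" "\<And>s t. s \<le> t ==> t - s < d ==> (LINT x:{s..t}|lborel. m x) < e"
  using integral_Icc_tendsto_0[OF m(1) e] by blast
 have "wasserstein p (u (max 0 s)) (u (max 0 t)) < e" if s: "\<bar>s - t\<bar> < min 1 d" for s
 proof (cases "s \<le> t")
  case True
  have "wasserstein p (u (max 0 s)) (u (max 0 t)) \<le> (LINT x:{max 0 s..max 0 t}|lborel. m x)"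
   by (rule m(3)) (use True n in auto)
  also have "\<dots> < e" by (rule d(2)) (use True s in auto)
  finally show ?thesis .
 next
  case False
  have "wasserstein p (u (max 0 t)) (u (max 0 s)) \<le> (LINT x:{max 0 t..max 0 s}|lborel. m x)"
   by (rule m(3)) (use False n s in auto)
  also have "\<dots> < e" by (rule d(2)) (use False s in auto)
  finally show ?thesis by (simp add: wasserstein_commute[OF p, of "u (max 0 s)"])
 qed
 then show ?thesis using d(1) by (intro exI[of _ "min 1 d"]) auto
qed

end

section \<open>The dissipation at a fixed time\<close>

lemma ennpowr_ennreal: "0 \<le> x ==> ennpowr (ennreal x) a = ennreal (x powr a)"
 by (simp add: ennpowr_def)

lemma ennpowr_mono: "0 \<le> a ==> x \<le> y ==> ennpowr x a \<le> ennpowr y a"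
 by (cases x; cases y) (auto simp: ennpowr_def top_unique intro!: ennreal_leI powr_mono2)

lemma ennpowr_measurable[measurable]: "f \<in> borel_measurable M ==> (\<lambda>x. ennpowr (f x) a) \<in> borel_measurable M"
proof -
 assume [measurable]: "f \<in> borel_measurable M"
 show "(\<lambda>x. ennpowr (f x) a) \<in> borel_measurable M" unfolding ennpowr_def by measurable
qed

lemma ennpowr_le_cancel:
 assumes "0 < a" "0 \<le> y" "ennpowr x a \<le> ennreal (y powr a)"
 shows "x \<le> ennreal y"
proof (cases x)
 case (real r)
 then have "ennreal (r powr a) \<le> ennreal (y powr a)" using assms(3) by (simp only: real ennpowr_ennreal)
 then have "r powr a \<le> y powr a" by (subst (asm) ennreal_le_iff) simp_all
 then have "\<not> y < r" using powr_less_mono2[OF assms(1,2), of r] by linarith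
 then have "r \<le> y" by simp
 then show ?thesis using real by (simp add: ennreal_leI)
qed (use assms(3) in \<open>simp add: ennpowr_def top_unique\<close>)

lemma enn2ereal_le_ereal: "enn2ereal x \<le> ereal r \<longleftrightarrow> 0 \<le> r \<and> x \<le> ennreal r"
proof (cases x)
 case (real y)
 then show ?thesis by (auto simp: ennreal.rep_eq max_def ennreal_le_iff)
qed (auto simp: top_unique top_ereal_def)

lemma ereal_eq_enn2ereal: "ereal r = enn2ereal x \<longleftrightarrow> 0 \<le> r \<and> x = ennreal r"
proof (cases x)
 case (real y)
 then show ?thesis by (auto simp: ennreal.rep_eq max_def)
qed (auto simp: top_ereal_def)

lemma nn_integral_Icc_split:
 fixes f :: "real \<Rightarrow> ennreal"
 assumes [measurable]: "f \<in> borel_measurable borel" and "a \<le> b" "b \<le> c"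
 shows "(\<integral>\<^sup>+x\<in>{a..c}. f x \<partial>lborel) = (\<integral>\<^sup>+x\<in>{a..b}. f x \<partial>lborel) + (\<integral>\<^sup>+x\<in>{b..c}. f x \<partial>lborel)"
proof -
 have "(\<integral>\<^sup>+x\<in>{a..c}. f x \<partial>lborel) = (\<integral>\<^sup>+x. f x * indicator {a..b} x + f x * indicator {b..c} x \<partial>lborel)"
  by (rule nn_integral_cong_AE, use AE_lborel_singleton[of b] in eventually_elim)
   (use assms(2,3) in \<open>auto simp: indicator_def\<close>)
 also have "\<dots> = (\<integral>\<^sup>+x\<in>{a..b}. f x \<partial>lborel) + (\<integral>\<^sup>+x\<in>{b..c}. f x \<partial>lborel)"
  by (rule nn_integral_add) measurable
 finally show ?thesis .
qed

text \<open>J + g is the integral of the defect in Young's inequality, hence nonnegative, and I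
  \<ge> J because S dominates the norm of z. If I \<le> -g, both gaps close: the first gives the
  flow equation, the second the value of S.\<close>

lemma (in conjugate_exponents) pointwise_dissipation:
 fixes z v :: "'a::euclidean_space \<Rightarrow> 'a"
 assumes z: "z \<in> Lp_space q \<mu>" and v: "v \<in> Lp_space p \<mu>"
  and w: "Lp_norm p \<mu> v = w" and g: "g = (\<integral>x. z x \<bullet> v x \<partial>\<mu>)" and S: "ennreal (Lp_norm q \<mu> z) \<le> S"
 defines "I \<equiv> ennreal (1 / q) * ennpowr S q + ennreal (1 / p) * ennreal (w powr p)"
 shows "ennreal (- g) \<le> I"
  and "I \<le> ennreal (- g) ==> (AE x in \<mu>. v x = - duality_map q (z x)) \<and> S = ennreal (Lp_norm q \<mu> z)"
  and "(AE x in \<mu>. v x = - duality_map q (z x)) ==> S = ennreal (Lp_norm q \<mu> z) ==> g \<le> 0 \<and> I = ennreal (- g)"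
proof -
 define N where "N = Lp_norm q \<mu> z"
 define J where "J = N powr q / q + w powr p / p"
 have [measurable]: "z \<in> borel_measurable \<mu>" "v \<in> borel_measurable \<mu>" using z v by (auto simp: Lp_space_def)
 have N: "0 \<le> N" "N powr q = (\<integral>x. norm (z x) powr q \<partial>\<mu>)" by (simp_all add: N_def Lp_norm_nonneg Lp_norm_powr q_pos)
 have wp: "0 \<le> w" "w powr p = (\<integral>x. norm (v x) powr p \<partial>\<mu>)"
  unfolding w[symmetric] by (simp_all add: Lp_norm_nonneg Lp_norm_powr p_pos)
 have J0: "0 \<le> J" using p_pos q_pos by (simp add: J_def)
 have i: "integrable \<mu> (\<lambda>x. norm (z x) powr q / q + norm (v x) powr p / p + z x \<bullet> v x)"
  and ieq: "(\<integral>x. norm (z x) powr q / q + norm (v x) powr p / p + z x \<bullet> v x \<partial>\<mu>) = J + g"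
 proof -
  have iz: "integrable \<mu> (\<lambda>x. norm (z x) powr q / q)" and iv: "integrable \<mu> (\<lambda>x. norm (v x) powr p / p)"
   using z v by (auto simp: Lp_space_def)
  have ii: "integrable \<mu> (\<lambda>x. z x \<bullet> v x)" using holder_inner(1)[OF v z] by (simp add: inner_commute)
  show "integrable \<mu> (\<lambda>x. norm (z x) powr q / q + norm (v x) powr p / p + z x \<bullet> v x)"
   by (intro Bochner_Integration.integrable_add iz iv ii)
  show "(\<integral>x. norm (z x) powr q / q + norm (v x) powr p / p + z x \<bullet> v x \<partial>\<mu>) = J + g"
   by (simp add: Bochner_Integration.integral_add[OF Bochner_Integration.integrable_add[OF iz iv] ii]
     Bochner_Integration.integral_add[OF iz iv] J_def N(2) wp(2) g)
 qed
 have Jg: "0 \<le> J + g" unfolding ieq[symmetric] by (rule integral_nonneg_AE) (simp add: inner_young)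
 have JI: "ennreal J = ennreal (1 / q) * ennpowr (ennreal N) q + ennreal (1 / p) * ennreal (w powr p)"
  using p_pos q_pos N(1) by (simp add: J_def ennpowr_ennreal flip: ennreal_mult ennreal_plus)
 have JI_le: "ennreal J \<le> I"
  unfolding JI I_def by (intro add_right_mono mult_left_mono ennpowr_mono) (use q_pos S in \<open>auto simp: N_def\<close>)
 have "ennreal (- g) \<le> ennreal J" using Jg by (intro ennreal_leI) simp
 then show "ennreal (- g) \<le> I" using JI_le by (rule order_trans)
 show "(AE x in \<mu>. v x = - duality_map q (z x)) \<and> S = ennreal (Lp_norm q \<mu> z)" if le: "I \<le> ennreal (- g)"
 proof -
  have Jle: "ennreal J \<le> ennreal (- g)" using JI_le le by (rule order_trans)
  \<comment> \<open>\<open>ennreal\<close> truncates at 0, so a positive g has to be excluded before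
    real numbers are compared: it would force J = 0, then norm 0 for z, then g = 0.\<close>
  have g0: "g \<le> 0"
  proof (rule ccontr)
   assume "\<not> g \<le> 0"
   with Jle have "ennreal J \<le> 0" by (simp add: ennreal_neg)
   then have "J = 0" using J0 by (simp add: ennreal_eq_0_iff)
   then have "N powr q / q = 0" using p_pos q_pos unfolding J_def by (intro order_antisym) (auto simp: add_nonneg_eq_0_iff)
   then have "N = 0" using q_pos by simp
   then have "\<bar>g\<bar> \<le> 0" using holder_inner(2)[OF v z] by (simp add: g N_def inner_commute)
   then show False using \<open>\<not> g \<le> 0\<close> by simp
  qed
  then have "J + g = 0" using Jle Jg by (simp add: ennreal_le_iff)
  then have "AE x in \<mu>. norm (z x) powr q / q + norm (v x) powr p / p + z x \<bullet> v x = 0"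
   using integral_nonneg_eq_0_iff_AE[OF i] by (simp add: inner_young ieq)
  then have "AE x in \<mu>. v x = - duality_map q (z x)" by eventually_elim (rule inner_young_eq)
  moreover have "S \<le> ennreal N"
  proof (rule ennpowr_le_cancel[OF q_pos N(1)])
   have "I \<le> ennreal J" using le \<open>J + g = 0\<close> by (simp add: eq_neg_iff_add_eq_0[symmetric] add.commute)
   then have "ennreal (1 / q) * ennpowr S q \<le> ennreal (1 / q) * ennpowr (ennreal N) q"
    unfolding JI I_def by (simp add: ennreal_mult_eq_top_iff)
   then show "ennpowr S q \<le> ennreal (N powr q)"
    using q_pos N(1) by (simp add: ennreal_mult_le_mult_iff ennpowr_ennreal)
  qed
  ultimately show ?thesis using S by (auto simp: N_def)
 qed
 show "g \<le> 0 \<and> I = ennreal (- g)" if ae: "AE x in \<mu>. v x = - duality_map q (z x)" and SN: "S = ennreal (Lp_norm q \<mu> z)"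
 proof -
  have "(\<integral>x. norm (v x) powr p \<partial>\<mu>) = (\<integral>x. norm (z x) powr q \<partial>\<mu>)"
   by (rule integral_cong_AE, measurable, use ae in eventually_elim)
    (simp add: norm_duality_map powr_powr q_minus_1_times_p)
  then have wN: "w powr p = N powr q" using N wp by simp
  have "g = (\<integral>x. - (norm (z x) powr q) \<partial>\<mu>)" unfolding g
   by (rule integral_cong_AE, measurable, use ae in eventually_elim) (simp add: inner_duality_map)
  then have gN: "g = - (N powr q)" using N by simp
  have "J = N powr q * (1 / p + 1 / q)" unfolding J_def wN by (simp add: algebra_simps)
  then have "J = - g" using conjugate gN by simp
  moreover have "I = ennreal J" unfolding JI I_def SN N_def ..
  ultimately show ?thesis using gN by simp
 qed
qed

section \<open>The energy dissipation equality\<close>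

lemma nn_integral_ge_integral:
 fixes f :: "'a \<Rightarrow> real"
 assumes "integrable M f"
 shows "ennreal (\<integral>x. f x \<partial>M) \<le> (\<integral>\<^sup>+x. ennreal (f x) \<partial>M)"
proof -
 have i: "integrable M (\<lambda>x. max 0 (f x))" using assms by simp
 have "(\<integral>x. f x \<partial>M) \<le> (\<integral>x. max 0 (f x) \<partial>M)" by (rule integral_mono[OF assms i]) simp
 then have "ennreal (\<integral>x. f x \<partial>M) \<le> ennreal (\<integral>x. max 0 (f x) \<partial>M)" by (rule ennreal_leI)
 also have "\<dots> = (\<integral>\<^sup>+x. ennreal (max 0 (f x)) \<partial>M)" by (rule nn_integral_eq_integral[OF i, symmetric]) simp
 also have "\<dots> = (\<integral>\<^sup>+x. ennreal (f x) \<partial>M)"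
  by (rule nn_integral_cong) (simp add: max_def ennreal_neg)
 finally show ?thesis .
qed

text \<open>The Sobolev assumption acts only on the open half-line. Time 0 is reached by continuity
  for the energy and by monotone convergence for the dissipation.\<close>

lemma (in minimizing_movements) energy_identity_equivalence:
 fixes u :: "real \<Rightarrow> 'a measure" and v g
 assumes ac: "locally_ac_curve p u" and tf: "tangent_field p u v"
  and fin: "\<And>t. 0 \<le> t ==> \<phi> (u t) < \<infinity>"
  and cont: "continuous_on {0..} (\<lambda>t. real_of_ereal (\<phi> (u t)))"
  and W11: "W11_loc_derivative (\<lambda>t. real_of_ereal (\<phi> (u t))) g"
  and chain: "AE t in lborel. 0 < t \<longrightarrow> limiting_subdifferential p q \<phi> (u t) \<noteq> {} \<and>
    g t = (\<integral>x. Dl p q \<phi> (u t) x \<bullet> v t x \<partial>(u t))"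
  and unique: "\<And>\<nu> \<zeta> \<zeta>'. \<nu> \<in> fdom ==> \<zeta> \<in> limiting_subdifferential p q \<phi> \<nu> ==>
   \<zeta>' \<in> limiting_subdifferential p q \<phi> \<nu> ==> AE x in \<nu>. \<zeta> x = \<zeta>' x"
 defines "flow \<equiv> AE t in lborel. 0 < t \<longrightarrow>
   (AE x in u t. v t x = - duality_map q (Dl p q \<phi> (u t) x)) \<and>
   relaxed_slope p \<phi> (u t) = ennreal (Lp_norm q (u t) (Dl p q \<phi> (u t)))"
 shows "energy_inequality p q \<phi> u \<longleftrightarrow> energy_dissipation_equality p q \<phi> u"
  and "energy_dissipation_equality p q \<phi> u \<longleftrightarrow> flow"
proof -
 define f where "f t = real_of_ereal (\<phi> (u t))" for t
 have uP: "u t \<in> P" if "0 \<le> t" for t using ac that by (simp add: locally_ac_curve_def)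
 have ufd: "u t \<in> fdom" if "0 \<le> t" for t using uP[OF that] fin[OF that] by (simp add: fdom_def)
 have f: "\<phi> (u t) = ereal (f t)" if "0 \<le> t" for t using fdomD(2)[OF ufd[OF that]] by (simp add: f_def energy_def)
 have aci: "ac_on_intervals p u" by (rule locally_ac_imp_intervals[OF p_gt_1 ac])
 obtain w where w[measurable]: "w \<in> borel_measurable borel" and md: "AE t in lborel. 0 < t \<longrightarrow> metric_derivative p u t = w t"
  by (rule ac_curve_speed[OF p_gt_1 uP aci]) (assumption | rule that)+
 \<comment> \<open>Frozen at negative times, so that measurability can be stated on the whole
   line.\<close>
 define S where "S t = relaxed_slope p \<phi> (u (max 0 t))" for t
 have S[measurable]: "S \<in> borel_measurable borel"
  unfolding S_def
  by (rule relaxed_slope_measurable[OF uP ac_curve_continuous[OF p_gt_1 aci]]) auto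
 define I where "I t = ennreal (1 / q) * ennpowr (S t) q + ennreal (1 / p) * ennreal (w t powr p)" for t
 have I[measurable]: "I \<in> borel_measurable borel" unfolding I_def by measurable
 define d where "d s t = (\<integral>\<^sup>+r\<in>{s..t}. I r \<partial>lborel)" for s t
 have diss: "dissipation p q \<phi> u s t = d s t" if s: "0 \<le> s" for s t
 proof -
  have 1: "(\<integral>\<^sup>+r\<in>{s..t}. ennpowr (relaxed_slope p \<phi> (u r)) q \<partial>lborel) = (\<integral>\<^sup>+r\<in>{s..t}. ennpowr (S r) q \<partial>lborel)"
   by (rule nn_integral_cong) (use s in \<open>auto simp: S_def indicator_def max_def\<close>)
  have 2: "(\<integral>\<^sup>+r\<in>{s..t}. ennreal (metric_derivative p u r powr p) \<partial>lborel) = (\<integral>\<^sup>+r\<in>{s..t}. ennreal (w r powr p) \<partial>lborel)"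
   by (rule nn_integral_cong_AE, use md AE_lborel_singleton[of 0] in eventually_elim) (use s in \<open>auto simp: indicator_def\<close>)
  have "d s t = (\<integral>\<^sup>+r. ennreal (1 / q) * (ennpowr (S r) q * indicator {s..t} r) + ennreal (1 / p) * (ennreal (w r powr p) * indicator {s..t} r) \<partial>lborel)"
   unfolding d_def I_def by (rule nn_integral_cong) (simp add: distrib_right mult.assoc)
  also have "\<dots> = ennreal (1 / q) * (\<integral>\<^sup>+r\<in>{s..t}. ennpowr (S r) q \<partial>lborel) + ennreal (1 / p) * (\<integral>\<^sup>+r\<in>{s..t}. ennreal (w r powr p) \<partial>lborel)"
   by (subst nn_integral_add, measurable, subst nn_integral_cmult, measurable, subst nn_integral_cmult, measurable)
  finally show ?thesis by (simp add: dissipation_def 1 2)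
 qed
 define C where "C t \<longleftrightarrow> (AE x in u t. v t x = - duality_map q (Dl p q \<phi> (u t) x)) \<and>
   relaxed_slope p \<phi> (u t) = ennreal (Lp_norm q (u t) (Dl p q \<phi> (u t)))" for t
 have tf': "AE t in lborel. 0 < t \<longrightarrow> v t \<in> Lp_space p (u t) \<and> Lp_norm p (u t) (v t) = metric_derivative p u t"
  using tf by (simp add: tangent_field_def)
 have pt: "AE t in lborel. 0 < t \<longrightarrow> ennreal (- g t) \<le> I t \<and> (I t \<le> ennreal (- g t) \<longrightarrow> C t) \<and>
   (C t \<longrightarrow> g t \<le> 0 \<and> I t = ennreal (- g t))"
  using chain tf' md
 proof eventually_elim
  case (elim t)
  show ?case
  proof
   assume t: "0 < t"
   define z where "z = Dl p q \<phi> (u t)"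
   have "\<exists>\<zeta>. \<zeta> \<in> limiting_subdifferential p q \<phi> (u t)" using elim(1) t by auto
   then have z: "z \<in> limiting_subdifferential p q \<phi> (u t)" unfolding z_def Dl_def by (rule someI_ex)
   then have zL: "z \<in> Lp_space q (u t)" by (simp add: limiting_subdifferential_def)
   have St: "S t = relaxed_slope p \<phi> (u t)" using t by (simp add: S_def max_def)
   have leS: "ennreal (Lp_norm q (u t) z) \<le> S t"
   proof (rule ccontr)
    assume "\<not> ennreal (Lp_norm q (u t) z) \<le> S t"
    then have "S t < ennreal (Lp_norm q (u t) z)" by simp
    then obtain x where x: "S t < x" "x < ennreal (Lp_norm q (u t) z)" using dense[of "S t"] by blast
    then obtain c where c: "x = ennreal c" "0 \<le> c" by (cases x) auto
    obtain \<zeta> where \<zeta>: "\<zeta> \<in> limiting_subdifferential p q \<phi> (u t)" "Lp_norm q (u t) \<zeta> \<le> c"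
     by (rule relaxed_slope_subgradient[of "u t" c]) (use uP[of t] t x(1) St c(1) that in auto)
    have ae: "AE x in u t. \<zeta> x = z x" using unique[OF ufd \<zeta>(1) z] t by simp
    have [measurable]: "\<zeta> \<in> borel_measurable (u t)" "z \<in> borel_measurable (u t)"
     using \<zeta>(1) z by (auto simp: limiting_subdifferential_def Lp_space_def)
    have "(\<integral>x. norm (\<zeta> x) powr q \<partial>u t) = (\<integral>x. norm (z x) powr q \<partial>u t)"
     by (rule integral_cong_AE, measurable, use ae in eventually_elim) simp
    then have "Lp_norm q (u t) z \<le> c" using \<zeta>(2) by (simp add: Lp_norm_def)
    then have "ennreal (Lp_norm q (u t) z) \<le> x" unfolding c(1) by (rule ennreal_leI)
    with x(2) show False by simp
   qed
   have vL: "v t \<in> Lp_space p (u t)" "Lp_norm p (u t) (v t) = w t" and gz: "g t = (\<integral>x. z x \<bullet> v t x \<partial>u t)"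
    using elim t by (simp_all add: z_def)
   note pd = pointwise_dissipation[OF zL vL gz leS, folded I_def]
   have Ct: "C t \<longleftrightarrow> (AE x in u t. v t x = - duality_map q (z x)) \<and> S t = ennreal (Lp_norm q (u t) z)"
    by (simp only: C_def z_def St)
   show "ennreal (- g t) \<le> I t \<and> (I t \<le> ennreal (- g t) \<longrightarrow> C t) \<and> (C t \<longrightarrow> g t \<le> 0 \<and> I t = ennreal (- g t))"
    unfolding Ct using pd by blast
  qed
 qed
 have gi: "set_integrable lborel {s..t} g" if "0 < s" for s t
 proof -
  have "locally_integrable_pos g" using W11 by (simp add: W11_loc_derivative_def)
  moreover have "compact {s..t} \<and> {s..t} \<subseteq> {0<..}" using that by auto
  ultimately show ?thesis unfolding locally_integrable_pos_def by blast
 qed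
 then have ngi: "integrable lborel (\<lambda>r. indicator {s..t} r * - g r)" if "0 < s" for s t
  using that set_integrable_mult_right[of "-1" lborel "{s..t}" g] by (simp add: set_integrable_def)
 have inc: "f s - f t = (\<integral>r. indicator {s..t} r * - g r \<partial>lborel)" if "0 < s" "s \<le> t" for s t
 proof (cases "s = t")
  case True
  have "AE r in lborel. indicator {s..t} r * - g r = 0"
   using AE_lborel_singleton[of s] by eventually_elim (auto simp: True indicator_def)
  then show ?thesis using True by (simp add: integral_eq_zero_AE)
 next
  case False
  have "continuous_on {0<..} f" unfolding f_def[abs_def] by (rule continuous_on_subset[OF cont]) auto
  from continuous_W11_increment[OF this W11[folded f_def]] that False
  have "f t - f s = (LINT r:{s..t}|lborel. g r)" by simp
  then show ?thesis by (simp add: set_lebesgue_integral_def)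
 qed
 \<comment> \<open>Through \<open>ennreal\<close> this is the positive part of -g on [s, t], whose
   integral dominates the energy drop.\<close>
 define G where "G s t r = ennreal (indicator {s..t} r * - g r)" for s t r
 have G[measurable]: "G s t \<in> borel_measurable borel" if "0 < s" for s t
  using borel_measurable_integrable[OF ngi[OF that]] unfolding G_def[abs_def] by (intro measurable_compose[OF _ measurable_ennreal]) simp
 have GI: "AE r in lborel. G s t r \<le> I r * indicator {s..t} r" if "0 < s" for s t
  using pt by eventually_elim (use that in \<open>auto simp: G_def indicator_def\<close>)
 have low0: "ennreal (f s - f t) \<le> d s t" if st: "0 < s" "s \<le> t" for s t
 proof -
  have "ennreal (f s - f t) \<le> (\<integral>\<^sup>+r. G s t r \<partial>lborel)"
   unfolding inc[OF st] G_def by (rule nn_integral_ge_integral[OF ngi[OF st(1)]])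
  also have "\<dots> \<le> d s t" unfolding d_def by (rule nn_integral_mono_AE[OF GI[OF st(1)]])
  finally show ?thesis .
 qed
 have f0: "((\<lambda>s. f s - f t) \<longlongrightarrow> f 0 - f t) (at_right 0)" for t
 proof (intro tendsto_intros)
  have "(f \<longlongrightarrow> f 0) (at 0 within {0..})" using cont[unfolded continuous_on_def, rule_format, of 0] by (simp add: f_def[abs_def])
  then show "(f \<longlongrightarrow> f 0) (at_right 0)" by (rule tendsto_within_subset) auto
 qed
 have low: "ennreal (f s - f t) \<le> d s t" if st: "0 \<le> s" "s \<le> t" for s t
 proof (cases "0 < s")
  case True then show ?thesis using low0 st by simp
 next
  case False
  then have s: "s = 0" using st by simp
  show ?thesis
  proof (cases "t = 0")
   case False
   then have t: "0 < t" using st s by simp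
   have "((\<lambda>s. ennreal (f s - f t)) \<longlongrightarrow> ennreal (f 0 - f t)) (at_right 0)" using f0 by (rule tendsto_ennrealI)
   moreover have "\<forall>\<^sub>F s in at_right 0. ennreal (f s - f t) \<le> d 0 t"
    using eventually_at_right_less[of 0] eventually_at_right_real[OF t]
   proof eventually_elim
    case (elim s)
    have "d s t \<le> d 0 t" unfolding d_def by (rule nn_integral_mono) (use elim in \<open>auto simp: indicator_def\<close>)
    then show ?case using low0[of s t] elim by (auto intro: order_trans)
   qed
   ultimately show ?thesis unfolding s by (rule tendsto_upperbound) simp
  qed (simp add: s)
 qed
 have a: "energy_inequality p q \<phi> u \<longleftrightarrow> (\<forall>t\<ge>0. 0 \<le> f 0 - f t \<and> d 0 t \<le> ennreal (f 0 - f t))"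
  unfolding energy_inequality_def by (simp add: diss f enn2ereal_le_ereal)
 have b: "energy_dissipation_equality p q \<phi> u \<longleftrightarrow> (\<forall>s t. 0 \<le> s \<and> s \<le> t \<longrightarrow> 0 \<le> f s - f t \<and> d s t = ennreal (f s - f t))"
  unfolding energy_dissipation_equality_def by (auto simp: diss f ereal_eq_enn2ereal)
 have ab: "energy_dissipation_equality p q \<phi> u" if "energy_inequality p q \<phi> u"
  unfolding b
 proof (intro allI impI)
  have A: "0 \<le> f 0 - f t" "d 0 t = ennreal (f 0 - f t)" if "0 \<le> t" for t
   using \<open>energy_inequality p q \<phi> u\<close> low[of 0 t] that unfolding a by (auto intro: antisym)
  fix s t :: real assume st: "0 \<le> s \<and> s \<le> t"
  \<comment> \<open>The dissipation from time 0 is additive and finite, so the identities for s and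
    t can be subtracted.\<close>
  have eq: "ennreal (f 0 - f t) = ennreal (f 0 - f s) + d s t"
   using nn_integral_Icc_split[OF I, of 0 s t] A[of s] A[of t] st unfolding d_def by simp
  then have "d s t \<noteq> \<infinity>" by auto
  then obtain x where x: "d s t = ennreal x" "0 \<le> x" by (cases "d s t") auto
  have "ennreal (f 0 - f t) = ennreal (f 0 - f s + x)" using eq A(1)[of s] st x by (simp flip: ennreal_plus)
  then have "f 0 - f t = f 0 - f s + x" using A(1)[of s] A(1)[of t] st x by (subst (asm) ennreal_inj) auto
  then show "0 \<le> f s - f t \<and> d s t = ennreal (f s - f t)" using x by simp
 qed
 have ba: "energy_inequality p q \<phi> u" if "energy_dissipation_equality p q \<phi> u"
  using that unfolding a b by auto
 show "energy_inequality p q \<phi> u \<longleftrightarrow> energy_dissipation_equality p q \<phi> u" using ab ba by blast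
 have flow: "flow \<longleftrightarrow> (AE t in lborel. 0 < t \<longrightarrow> C t)" by (simp add: flow_def C_def)
 show "energy_dissipation_equality p q \<phi> u \<longleftrightarrow> flow"
 proof
  assume E: "energy_dissipation_equality p q \<phi> u"
  \<comment> \<open>The intervals [1 / (n + 1), n + 1] exhaust the open half-line; on each, ordered
    functions with equal finite integrals agree almost everywhere.\<close>
  have "AE r in lborel. r \<in> {1 / real (Suc n)..real (Suc n)} \<longrightarrow> I r \<le> ennreal (- g r)" for n
  proof -
   define s t where "s = 1 / real (Suc n)" and "t = real (Suc n)"
   have st: "0 < s" "s \<le> t" by (auto simp: s_def t_def field_simps)
   have dst: "d s t = ennreal (f s - f t)" using E st unfolding b by auto
   have Gle: "(\<integral>\<^sup>+r. G s t r \<partial>lborel) \<le> d s t" unfolding d_def by (rule nn_integral_mono_AE[OF GI[OF st(1)]])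
   have dG: "d s t \<le> (\<integral>\<^sup>+r. G s t r \<partial>lborel)"
    unfolding dst inc[OF st] G_def by (rule nn_integral_ge_integral[OF ngi[OF st(1)]])
   have "(\<integral>\<^sup>+r. (I r * indicator {s..t} r - G s t r) \<partial>lborel) = d s t - (\<integral>\<^sup>+r. G s t r \<partial>lborel)"
    unfolding d_def
   proof (rule nn_integral_diff)
    show "integral\<^sup>N lborel (G s t) \<noteq> \<infinity>" using le_less_trans[OF Gle, of \<infinity>] by (simp add: dst)
   qed (use G[OF st(1)] GI[OF st(1)] in auto)
   also have "\<dots> = 0" using dG by (intro diff_eq_0_ennreal) (simp_all add: dst)
   finally have "AE r in lborel. I r * indicator {s..t} r - G s t r = 0"
    using G[OF st(1)] by (subst (asm) nn_integral_0_iff_AE) auto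
   then have "AE r in lborel. r \<in> {s..t} \<longrightarrow> I r \<le> ennreal (- g r)"
    by eventually_elim (auto simp: G_def dest: ennreal_minus_eq_0)
   then show ?thesis by (simp only: s_def t_def)
  qed
  then have "AE r in lborel. \<forall>n. r \<in> {1 / real (Suc n)..real (Suc n)} \<longrightarrow> I r \<le> ennreal (- g r)"
   unfolding AE_all_countable by blast
  then show flow unfolding flow using pt
  proof eventually_elim
   case (elim r)
   show ?case
   proof
    assume r: "0 < r"
    obtain n where n: "max r (1 / r) < real n" using reals_Archimedean2 by blast
    then have "r < real n" "1 < r * real n" using r by (simp_all add: field_simps)
    then have "r \<in> {1 / real (Suc n)..real (Suc n)}" using r by (auto simp: field_simps)
    then show "C r" using elim r by blast
   qed
  qed
 next
  assume flow
  then have Ig: "AE t in lborel. 0 < t \<longrightarrow> g t \<le> 0 \<and> I t = ennreal (- g t)"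
   unfolding flow using pt by eventually_elim blast
  have pos: "0 \<le> f s - f t \<and> d s t = ennreal (f s - f t)" if st: "0 < s" "s \<le> t" for s t
  proof -
   have ae0: "AE r in lborel. 0 \<le> indicator {s..t} r * - g r"
    using Ig by eventually_elim (use st in \<open>auto simp: indicator_def\<close>)
   have "d s t = (\<integral>\<^sup>+r. G s t r \<partial>lborel)"
    unfolding d_def by (rule nn_integral_cong_AE, use Ig in eventually_elim) (use st in \<open>auto simp: G_def indicator_def\<close>)
   also have "\<dots> = ennreal (f s - f t)"
    unfolding G_def inc[OF st] by (rule nn_integral_eq_integral[OF ngi[OF st(1)] ae0])
   finally have "d s t = ennreal (f s - f t)" .
   moreover have "0 \<le> f s - f t" unfolding inc[OF st] by (rule integral_nonneg_AE[OF ae0])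
   ultimately show ?thesis by simp
  qed
  have zero: "0 \<le> f 0 - f t \<and> d 0 t = ennreal (f 0 - f t)" if t: "0 < t" for t
  proof -
   have "\<forall>\<^sub>F s in at_right 0. 0 \<le> f s - f t"
    using eventually_at_right_less[of 0] eventually_at_right_real[OF t] by eventually_elim (use pos in auto)
   then have pos0: "0 \<le> f 0 - f t" by (rule tendsto_lowerbound[OF f0]) simp
   \<comment> \<open>Times decreasing to 0: the dissipation over [s(n), t] increases to that over
     (0, t].\<close>
   define s where "s n = t / real (Suc n)" for n
   have s: "0 < s n" "s n \<le> t" for n using t by (auto simp: s_def field_simps)
   have slim: "s \<longlonglongrightarrow> 0" unfolding s_def[abs_def] using t LIMSEQ_Suc[OF lim_const_over_n[of t]] by simp
   have "filterlim s (at_right 0) sequentially"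
    unfolding filterlim_at using slim s(1) less_imp_neq[OF s(1), symmetric] by auto
   then have "(\<lambda>n. f (s n) - f t) \<longlonglongrightarrow> f 0 - f t" by (rule filterlim_compose[OF f0])
   then have l1: "(\<lambda>n. d (s n) t) \<longlonglongrightarrow> ennreal (f 0 - f t)" using pos[OF s] by (simp add: tendsto_ennrealI)
   have "(\<lambda>n. d (s n) t) \<longlonglongrightarrow> (\<integral>\<^sup>+r. I r * indicator {0<..t} r \<partial>lborel)"
    unfolding d_def
   proof (rule nn_integral_LIMSEQ)
    have "s (Suc n) \<le> s n" for n using t by (simp add: s_def frac_le)
    then have "decseq s" by (rule decseq_SucI)
    then show "incseq (\<lambda>n r. I r * indicator {s n..t} r)"
     by (auto simp: incseq_def le_fun_def indicator_def decseq_def intro: order_trans)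
    show "(\<lambda>n. I r * indicator {s n..t} r) \<longlonglongrightarrow> I r * indicator {0<..t} r" for r
    proof (cases "0 < r")
     case True
     then have "\<forall>\<^sub>F n in sequentially. s n < r" using slim by (rule order_tendstoD(2)[rotated])
     then have "\<forall>\<^sub>F n in sequentially. I r * indicator {s n..t} r = I r * indicator {0<..t} r"
      by eventually_elim (use True in \<open>auto simp: indicator_def\<close>)
     then show ?thesis by (rule tendsto_eventually)
    next
     case False
     then have "I r * indicator {s n..t} r = I r * indicator {0<..t} r" for n using s(1)[of n] by (auto simp: indicator_def)
     then show ?thesis by simp
    qed
   qed measurable
   also have "(\<integral>\<^sup>+r. I r * indicator {0<..t} r \<partial>lborel) = d 0 t"
    unfolding d_def by (rule nn_integral_cong_AE, use AE_lborel_singleton[of 0] in eventually_elim) (auto simp: indicator_def)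
   finally have "d 0 t = ennreal (f 0 - f t)" using l1 LIMSEQ_unique by blast
   with pos0 show ?thesis by simp
  qed
  have "0 \<le> f 0 - f t \<and> d 0 t \<le> ennreal (f 0 - f t)" if "0 \<le> t" for t
  proof (cases "t = 0")
   case True
   have "d 0 0 = (\<integral>\<^sup>+r. 0 \<partial>(lborel :: real measure))"
    unfolding d_def by (rule nn_integral_cong_AE, use AE_lborel_singleton[of 0] in eventually_elim) (auto simp: indicator_def)
   with True show ?thesis by simp
  qed (use that zero[of t] in auto)
  then show "energy_dissipation_equality p q \<phi> u" by (intro ab) (simp add: a)
 qed
qed

section \<open>Discrete solutions and their limits\<close>

text \<open>Sum the tangent inequality at the mean of the numbers; the linear terms cancel.\<close>

lemma (in conjugate_exponents) sum_powr_le: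
 fixes a :: "'b \<Rightarrow> real"
 assumes "finite I" and a: "\<And>i. i \<in> I ==> 0 \<le> a i"
 shows "(\<Sum>i\<in>I. a i) powr p \<le> real (card I) powr (p - 1) * (\<Sum>i\<in>I. a i powr p)"
proof (cases "I = {}")
 case False
 define n where "n = real (card I)"
 have n: "0 < n" using False assms(1) by (simp add: n_def card_gt_0_iff)
 define x where "x = (\<Sum>i\<in>I. a i) / n"
 have x: "0 \<le> x" using a n by (auto simp: x_def intro!: divide_nonneg_pos sum_nonneg)
 have "(\<Sum>i\<in>I. x powr p + p * (x powr (p - 1) * (a i - x))) \<le> (\<Sum>i\<in>I. a i powr p)"
  by (rule sum_mono) (rule powr_tangent[OF x a])
 also have "(\<Sum>i\<in>I. x powr p + p * (x powr (p - 1) * (a i - x))) = n * x powr p + p * (x powr (p - 1) * ((\<Sum>i\<in>I. a i) - n * x))"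
  by (simp add: sum.distrib n_def sum_subtractf flip: sum_distrib_left)
 also have "(\<Sum>i\<in>I. a i) - n * x = 0" using n by (simp add: x_def)
 finally have "n powr (p - 1) * (n * x powr p) \<le> n powr (p - 1) * (\<Sum>i\<in>I. a i powr p)"
  by (intro mult_left_mono) auto
 also have "n powr (p - 1) * (n * x powr p) = (n * x) powr p"
  using n x by (simp add: powr_mult powr_diff)
 also have "n * x = (\<Sum>i\<in>I. a i)" using n by (simp add: x_def)
 finally show ?thesis by (simp add: n_def)
qed simp

text \<open>Lebesgue measure on [0, T] is normalized to a probability M. With the constant sequence
  M in place of the plans and the identity as X, the dual form of \<open>weak_compactness\<close> is
  weak compactness in L^p(0, T).\<close>

lemma (in conjugate_exponents) weak_limit_interval:
 fixes Z :: "nat \<Rightarrow> real \<Rightarrow> real"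
 assumes T: "0 < T" and Z[measurable]: "\<And>n. Z n \<in> borel_measurable borel" and C: "0 \<le> C"
  and bound: "\<And>n. (\<integral>\<^sup>+x\<in>{0..T}. ennreal (\<bar>Z n x\<bar> powr p) \<partial>lborel) \<le> ennreal C"
 obtains r \<zeta> where "strict_mono (r :: nat \<Rightarrow> nat)" "\<zeta> \<in> borel_measurable borel"
  "(\<integral>\<^sup>+x\<in>{0..T}. ennreal (\<bar>\<zeta> x\<bar> powr p) \<partial>lborel) \<le> ennreal C" "set_integrable lborel {0..T} \<zeta>"
  "\<And>s t. 0 \<le> s ==> t \<le> T ==> (\<lambda>n. LINT x:{s..t}|lborel. Z (r n) x) \<longlonglongrightarrow> (LINT x:{s..t}|lborel. \<zeta> x)"
proof -
 define d where "d x = indicator {0..T} x / T" for x :: real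
 have d[measurable]: "d \<in> borel_measurable lborel" and d0: "0 \<le> d x" for x using T by (auto simp: d_def[abs_def])
 define M where "M = density lborel (\<lambda>x. ennreal (d x))"
 have sM: "sets M = sets borel" by (simp add: M_def)
 have nnM: "(\<integral>\<^sup>+x. f x \<partial>M) = ennreal (1 / T) * (\<integral>\<^sup>+x\<in>{0..T}. f x \<partial>lborel)"
  if [measurable]: "f \<in> borel_measurable borel" for f
 proof -
  have "(\<integral>\<^sup>+x. f x \<partial>M) = (\<integral>\<^sup>+x. ennreal (1 / T) * (f x * indicator {0..T} x) \<partial>lborel)"
   unfolding M_def by (subst nn_integral_density) (auto intro!: nn_integral_cong simp: d_def indicator_def)
  then show ?thesis by (simp add: nn_integral_cmult)
 qed
 have prob: "prob_space M"
 proof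
  have "emeasure M (space M) = (\<integral>\<^sup>+x. 1 \<partial>M)" by simp
  also have "\<dots> = ennreal (1 / T) * ennreal T" using T by (subst nnM) auto
  also have "\<dots> = 1" using T by (simp flip: ennreal_mult)
  finally show "emeasure M (space M) = 1" .
 qed
 have Mm: "borel_measurable M = borel_measurable borel" by (rule measurable_cong_sets[OF sM refl])
 have LpM: "f \<in> Lp_space p M" "Lp_norm p M f \<le> (C / T) powr (1 / p)"
  if [measurable]: "f \<in> borel_measurable borel" and le: "(\<integral>\<^sup>+x\<in>{0..T}. ennreal (\<bar>f x\<bar> powr p) \<partial>lborel) \<le> ennreal C" for f :: "real \<Rightarrow> real"
 proof -
  have "(\<integral>\<^sup>+x. ennreal (norm (f x) powr p) \<partial>M) \<le> ennreal (1 / T) * ennreal C"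
   by (subst nnM) (use le in \<open>auto intro!: mult_left_mono\<close>)
  also have "\<dots> = ennreal (C / T)" using T C by (simp flip: ennreal_mult)
  finally have le': "(\<integral>\<^sup>+x. ennreal (norm (f x) powr p) \<partial>M) \<le> ennreal (C / T)" .
  have fM: "f \<in> borel_measurable M" unfolding Mm by fact
  have i: "integrable M (\<lambda>x. norm (f x) powr p)"
  proof (rule integrableI_bounded)
   have "(\<integral>\<^sup>+x. ennreal (norm (norm (f x) powr p)) \<partial>M) \<le> ennreal (C / T)" using le' by simp
   then show "(\<integral>\<^sup>+x. ennreal (norm (norm (f x) powr p)) \<partial>M) < \<infinity>" by (rule le_less_trans) simp
   show "(\<lambda>x. norm (f x) powr p) \<in> borel_measurable M" unfolding Mm by measurable
  qed
  then show "f \<in> Lp_space p M" using fM by (simp add: Lp_space_def)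
  have "ennreal (\<integral>x. norm (f x) powr p \<partial>M) \<le> ennreal (C / T)"
   using le' nn_integral_eq_integral[OF i] by simp
  then have "(\<integral>x. norm (f x) powr p \<partial>M) \<le> C / T" using T C by (subst (asm) ennreal_le_iff) auto
  then show "Lp_norm p M f \<le> (C / T) powr (1 / p)"
   unfolding Lp_norm_def using p_pos by (intro powr_mono2) auto
 qed
 have dist: "distr M borel (\<lambda>x. x) = M" by (rule distr_id2[OF sM[symmetric]])
 have idm: "(\<lambda>x. x) \<in> borel_measurable M" unfolding Mm by measurable
 obtain r \<zeta> where r: "strict_mono (r :: nat \<Rightarrow> nat)" and \<zeta>: "\<zeta> \<in> Lp_space p M" "Lp_norm p M \<zeta> \<le> (C / T) powr (1 / p)"
  and lim: "\<And>h :: real \<Rightarrow> real. h \<in> Lp_space q M ==> (\<lambda>n. \<integral>z. h z \<bullet> Z (r n) z \<partial>M) \<longlonglongrightarrow> (\<integral>x. h x \<bullet> \<zeta> x \<partial>M)"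
  using dual.weak_compactness[where \<mu>=M and \<gamma>="\<lambda>n. M" and X="\<lambda>n x. x" and Z=Z, OF prob sM prob idm dist LpM(1)[OF Z bound] LpM(2)[OF Z bound]]
  by blast
 have \<zeta>m[measurable]: "\<zeta> \<in> borel_measurable borel" using \<zeta>(1) by (simp add: Lp_space_def Mm)
 have intM: "(\<integral>x. f x \<partial>M) = (LINT x:{0..T}|lborel. f x) / T" if [measurable]: "f \<in> borel_measurable borel" for f :: "real \<Rightarrow> real"
 proof -
  have "(\<integral>x. f x \<partial>M) = (\<integral>x. d x *\<^sub>R f x \<partial>lborel)"
   unfolding M_def by (rule integral_density) (use d0 in auto)
  also have "\<dots> = (\<integral>x. (indicator {0..T} x *\<^sub>R f x) / T \<partial>lborel)"
   by (rule Bochner_Integration.integral_cong) (auto simp: d_def)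
  finally show ?thesis by (simp add: set_lebesgue_integral_def)
 qed
 show ?thesis
 proof (rule that[OF r \<zeta>m])
  have "(\<integral>x. norm (\<zeta> x) powr p \<partial>M) = Lp_norm p M \<zeta> powr p" by (simp add: Lp_norm_powr p_pos)
  also have "\<dots> \<le> ((C / T) powr (1 / p)) powr p" using \<zeta>(2) p_pos by (intro powr_mono2 Lp_norm_nonneg) auto
  also have "\<dots> = C / T" using C T p_pos by (simp add: powr_powr)
  finally have le: "(\<integral>x. norm (\<zeta> x) powr p \<partial>M) \<le> C / T" .
  have "(\<integral>\<^sup>+x. ennreal (norm (\<zeta> x) powr p) \<partial>M) = ennreal (\<integral>x. norm (\<zeta> x) powr p \<partial>M)"
   using \<zeta>(1) by (intro nn_integral_eq_integral) (auto simp: Lp_space_def)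
  then have "ennreal (1 / T) * (\<integral>\<^sup>+x\<in>{0..T}. ennreal (\<bar>\<zeta> x\<bar> powr p) \<partial>lborel) \<le> ennreal (C / T)"
   using le by (subst (asm) nnM) (auto intro: ennreal_leI)
  also have "\<dots> = ennreal (1 / T) * ennreal C" using T C by (simp flip: ennreal_mult)
  finally show "(\<integral>\<^sup>+x\<in>{0..T}. ennreal (\<bar>\<zeta> x\<bar> powr p) \<partial>lborel) \<le> ennreal C"
   using T by (simp add: ennreal_mult_le_mult_iff)
  have one: "(\<lambda>x. 1::real) \<in> Lp_space q M"
   using finite_prob_powr_integrable[OF prob, of "\<lambda>x. 1::real" 1 q] q_pos by (simp add: Lp_space_def)
  have "integrable M (\<lambda>x. norm (1::real) * norm (\<zeta> x))" by (rule dual.holder(1)[OF one \<zeta>(1)])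
  then have "integrable lborel (\<lambda>x. d x *\<^sub>R norm (\<zeta> x))"
   unfolding M_def by (subst (asm) integrable_density) (use d0 in auto)
  then have "integrable lborel (\<lambda>x. T * (d x *\<^sub>R norm (\<zeta> x)))" by (rule integrable_mult_right)
  then have "integrable lborel (\<lambda>x. indicator {0..T} x *\<^sub>R \<zeta> x)"
   by (rule Bochner_Integration.integrable_bound) (use T in \<open>auto simp: d_def indicator_def\<close>)
  then show "set_integrable lborel {0..T} \<zeta>" by (simp add: set_integrable_def)
  fix s t :: real assume st: "0 \<le> s" "t \<le> T"
  have hm: "indicat_real {s..t} \<in> borel_measurable M" unfolding Mm by measurable
  have "indicat_real {s..t} \<in> Lp_space q M"
   using finite_prob_powr_integrable[OF prob hm, of 1 q] hm q_pos by (simp add: Lp_space_def indicator_def)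
  note lim[OF this]
  moreover have "(\<integral>z. indicat_real {s..t} z \<bullet> f z \<partial>M) = (LINT x:{s..t}|lborel. f x) / T"
   if [measurable]: "f \<in> borel_measurable borel" for f :: "real \<Rightarrow> real"
  proof -
   have "(LINT x:{0..T}|lborel. indicat_real {s..t} x \<bullet> f x) = (LINT x:{s..t}|lborel. f x)"
    unfolding set_lebesgue_integral_def by (rule Bochner_Integration.integral_cong) (use st in \<open>auto simp: indicator_def\<close>)
   then show ?thesis by (subst intM) auto
  qed
  ultimately have "(\<lambda>n. (LINT x:{s..t}|lborel. Z (r n) x) / T) \<longlonglongrightarrow> (LINT x:{s..t}|lborel. \<zeta> x) / T"
   by simp
  from tendsto_mult_right[OF this, of T] T
  show "(\<lambda>n. LINT x:{s..t}|lborel. Z (r n) x) \<longlonglongrightarrow> (LINT x:{s..t}|lborel. \<zeta> x)" by simp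
 qed
qed

lemma nn_integral_cells:
 fixes f :: "real \<Rightarrow> ennreal" and \<tau> :: real
 assumes [measurable]: "f \<in> borel_measurable borel" and "0 < \<tau>" "i \<le> j"
 shows "(\<integral>\<^sup>+x\<in>{real i * \<tau><..real j * \<tau>}. f x \<partial>lborel) =
  (\<Sum>m=i..<j. \<integral>\<^sup>+x\<in>{real m * \<tau><..real (Suc m) * \<tau>}. f x \<partial>lborel)"
 using assms(3)
proof (induction j rule: dec_induct)
 case (step j)
 have le: "real i * \<tau> \<le> real j * \<tau>" "real j * \<tau> \<le> real (Suc j) * \<tau>"
  using step(1) \<open>0 < \<tau>\<close> by (auto intro!: mult_right_mono)
 have "(\<integral>\<^sup>+x\<in>{real i * \<tau><..real (Suc j) * \<tau>}. f x \<partial>lborel) =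
  (\<integral>\<^sup>+x. f x * indicator {real i * \<tau><..real j * \<tau>} x + f x * indicator {real j * \<tau><..real (Suc j) * \<tau>} x \<partial>lborel)"
  by (rule nn_integral_cong) (use le in \<open>auto simp: indicator_def\<close>)
 also have "\<dots> = (\<integral>\<^sup>+x\<in>{real i * \<tau><..real j * \<tau>}. f x \<partial>lborel) + (\<integral>\<^sup>+x\<in>{real j * \<tau><..real (Suc j) * \<tau>}. f x \<partial>lborel)"
  by (rule nn_integral_add) measurable
 finally show ?case using step by simp
qed simp

section \<open>Uniform estimates for the discrete scheme\<close>

context minimizing_movements
begin

text \<open>Existence of minimizers asks only for slack + 1 \<le> pen; the factor 2 leaves a
  multiple of W^p after the growth bound has been absorbed in
  \<open>scheme_short_distance\<close>.\<close>

definition "horizon = (SOME T. 0 < T \<and> (\<forall>\<sigma>. 0 < \<sigma> \<longrightarrow> \<sigma> \<le> T \<longrightarrow> 2 * (slack + 1) \<le> pen \<sigma>))"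

lemma horizon: "0 < horizon" "\<And>\<sigma>. 0 < \<sigma> ==> \<sigma> \<le> horizon ==> 2 * (slack + 1) \<le> pen \<sigma>"
proof -
 obtain T where "0 < T" "\<And>\<sigma>. 0 < \<sigma> ==> \<sigma> \<le> T ==> 2 * (slack + 1) \<le> pen \<sigma>"
  by (rule pen_large[of "2 * (slack + 1)"], rule that)
 then have "\<exists>T. 0 < T \<and> (\<forall>\<sigma>. 0 < \<sigma> \<longrightarrow> \<sigma> \<le> T \<longrightarrow> 2 * (slack + 1) \<le> pen \<sigma>)" by blast
 from someI_ex[OF this] show "0 < horizon" "\<And>\<sigma>. 0 < \<sigma> ==> \<sigma> \<le> horizon ==> 2 * (slack + 1) \<le> pen \<sigma>"
  unfolding horizon_def by blast+
qed

text \<open>The step is at most half the horizon, so that a time span of horizon / 2 prolonged by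
  one step still fits.\<close>

definition "scheme \<tau> M \<longleftrightarrow> 0 < \<tau> \<and> \<tau> \<le> horizon / 2 \<and> M 0 \<in> fdom \<and> (\<forall>m. minimizer \<tau> (M m) (M (Suc m)))"

text \<open>\<open>pen \<tau> * W powr p\<close> is (\<tau> / p) (W / \<tau>)^p: the sum is 1 / p
  times the integral of the p-th power of the discrete speed.\<close>

definition "action \<tau> M i j = (\<Sum>m=i..<j. pen \<tau> * W (M (Suc m)) (M m) powr p)"

context
 fixes \<tau> :: real and M :: "nat \<Rightarrow> 'a measure"
 assumes scheme: "scheme \<tau> M"
begin

lemma step_pos: "0 < \<tau>" and step_le: "\<tau> \<le> horizon / 2" and step_minimizer: "minimizer \<tau> (M m) (M (Suc m))"
 using scheme by (auto simp: scheme_def)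

lemma scheme_fdom: "M m \<in> fdom"
 using scheme minimizer_fdom[OF step_minimizer] by (cases m) (auto simp: scheme_def)

lemma scheme_P: "M m \<in> P"
 by (rule fdomD(1)[OF scheme_fdom])

lemma action_nonneg: "0 \<le> action \<tau> M i j"
 unfolding action_def using pen_pos[OF step_pos] by (intro sum_nonneg) auto

lemma scheme_energy:
 assumes "i \<le> j"
 shows "energy (M j) + action \<tau> M i j \<le> energy (M i)"
 using assms
proof (induction j rule: dec_induct)
 case (step j)
 then show ?case using minimizer_base[OF step_minimizer scheme_fdom, of j] by (simp add: action_def)
qed (simp add: action_def)

lemma scheme_distance_sum:
 assumes "i \<le> j"
 shows "W (M j) (M i) \<le> (\<Sum>m=i..<j. W (M (Suc m)) (M m))"
 using assms
proof (induction j rule: dec_induct)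
 case (step j)
 then show ?case using W_triangle[OF scheme_P scheme_P scheme_P, of "Suc j" i j] by simp
qed (simp add: W_self scheme_P)

text \<open>Convexity over n = j - i steps costs the factor n^(p-1), and
  \<open>pen (n * \<tau>)\<close> times this factor is \<open>pen \<tau>\<close>: the action
  dominates the penalty of one step of length n \<tau> from i to j.\<close>

lemma scheme_distance:
 assumes ij: "i < j"
 shows "pen (real (j - i) * \<tau>) * W (M j) (M i) powr p \<le> action \<tau> M i j"
proof -
 define n where "n = real (j - i)"
 have n: "0 < n" using ij by (simp add: n_def)
 have "W (M j) (M i) powr p \<le> (\<Sum>m=i..<j. W (M (Suc m)) (M m)) powr p"
  using scheme_distance_sum[of i j] ij W_nonneg p_pos by (intro powr_mono2) auto
 also have "\<dots> \<le> n powr (p - 1) * (\<Sum>m=i..<j. W (M (Suc m)) (M m) powr p)"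
  using sum_powr_le[of "{i..<j}" "\<lambda>m. W (M (Suc m)) (M m)"] by (simp add: n_def W_nonneg)
 finally have "pen (n * \<tau>) * W (M j) (M i) powr p \<le> pen (n * \<tau>) * (n powr (p - 1) * (\<Sum>m=i..<j. W (M (Suc m)) (M m) powr p))"
  using pen_pos[of "n * \<tau>"] n step_pos by (intro mult_left_mono) auto
 also have "pen (n * \<tau>) * n powr (p - 1) = pen \<tau>"
  using n step_pos by (simp add: pen_def powr_mult)
 then have "pen (n * \<tau>) * (n powr (p - 1) * (\<Sum>m=i..<j. W (M (Suc m)) (M m) powr p)) = action \<tau> M i j"
  by (simp add: action_def sum_distrib_left flip: mult.assoc)
 finally show ?thesis by (simp add: n_def)
qed

text \<open>Over a short time the energy drop bounds 2 (slack + 1) W^p, while the growth bound lets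
  the final energy fall by at most slack W^p, up to constants of the starting vertex.\<close>

lemma scheme_short_distance:
 assumes ij: "i \<le> j" and short: "real (j - i) * \<tau> \<le> horizon"
 shows "slack * W (M j) (M i) powr p \<le> energy (M i) + base (M i)"
proof (cases "i = j")
 case True
 then show ?thesis using energy_below[OF scheme_P scheme_fdom, of i i] W_self[OF scheme_P] by simp
next
 case False
 then have ij': "i < j" using ij by simp
 define w where "w = W (M j) (M i) powr p"
 have "(2 * (slack + 1)) * w \<le> pen (real (j - i) * \<tau>) * w"
  using horizon(2)[OF _ short] ij' step_pos by (intro mult_right_mono) (auto simp: w_def)
 also have "\<dots> \<le> action \<tau> M i j" unfolding w_def by (rule scheme_distance[OF ij'])
 also have "\<dots> \<le> energy (M i) - energy (M j)" using scheme_energy[OF ij] by simp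
 also have "\<dots> \<le> energy (M i) + base (M i) + slack * w"
  using energy_below[OF scheme_P scheme_fdom, of i j] by (simp add: w_def)
 finally have "slack * w + 2 * w \<le> energy (M i) + base (M i)" by (simp add: algebra_simps)
 moreover have "0 \<le> w" by (simp add: w_def)
 ultimately show ?thesis unfolding w_def[symmetric] by linarith
qed

end

text \<open>The growth condition controls the distance travelled in a short time \<open>horizon\<close> that depends only
 on \<open>p\<close> and \<open>B\<close>; longer times are reached by concatenation.\<close>

lemma scheme_bounded:
 obtains K where "\<And>\<tau> M N. scheme \<tau> M ==> energy (M 0) \<le> C0 ==> W (M 0) \<mu>star \<le> C1 ==> real N * \<tau> \<le> T ==> W (M N) \<mu>star \<le> K"
proof -
 define h where "h = horizon / 2"
 have h: "0 < h" using horizon(1) by (simp add: h_def)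
 have "\<exists>K. \<forall>\<tau> M N. scheme \<tau> M \<longrightarrow> energy (M 0) \<le> C0 \<longrightarrow> W (M 0) \<mu>star \<le> C1 \<longrightarrow> real N * \<tau> \<le> real j * h \<longrightarrow> W (M N) \<mu>star \<le> K" for j
 proof (induction j)
  case 0
  have "W (M N) \<mu>star \<le> C1" if "scheme \<tau> M" "W (M 0) \<mu>star \<le> C1" "real N * \<tau> \<le> real 0 * h" for \<tau> M N
  proof -
   have "N = 0" using that(3) step_pos[OF that(1)] by (auto simp: mult_le_0_iff)
   then show ?thesis using that(2) by simp
  qed
  then show ?case by blast
 next
  case (Suc j)
  then obtain K where K: "\<And>\<tau> M N. scheme \<tau> M ==> energy (M 0) \<le> C0 ==> W (M 0) \<mu>star \<le> C1 ==> real N * \<tau> \<le> real j * h ==> W (M N) \<mu>star \<le> K"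
   by blast
  \<comment> \<open>From a vertex within K of \<open>\<mu>star\<close>, one more interval of length
    h moves the scheme by at most Q^(1/p).\<close>
  define Q where "Q = (C0 + (A + slack * K powr p)) / slack"
  have "W (M N) \<mu>star \<le> Q powr (1 / p) + K"
   if s: "scheme \<tau> M" and C: "energy (M 0) \<le> C0" "W (M 0) \<mu>star \<le> C1" and N: "real N * \<tau> \<le> real (Suc j) * h" for \<tau> M N
  proof (cases "real N * \<tau> \<le> real j * h")
   case True
   then show ?thesis using K[OF s C True] powr_ge_zero[of Q "1 / p"] by linarith
  next
   case False
   note \<tau> = step_pos[OF s]
   \<comment> \<open>The last vertex not later than time j h, to which the induction hypothesis
     applies.\<close>
   define n where "n = nat \<lfloor>real j * h / \<tau>\<rfloor>"
   have jh: "0 \<le> real j * h / \<tau>" using h \<tau> by simp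
   have "real n \<le> real j * h / \<tau>" "real j * h / \<tau> < real n + 1" using jh unfolding n_def by linarith+
   then have n: "real n * \<tau> \<le> real j * h" "real j * h < (real n + 1) * \<tau>" using \<tau> by (simp_all add: field_simps)
   have "real n * \<tau> < real N * \<tau>" using n(1) False by linarith
   then have nN: "n \<le> N" using \<tau> by simp
   have "real (N - n) * \<tau> = real N * \<tau> - real n * \<tau>" using nN by (simp add: of_nat_diff left_diff_distrib)
   also have "\<dots> \<le> horizon" using n(2) N step_le[OF s] by (simp add: h_def algebra_simps)
   finally have short: "real (N - n) * \<tau> \<le> horizon" .
   note Kn = K[OF s C n(1)]
   have "energy (M n) \<le> C0" using scheme_energy[OF s, of 0 n] action_nonneg[OF s, of 0 n] C by simp
   moreover have "base (M n) \<le> A + slack * K powr p"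
    using Kn W_nonneg p_pos slack_pos unfolding base_def slack_def[symmetric] by (auto intro!: mult_left_mono powr_mono2)
   ultimately have "slack * W (M N) (M n) powr p \<le> C0 + (A + slack * K powr p)"
    using scheme_short_distance[OF s nN short] by linarith
   then have "W (M N) (M n) powr p \<le> Q" using slack_pos by (simp add: Q_def field_simps)
   then have "(W (M N) (M n) powr p) powr (1 / p) \<le> Q powr (1 / p)" using p_pos by (intro powr_mono2) auto
   then have "W (M N) (M n) \<le> Q powr (1 / p)" using p_pos W_nonneg by (simp add: powr_powr)
   then show ?thesis using W_triangle[OF scheme_P[OF s] scheme_P[OF s] star, of N n] Kn by linarith
  qed
  then show ?case by blast
 qed
 moreover obtain j where "T \<le> real j * h" using reals_Archimedean3[OF h] by (metis less_imp_le)
 ultimately obtain K where "\<And>\<tau> M N. scheme \<tau> M ==> energy (M 0) \<le> C0 ==> W (M 0) \<mu>star \<le> C1 ==> real N * \<tau> \<le> T ==> W (M N) \<mu>star \<le> K"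
  by (meson order_trans)
 then show ?thesis by (rule that)
qed

end

lemma small_powr:
 fixes a e K :: real
 assumes "0 < a" "0 < e" "0 \<le> K"
 obtains \<delta> where "0 < \<delta>" "\<And>x. 0 \<le> x ==> x < \<delta> ==> K * x powr a < e"
proof
 define y where "y = e / (K + 1)"
 have y: "0 < y" using assms by (simp add: y_def)
 show "0 < y powr (1 / a)" using y by simp
 fix x :: real assume x: "0 \<le> x" "x < y powr (1 / a)"
 have "x powr a < (y powr (1 / a)) powr a" using assms x by (intro powr_less_mono2) auto
 then have "x powr a < y" using assms y by (simp add: powr_powr)
 then have "K * x powr a \<le> K * y" using assms by (intro mult_left_mono) auto
 also have "\<dots> < e" using assms by (simp add: y_def field_simps)
 finally show "K * x powr a < e" .
qed

text \<open>Rounding up matches the left-open cells of a discrete solution; time 0 gets index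
  0.\<close>

definition "index \<tau> t = nat \<lceil>t / \<tau>\<rceil>" for \<tau> t :: real

lemma index_measurable[measurable]: "index \<tau> \<in> measurable borel (count_space UNIV)"
 unfolding index_def[abs_def] by measurable

lemma index_mono: "0 < \<tau> ==> s \<le> t ==> index \<tau> s \<le> index \<tau> t"
 unfolding index_def by (intro nat_mono ceiling_mono divide_right_mono) auto

lemma index_eq: "0 < \<tau> ==> real m * \<tau> < t ==> t \<le> real (Suc m) * \<tau> ==> index \<tau> t = Suc m"
proof -
 assume a: "0 < \<tau>" "real m * \<tau> < t" "t \<le> real (Suc m) * \<tau>"
 then have "real m < t / \<tau>" "t / \<tau> \<le> real m + 1" by (simp_all add: field_simps)
 then have "\<lceil>t / \<tau>\<rceil> = int m + 1" by linarith
 then show ?thesis by (simp add: index_def)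
qed

lemma index_bounds: "0 < \<tau> ==> t \<le> real (index \<tau> t) * \<tau>" "0 < \<tau> ==> 0 \<le> t ==> real (index \<tau> t) * \<tau> < t + \<tau>"
proof -
 assume \<tau>: "0 < \<tau>"
 have "t / \<tau> \<le> real (index \<tau> t)" unfolding index_def by linarith
 then show "t \<le> real (index \<tau> t) * \<tau>" using \<tau> by (simp add: field_simps)
 assume t: "0 \<le> t"
 then have "0 \<le> t / \<tau>" using \<tau> by simp
 then have "real (index \<tau> t) < t / \<tau> + 1" unfolding index_def by linarith
 then show "real (index \<tau> t) * \<tau> < t + \<tau>" using \<tau> by (simp add: field_simps)
qed

section \<open>Compactness of discrete solutions\<close>

context minimizing_movements
begin

lemma W_tendsto2:
 assumes "\<And>n. a n \<in> P" "\<And>n. b n \<in> P" "\<mu> \<in> P" "\<nu> \<in> P"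
  and "(\<lambda>n. W (a n) \<mu>) \<longlonglongrightarrow> 0" "(\<lambda>n. W (b n) \<nu>) \<longlonglongrightarrow> 0"
 shows "(\<lambda>n. W (a n) (b n)) \<longlonglongrightarrow> W \<mu> \<nu>"
proof -
 have "(\<lambda>n. W (a n) \<mu> + W (b n) \<nu>) \<longlonglongrightarrow> 0 + 0" by (intro tendsto_add assms)
 then have sum: "(\<lambda>n. W (a n) \<mu> + W (b n) \<nu>) \<longlonglongrightarrow> 0" by simp
 have "(\<lambda>n. W (a n) (b n) - W \<mu> \<nu>) \<longlonglongrightarrow> 0"
 proof (rule Lim_null_comparison[OF _ sum], rule always_eventually, rule allI)
  fix n
  have "\<bar>W (a n) (b n) - W \<mu> (b n)\<bar> \<le> W (a n) \<mu>" by (rule W_diff) fact+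
  moreover have "\<bar>W (b n) \<mu> - W \<nu> \<mu>\<bar> \<le> W (b n) \<nu>" by (rule W_diff) fact+
  ultimately show "norm (W (a n) (b n) - W \<mu> \<nu>) \<le> W (a n) \<mu> + W (b n) \<nu>"
   using W_commute[of \<mu> "b n"] W_commute[of \<mu> \<nu>] by simp
 qed
 then show ?thesis using LIM_zero_iff by blast
qed

context
 fixes \<tau> :: "nat \<Rightarrow> real" and U :: "nat \<Rightarrow> nat \<Rightarrow> 'a measure" and C0 C1 :: real
 assumes sch: "\<And>n. scheme (\<tau> n) (U n)" and \<tau>0: "\<tau> \<longlonglongrightarrow> 0"
  and C0: "\<And>n. energy (U n 0) \<le> C0" and C1: "\<And>n. W (U n 0) \<mu>star \<le> C1"
begin

definition "curve n t = U n (index (\<tau> n) t)"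

lemmas \<tau>_pos = step_pos[OF sch] and U_P = scheme_P[OF sch] and U_fdom = scheme_fdom[OF sch]

lemma U_energy: "energy (U n m) \<le> C0"
 using scheme_energy[OF sch, of 0 m n] action_nonneg[OF sch, of n 0 m] C0[of n] by simp

lemma curve_P: "curve n t \<in> P"
 by (simp add: curve_def U_P)

text \<open>The exponent 1 / q is (p - 1) / p: action at most E gives W^p \<le> p E x^(p-1) for
  vertices at time distance x. Rounding times to vertices adds one step, hence
  \<open>t - s + \<tau> n\<close>.\<close>

lemma apriori:
 assumes T: "0 \<le> T"
 obtains K where "0 \<le> K" "\<And>n t. 0 \<le> t ==> t \<le> T ==> W (curve n t) \<mu>star \<le> K"
  "\<And>n. energy (curve n T) \<ge> - K"
  "\<And>n s t. 0 \<le> s ==> s \<le> t ==> t \<le> T ==> W (curve n t) (curve n s) \<le> K * (t - s + \<tau> n) powr (1 / q)"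
  "\<And>n. action (\<tau> n) (U n) 0 (index (\<tau> n) T) \<le> K"
  "\<And>n m. m < index (\<tau> n) T ==> W (U n (Suc m)) (U n m) \<le> K * \<tau> n powr (1 / q)"
proof -
 \<comment> \<open>The vertex used at time T may lie beyond T by up to one step, hence the
   margin.\<close>
 obtain K1 where K1: "\<And>\<tau> M N. scheme \<tau> M ==> energy (M 0) \<le> C0 ==> W (M 0) \<mu>star \<le> C1 ==> real N * \<tau> \<le> T + horizon ==> W (M N) \<mu>star \<le> K1"
  by (rule scheme_bounded[where ?C0.0=C0 and ?C1.0=C1 and T="T + horizon"], rule that)
 have Nle: "real m * \<tau> n \<le> T + horizon" if "m \<le> index (\<tau> n) T" for n m
 proof -
  have "real m * \<tau> n \<le> real (index (\<tau> n) T) * \<tau> n" using that \<tau>_pos[of n] by (intro mult_right_mono) auto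
  also have "\<dots> \<le> T + \<tau> n" using index_bounds(2)[OF \<tau>_pos T, of n] by simp
  finally show ?thesis using step_le[OF sch, of n] horizon(1) by simp
 qed
 have bd: "W (U n m) \<mu>star \<le> K1" if "m \<le> index (\<tau> n) T" for n m by (rule K1[OF sch C0 C1 Nle[OF that]])
 have K10: "0 \<le> K1" using order_trans[OF W_nonneg bd[of 0 0]] by simp
 define L where "L = A + B * K1 powr p"
 have L0: "0 \<le> L" using AB by (simp add: L_def)
 have low: "- L \<le> energy (U n m)" if "m \<le> index (\<tau> n) T" for n m
 proof -
  have "ereal (- A - B * W (U n m) \<mu>star powr p) \<le> ereal (energy (U n m))"
   using below[OF U_P, of n m] fdomD(2)[OF U_fdom, of n m] by simp
  moreover have "B * W (U n m) \<mu>star powr p \<le> B * K1 powr p"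
   using bd[OF that] AB p_pos by (intro mult_left_mono powr_mono2 W_nonneg) auto
  ultimately show ?thesis by (simp add: L_def)
 qed
 define E where "E = \<bar>C0\<bar> + L"
 have E0: "0 \<le> E" using L0 by (simp add: E_def)
 have act: "action (\<tau> n) (U n) i j \<le> E" if "i \<le> j" "j \<le> index (\<tau> n) T" for n i j
  using scheme_energy[OF sch that(1), of n] low[OF that(2)] U_energy[of n i] by (simp add: E_def)
 define K2 where "K2 = (p * E) powr (1 / p)"
 have dist: "W (U n j) (U n i) \<le> K2 * (real (j - i) * \<tau> n) powr (1 / q)" if ij: "i \<le> j" "j \<le> index (\<tau> n) T" for n i j
 proof (cases "i = j")
  case True then show ?thesis by (simp add: W_self U_P K2_def)
 next
  case False
  define x where "x = real (j - i) * \<tau> n"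
  have x: "0 < x" using False ij \<tau>_pos[of n] by (simp add: x_def)
  have "pen x * W (U n j) (U n i) powr p \<le> E"
   using scheme_distance[OF sch, of i j n] act[OF ij] False ij by (simp add: x_def)
  then have "W (U n j) (U n i) powr p \<le> (p * E) * x powr (p - 1)"
   using x p_pos by (simp add: pen_def field_simps)
  then have "(W (U n j) (U n i) powr p) powr (1 / p) \<le> ((p * E) * x powr (p - 1)) powr (1 / p)"
   using p_pos by (intro powr_mono2) auto
  also have "\<dots> = K2 * x powr (1 / q)"
   using p_pos E0 by (simp add: powr_mult powr_powr K2_def inverse_q)
  finally show ?thesis using p_pos W_nonneg by (simp add: powr_powr x_def)
 qed
 define K where "K = K1 + L + E + K2"
 have K: "K1 \<le> K" "L \<le> K" "E \<le> K" "K2 \<le> K" "0 \<le> K" using K10 L0 E0 by (auto simp: K_def K2_def)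
 show ?thesis
 proof (rule that[OF K(5)])
  show "W (curve n t) \<mu>star \<le> K" if "0 \<le> t" "t \<le> T" for n t
   using bd[OF index_mono[OF \<tau>_pos that(2)]] K(1) by (simp add: curve_def) (meson order_trans)
  show "energy (curve n T) \<ge> - K" for n using low[of "index (\<tau> n) T" n] K(2) by (simp add: curve_def)
  show "action (\<tau> n) (U n) 0 (index (\<tau> n) T) \<le> K" for n using act[of 0 "index (\<tau> n) T" n] K(3) by simp
  show "W (U n (Suc m)) (U n m) \<le> K * \<tau> n powr (1 / q)" if "m < index (\<tau> n) T" for n m
  proof -
   have "W (U n (Suc m)) (U n m) \<le> K2 * \<tau> n powr (1 / q)" using dist[of m "Suc m" n] that by simp
   also have "\<dots> \<le> K * \<tau> n powr (1 / q)" using K(4) by (intro mult_right_mono) auto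
   finally show ?thesis .
  qed
  fix n s t assume st: "0 \<le> s" "s \<le> t" "t \<le> T"
  define i j where "i = index (\<tau> n) s" and "j = index (\<tau> n) t"
  have ij: "i \<le> j" "j \<le> index (\<tau> n) T" unfolding i_def j_def by (intro index_mono \<tau>_pos st)+
  have "real (j - i) * \<tau> n = real j * \<tau> n - real i * \<tau> n" using ij by (simp add: of_nat_diff left_diff_distrib)
  also have "\<dots> \<le> t - s + \<tau> n"
   using index_bounds(1)[OF \<tau>_pos, of s n] index_bounds(2)[OF \<tau>_pos, of t n] st unfolding i_def j_def by simp
  finally have le: "real (j - i) * \<tau> n \<le> t - s + \<tau> n" .
  have "W (curve n t) (curve n s) \<le> K2 * (real (j - i) * \<tau> n) powr (1 / q)"
   using dist[OF ij] by (simp add: curve_def i_def j_def)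
  also have "\<dots> \<le> K * (t - s + \<tau> n) powr (1 / q)"
   using K(4,5) le \<tau>_pos[of n] q_pos by (intro mult_mono powr_mono2) auto
  finally show "W (curve n t) (curve n s) \<le> K * (t - s + \<tau> n) powr (1 / q)" .
 qed
qed

lemma curve_subsequence_compact:
 assumes t: "0 \<le> t"
 obtains k \<nu> where "strict_mono (k :: nat \<Rightarrow> nat)" "\<nu> \<in> P" "(\<lambda>n. W (curve (r (k n)) t) \<nu>) \<longlonglongrightarrow> 0"
proof -
 obtain K where K: "\<And>n s. 0 \<le> s ==> s \<le> t ==> W (curve n s) \<mu>star \<le> K"
  by (rule apriori[OF t], rule that)
 have "curve (r n) t \<in> fdom" "energy (curve (r n) t) \<le> C0" "W (curve (r n) t) \<mu>star \<le> K" for n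
  using U_fdom U_energy K[OF t order_refl] by (simp_all add: curve_def)
 note b = this
 show ?thesis
  by (rule bounded_energy_compact[where m="\<lambda>n. curve (r n) t", OF b(1,2) star b(3)]) (rule that)
qed

text \<open>Arzela-Ascoli for curves that are equicontinuous only up to \<open>\<tau> n\<close>: a
  diagonal subsequence converges at all nonnegative rational times, and the Hoelder bound carries
  convergence to the other times.\<close>

lemma curve_compactness:
 obtains r \<mu> where "strict_mono (r :: nat \<Rightarrow> nat)" "\<And>t. 0 \<le> t ==> \<mu> t \<in> P"
  "\<And>t. 0 \<le> t ==> (\<lambda>n. W (curve (r n) t) (\<mu> t)) \<longlonglongrightarrow> 0"
proof -
 define a where "a i = \<bar>real_of_rat (nat_to_rat_surj i)\<bar>" for i
 have a0: "0 \<le> a i" for i by (simp add: a_def)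
 define Q where "Q i r \<longleftrightarrow> (\<exists>\<nu>\<in>P. (\<lambda>n. W (curve (r n) (a i)) \<nu>) \<longlonglongrightarrow> 0)" for i and r :: "nat \<Rightarrow> nat"
 have sub: "\<exists>k. strict_mono (k :: nat \<Rightarrow> nat) \<and> Q i (r \<circ> k)" for i r
 proof -
  obtain k \<nu> where "strict_mono (k :: nat \<Rightarrow> nat)" "\<nu> \<in> P" "(\<lambda>n. W (curve (r (k n)) (a i)) \<nu>) \<longlonglongrightarrow> 0"
   by (rule curve_subsequence_compact[OF a0, of r i], rule that)
  then have "strict_mono k \<and> Q i (r \<circ> k)" unfolding Q_def comp_def by (intro conjI bexI[of _ \<nu>])
  then show ?thesis by (intro exI[of _ k])
 qed
 \<comment> \<open>The diagonal sequence is a subsequence of each earlier one only from some index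
   on, and convergence ignores the rest.\<close>
 have tail: "Q i (r \<circ> k2)" if Qk: "Q i (r \<circ> k1)" and sub: "\<And>j. N \<le> j ==> \<exists>j'\<ge>j. k2 j = k1 j'"
  for i N and r k1 k2 :: "nat \<Rightarrow> nat"
 proof -
  obtain \<nu> where \<nu>: "\<nu> \<in> P" "(\<lambda>n. W (curve (r (k1 n)) (a i)) \<nu>) \<longlonglongrightarrow> 0"
   using Qk unfolding Q_def comp_def by (rule bexE)
  have "(\<lambda>n. W (curve (r (k2 n)) (a i)) \<nu>) \<longlonglongrightarrow> 0"
  proof (rule LIMSEQ_I)
   fix e :: real assume "0 < e"
   then obtain N0 where N0: "\<And>n. N0 \<le> n ==> norm (W (curve (r (k1 n)) (a i)) \<nu> - 0) < e"
    using LIMSEQ_D[OF \<nu>(2) \<open>0 < e\<close>] by blast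
   have "norm (W (curve (r (k2 n)) (a i)) \<nu> - 0) < e" if n: "max N N0 \<le> n" for n
   proof -
    obtain j' where j': "n \<le> j'" "k2 n = k1 j'" using sub[of n] n by auto
    show ?thesis unfolding j'(2) by (rule N0) (use n j'(1) in simp)
   qed
   then show "\<exists>N. \<forall>n\<ge>N. norm (W (curve (r (k2 n)) (a i)) \<nu> - 0) < e" by (intro exI[of _ "max N N0"] allI impI)
  qed
  then show "Q i (r \<circ> k2)" unfolding Q_def comp_def using \<nu>(1) by (intro bexI[of _ \<nu>])
 qed
 obtain r where r: "strict_mono (r :: nat \<Rightarrow> nat)" "\<And>i. Q i (id \<circ> r)"
  by (rule subsequence_diagonalization_lemma[of Q id, OF sub tail]) (assumption | rule that)+
 have "\<exists>\<nu>. \<nu> \<in> P \<and> (\<lambda>n. W (curve (r n) t) \<nu>) \<longlonglongrightarrow> 0" if t: "0 \<le> t" for t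
 proof -
  have t1: "0 \<le> t + 1" using t by simp
  obtain K where K: "0 \<le> K"
   "\<And>n s t'. 0 \<le> s ==> s \<le> t' ==> t' \<le> t + 1 ==> W (curve n t') (curve n s) \<le> K * (t' - s + \<tau> n) powr (1 / q)"
   by (rule apriori[OF t1], rule that)
  \<comment> \<open>The candidate limit at t comes from sequential compactness along a further
    subsequence, in place of completeness. Five distances, through a nearby rational time b, then
    show that the whole sequence tends to it.\<close>
  obtain k \<nu> where k: "strict_mono (k :: nat \<Rightarrow> nat)" and \<nu>: "\<nu> \<in> P" "(\<lambda>n. W (curve (r (k n)) t) \<nu>) \<longlonglongrightarrow> 0"
   by (rule curve_subsequence_compact[OF t, of r], rule that)
  have "(\<lambda>n. W (curve (r n) t) \<nu>) \<longlonglongrightarrow> 0"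
  proof (rule LIMSEQ_I)
   fix e :: real assume e: "0 < e"
   then have e5: "0 < e / 5" and iq: "0 < 1 / q" using q_pos by simp_all
   obtain \<delta> where \<delta>: "0 < \<delta>" "\<And>x. 0 \<le> x ==> x < \<delta> ==> K * x powr (1 / q) < e / 5"
    by (rule small_powr[OF iq e5 K(1)], rule that)
   have "t < t + min 1 (\<delta> / 2)" using \<delta>(1) by simp
   then obtain b where b: "b \<in> \<rat>" "t < b" "b < t + min 1 (\<delta> / 2)" using Rats_dense_in_real by blast
   then obtain y where y: "b = real_of_rat y" by (auto elim: Rats_cases)
   obtain i where i: "y = nat_to_rat_surj i" using surj_nat_to_rat_surj by (metis surj_def)
   have ai: "a i = b" using b t by (simp add: a_def flip: i y)
   obtain \<omega> where \<omega>: "\<omega> \<in> P" "(\<lambda>n. W (curve (r n) b) \<omega>) \<longlonglongrightarrow> 0"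
    using r(2)[of i] unfolding Q_def ai by auto
   have "(\<lambda>n. \<tau> (r n)) \<longlonglongrightarrow> 0" using LIMSEQ_subseq_LIMSEQ[OF \<tau>0 r(1)] by (simp add: comp_def)
   then have "\<forall>\<^sub>F n in sequentially. \<tau> (r n) < \<delta> / 2" using \<delta>(1) by (intro order_tendstoD(2)) auto
   moreover have "\<forall>\<^sub>F n in sequentially. W (curve (r n) b) \<omega> < e / 5" by (rule order_tendstoD(2)[OF \<omega>(2) e5])
   ultimately have "\<forall>\<^sub>F n in sequentially. \<tau> (r n) < \<delta> / 2 \<and> W (curve (r n) b) \<omega> < e / 5" by (rule eventually_conj)
   then obtain N where N: "\<And>n. N \<le> n ==> \<tau> (r n) < \<delta> / 2" "\<And>n. N \<le> n ==> W (curve (r n) b) \<omega> < e / 5"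
    unfolding eventually_sequentially by blast
   have near: "W (curve (r n) b) (curve (r n) t) < e / 5" if "N \<le> n" for n
   proof -
    have "W (curve (r n) b) (curve (r n) t) \<le> K * (b - t + \<tau> (r n)) powr (1 / q)" using K(2)[of t b "r n"] t b by simp
    also have "\<dots> < e / 5" using \<delta>(2)[of "b - t + \<tau> (r n)"] N(1)[OF that] b \<tau>_pos[of "r n"] by simp
    finally show ?thesis .
   qed
   have "\<forall>\<^sub>F n in sequentially. W (curve (r (k n)) t) \<nu> < e / 5" by (rule order_tendstoD(2)[OF \<nu>(2) e5])
   then obtain N' where N': "\<And>n. N' \<le> n ==> W (curve (r (k n)) t) \<nu> < e / 5" unfolding eventually_sequentially by blast
   define j where "j = k (max N N')"
   have j: "N \<le> j" unfolding j_def using seq_suble[OF k, of "max N N'"] by simp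
   have j2: "W (curve (r j) t) \<nu> < e / 5" unfolding j_def by (rule N') simp
   have "W (curve (r n) t) \<nu> < e" if n: "N \<le> n" for n
   proof -
    note t1 = W_triangle[OF curve_P curve_P \<nu>(1), of "r n" t "r n" b]
    note t2 = W_triangle[OF curve_P \<omega>(1) \<nu>(1), of "r n" b]
    note t3 = W_triangle[OF \<omega>(1) curve_P \<nu>(1), of "r j" b]
    note t4 = W_triangle[OF curve_P curve_P \<nu>(1), of "r j" b "r j" t]
    show ?thesis
     using t1 t2 t3 t4 near[OF n] near[OF j] N(2)[OF n] N(2)[OF j] j2
      W_commute[of "curve (r n) t" "curve (r n) b"] W_commute[of \<omega> "curve (r j) b"] by linarith
   qed
   then show "\<exists>N. \<forall>n\<ge>N. norm (W (curve (r n) t) \<nu> - 0) < e" by (intro exI[of _ N]) (simp add: W_nonneg)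
  qed
  with \<nu>(1) show ?thesis by blast
 qed
 then have "\<forall>t. \<exists>\<nu>. 0 \<le> t \<longrightarrow> \<nu> \<in> P \<and> (\<lambda>n. W (curve (r n) t) \<nu>) \<longlonglongrightarrow> 0" by blast
 from choice[OF this] obtain \<mu> where "\<forall>t\<ge>0. \<mu> t \<in> P \<and> (\<lambda>n. W (curve (r n) t) (\<mu> t)) \<longlonglongrightarrow> 0" by (rule exE)
 then show ?thesis by (intro that[OF r(1), of \<mu>]) simp_all
qed

end

end

text \<open>The exponents match because (p - 1) q = p; comparison with every y below the left-hand
  side avoids continuity of the extended power.\<close>

lemma (in conjugate_exponents) ennpowr_liminf:
 assumes S: "S \<le> liminf (\<lambda>n. ennreal (g n powr (p - 1)))" and g: "\<And>n. 0 \<le> g n"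
 shows "ennpowr S q \<le> liminf (\<lambda>n. ennreal (g n powr p))"
proof (rule dense_le)
 fix y assume y: "y < ennpowr S q"
 show "y \<le> liminf (\<lambda>n. ennreal (g n powr p))"
 proof (cases y)
  case (real c)
  define z where "z = c powr (1 / q)"
  have z: "0 \<le> z" "z powr q = c" using real q_pos by (auto simp: z_def powr_powr)
  have "ennreal z < S"
  proof (rule ccontr)
   assume "\<not> ennreal z < S"
   then have "ennpowr S q \<le> ennpowr (ennreal z) q" using q_pos by (intro ennpowr_mono) auto
   also have "\<dots> = y" using real z by (simp add: ennpowr_ennreal)
   finally show False using y by simp
  qed
  then have "ennreal z < liminf (\<lambda>n. ennreal (g n powr (p - 1)))" using S by (rule less_le_trans)
  then have "\<forall>\<^sub>F n in sequentially. ennreal z < ennreal (g n powr (p - 1))" by (rule less_LiminfD)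
  then have "\<forall>\<^sub>F n in sequentially. y \<le> ennreal (g n powr p)"
  proof eventually_elim
   case (elim n)
   then have "z \<le> g n powr (p - 1)" using z(1) by (simp add: ennreal_less_iff)
   then have "z powr q \<le> (g n powr (p - 1)) powr q" using z(1) q_pos by (intro powr_mono2) auto
   then show ?case using real z(2) by (simp add: powr_powr p_minus_1_times_q ennreal_leI)
  qed
  then show ?thesis by (rule Liminf_bounded)
 qed (use y in simp)
qed

section \<open>Speed and slope of the limit curve\<close>

context minimizing_movements
begin

context
 fixes \<tau> :: "nat \<Rightarrow> real" and U :: "nat \<Rightarrow> nat \<Rightarrow> 'a measure" and C0 C1 :: real and \<mu> :: "real \<Rightarrow> 'a measure"
 assumes sch: "\<And>n. scheme (\<tau> n) (U n)" and \<tau>0: "\<tau> \<longlonglongrightarrow> 0"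
  and C0: "\<And>n. energy (U n 0) \<le> C0" and C1: "\<And>n. W (U n 0) \<mu>star \<le> C1"
  and \<mu>P: "\<And>t. 0 \<le> t ==> \<mu> t \<in> P" and conv: "\<And>t. 0 \<le> t ==> (\<lambda>n. W (curve \<tau> U n t) (\<mu> t)) \<longlonglongrightarrow> 0"
begin

lemmas tau_pos = step_pos[OF sch] and vertex_P = scheme_P[OF sch] and vertex_fdom = scheme_fdom[OF sch]

lemma vertex_energy: "energy (U n m) \<le> C0"
 by (rule U_energy[OF sch \<tau>0 C0 C1])

lemma curve_eq: "curve \<tau> U n t = U n (index (\<tau> n) t)"
 by (rule curve_def[OF sch \<tau>0 C0 C1])

lemma point_P: "curve \<tau> U n t \<in> P"
 by (simp add: curve_eq vertex_P)

lemma limit_continuity: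
 assumes T: "0 \<le> T"
 obtains K where "0 \<le> K" "\<And>s t. 0 \<le> s ==> s \<le> t ==> t \<le> T ==> W (\<mu> t) (\<mu> s) \<le> K * (t - s) powr (1 / q)"
proof -
 obtain K where K: "0 \<le> K"
  "\<And>n s t. 0 \<le> s ==> s \<le> t ==> t \<le> T ==> W (curve \<tau> U n t) (curve \<tau> U n s) \<le> K * (t - s + \<tau> n) powr (1 / q)"
  by (rule apriori[OF sch \<tau>0 C0 C1 T], rule that)
 show ?thesis
 proof (rule that[OF K(1)])
  fix s t assume st: "0 \<le> s" "s \<le> t" "t \<le> T"
  have t0: "0 \<le> t" using st by simp
  have l1: "(\<lambda>n. W (curve \<tau> U n t) (curve \<tau> U n s)) \<longlonglongrightarrow> W (\<mu> t) (\<mu> s)"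
   by (rule W_tendsto2[OF point_P point_P \<mu>P[OF t0] \<mu>P[OF st(1)] conv[OF t0] conv[OF st(1)]])
  have "(\<lambda>n. t - s + \<tau> n) \<longlonglongrightarrow> t - s + 0" by (intro tendsto_intros \<tau>0)
  then have "(\<lambda>n. (t - s + \<tau> n) powr (1 / q)) \<longlonglongrightarrow> (t - s + 0) powr (1 / q)"
  proof (rule tendsto_powr'[OF _ tendsto_const])
   show "t - s + 0 \<noteq> 0 \<or> 0 < 1 / q \<and> (\<forall>\<^sub>F n in sequentially. 0 \<le> t - s + \<tau> n)"
    using q_pos st tau_pos by (auto intro!: always_eventually add_nonneg_nonneg less_imp_le)
  qed
  then have l2: "(\<lambda>n. K * (t - s + \<tau> n) powr (1 / q)) \<longlonglongrightarrow> K * (t - s) powr (1 / q)"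
   by (intro tendsto_mult_left) simp
  show "W (\<mu> t) (\<mu> s) \<le> K * (t - s) powr (1 / q)"
   by (rule LIMSEQ_le[OF l1 l2]) (use K(2)[OF st] in blast)
 qed
qed

text \<open>The piecewise constant discrete speed has p-th power integral at most p times the
  action. Displacements are at most integrals of the speed, and this survives a weak L^p limit
  \<zeta>; m is |\<zeta>| on [0, T].\<close>

lemma limit_speed:
 assumes T: "0 < T" and C: "\<And>n. action (\<tau> n) (U n) 0 (index (\<tau> n) T) \<le> C"
 obtains m where "integrable lborel m" "\<And>x. 0 \<le> m x"
  "\<And>s t. 0 \<le> s ==> s \<le> t ==> t \<le> T ==> W (\<mu> s) (\<mu> t) \<le> (LINT x:{s..t}|lborel. m x)"
  "(\<integral>\<^sup>+x\<in>{0..T}. ennreal (m x powr p) \<partial>lborel) \<le> ennreal (p * C)"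
proof -
 have "0 \<le> C" by (rule order_trans[OF action_nonneg[OF sch] C[of 0]])
 then have pC: "0 \<le> p * C" using p_pos by simp
 \<comment> \<open>Index k carries the step from vertex k - 1 to vertex k.\<close>
 define jump where "jump n k = W (U n k) (U n (k - 1)) / \<tau> n" for n k
 define sp where "sp n x = (if x \<le> 0 then 0 else jump n (index (\<tau> n) x))" for n and x :: real
 have sp0: "0 \<le> sp n x" for n x using tau_pos[of n] by (simp add: sp_def jump_def W_nonneg)
 have spm[measurable]: "sp n \<in> borel_measurable borel" for n
 proof -
  have [measurable]: "(\<lambda>x. jump n (index (\<tau> n) x)) \<in> borel_measurable borel"
   by (rule measurable_compose[OF index_measurable]) simp
  show ?thesis unfolding sp_def[abs_def] by measurable
 qed
 have cell: "sp n x = W (U n (Suc k)) (U n k) / \<tau> n" if x: "real k * \<tau> n < x" "x \<le> real (Suc k) * \<tau> n" for n k x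
 proof -
  have "0 \<le> real k * \<tau> n" using tau_pos[of n] by simp
  then have "0 < x" using x by linarith
  then show ?thesis using index_eq[OF tau_pos x] by (simp add: sp_def jump_def)
 qed
 have cell_int: "(\<integral>\<^sup>+x\<in>{real k * \<tau> n<..real (Suc k) * \<tau> n}. F (sp n x) \<partial>lborel) = F (W (U n (Suc k)) (U n k) / \<tau> n) * ennreal (\<tau> n)"
  for F :: "real \<Rightarrow> ennreal" and n k
 proof -
  have "(\<integral>\<^sup>+x\<in>{real k * \<tau> n<..real (Suc k) * \<tau> n}. F (sp n x) \<partial>lborel) =
   (\<integral>\<^sup>+x. F (W (U n (Suc k)) (U n k) / \<tau> n) * indicator {real k * \<tau> n<..real (Suc k) * \<tau> n} x \<partial>lborel)"
   by (rule nn_integral_cong) (auto simp: cell indicator_def)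
  also have "\<dots> = F (W (U n (Suc k)) (U n k) / \<tau> n) * emeasure lborel {real k * \<tau> n<..real (Suc k) * \<tau> n}"
   by (rule nn_integral_cmult_indicator) simp
  also have "emeasure lborel {real k * \<tau> n<..real (Suc k) * \<tau> n} = ennreal (\<tau> n)"
   using tau_pos[of n] by (subst emeasure_lborel_Ioc) (auto simp: algebra_simps)
  finally show ?thesis .
 qed
 have pw: "(\<integral>\<^sup>+x\<in>{0..T}. ennreal (\<bar>sp n x\<bar> powr p) \<partial>lborel) \<le> ennreal (p * C)" for n
 proof -
  define N where "N = index (\<tau> n) T"
  have TN: "T \<le> real N * \<tau> n" unfolding N_def by (rule index_bounds(1)[OF tau_pos])
  have "(\<integral>\<^sup>+x\<in>{0..T}. ennreal (\<bar>sp n x\<bar> powr p) \<partial>lborel) \<le> (\<integral>\<^sup>+x\<in>{real 0 * \<tau> n<..real N * \<tau> n}. ennreal (\<bar>sp n x\<bar> powr p) \<partial>lborel)"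
   by (rule nn_integral_mono) (use TN in \<open>auto simp: indicator_def sp_def\<close>)
  also have "\<dots> = (\<Sum>k=0..<N. \<integral>\<^sup>+x\<in>{real k * \<tau> n<..real (Suc k) * \<tau> n}. ennreal (\<bar>sp n x\<bar> powr p) \<partial>lborel)"
   by (rule nn_integral_cells[OF _ tau_pos le0]) measurable
  also have "\<dots> = (\<Sum>k=0..<N. ennreal (p * (pen (\<tau> n) * W (U n (Suc k)) (U n k) powr p)))"
  proof (rule sum.cong[OF refl])
   fix k
   have "(W (U n (Suc k)) (U n k) / \<tau> n) powr p * \<tau> n = p * (pen (\<tau> n) * W (U n (Suc k)) (U n k) powr p)"
    using tau_pos[of n] p_pos by (simp add: pen_def powr_divide powr_diff W_nonneg)
   then show "(\<integral>\<^sup>+x\<in>{real k * \<tau> n<..real (Suc k) * \<tau> n}. ennreal (\<bar>sp n x\<bar> powr p) \<partial>lborel) =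
     ennreal (p * (pen (\<tau> n) * W (U n (Suc k)) (U n k) powr p))"
    using tau_pos[of n] W_nonneg[of "U n (Suc k)" "U n k"] cell_int[where k=k and n=n and F="\<lambda>y. ennreal (\<bar>y\<bar> powr p)"]
    by (simp add: ennreal_mult[symmetric])
  qed
  also have "\<dots> = ennreal (p * action (\<tau> n) (U n) 0 N)"
   unfolding action_def sum_distrib_left using pen_pos[OF tau_pos, of n] p_pos by (intro sum_ennreal) auto
  also have "\<dots> \<le> ennreal (p * C)" using C[of n] p_pos by (intro ennreal_leI) (simp add: N_def)
  finally show ?thesis .
 qed
 have spi: "integrable lborel (\<lambda>x. indicator {0..T} x * sp n x)" for n
 proof (rule integrableI_bounded)
  have le: "y \<le> 1 + y powr p" if "0 \<le> y" for y :: real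
  proof (cases "y \<le> 1")
   case False
   then have "y powr 1 \<le> y powr p" using p_gt_1 by (intro powr_mono) auto
   then show ?thesis using False by simp
  qed (use powr_ge_zero[of y p] in linarith)
  have "(\<integral>\<^sup>+x. ennreal (norm (indicator {0..T} x * sp n x)) \<partial>lborel) \<le>
   (\<integral>\<^sup>+x. indicator {0..T} x + ennreal (\<bar>sp n x\<bar> powr p) * indicator {0..T} x \<partial>lborel)"
  proof (rule nn_integral_mono)
   fix x
   have "ennreal (sp n x) \<le> 1 + ennreal (sp n x powr p)"
    using ennreal_leI[OF le[OF sp0[of n x]]] by (simp add: ennreal_plus)
   then show "ennreal (norm (indicator {0..T} x * sp n x)) \<le> indicator {0..T} x + ennreal (\<bar>sp n x\<bar> powr p) * indicator {0..T} x"
    using sp0[of n x] by (simp add: indicator_def)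
  qed
  also have "\<dots> = (\<integral>\<^sup>+x. indicator {0..T} x \<partial>lborel) + (\<integral>\<^sup>+x\<in>{0..T}. ennreal (\<bar>sp n x\<bar> powr p) \<partial>lborel)"
   by (rule nn_integral_add) measurable
  also have "\<dots> \<le> ennreal T + ennreal (p * C)" using T pw[of n] by (intro add_mono) auto
  also have "\<dots> < \<infinity>" by simp
  finally show "(\<integral>\<^sup>+x. ennreal (norm (indicator {0..T} x * sp n x)) \<partial>lborel) < \<infinity>" .
 qed measurable
 \<comment> \<open>The vertex used at t' may lie up to one step later, so the speed is integrated
   beyond t' by at least that much.\<close>
 have disp: "W (curve \<tau> U n s) (curve \<tau> U n t') \<le> (LINT x:{s..t}|lborel. sp n x)"
  if st: "0 \<le> s" "s \<le> t'" "t' + \<tau> n \<le> t" "t \<le> T" for n s t t'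
 proof -
  define i j where "i = index (\<tau> n) s" and "j = index (\<tau> n) t'"
  have ij: "i \<le> j" unfolding i_def j_def by (rule index_mono[OF tau_pos st(2)])
  have bds: "s \<le> real i * \<tau> n" "real j * \<tau> n \<le> t"
   using index_bounds(1)[OF tau_pos, of s n] index_bounds(2)[OF tau_pos, of t' n] st unfolding i_def j_def by auto
  have int: "integrable lborel (\<lambda>x. indicator {s..t} x * sp n x)"
   by (rule Bochner_Integration.integrable_bound[OF spi[of n]]) (use st tau_pos[of n] in \<open>auto simp: indicator_def\<close>)
  have "ennreal (\<Sum>k=i..<j. W (U n (Suc k)) (U n k)) = (\<Sum>k=i..<j. ennreal (W (U n (Suc k)) (U n k)))"
   by (rule sum_ennreal[symmetric]) (rule W_nonneg)
  also have "\<dots> = (\<Sum>k=i..<j. \<integral>\<^sup>+x\<in>{real k * \<tau> n<..real (Suc k) * \<tau> n}. ennreal (sp n x) \<partial>lborel)"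
  proof (rule sum.cong[OF refl])
   fix k
   show "ennreal (W (U n (Suc k)) (U n k)) = (\<integral>\<^sup>+x\<in>{real k * \<tau> n<..real (Suc k) * \<tau> n}. ennreal (sp n x) \<partial>lborel)"
    using tau_pos[of n] cell_int[where k=k and n=n and F=ennreal] by (simp add: ennreal_mult''[symmetric])
  qed
  also have "\<dots> = (\<integral>\<^sup>+x\<in>{real i * \<tau> n<..real j * \<tau> n}. ennreal (sp n x) \<partial>lborel)"
   by (rule nn_integral_cells[OF _ tau_pos ij, symmetric]) measurable
  also have "\<dots> \<le> (\<integral>\<^sup>+x. ennreal (indicator {s..t} x * sp n x) \<partial>lborel)"
   by (rule nn_integral_mono) (use bds in \<open>auto simp: indicator_def\<close>)
  also have "\<dots> = ennreal (\<integral>x. indicator {s..t} x * sp n x \<partial>lborel)"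
   by (rule nn_integral_eq_integral[OF int]) (simp add: sp0)
  finally have "(\<Sum>k=i..<j. W (U n (Suc k)) (U n k)) \<le> (\<integral>x. indicator {s..t} x * sp n x \<partial>lborel)"
   by (subst (asm) ennreal_le_iff) (simp_all add: sp0 integral_nonneg_AE)
  moreover have "W (U n j) (U n i) \<le> (\<Sum>k=i..<j. W (U n (Suc k)) (U n k))" by (rule scheme_distance_sum[OF sch ij])
  ultimately show ?thesis
   using W_commute[of "U n i" "U n j"] by (simp add: curve_eq i_def j_def set_lebesgue_integral_def)
 qed
 obtain r \<zeta> where r: "strict_mono (r :: nat \<Rightarrow> nat)" and \<zeta>[measurable]: "\<zeta> \<in> borel_measurable borel"
  and \<zeta>p: "(\<integral>\<^sup>+x\<in>{0..T}. ennreal (\<bar>\<zeta> x\<bar> powr p) \<partial>lborel) \<le> ennreal (p * C)" and \<zeta>i: "set_integrable lborel {0..T} \<zeta>"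
  and lim: "\<And>s t. 0 \<le> s ==> t \<le> T ==> (\<lambda>n. LINT x:{s..t}|lborel. sp (r n) x) \<longlonglongrightarrow> (LINT x:{s..t}|lborel. \<zeta> x)"
  by (rule weak_limit_interval[OF T spm pC pw], rule that)
 define m where "m x = \<bar>indicator {0..T} x * \<zeta> x\<bar>" for x
 have mi: "integrable lborel m"
  unfolding m_def using \<zeta>i by (intro integrable_abs) (simp add: set_integrable_def)
 show ?thesis
 proof (rule that[OF mi])
  show "0 \<le> m x" for x by (simp add: m_def)
  have "(\<integral>\<^sup>+x\<in>{0..T}. ennreal (m x powr p) \<partial>lborel) = (\<integral>\<^sup>+x\<in>{0..T}. ennreal (\<bar>\<zeta> x\<bar> powr p) \<partial>lborel)"
   by (rule nn_integral_cong) (simp add: m_def indicator_def)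
  then show "(\<integral>\<^sup>+x\<in>{0..T}. ennreal (m x powr p) \<partial>lborel) \<le> ennreal (p * C)" using \<zeta>p by simp
  fix s t assume st: "0 \<le> s" "s \<le> t" "t \<le> T"
  define L where "L = (LINT x:{s..t}|lborel. m x)"
  have t0: "0 \<le> t" using st by simp
  have \<zeta>L: "(LINT x:{s..t}|lborel. \<zeta> x) \<le> L"
   unfolding L_def
  proof (rule set_integral_Icc_mono)
   show "set_integrable lborel {s..t} \<zeta>" by (rule set_integrable_subset[OF \<zeta>i]) (use st in auto)
   show "set_integrable lborel {s..t} m" by (rule integrable_imp_set_integrable[OF mi]) simp
  qed (use st in \<open>auto simp: m_def indicator_def\<close>)
  \<comment> \<open>As the steps tend to 0, every t' < t becomes admissible; the endpoint t itself
    follows from Hoelder continuity of the limit curve.\<close>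
  have before: "W (\<mu> s) (\<mu> t') \<le> L" if t': "s \<le> t'" "t' < t" for t'
  proof -
   have t'0: "0 \<le> t'" using st t' by simp
   have "(\<lambda>n. W (curve \<tau> U n s) (curve \<tau> U n t')) \<longlonglongrightarrow> W (\<mu> s) (\<mu> t')"
    by (rule W_tendsto2[OF point_P point_P \<mu>P[OF st(1)] \<mu>P[OF t'0] conv[OF st(1)] conv[OF t'0]])
   then have l1: "(\<lambda>n. W (curve \<tau> U (r n) s) (curve \<tau> U (r n) t')) \<longlonglongrightarrow> W (\<mu> s) (\<mu> t')"
    using LIMSEQ_subseq_LIMSEQ[OF _ r, of "\<lambda>n. W (curve \<tau> U n s) (curve \<tau> U n t')"] by (simp add: comp_def)
   have "\<forall>\<^sub>F n in sequentially. \<tau> (r n) < t - t'"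
    using order_tendstoD(2)[OF LIMSEQ_subseq_LIMSEQ[OF \<tau>0 r], of "t - t'"] t' by (simp add: comp_def)
   then have "\<forall>\<^sub>F n in sequentially. W (curve \<tau> U (r n) s) (curve \<tau> U (r n) t') \<le> (LINT x:{s..t}|lborel. sp (r n) x)"
    by eventually_elim (rule disp, use st t' in auto)
   then have "W (\<mu> s) (\<mu> t') \<le> (LINT x:{s..t}|lborel. \<zeta> x)"
    by (rule tendsto_le[OF sequentially_bot lim[OF st(1,3)] l1])
   then show ?thesis using \<zeta>L by simp
  qed
  have "W (\<mu> s) (\<mu> t) \<le> L"
  proof (cases "s = t")
   case True
   have "0 \<le> L" unfolding L_def set_lebesgue_integral_def by (rule integral_nonneg_AE) (simp add: m_def)
   then show ?thesis using True W_self[OF \<mu>P[OF t0]] by simp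
  next
   case False
   obtain K where K: "0 \<le> K" "\<And>s t. 0 \<le> s ==> s \<le> t ==> t \<le> T ==> W (\<mu> t) (\<mu> s) \<le> K * (t - s) powr (1 / q)"
    by (rule limit_continuity[OF less_imp_le[OF T]], rule that)
   show ?thesis
   proof (rule field_le_epsilon)
    fix e :: real assume e: "0 < e"
    have iq: "0 < 1 / q" using q_pos by simp
    obtain \<delta> where \<delta>: "0 < \<delta>" "\<And>x. 0 \<le> x ==> x < \<delta> ==> K * x powr (1 / q) < e"
     by (rule small_powr[OF iq e K(1)], rule that)
    define t' where "t' = max s (t - \<delta> / 2)"
    have t': "s \<le> t'" "t' < t" "t - t' < \<delta>" "0 \<le> t'" using False st \<delta>(1) by (auto simp: t'_def max_def)
    have "W (\<mu> t) (\<mu> t') \<le> K * (t - t') powr (1 / q)" by (rule K(2)) (use t' st in auto)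
    also have "\<dots> < e" by (rule \<delta>(2)) (use t' in auto)
    finally have "W (\<mu> t) (\<mu> t') < e" .
    then show "W (\<mu> s) (\<mu> t) \<le> L + e"
     using W_triangle[OF \<mu>P[OF st(1)] \<mu>P[OF t'(4)] \<mu>P[OF t0]] before[OF t'(1,2)] W_commute[of "\<mu> t" "\<mu> t'"] by linarith
   qed
  qed
  then show "W (\<mu> s) (\<mu> t) \<le> (LINT x:{s..t}|lborel. m x)" by (simp add: L_def)
 qed
qed


text \<open>G is the quotient W / \<sigma> of De Giorgi's interpolant, with \<sigma> the time
  elapsed in the current cell. Summed over cells, \<open>interpolation_estimate\<close> telescopes
  to q times the energy drop less the action.\<close>

lemma limit_dissipation:
 assumes T: "0 < T" and E: "(\<lambda>n. energy (U n 0)) \<longlonglongrightarrow> E0" and \<epsilon>: "(\<lambda>n. energy (curve \<tau> U n T)) \<longlonglongrightarrow> \<epsilon>"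
  and \<beta>: "(\<lambda>n. action (\<tau> n) (U n) 0 (index (\<tau> n) T)) \<longlonglongrightarrow> \<beta>"
 shows "(\<integral>\<^sup>+x\<in>{0..T}. ennpowr (relaxed_slope p \<phi> (\<mu> x)) q \<partial>lborel) \<le> ennreal (q * (E0 - \<epsilon> - \<beta>))"
  and "0 \<le> E0 - \<epsilon> - \<beta>"
proof -
 \<comment> \<open>At \<sigma> = \<tau> the scheme's own vertex is taken: minimizers need not be
   unique, and with another choice the sum over cells would not telescope.\<close>
 define N where "N n k \<sigma> = (if \<sigma> = \<tau> n then U n (Suc k) else SOME \<nu>. minimizer \<sigma> (U n k) \<nu>)" for n k \<sigma>
 have N: "minimizer \<sigma> (U n k) (N n k \<sigma>)" if \<sigma>: "0 < \<sigma>" "\<sigma> \<le> \<tau> n" for n k \<sigma>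
 proof (cases "\<sigma> = \<tau> n")
  case True
  then show ?thesis using step_minimizer[OF sch] by (simp add: N_def)
 next
  case False
  have "\<sigma> \<le> horizon" using \<sigma> step_le[OF sch, of n] horizon(1) by simp
  then have "slack + 1 \<le> pen \<sigma>" using horizon(2)[OF \<sigma>(1)] slack_pos by simp
  then have "\<exists>\<nu>. minimizer \<sigma> (U n k) \<nu>" using minimizer_exists[OF vertex_fdom _ \<sigma>(1)] by blast
  then have "minimizer \<sigma> (U n k) (SOME \<nu>. minimizer \<sigma> (U n k) \<nu>)" by (rule someI_ex)
  then show ?thesis using False by (simp add: N_def)
 qed
 have Nmono: "W (N n k \<sigma>) (U n k) \<le> W (N n k \<sigma>') (U n k)" if "0 < \<sigma>" "\<sigma> \<le> \<sigma>'" "\<sigma>' \<le> \<tau> n" for n k \<sigma> \<sigma>'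
 proof (cases "\<sigma> = \<sigma>'")
  case False
  then have lt: "\<sigma> < \<sigma>'" using that by simp
  show ?thesis by (rule minimizer_mono[OF N N _ lt]) (use that in auto)
 qed simp
 \<comment> \<open>Extended to a monotone function on the line, hence measurable although the
   minimizers are chosen arbitrarily.\<close>
 define h where "h n k \<sigma> = (if \<sigma> \<le> 0 then 0 else W (N n k (min \<sigma> (\<tau> n))) (U n k))" for n k \<sigma>
 have hm[measurable]: "h n k \<in> borel_measurable borel" for n k
 proof (rule borel_measurable_mono, rule monoI)
  fix x y :: real assume xy: "x \<le> y"
  show "h n k x \<le> h n k y"
   using xy tau_pos[of n] W_nonneg[of "N n k (min y (\<tau> n))" "U n k"] Nmono[where \<sigma>="min x (\<tau> n)" and \<sigma>'="min y (\<tau> n)" and n=n and k=k]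
   by (auto simp: h_def)
 qed
 define c where "c n x = index (\<tau> n) x - 1" for n x
 define G where "G n x = h n (c n x) (x - real (c n x) * \<tau> n) / (x - real (c n x) * \<tau> n)" for n x
 have [measurable]: "c n \<in> measurable borel (count_space UNIV)" for n unfolding c_def[abs_def] by measurable
 have Gm[measurable]: "G n \<in> borel_measurable borel" for n
  unfolding G_def
  by (rule measurable_compose_countable[where f="\<lambda>k x. h n k (x - real k * \<tau> n) / (x - real k * \<tau> n)" and g="c n"]) measurable
 have cellG: "c n x = k" "G n x = W (N n k (x - real k * \<tau> n)) (U n k) / (x - real k * \<tau> n)"
  if x: "real k * \<tau> n < x" "x \<le> real (Suc k) * \<tau> n" for n k x
 proof -
  show c: "c n x = k" using index_eq[OF tau_pos x] by (simp add: c_def)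
  have "0 < x - real k * \<tau> n" "x - real k * \<tau> n \<le> \<tau> n" using x by (simp_all add: algebra_simps)
  then show "G n x = W (N n k (x - real k * \<tau> n)) (U n k) / (x - real k * \<tau> n)"
   unfolding G_def c by (simp add: h_def min_def)
 qed
 define D where "D n k = q * (energy (U n k) - (energy (U n (Suc k)) + pen (\<tau> n) * W (U n (Suc k)) (U n k) powr p))" for n k
 have D0: "0 \<le> D n k" for n k
  using minimizer_base[OF step_minimizer[OF sch] vertex_fdom, of n k] q_pos by (simp add: D_def)
 have Dsum: "(\<Sum>k=0..<j. D n k) = q * (energy (U n 0) - energy (U n j) - action (\<tau> n) (U n) 0 j)" for n j
  by (induction j) (simp_all add: D_def action_def algebra_simps)
 have cell_int: "(\<integral>\<^sup>+x\<in>{real k * \<tau> n<..real (Suc k) * \<tau> n}. ennreal (G n x powr p) \<partial>lborel) \<le> ennreal (D n k)" for n k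
 proof -
  define F where "F x = ennreal (G n x powr p) * indicator {real k * \<tau> n<..real (Suc k) * \<tau> n} x" for x
  have Fm: "F \<in> borel_measurable borel" unfolding F_def by measurable
  have "(\<integral>\<^sup>+x. F x \<partial>lborel) = (\<integral>\<^sup>+\<sigma>. F (real k * \<tau> n + 1 * \<sigma>) \<partial>lborel)"
   using nn_integral_real_affine[OF Fm, of 1 "real k * \<tau> n"] by simp
  also have "\<dots> = (\<integral>\<^sup>+\<sigma>\<in>{0<..\<tau> n}. ennreal ((W (N n k \<sigma>) (U n k) / \<sigma>) powr p) \<partial>lborel)"
  proof (rule nn_integral_cong)
   fix \<sigma> :: real
   show "F (real k * \<tau> n + 1 * \<sigma>) = ennreal ((W (N n k \<sigma>) (U n k) / \<sigma>) powr p) * indicator {0<..\<tau> n} \<sigma>"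
   proof (cases "0 < \<sigma> \<and> \<sigma> \<le> \<tau> n")
    case True
    then have x: "real k * \<tau> n < real k * \<tau> n + 1 * \<sigma>" "real k * \<tau> n + 1 * \<sigma> \<le> real (Suc k) * \<tau> n"
     by (simp_all add: algebra_simps)
    have "G n (real k * \<tau> n + 1 * \<sigma>) = W (N n k \<sigma>) (U n k) / \<sigma>" using cellG(2)[OF x] by simp
    then show ?thesis unfolding F_def using x True by (simp add: indicator_def)
   next
    case False
    then show ?thesis by (auto simp: F_def indicator_def algebra_simps)
   qed
  qed
  also have "\<dots> \<le> ennreal (D n k)"
   using interpolation_estimate[where \<mu>="U n k" and \<tau>="\<tau> n" and N="N n k", OF vertex_fdom tau_pos N] tau_pos[of n] by (simp add: D_def N_def)
  finally show ?thesis by (simp add: F_def)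
 qed
 have total: "(\<integral>\<^sup>+x\<in>{0..T}. ennreal (G n x powr p) \<partial>lborel) \<le>
  ennreal (q * (energy (U n 0) - energy (curve \<tau> U n T) - action (\<tau> n) (U n) 0 (index (\<tau> n) T)))" for n
 proof -
  define J where "J = index (\<tau> n) T"
  have TJ: "T \<le> real J * \<tau> n" unfolding J_def by (rule index_bounds(1)[OF tau_pos])
  have "(\<integral>\<^sup>+x\<in>{0..T}. ennreal (G n x powr p) \<partial>lborel) \<le> (\<integral>\<^sup>+x\<in>{real 0 * \<tau> n<..real J * \<tau> n}. ennreal (G n x powr p) \<partial>lborel)"
   by (rule nn_integral_mono_AE, use AE_lborel_singleton[of 0] in eventually_elim) (use TJ in \<open>auto simp: indicator_def\<close>)
  also have "\<dots> = (\<Sum>k=0..<J. \<integral>\<^sup>+x\<in>{real k * \<tau> n<..real (Suc k) * \<tau> n}. ennreal (G n x powr p) \<partial>lborel)"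
   by (rule nn_integral_cells[OF _ tau_pos le0]) measurable
  also have "\<dots> \<le> (\<Sum>k=0..<J. ennreal (D n k))" by (rule sum_mono) (rule cell_int)
  also have "\<dots> = ennreal (\<Sum>k=0..<J. D n k)" by (rule sum_ennreal) (rule D0)
  finally show ?thesis by (simp add: Dsum J_def curve_eq)
 qed
 have lim: "(\<lambda>n. energy (U n 0) - energy (curve \<tau> U n T) - action (\<tau> n) (U n) 0 (index (\<tau> n) T)) \<longlonglongrightarrow> E0 - \<epsilon> - \<beta>"
  by (intro tendsto_diff E \<epsilon> \<beta>)
 have "0 \<le> energy (U n 0) - energy (curve \<tau> U n T) - action (\<tau> n) (U n) 0 (index (\<tau> n) T)" for n
  using scheme_energy[OF sch, of 0 "index (\<tau> n) T" n] by (simp add: curve_eq)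
 then show "0 \<le> E0 - \<epsilon> - \<beta>" by (intro LIMSEQ_le_const[OF lim]) blast
 obtain K where K: "\<And>n k. k < index (\<tau> n) T ==> W (U n (Suc k)) (U n k) \<le> K * \<tau> n powr (1 / q)"
  by (rule apriori[OF sch \<tau>0 C0 C1 less_imp_le[OF T]], rule that)
 have slope: "ennpowr (relaxed_slope p \<phi> (\<mu> x)) q \<le> liminf (\<lambda>n. ennreal (G n x powr p))" if x: "0 < x" "x \<le> T" for x
 proof (rule ennpowr_liminf)
  define k where "k n = c n x" for n
  define \<sigma> where "\<sigma> n = x - real (k n) * \<tau> n" for n
  define \<nu> where "\<nu> n = N n (k n) (\<sigma> n)" for n
  have idx: "index (\<tau> n) x = Suc (k n)" for n
  proof -
   have "0 < real (index (\<tau> n) x) * \<tau> n" using index_bounds(1)[OF tau_pos, of x n] x by linarith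
   then have "0 < index (\<tau> n) x" using tau_pos[of n] by (simp add: zero_less_mult_iff)
   then show ?thesis by (simp add: k_def c_def)
  qed
  have xk: "real (k n) * \<tau> n < x" "x \<le> real (Suc (k n)) * \<tau> n" for n
   using index_bounds[OF tau_pos, of x n] x unfolding idx by (simp_all add: algebra_simps)
  have \<sigma>: "0 < \<sigma> n" "\<sigma> n \<le> \<tau> n" for n using xk[of n] by (simp_all add: \<sigma>_def algebra_simps)
  have Gx: "G n x = W (\<nu> n) (U n (k n)) / \<sigma> n" for n using cellG(2)[OF xk, of n] by (simp add: \<nu>_def \<sigma>_def)
  show "0 \<le> G n x" for n unfolding Gx using \<sigma>[of n] by (simp add: W_nonneg)
  have min: "minimizer (\<sigma> n) (U n (k n)) (\<nu> n)" for n unfolding \<nu>_def by (rule N[OF \<sigma>])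
  have \<nu>f: "\<nu> n \<in> fdom" for n by (rule minimizer_fdom[OF min])
  have \<nu>P: "\<nu> n \<in> P" for n by (rule fdomD(1)[OF \<nu>f])
  have kT: "k n < index (\<tau> n) T" for n using index_mono[OF tau_pos x(2), of n] unfolding idx by simp
  \<comment> \<open>The interpolant is within one step length of the previous vertex, and that one
    within the same length of the next, which is the curve at x: hence the factor 2.\<close>
  have bd: "W (\<nu> n) (\<mu> x) \<le> 2 * (K * \<tau> n powr (1 / q)) + W (curve \<tau> U n x) (\<mu> x)" for n
  proof -
   have "W (\<nu> n) (U n (k n)) \<le> W (N n (k n) (\<tau> n)) (U n (k n))" unfolding \<nu>_def by (rule Nmono) (use \<sigma> in auto)
   then have a: "W (\<nu> n) (U n (k n)) \<le> W (U n (Suc (k n))) (U n (k n))" by (simp add: N_def)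
   have x0: "0 \<le> x" using x by simp
   show ?thesis
    using a K[OF kT, of n] W_triangle[OF \<nu>P vertex_P \<mu>P[OF x0], of n n "k n"]
     W_triangle[OF vertex_P vertex_P \<mu>P[OF x0], of n "k n" n "Suc (k n)"]
     W_commute[of "U n (k n)" "U n (Suc (k n))"] by (simp add: curve_eq idx)
  qed
  have bd0: "(\<lambda>n. 2 * (K * \<tau> n powr (1 / q)) + W (curve \<tau> U n x) (\<mu> x)) \<longlonglongrightarrow> 0"
  proof -
   have "(\<lambda>n. \<tau> n powr (1 / q)) \<longlonglongrightarrow> 0 powr (1 / q)"
    by (rule tendsto_powr'[OF \<tau>0 tendsto_const]) (use q_pos tau_pos in \<open>auto intro!: always_eventually less_imp_le\<close>)
   moreover have "(\<lambda>n. W (curve \<tau> U n x) (\<mu> x)) \<longlonglongrightarrow> 0" using x by (intro conv) simp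
   ultimately have "(\<lambda>n. 2 * (K * \<tau> n powr (1 / q)) + W (curve \<tau> U n x) (\<mu> x)) \<longlonglongrightarrow> 2 * (K * 0 powr (1 / q)) + 0"
    by (intro tendsto_add tendsto_mult_left)
   then show ?thesis by simp
  qed
  have \<nu>0: "(\<lambda>n. W (\<nu> n) (\<mu> x)) \<longlonglongrightarrow> 0"
  proof (rule tendsto_sandwich[OF _ _ tendsto_const bd0])
   show "\<forall>\<^sub>F n in sequentially. 0 \<le> W (\<nu> n) (\<mu> x)" by (simp add: W_nonneg)
   show "\<forall>\<^sub>F n in sequentially. W (\<nu> n) (\<mu> x) \<le> 2 * (K * \<tau> n powr (1 / q)) + W (curve \<tau> U n x) (\<mu> x)"
    by (intro always_eventually allI bd)
  qed
  have "\<phi> (\<nu> n) \<le> ereal C0" for n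
  proof -
   have "0 \<le> pen (\<sigma> n) * W (\<nu> n) (U n (k n)) powr p" using pen_pos[OF \<sigma>(1), of n] by simp
   then have "energy (\<nu> n) \<le> C0" using minimizer_base[OF min vertex_fdom, of n] vertex_energy[of n "k n"] by linarith
   then show ?thesis using fdomD(2)[OF \<nu>f, of n] by simp
  qed
  then have "(SUP n. \<phi> (\<nu> n)) \<le> ereal C0" by (intro SUP_least)
  then have "(SUP n. \<phi> (\<nu> n)) < \<infinity>" by (rule le_less_trans) simp
  then have "relaxed_slope p \<phi> (\<mu> x) \<le> liminf (\<lambda>n. local_slope p \<phi> (\<nu> n))"
   unfolding relaxed_slope_def using \<nu>P \<nu>0 by (intro INF_lower) simp
  also have "\<dots> \<le> liminf (\<lambda>n. ennreal (G n x powr (p - 1)))"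
   unfolding Gx by (intro Liminf_mono always_eventually allI slope_minimizer[OF min vertex_P \<sigma>(1)])
  finally show "relaxed_slope p \<phi> (\<mu> x) \<le> liminf (\<lambda>n. ennreal (G n x powr (p - 1)))" .
 qed
 have "(\<integral>\<^sup>+x\<in>{0..T}. ennpowr (relaxed_slope p \<phi> (\<mu> x)) q \<partial>lborel) \<le>
  (\<integral>\<^sup>+x. liminf (\<lambda>n. ennreal (G n x powr p) * indicator {0..T} x) \<partial>lborel)"
  by (rule nn_integral_mono_AE, use AE_lborel_singleton[of 0] in eventually_elim)
   (use slope in \<open>auto simp: indicator_def\<close>)
 also have "\<dots> \<le> liminf (\<lambda>n. \<integral>\<^sup>+x\<in>{0..T}. ennreal (G n x powr p) \<partial>lborel)"
  by (rule nn_integral_liminf) measurable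
 also have "\<dots> \<le> liminf (\<lambda>n. ennreal (q * (energy (U n 0) - energy (curve \<tau> U n T) - action (\<tau> n) (U n) 0 (index (\<tau> n) T))))"
  by (intro Liminf_mono always_eventually allI total)
 also have "\<dots> = ennreal (q * (E0 - \<epsilon> - \<beta>))"
  by (intro lim_imp_Liminf tendsto_ennrealI tendsto_mult_left lim) simp
 finally show "(\<integral>\<^sup>+x\<in>{0..T}. ennpowr (relaxed_slope p \<phi> (\<mu> x)) q \<partial>lborel) \<le> ennreal (q * (E0 - \<epsilon> - \<beta>))" .
qed

end

end

context minimizing_movements
begin

text \<open>For each T, a further subsequence makes the action and the final energy converge, to
  \<beta> and \<epsilon>. The slope term is then at most E0 - \<epsilon> - \<beta>, the speed term
  at most \<beta>, and energy(\<mu>(T)) \<le> \<epsilon> by lower semicontinuity. The subsequence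
  may depend on T because the limit curve does not.\<close>

lemma discrete_limit:
 fixes \<mu> :: "real \<Rightarrow> 'a measure"
 assumes sch: "\<And>n. scheme (\<tau> n) (U n)" and \<tau>0: "\<tau> \<longlonglongrightarrow> 0"
  and C0: "\<And>n. energy (U n 0) \<le> C0" and C1: "\<And>n. W (U n 0) \<mu>star \<le> C1"
  and \<mu>P: "\<And>t. 0 \<le> t ==> \<mu> t \<in> P" and conv: "\<And>t. 0 \<le> t ==> (\<lambda>n. W (curve \<tau> U n t) (\<mu> t)) \<longlonglongrightarrow> 0"
  and E: "(\<lambda>n. energy (U n 0)) \<longlonglongrightarrow> E0"
 shows "ac_on_intervals p \<mu>"
  and "0 \<le> T ==> \<mu> T \<in> fdom \<and> energy (\<mu> T) \<le> E0 \<and> dissipation p q \<phi> \<mu> 0 T \<le> ennreal (E0 - energy (\<mu> T))"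
proof -
 note ceq = curve_def[OF sch \<tau>0 C0 C1]
 have cP: "curve \<tau> U n t \<in> P" for n t by (simp add: ceq scheme_P[OF sch])
 have cf: "curve \<tau> U n t \<in> fdom" for n t by (simp add: ceq scheme_fdom[OF sch])
 show "ac_on_intervals p \<mu>"
  unfolding ac_on_intervals_def[OF p_gt_1]
 proof
  fix n :: nat
  have T: "0 < real n + 1" by simp
  obtain K where K: "\<And>k. action (\<tau> k) (U k) 0 (index (\<tau> k) (real n + 1)) \<le> K"
   by (rule apriori[OF sch \<tau>0 C0 C1 less_imp_le[OF T]], rule that)
  obtain m where m: "integrable lborel m" "\<And>x. 0 \<le> m x"
   "\<And>s t. 0 \<le> s ==> s \<le> t ==> t \<le> real n + 1 ==> W (\<mu> s) (\<mu> t) \<le> (LINT x:{s..t}|lborel. m x)"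
   by (rule limit_speed[OF sch \<tau>0 C0 C1 \<mu>P conv T K], assumption, assumption, rule that)
  show "\<exists>m. integrable lborel m \<and> (\<forall>x. 0 \<le> m x) \<and>
   (\<forall>s t. 0 \<le> s \<longrightarrow> s \<le> t \<longrightarrow> t \<le> real n + 1 \<longrightarrow> W (\<mu> s) (\<mu> t) \<le> (LINT x:{s..t}|lborel. m x))"
   by (intro exI[of _ m] conjI allI impI m)
 qed
 assume T0: "0 \<le> T"
 show "\<mu> T \<in> fdom \<and> energy (\<mu> T) \<le> E0 \<and> dissipation p q \<phi> \<mu> 0 T \<le> ennreal (E0 - energy (\<mu> T))"
 proof (cases "T = 0")
  case True
  have "curve \<tau> U n 0 = U n 0" for n by (simp add: ceq index_def)
  then have eq: "\<phi> (curve \<tau> U n 0) \<le> ereal (energy (U n 0))" for n using fdomD(2)[OF cf, of n 0] by simp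
  have \<mu>0: "\<mu> 0 \<in> fdom" "energy (\<mu> 0) \<le> E0"
   by (rule lsc_bound[OF cP \<mu>P[OF order_refl] conv[OF order_refl] eq E])+
  have "dissipation p q \<phi> \<mu> 0 0 = 0"
  proof -
   have z: "(\<integral>\<^sup>+r\<in>{0..0}. f r \<partial>lborel) = 0" for f :: "real \<Rightarrow> ennreal"
   proof -
    have "(\<integral>\<^sup>+r\<in>{0..0}. f r \<partial>lborel) = (\<integral>\<^sup>+r. 0 \<partial>(lborel :: real measure))"
     by (rule nn_integral_cong_AE, use AE_lborel_singleton[of 0] in eventually_elim) (auto simp: indicator_def)
    then show ?thesis by simp
   qed
   show ?thesis unfolding dissipation_def z by simp
  qed
  with \<mu>0 True show ?thesis by simp
 next
  case False
  then have T: "0 < T" using T0 by simp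
  obtain K where Kl: "\<And>n. - K \<le> energy (curve \<tau> U n T)" and Ka: "\<And>n. action (\<tau> n) (U n) 0 (index (\<tau> n) T) \<le> K"
   by (rule apriori[OF sch \<tau>0 C0 C1 T0], rule that)
  define f where "f n = (action (\<tau> n) (U n) 0 (index (\<tau> n) T), energy (curve \<tau> U n T))" for n
  have "norm (f n) \<le> K + (\<bar>K\<bar> + \<bar>C0\<bar>)" for n
  proof -
   have "\<bar>energy (curve \<tau> U n T)\<bar> \<le> \<bar>K\<bar> + \<bar>C0\<bar>"
    using Kl[of n] U_energy[OF sch \<tau>0 C0 C1, of n "index (\<tau> n) T"] by (simp add: ceq)
   moreover have "\<bar>action (\<tau> n) (U n) 0 (index (\<tau> n) T)\<bar> \<le> K"
    using Ka[of n] action_nonneg[OF sch, of n 0 "index (\<tau> n) T"] by simp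
   ultimately show ?thesis using norm_Pair_le[of "fst (f n)" "snd (f n)"] by (simp add: f_def)
  qed
  then have "bounded (range f)" by (auto intro!: boundedI)
  from bounded_imp_convergent_subsequence[OF this] obtain l r where r: "strict_mono (r :: nat \<Rightarrow> nat)" and l: "(f \<circ> r) \<longlonglongrightarrow> l"
   by blast
  define \<beta> \<epsilon> where "\<beta> = fst l" and "\<epsilon> = snd l"
  have \<beta>: "(\<lambda>n. action (\<tau> (r n)) (U (r n)) 0 (index (\<tau> (r n)) T)) \<longlonglongrightarrow> \<beta>"
   using tendsto_fst[OF l] by (simp add: \<beta>_def f_def comp_def)
  have \<epsilon>: "(\<lambda>n. energy (curve \<tau> U (r n) T)) \<longlonglongrightarrow> \<epsilon>"
   using tendsto_snd[OF l] by (simp add: \<epsilon>_def f_def comp_def)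
  have sub: "curve (\<lambda>n. \<tau> (\<kappa> n)) (\<lambda>n. U (\<kappa> n)) n t = curve \<tau> U (\<kappa> n) t" if "(\<lambda>n. \<tau> (\<kappa> n)) \<longlonglongrightarrow> 0" for \<kappa> n t
   using curve_def[where \<tau>="\<lambda>n. \<tau> (\<kappa> n)" and U="\<lambda>n. U (\<kappa> n)", OF sch that C0 C1] by (simp add: ceq)
  have sub\<tau>: "(\<lambda>n. \<tau> (\<kappa> n)) \<longlonglongrightarrow> 0" if "strict_mono \<kappa>" for \<kappa> :: "nat \<Rightarrow> nat"
   using LIMSEQ_subseq_LIMSEQ[OF \<tau>0 that] by (simp add: comp_def)
  have subconv: "(\<lambda>n. W (curve (\<lambda>n. \<tau> (\<kappa> n)) (\<lambda>n. U (\<kappa> n)) n t) (\<mu> t)) \<longlonglongrightarrow> 0" if \<kappa>: "strict_mono \<kappa>" and t: "0 \<le> t" for \<kappa> :: "nat \<Rightarrow> nat" and t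
   unfolding sub[OF sub\<tau>[OF \<kappa>]] using LIMSEQ_subseq_LIMSEQ[OF conv[OF t] \<kappa>] by (simp add: comp_def)
  have slope: "(\<integral>\<^sup>+x\<in>{0..T}. ennpowr (relaxed_slope p \<phi> (\<mu> x)) q \<partial>lborel) \<le> ennreal (q * (E0 - \<epsilon> - \<beta>))" "0 \<le> E0 - \<epsilon> - \<beta>"
  proof -
   have Er: "(\<lambda>n. energy (U (r n) 0)) \<longlonglongrightarrow> E0" using LIMSEQ_subseq_LIMSEQ[OF E r] by (simp add: comp_def)
   have \<epsilon>r: "(\<lambda>n. energy (curve (\<lambda>n. \<tau> (r n)) (\<lambda>n. U (r n)) n T)) \<longlonglongrightarrow> \<epsilon>" unfolding sub[OF sub\<tau>[OF r]] by (rule \<epsilon>)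
   note ld = limit_dissipation[where \<tau>="\<lambda>n. \<tau> (r n)" and U="\<lambda>n. U (r n)", OF sch sub\<tau>[OF r] C0 C1 \<mu>P subconv[OF r] T Er \<epsilon>r \<beta>]
   show "(\<integral>\<^sup>+x\<in>{0..T}. ennpowr (relaxed_slope p \<phi> (\<mu> x)) q \<partial>lborel) \<le> ennreal (q * (E0 - \<epsilon> - \<beta>))" by (rule ld(1))
   show "0 \<le> E0 - \<epsilon> - \<beta>" by (rule ld(2))
  qed
  have \<phi>e: "\<phi> (curve \<tau> U (r n) T) \<le> ereal (energy (curve \<tau> U (r n) T))" for n using fdomD(2)[OF cf, of "r n" T] by simp
  have cr: "(\<lambda>n. W (curve \<tau> U (r n) T) (\<mu> T)) \<longlonglongrightarrow> 0" using LIMSEQ_subseq_LIMSEQ[OF conv[OF T0] r] by (simp add: comp_def)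
  have \<mu>T: "\<mu> T \<in> fdom" "energy (\<mu> T) \<le> \<epsilon>"
   by (rule lsc_bound[OF cP \<mu>P[OF T0] cr \<phi>e \<epsilon>])+
  have \<beta>0: "0 \<le> \<beta>" by (rule LIMSEQ_le_const[OF \<beta>]) (use action_nonneg[OF sch] in blast)
  \<comment> \<open>\<open>limit_speed\<close> wants one bound for all indices; from some index on
    the action is below \<beta> + e, so it is applied to a tail.\<close>
  have speed: "ennreal (1 / p) * (\<integral>\<^sup>+x\<in>{0..T}. ennreal (metric_derivative p \<mu> x powr p) \<partial>lborel) \<le> ennreal \<beta>"
  proof (rule ennreal_le_epsilon)
   fix e :: real assume e: "0 < e"
   have "\<forall>\<^sub>F n in sequentially. action (\<tau> (r n)) (U (r n)) 0 (index (\<tau> (r n)) T) < \<beta> + e"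
    by (rule order_tendstoD(2)[OF \<beta>]) (use e in simp)
   then obtain N where N: "\<And>n. N \<le> n ==> action (\<tau> (r n)) (U (r n)) 0 (index (\<tau> (r n)) T) < \<beta> + e"
    unfolding eventually_sequentially by blast
   define \<kappa> where "\<kappa> n = r (n + N)" for n
   have \<kappa>: "strict_mono \<kappa>" using r by (simp add: \<kappa>_def strict_mono_def)
   have act: "action (\<tau> (\<kappa> n)) (U (\<kappa> n)) 0 (index (\<tau> (\<kappa> n)) T) \<le> \<beta> + e" for n
    unfolding \<kappa>_def by (rule less_imp_le[OF N]) simp
   obtain m where m: "integrable lborel m" "\<And>x. 0 \<le> m x"
    "\<And>s t. 0 \<le> s ==> s \<le> t ==> t \<le> T ==> W (\<mu> s) (\<mu> t) \<le> (LINT x:{s..t}|lborel. m x)"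
    "(\<integral>\<^sup>+x\<in>{0..T}. ennreal (m x powr p) \<partial>lborel) \<le> ennreal (p * (\<beta> + e))"
    by (rule limit_speed[where \<tau>="\<lambda>n. \<tau> (\<kappa> n)" and U="\<lambda>n. U (\<kappa> n)", OF sch sub\<tau>[OF \<kappa>] C0 C1 \<mu>P subconv[OF \<kappa>] T act],
      assumption, assumption, rule that)
   obtain w where w: "\<And>x. 0 \<le> w x" "\<And>x. w x \<le> m x"
    "AE t in lborel. 0 < t \<longrightarrow> t < T \<longrightarrow> metric_derivative p \<mu> t = w t"
    by (rule metric_derivative_on_interval[OF p_gt_1 T \<mu>P m(1-3)]) (assumption | rule that)+
   have "(\<integral>\<^sup>+x\<in>{0..T}. ennreal (metric_derivative p \<mu> x powr p) \<partial>lborel) \<le> (\<integral>\<^sup>+x\<in>{0..T}. ennreal (m x powr p) \<partial>lborel)"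
   proof (rule nn_integral_mono_AE)
    show "AE x in lborel. ennreal (metric_derivative p \<mu> x powr p) * indicator {0..T} x \<le> ennreal (m x powr p) * indicator {0..T} x"
     using w(3) AE_lborel_singleton[of 0] AE_lborel_singleton[of T]
    proof eventually_elim
     case (elim x)
     have "w x powr p \<le> m x powr p" using w(1,2)[of x] p_pos by (intro powr_mono2) auto
     then show ?case using elim by (auto simp: indicator_def intro!: ennreal_leI)
    qed
   qed
   also note m(4)
   finally have "ennreal (1 / p) * (\<integral>\<^sup>+x\<in>{0..T}. ennreal (metric_derivative p \<mu> x powr p) \<partial>lborel) \<le> ennreal (1 / p) * ennreal (p * (\<beta> + e))"
    by (rule mult_left_mono) simp
   also have "\<dots> = ennreal \<beta> + ennreal e" using p_pos \<beta>0 e by (simp flip: ennreal_mult ennreal_plus)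
   finally show "ennreal (1 / p) * (\<integral>\<^sup>+x\<in>{0..T}. ennreal (metric_derivative p \<mu> x powr p) \<partial>lborel) \<le> ennreal \<beta> + ennreal e" .
  qed
  have "dissipation p q \<phi> \<mu> 0 T \<le> ennreal (1 / q) * ennreal (q * (E0 - \<epsilon> - \<beta>)) + ennreal \<beta>"
   unfolding dissipation_def by (intro add_mono mult_left_mono slope speed) simp
  also have "\<dots> = ennreal (E0 - \<epsilon>)" using slope(2) q_pos \<beta>0 by (simp flip: ennreal_mult ennreal_plus)
  also have "\<dots> \<le> ennreal (E0 - energy (\<mu> T))" using \<mu>T(2) by (intro ennreal_leI) simp
  finally show ?thesis using \<mu>T slope(2) \<beta>0 by simp
 qed
qed

context
 fixes \<tau> :: "nat \<Rightarrow> real" and u :: "nat \<Rightarrow> real \<Rightarrow> 'a measure" and \<mu>0 :: "'a measure"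
 assumes \<tau>: "\<And>k. 0 < \<tau> k" "\<tau> \<longlonglongrightarrow> 0" and ds: "\<And>k. discrete_solution p \<phi> (\<tau> k) (u k)"
  and \<mu>0: "\<mu>0 \<in> P" "\<phi> \<mu>0 < \<infinity>" and init: "(\<lambda>k. W (u k 0) \<mu>0) \<longlonglongrightarrow> 0" "(\<lambda>k. \<phi> (u k 0)) \<longlonglongrightarrow> \<phi> \<mu>0"
begin

text \<open>Finite initial energy and a step below half the horizon are guaranteed only for late
  members of the sequence, hence the index N.\<close>

lemma discrete_solutions_schemes:
 obtains M N where
  "\<forall>k\<ge>N. scheme (\<tau> k) (M k) \<and> energy (M k 0) \<le> energy \<mu>0 + 1 \<and> W (M k 0) \<mu>star \<le> W \<mu>0 \<mu>star + 1"
  "\<And>k t. 0 \<le> t ==> u k t = M k (index (\<tau> k) t)" "(\<lambda>k. energy (M k 0)) \<longlonglongrightarrow> energy \<mu>0"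
proof -
 have \<mu>0f: "\<mu>0 \<in> fdom" using \<mu>0 by (simp add: fdom_def)
 have "\<forall>k. \<exists>M. M 0 \<in> P \<and> (\<forall>m. is_arg_min (mm_functional p \<phi> (\<tau> k) (M m)) (\<lambda>\<nu>. \<nu> \<in> P) (M (Suc m))) \<and>
   u k 0 = M 0 \<and> (\<forall>m t. real m * \<tau> k < t \<and> t \<le> real (Suc m) * \<tau> k \<longrightarrow> u k t = M (Suc m))"
  using ds unfolding discrete_solution_def by (rule allI)
 from choice[OF this] obtain M where M: "\<forall>k. M k 0 \<in> P \<and> (\<forall>m. is_arg_min (mm_functional p \<phi> (\<tau> k) (M k m)) (\<lambda>\<nu>. \<nu> \<in> P) (M k (Suc m))) \<and>
   u k 0 = M k 0 \<and> (\<forall>m t. real m * \<tau> k < t \<and> t \<le> real (Suc m) * \<tau> k \<longrightarrow> u k t = M k (Suc m))" by (rule exE)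
 have M0: "M k 0 \<in> P" "u k 0 = M k 0" for k using M by simp_all
 have Mmin: "is_arg_min (mm_functional p \<phi> (\<tau> k) (M k m)) (\<lambda>\<nu>. \<nu> \<in> P) (M k (Suc m))" for k m using M by simp
 have Mu: "u k t = M k (Suc m)" if "real m * \<tau> k < t" "t \<le> real (Suc m) * \<tau> k" for k m t using M that by simp
 have eq: "u k t = M k (index (\<tau> k) t)" if t: "0 \<le> t" for k t
 proof (cases "t = 0")
  case True
  then show ?thesis by (simp add: M0 index_def)
 next
  case False
  have "0 < real (index (\<tau> k) t) * \<tau> k" using index_bounds(1)[OF \<tau>(1), of t k] t False by linarith
  then have "0 < index (\<tau> k) t" using \<tau>(1)[of k] by (simp add: zero_less_mult_iff)
  then obtain m where m: "index (\<tau> k) t = Suc m" using gr0_implies_Suc by blast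
  show ?thesis
   unfolding m by (rule Mu) (use index_bounds[OF \<tau>(1), of t k] t m in \<open>simp_all add: algebra_simps\<close>)
 qed
 have \<phi>lim: "(\<lambda>k. \<phi> (M k 0)) \<longlonglongrightarrow> ereal (energy \<mu>0)" using init(2) fdomD(2)[OF \<mu>0f] by (simp add: M0)
 have elim: "(\<lambda>k. energy (M k 0)) \<longlonglongrightarrow> energy \<mu>0"
  unfolding energy_def[of "M _ 0"] by (rule lim_real_of_ereal[OF \<phi>lim])
 have "0 < horizon / 2" using horizon(1) by simp
 then have e1: "\<forall>\<^sub>F k in sequentially. \<tau> k < horizon / 2" by (rule order_tendstoD(2)[OF \<tau>(2)])
 have e2: "\<forall>\<^sub>F k in sequentially. W (u k 0) \<mu>0 < 1" by (rule order_tendstoD(2)[OF init(1)]) simp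
 have e3: "\<forall>\<^sub>F k in sequentially. \<phi> (M k 0) < ereal (energy \<mu>0 + 1)" by (rule order_tendstoD(2)[OF \<phi>lim]) simp
 have "\<forall>\<^sub>F k in sequentially. scheme (\<tau> k) (M k) \<and> energy (M k 0) \<le> energy \<mu>0 + 1 \<and> W (M k 0) \<mu>star \<le> W \<mu>0 \<mu>star + 1"
  using e1 e2 e3
 proof eventually_elim
  case (elim k)
  have M0f: "M k 0 \<in> fdom" by (rule fdomI[OF M0(1) less_imp_le[OF elim(3)]])
  have "M k m \<in> fdom" for m
  proof (induction m)
   case (Suc m)
   show ?case by (rule minimizer_fdom[OF is_arg_min_minimizer[OF Mmin Suc]])
  qed (rule M0f)
  then have "scheme (\<tau> k) (M k)"
   unfolding scheme_def using \<tau>(1)[of k] elim(1) is_arg_min_minimizer[OF Mmin] by auto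
  moreover have "energy (M k 0) \<le> energy \<mu>0 + 1" by (rule fdomI_le[OF M0(1) less_imp_le[OF elim(3)]])
  moreover have "W (M k 0) \<mu>star \<le> W \<mu>0 \<mu>star + 1"
   using W_triangle[OF M0(1) \<mu>0(1) star, of k] elim(2) by (simp add: M0)
  ultimately show ?case by blast
 qed
 then obtain N where N: "\<forall>k\<ge>N. scheme (\<tau> k) (M k) \<and> energy (M k 0) \<le> energy \<mu>0 + 1 \<and> W (M k 0) \<mu>star \<le> W \<mu>0 \<mu>star + 1"
  unfolding eventually_sequentially by (rule exE)
 show ?thesis
  by (rule that[OF N eq elim])
qed

lemma discrete_solutions_compact:
 obtains k \<mu> where "strict_mono (k :: nat \<Rightarrow> nat)" "\<And>t. 0 \<le> t ==> \<mu> t \<in> P" "\<And>t. 0 \<le> t ==> (\<lambda>l. W (u (k l) t) (\<mu> t)) \<longlonglongrightarrow> 0"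
proof -
 obtain M N where s: "\<forall>k\<ge>N. scheme (\<tau> k) (M k) \<and> energy (M k 0) \<le> energy \<mu>0 + 1 \<and> W (M k 0) \<mu>star \<le> W \<mu>0 \<mu>star + 1"
  and eq: "\<And>k t. 0 \<le> t ==> u k t = M k (index (\<tau> k) t)"
  by (rule discrete_solutions_schemes, rule that)
 have sch: "scheme (\<tau> (l + N)) (M (l + N))" and C0: "energy (M (l + N) 0) \<le> energy \<mu>0 + 1"
  and C1: "W (M (l + N) 0) \<mu>star \<le> W \<mu>0 \<mu>star + 1" for l using s by simp_all
 have \<tau>N: "(\<lambda>l. \<tau> (l + N)) \<longlonglongrightarrow> 0" using \<tau>(2) by (rule LIMSEQ_ignore_initial_segment)
 obtain r \<mu> where r: "strict_mono (r :: nat \<Rightarrow> nat)" and \<mu>: "\<And>t. 0 \<le> t ==> \<mu> t \<in> P"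
  "\<And>t. 0 \<le> t ==> (\<lambda>n. W (curve (\<lambda>l. \<tau> (l + N)) (\<lambda>l. M (l + N)) (r n) t) (\<mu> t)) \<longlonglongrightarrow> 0"
  by (rule curve_compactness[where \<tau>="\<lambda>l. \<tau> (l + N)" and U="\<lambda>l. M (l + N)", OF sch \<tau>N C0 C1], rule that)
 show ?thesis
 proof (rule that[of "\<lambda>n. r n + N" \<mu>])
  show "strict_mono (\<lambda>n. r n + N)" using r by (simp add: strict_mono_def)
  show "\<mu> t \<in> P" if "0 \<le> t" for t by (rule \<mu>(1)[OF that])
  show "(\<lambda>l. W (u (r l + N) t) (\<mu> t)) \<longlonglongrightarrow> 0" if t: "0 \<le> t" for t
   using \<mu>(2)[OF t] by (simp add: eq[OF t] curve_def[where \<tau>="\<lambda>l. \<tau> (l + N)" and U="\<lambda>l. M (l + N)", OF sch \<tau>N C0 C1])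
 qed
qed

lemma discrete_solutions_limit:
 assumes k: "strict_mono (k :: nat \<Rightarrow> nat)" and \<mu>: "\<And>t. 0 \<le> t ==> \<mu> t \<in> P" and conv: "\<And>t. 0 \<le> t ==> (\<lambda>l. W (u (k l) t) (\<mu> t)) \<longlonglongrightarrow> 0"
 shows "locally_ac_curve p \<mu>" "energy_inequality p q \<phi> \<mu>"
proof -
 obtain M N where s: "\<forall>k\<ge>N. scheme (\<tau> k) (M k) \<and> energy (M k 0) \<le> energy \<mu>0 + 1 \<and> W (M k 0) \<mu>star \<le> W \<mu>0 \<mu>star + 1"
  and eq: "\<And>k t. 0 \<le> t ==> u k t = M k (index (\<tau> k) t)" and E: "(\<lambda>k. energy (M k 0)) \<longlonglongrightarrow> energy \<mu>0"
  by (rule discrete_solutions_schemes, rule that)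
 define \<kappa> where "\<kappa> l = k (l + N)" for l
 have \<kappa>: "strict_mono \<kappa>" using k by (simp add: \<kappa>_def strict_mono_def)
 have \<kappa>N: "N \<le> \<kappa> l" for l using seq_suble[OF k, of "l + N"] by (simp add: \<kappa>_def)
 have sch: "scheme (\<tau> (\<kappa> l)) (M (\<kappa> l))" and C0: "energy (M (\<kappa> l) 0) \<le> energy \<mu>0 + 1"
  and C1: "W (M (\<kappa> l) 0) \<mu>star \<le> W \<mu>0 \<mu>star + 1" for l using s \<kappa>N[of l] by simp_all
 have \<tau>\<kappa>: "(\<lambda>l. \<tau> (\<kappa> l)) \<longlonglongrightarrow> 0" using LIMSEQ_subseq_LIMSEQ[OF \<tau>(2) \<kappa>] by (simp add: comp_def)
 have E\<kappa>: "(\<lambda>l. energy (M (\<kappa> l) 0)) \<longlonglongrightarrow> energy \<mu>0" using LIMSEQ_subseq_LIMSEQ[OF E \<kappa>] by (simp add: comp_def)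
 have conv': "(\<lambda>l. W (u (\<kappa> l) t) (\<mu> t)) \<longlonglongrightarrow> 0" if t: "0 \<le> t" for t
  unfolding \<kappa>_def using conv[OF t] by (rule LIMSEQ_ignore_initial_segment)
 have cconv: "(\<lambda>l. W (curve (\<lambda>l. \<tau> (\<kappa> l)) (\<lambda>l. M (\<kappa> l)) l t) (\<mu> t)) \<longlonglongrightarrow> 0" if t: "0 \<le> t" for t
  using conv'[OF t] by (simp add: eq[OF t] curve_def[where \<tau>="\<lambda>l. \<tau> (\<kappa> l)" and U="\<lambda>l. M (\<kappa> l)", OF sch \<tau>\<kappa> C0 C1])
 note dl = discrete_limit[where \<tau>="\<lambda>l. \<tau> (\<kappa> l)" and U="\<lambda>l. M (\<kappa> l)", OF sch \<tau>\<kappa> C0 C1 \<mu> cconv E\<kappa>]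
 have ac: "ac_on_intervals p \<mu>" by (rule dl(1))
 show "locally_ac_curve p \<mu>" by (rule intervals_imp_locally_ac[OF p_gt_1 \<mu> ac])
 have uP: "u (\<kappa> l) 0 \<in> P" for l using scheme_P[OF sch, of l 0] by (simp add: eq index_def)
 \<comment> \<open>The limit curve starts at distance 0 from \<open>\<mu>0\<close>, so its initial
   energy is that of \<open>\<mu>0\<close>.\<close>
 have "(\<lambda>l. W (u (\<kappa> l) 0) \<mu>0) \<longlonglongrightarrow> W (\<mu> 0) \<mu>0" by (rule W_tendsto[OF uP \<mu>[OF order_refl] \<mu>0(1) conv'[OF order_refl]])
 moreover have "(\<lambda>l. W (u (\<kappa> l) 0) \<mu>0) \<longlonglongrightarrow> 0" using LIMSEQ_subseq_LIMSEQ[OF init(1) \<kappa>] by (simp add: comp_def)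
 ultimately have "W (\<mu> 0) \<mu>0 = 0" by (rule LIMSEQ_unique)
 then have \<phi>0: "\<phi> (\<mu> 0) = \<phi> \<mu>0" by (rule phi_cong[OF \<mu>[OF order_refl] \<mu>0(1)])
 have \<mu>0f: "\<mu>0 \<in> fdom" using \<mu>0 by (simp add: fdom_def)
 show "energy_inequality p q \<phi> \<mu>"
  unfolding energy_inequality_def
 proof (intro allI impI)
  fix t :: real assume t: "0 \<le> t"
  have d: "\<mu> t \<in> fdom" "energy (\<mu> t) \<le> energy \<mu>0" "dissipation p q \<phi> \<mu> 0 t \<le> ennreal (energy \<mu>0 - energy (\<mu> t))"
   using dl(2)[OF _ _ t] by simp_all
  show "enn2ereal (dissipation p q \<phi> \<mu> 0 t) \<le> \<phi> (\<mu> 0) - \<phi> (\<mu> t)"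
   unfolding \<phi>0 fdomD(2)[OF \<mu>0f] fdomD(2)[OF d(1)] using d(2,3) by (simp add: enn2ereal_le_ereal)
 qed
qed

end

end

theorem proposition3p4:
  fixes p q A B :: real
    and \<phi> :: "'a::euclidean_space measure \<Rightarrow> ereal"
    and \<mu>star :: "'a measure"
  assumes exponents: "1 < p" "1 < q" "1 / p + 1 / q = 1"
    and proper_range: "\<forall>\<mu> \<in> wasserstein_space p. \<phi> \<mu> \<noteq> -\<infinity>"
    and phi1: "\<forall>\<mu> \<in> wasserstein_space p. \<phi> \<mu> < \<infinity> \<longrightarrow> absolutely_continuous lborel \<mu>"
    and phi2: "A > 0" "B > 0" "\<mu>star \<in> wasserstein_space p"
      "\<forall>\<mu> \<in> wasserstein_space p. \<phi> \<mu> \<ge> ereal (- A - B * wasserstein p \<mu> \<mu>star powr p)"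
    and phi3: "\<forall>(m :: nat \<Rightarrow> 'a measure) \<mu>. (\<forall>n. m n \<in> wasserstein_space p) \<longrightarrow>
      \<mu> \<in> wasserstein_space p \<longrightarrow> (\<lambda>n. wasserstein p (m n) \<mu>) \<longlonglongrightarrow> 0 \<longrightarrow>
      \<phi> \<mu> \<le> liminf (\<lambda>n. \<phi> (m n))"
    and phi4: "\<forall>m :: nat \<Rightarrow> 'a measure. (\<forall>n. m n \<in> wasserstein_space p) \<longrightarrow>
      (SUP n. \<phi> (m n)) < \<infinity> \<longrightarrow> (SUP n. ereal (wasserstein p (m n) \<mu>star)) < \<infinity> \<longrightarrow>
      (\<exists>(k :: nat \<Rightarrow> nat) \<mu>. strict_mono k \<and> \<mu> \<in> wasserstein_space p \<and>
         (\<lambda>n. wasserstein p (m (k n)) \<mu>) \<longlonglongrightarrow> 0)"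
    and unique_subdifferential: "\<forall>\<nu> \<in> wasserstein_space p. \<phi> \<nu> < \<infinity> \<longrightarrow>
      (\<forall>\<zeta> \<in> limiting_subdifferential p q \<phi> \<nu>. \<forall>\<zeta>' \<in> limiting_subdifferential p q \<phi> \<nu>.
         AE x in \<nu>. \<zeta> x = \<zeta>' x)"
  shows
    "(\<forall>(\<tau> :: nat \<Rightarrow> real) (u :: nat \<Rightarrow> real \<Rightarrow> 'a measure) \<mu>0.
        (\<forall>k. 0 < \<tau> k) \<and> decseq \<tau> \<and> \<tau> \<longlonglongrightarrow> 0 \<and>
        (\<forall>k. discrete_solution p \<phi> (\<tau> k) (u k)) \<and>
        \<mu>0 \<in> wasserstein_space p \<and> \<phi> \<mu>0 < \<infinity> \<and>
        (\<lambda>k. wasserstein p (u k 0) \<mu>0) \<longlonglongrightarrow> 0 \<and>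
        (\<lambda>k. \<phi> (u k 0)) \<longlonglongrightarrow> \<phi> \<mu>0 \<longrightarrow>
        (\<exists>(k :: nat \<Rightarrow> nat) \<mu>. strict_mono k \<and>
           (\<forall>t\<ge>0. \<mu> t \<in> wasserstein_space p \<and>
              (\<lambda>l. wasserstein p (u (k l) t) (\<mu> t)) \<longlonglongrightarrow> 0)) \<and>
        (\<forall>(k :: nat \<Rightarrow> nat) \<mu>. strict_mono k \<and>
           (\<forall>t\<ge>0. \<mu> t \<in> wasserstein_space p \<and>
              (\<lambda>l. wasserstein p (u (k l) t) (\<mu> t)) \<longlonglongrightarrow> 0) \<longrightarrow>
           locally_ac_curve p \<mu> \<and> energy_inequality p q \<phi> \<mu>))
     \<and>
     (\<forall>(\<mu> :: real \<Rightarrow> 'a measure) v (\<phi>\<mu>' :: real \<Rightarrow> real).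
        locally_ac_curve p \<mu> \<and> tangent_field p \<mu> v \<and>
        (\<forall>t\<ge>0. \<phi> (\<mu> t) < \<infinity>) \<and>
        continuous_on {0..} (\<lambda>t. real_of_ereal (\<phi> (\<mu> t))) \<and>
        W11_loc_derivative (\<lambda>t. real_of_ereal (\<phi> (\<mu> t))) \<phi>\<mu>' \<and>
        (AE t in lborel. 0 < t \<longrightarrow>
           limiting_subdifferential p q \<phi> (\<mu> t) \<noteq> {} \<and>
           \<phi>\<mu>' t = (\<integral>x. Dl p q \<phi> (\<mu> t) x \<bullet> v t x \<partial>(\<mu> t))) \<longrightarrow>
        (energy_inequality p q \<phi> \<mu> \<longleftrightarrow> energy_dissipation_equality p q \<phi> \<mu>) \<and>
        (energy_dissipation_equality p q \<phi> \<mu> \<longleftrightarrow>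
           (AE t in lborel. 0 < t \<longrightarrow>
              (AE x in \<mu> t. v t x = - duality_map q (Dl p q \<phi> (\<mu> t) x)) \<and>
              relaxed_slope p \<phi> (\<mu> t) = ennreal (Lp_norm q (\<mu> t) (Dl p q \<phi> (\<mu> t))))))"
proof -
  interpret minimizing_movements p q \<phi> A B \<mu>star
  proof
    show "1 < p" "1 < q" "1 / p + 1 / q = 1" by (rule exponents)+
    show "\<phi> \<mu> \<noteq> -\<infinity>" if "\<mu> \<in> wasserstein_space p" for \<mu> using proper_range that by blast
    show "A > 0" "B > 0" "\<mu>star \<in> wasserstein_space p" by (rule phi2)+
    show "ereal (- A - B * wasserstein p \<mu> \<mu>star powr p) \<le> \<phi> \<mu>" if "\<mu> \<in> wasserstein_space p" for \<mu>
      using phi2(4) that by blast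
    show "\<phi> \<mu> \<le> liminf (\<lambda>n. \<phi> (m n))"
      if "\<And>n. m n \<in> wasserstein_space p" "\<mu> \<in> wasserstein_space p" "(\<lambda>n. wasserstein p (m n) \<mu>) \<longlonglongrightarrow> 0"
      for m :: "nat \<Rightarrow> 'a measure" and \<mu>
      by (rule phi3[rule_format, OF that])
    show "\<exists>(k :: nat \<Rightarrow> nat) \<mu>. strict_mono k \<and> \<mu> \<in> wasserstein_space p \<and> (\<lambda>n. wasserstein p (m (k n)) \<mu>) \<longlonglongrightarrow> 0"
      if "\<And>n. m n \<in> wasserstein_space p" "(SUP n. \<phi> (m n)) < \<infinity>" "(SUP n. ereal (wasserstein p (m n) \<mu>star)) < \<infinity>"
      for m :: "nat \<Rightarrow> 'a measure"
      by (rule phi4[rule_format, OF that])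
  qed
  have unique: "AE x in \<nu>. \<zeta> x = \<zeta>' x"
    if "\<nu> \<in> fdom" "\<zeta> \<in> limiting_subdifferential p q \<phi> \<nu>" "\<zeta>' \<in> limiting_subdifferential p q \<phi> \<nu>" for \<nu> \<zeta> \<zeta>'
    using unique_subdifferential that by (simp add: fdom_def)
  show ?thesis
  proof (rule conjI; intro allI impI; elim conjE)
    fix \<tau> :: "nat \<Rightarrow> real" and u :: "nat \<Rightarrow> real \<Rightarrow> 'a measure" and \<mu>0
    assume "\<forall>k. 0 < \<tau> k" "\<tau> \<longlonglongrightarrow> 0" "\<forall>k. discrete_solution p \<phi> (\<tau> k) (u k)"
      and \<mu>0: "\<mu>0 \<in> wasserstein_space p" "\<phi> \<mu>0 < \<infinity>"
      and init: "(\<lambda>k. wasserstein p (u k 0) \<mu>0) \<longlonglongrightarrow> 0" "(\<lambda>k. \<phi> (u k 0)) \<longlonglongrightarrow> \<phi> \<mu>0"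
    then have \<tau>: "\<And>k. 0 < \<tau> k" "\<tau> \<longlonglongrightarrow> 0" and ds: "\<And>k. discrete_solution p \<phi> (\<tau> k) (u k)" by simp_all
    obtain k \<mu> where "strict_mono (k :: nat \<Rightarrow> nat)" "\<And>t. 0 \<le> t \<Longrightarrow> \<mu> t \<in> wasserstein_space p"
      "\<And>t. 0 \<le> t \<Longrightarrow> (\<lambda>l. wasserstein p (u (k l) t) (\<mu> t)) \<longlonglongrightarrow> 0"
      by (rule discrete_solutions_compact[OF \<tau> ds \<mu>0 init], rule that)
    then have compact: "\<exists>(k :: nat \<Rightarrow> nat) \<mu>. strict_mono k \<and>
        (\<forall>t\<ge>0. \<mu> t \<in> wasserstein_space p \<and> (\<lambda>l. wasserstein p (u (k l) t) (\<mu> t)) \<longlonglongrightarrow> 0)"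
      by (intro exI[of _ k] exI[of _ \<mu>] conjI allI impI)
    have limit: "locally_ac_curve p \<mu> \<and> energy_inequality p q \<phi> \<mu>"
      if k: "strict_mono k" and \<mu>: "\<forall>t\<ge>0. \<mu> t \<in> wasserstein_space p \<and> (\<lambda>l. wasserstein p (u (k l) t) (\<mu> t)) \<longlonglongrightarrow> 0"
      for k :: "nat \<Rightarrow> nat" and \<mu>
    proof -
      have "\<And>t. 0 \<le> t \<Longrightarrow> \<mu> t \<in> wasserstein_space p" "\<And>t. 0 \<le> t \<Longrightarrow> (\<lambda>l. wasserstein p (u (k l) t) (\<mu> t)) \<longlonglongrightarrow> 0"
        using \<mu> by simp_all
      from discrete_solutions_limit[OF \<tau> ds \<mu>0 init k this] show ?thesis by (rule conjI)
    qed
    show "(\<exists>(k :: nat \<Rightarrow> nat) \<mu>. strict_mono k \<and>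
           (\<forall>t\<ge>0. \<mu> t \<in> wasserstein_space p \<and> (\<lambda>l. wasserstein p (u (k l) t) (\<mu> t)) \<longlonglongrightarrow> 0)) \<and>
        (\<forall>(k :: nat \<Rightarrow> nat) \<mu>. strict_mono k \<and>
           (\<forall>t\<ge>0. \<mu> t \<in> wasserstein_space p \<and> (\<lambda>l. wasserstein p (u (k l) t) (\<mu> t)) \<longlonglongrightarrow> 0) \<longrightarrow>
           locally_ac_curve p \<mu> \<and> energy_inequality p q \<phi> \<mu>)"
    proof (rule conjI[OF compact], intro allI impI, elim conjE)
      fix k :: "nat \<Rightarrow> nat" and \<mu>
      assume "strict_mono k"
        "\<forall>t\<ge>0. \<mu> t \<in> wasserstein_space p \<and> (\<lambda>l. wasserstein p (u (k l) t) (\<mu> t)) \<longlonglongrightarrow> 0"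
      then show "locally_ac_curve p \<mu> \<and> energy_inequality p q \<phi> \<mu>" by (rule limit)
    qed
  next
    fix \<mu> :: "real \<Rightarrow> 'a measure" and v \<phi>\<mu>'
    assume ac: "locally_ac_curve p \<mu>" and tf: "tangent_field p \<mu> v" and "\<forall>t\<ge>0. \<phi> (\<mu> t) < \<infinity>"
      and cont: "continuous_on {0..} (\<lambda>t. real_of_ereal (\<phi> (\<mu> t)))"
      and W11: "W11_loc_derivative (\<lambda>t. real_of_ereal (\<phi> (\<mu> t))) \<phi>\<mu>'"
      and chain: "AE t in lborel. 0 < t \<longrightarrow> limiting_subdifferential p q \<phi> (\<mu> t) \<noteq> {} \<and>
        \<phi>\<mu>' t = (\<integral>x. Dl p q \<phi> (\<mu> t) x \<bullet> v t x \<partial>(\<mu> t))"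
    then have fin: "\<And>t. 0 \<le> t \<Longrightarrow> \<phi> (\<mu> t) < \<infinity>" by simp
    show "(energy_inequality p q \<phi> \<mu> \<longleftrightarrow> energy_dissipation_equality p q \<phi> \<mu>) \<and>
        (energy_dissipation_equality p q \<phi> \<mu> \<longleftrightarrow>
           (AE t in lborel. 0 < t \<longrightarrow>
              (AE x in \<mu> t. v t x = - duality_map q (Dl p q \<phi> (\<mu> t) x)) \<and>
              relaxed_slope p \<phi> (\<mu> t) = ennreal (Lp_norm q (\<mu> t) (Dl p q \<phi> (\<mu> t)))))"
      by (rule conjI; rule energy_identity_equivalence[OF ac tf fin cont W11 chain unique])
  qed
qed

end
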